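(* Suppose Assumptions (A1)–(A5) of the context hold and $f\in\mathcal D_{\alpha,2}(L)$ for some $L>0$. Assume $I_0$ is known, and let $\hat\beta_{q_0}$ be the penalized least squares estimator of $\beta_{q_0}$ based on the approximating spaces $\{S_{I_0,K_n}\}_{K_n\in\mathcal K_n}$ with penalty $\mathrm{pen}(I_0,K_n)=2(|I_0|+1)rK_n\frac{\log n}{n}$. Then $$\sqrt n(\hat\beta_{q_0}-\beta_{q_0})\xrightarrow{d}N_{q_0}(0,\sigma^2\Sigma_{q_0}^{-1})\qquad(n\to\infty).$$ This holds uniformly over $\alpha\in(1/2,r)$ and $\gamma\in(b/4,r)$, in the sense that this single procedure, which depends on neither $\alpha$ nor $\gamma$, has this property for all such $\alpha$ and $\gamma$ ($\gamma$ being the smoothness index in (A5)).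
   Context: Model. Let $q\ge 1$. For $n\ge 2$ one observes i.i.d. $((\underline X_i,T_i),Y_i)$, $i=1,\dots,n$, with $Y_i=\beta'\underline X_i+f(T_i)+W_i=s(\underline X_i,T_i)+W_i$, where $\beta\in\mathbb R^q$, $f:[0,1]\to\mathbb R$, $s(\underline x,t)=\beta'\underline x+f(t)$, and the $W_i$ are i.i.d., mean zero, with variance $\sigma^2$, independent of the $(\underline X_i,T_i)\in\mathbb R^q\times\mathbb R$. The law of the data does not change with $n$. $\mu,\mu_X,\mu_T$ are the laws of $(\underline X,T)$, $\underline X=(X_1,\dots,X_q)'$ and $T$; $\lambda$ is Lebesgue measure (on $\mathcal K\times[0,1]$ below); $\|\cdot\|_\nu$ is the $L_2(\nu)$ norm. $I_0\subseteq\{1,\dots,q\}$ is the set of indices of the nonzero components of $\beta$, $q_0=|I_0|$, and $\beta_{q_0}\in\mathbb R^{q_0}$ is the subvector $(\beta_j)_{j\in I_0}$. Smoothness classes. For $\alpha>0$, $\mathrm{Lip}^*(\alpha,L_2(\mu_T))$ is the generalized Lipschitz space of $g\in L_2([0,1],\mu_T)$ with finite seminorm $|g|_{\alpha,2}=\sup_{h>0}h^{-\alpha}\omega_{k}(g,h)_2$, where $k=[\alpha]+1$ and $\omega_k(\cdot,\cdot)_2$ is the $k$-th order modulus of smoothness in $L_2(\mu_T)$. For $A>0$, $\mathcal D_{\alpha,2}(A)=\{g\in \mathrm{Lip}^*(\alpha,L_2(\mu_T)):|g|_{\alpha,2}\le A\}$. Assumptions. Fix a constant $b\ge 3$ and put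 $r=[\frac{b-1}{2}]$ ($[\cdot]$ is integer part). (A1) The support of $\mu$ is $\mathcal K\times[0,1]$ for a compact set $\mathcal K\subset\mathbb R^q$ ($\underline X\in\mathcal K$, $T\in[0,1]$ almost surely), and there $\mu$ has a Lebesgue density bounded below by $h_0>0$ and above by $h_1<\infty$. (A2) There are $d>0$ and $p>4+d$ with $\tau_p=E|W_1|^p<\infty$. (A3) For every $l\in\mathbb R^q\setminus\{0\}$, $\mathrm{Var}(l'\underline X\mid T=t)>0$ for all $t\in[0,1]$. (A4) $s\in L_2(\mathcal K\times[0,1],\lambda)$. (A5) For some $\gamma>b/4$ and $A>0$, $\theta_j(t)=E(X_j\mid T=t)$ belongs to $\mathcal D_{\gamma,2}(A)$ for all $j\in\{1,\dots,q\}$. Approximating spaces. $A_n=[\log_2 (n/\log n)^{1/b}]$, $J_n=[\log_2 (n/\log n)^{1/2}]$, and $\mathcal K_n=\{2^k:k\in\{A_n,A_n+1,\dots,J_n\}\}$. For $K$ a power of $2$, $S_K$ is the space of piecewise polynomials $v(t)=\sum_{j=1}^K P_j(t)\mathbb 1(\frac{j-1}{K}\le t<\frac jK)$ with each $P_j$ of degree at most $r-1$ (dimension $rK$). $S_{I,K}$ is the linear span of the coordinate functions $x_i$, $i\in I$, together with $S_K$ (as functions of $t$). Estimator. For $u\in S_{I_0,K}$ let $\gamma_n(u)=n^{-1}\sum_{i=1}^n[Y_i-u(\underline X_i,T_i)]^2$. $\tilde s\in S_{I_0,\hat K_n}$ is a minimizer of $\gamma_n(u)+\mathrm{pen}(I_0,K)$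 over all $u\in S_{I_0,K}$ and $K\in\mathcal K_n$. Write $\tilde s(\underline x,t)=\sum_{j\in I_0}\tilde\beta_jx_j+\tilde f(t)$ with $\tilde f\in S_{\hat K_n}$. Let $\Gamma_n=\{\|\tilde s\|_\lambda\le 2\exp(\log^2 n)\}$; then $\hat\beta_{q_0}=(\tilde\beta_j)_{j\in I_0}\mathbb 1_{\Gamma_n}$. On the event (of probability tending to zero) where the least squares solution is not unique, the estimator is set to zero. Covariance. $\Sigma_{q_0}=(\sigma_{kj})_{(k,j)\in I_0\times I_0}$ with $\sigma_{kj}=\mathrm{Cov}(X_k,X_j)-\mathrm{Cov}(\theta_k(T),\theta_j(T))$. *)

theory Defs
  imports "HOL-Probability.Probability"
begin

section \<open>Square-integrable functions and generalized Lipschitz classes\<close>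

definition in_L2 :: "'a measure \<Rightarrow> ('a \<Rightarrow> real) \<Rightarrow> bool" where
  "in_L2 \<nu> g \<longleftrightarrow> g \<in> borel_measurable \<nu> \<and> integrable \<nu> (\<lambda>x. (g x)\<^sup>2)"

text \<open>Extended-real valued, so that a function outside \<open>L\<^sub>2\<close> gets norm \<open>\<infinity>\<close> instead of the
  default value \<open>0\<close> of the Bochner integral.\<close>

definition L2_norm_of :: "'a measure \<Rightarrow> ('a \<Rightarrow> real) \<Rightarrow> ereal" where
  "L2_norm_of \<nu> g = (if in_L2 \<nu> g then ereal (sqrt (\<integral>x. (g x)\<^sup>2 \<partial>\<nu>)) else \<infinity>)"

definition fwd_diff :: "nat \<Rightarrow> real \<Rightarrow> (real \<Rightarrow> real) \<Rightarrow> real \<Rightarrow> real" where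
  "fwd_diff k s g t = (\<Sum>i\<le>k. (- 1) ^ (k - i) * of_nat (k choose i) * g (t + of_nat i * s))"

text \<open>The \<open>k\<close>-th difference with step \<open>s\<close> is taken only at those \<open>t\<close> for which
  all nodes \<open>t, t + s, \<dots>, t + k s\<close> lie in \<open>[0,1]\<close>.\<close>

definition modulus_L2 :: "real measure \<Rightarrow> nat \<Rightarrow> (real \<Rightarrow> real) \<Rightarrow> real \<Rightarrow> ereal" where
  "modulus_L2 \<nu> k g h =
     (SUP s\<in>{0<..h}. L2_norm_of (restrict_space \<nu> {0..1 - of_nat k * s}) (fwd_diff k s g))"

definition lip_seminorm :: "real measure \<Rightarrow> real \<Rightarrow> (real \<Rightarrow> real) \<Rightarrow> ereal" where
  "lip_seminorm \<nu> \<alpha> g =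
     (SUP h\<in>{0<..}. ereal (h powr (- \<alpha>)) * modulus_L2 \<nu> (nat \<lfloor>\<alpha>\<rfloor> + 1) g h)"

definition Lip_star :: "real measure \<Rightarrow> real \<Rightarrow> (real \<Rightarrow> real) set" where
  "Lip_star \<nu> \<alpha> = {g. in_L2 (restrict_space \<nu> {0..1}) g \<and> lip_seminorm \<nu> \<alpha> g < \<infinity>}"

definition Lip_ball :: "real measure \<Rightarrow> real \<Rightarrow> real \<Rightarrow> (real \<Rightarrow> real) set" where
  "Lip_ball \<nu> \<alpha> A = {g \<in> Lip_star \<nu> \<alpha>. lip_seminorm \<nu> \<alpha> g \<le> ereal A}"

section \<open>Probabilistic notions\<close>

definition measure_support :: "'a::topological_space measure \<Rightarrow> 'a set" where
  "measure_support \<nu> = {z. \<forall>U. open U \<longrightarrow> z \<in> U \<longrightarrow> emeasure \<nu> U \<noteq> 0}"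

definition covariance :: "'a measure \<Rightarrow> ('a \<Rightarrow> real) \<Rightarrow> ('a \<Rightarrow> real) \<Rightarrow> real" where
  "covariance M U V =
     (\<integral>\<omega>. (U \<omega> - integral\<^sup>L M U) * (V \<omega> - integral\<^sup>L M V) \<partial>M)"

abbreviation cond_exp_on :: "'a measure \<Rightarrow> ('a \<Rightarrow> real) \<Rightarrow> ('a \<Rightarrow> real) \<Rightarrow> ('a \<Rightarrow> real)" where
  "cond_exp_on M T Z \<equiv> real_cond_exp M (vimage_algebra (space M) T borel) Z"

text \<open>\<open>is_cond_exp M T Z \<phi>\<close>: the function \<open>\<phi>\<close> is a version of \<open>t \<mapsto> E(Z | T = t)\<close>.\<close>

definition is_cond_exp ::
    "'a measure \<Rightarrow> ('a \<Rightarrow> real) \<Rightarrow> ('a \<Rightarrow> real) \<Rightarrow> (real \<Rightarrow> real) \<Rightarrow> bool" where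
  "is_cond_exp M T Z \<phi> \<longleftrightarrow>
     \<phi> \<in> borel_measurable borel \<and> (AE \<omega> in M. \<phi> (T \<omega>) = cond_exp_on M T Z \<omega>)"

definition is_cond_var ::
    "'a measure \<Rightarrow> ('a \<Rightarrow> real) \<Rightarrow> ('a \<Rightarrow> real) \<Rightarrow> (real \<Rightarrow> real) \<Rightarrow> bool" where
  "is_cond_var M T Z V \<longleftrightarrow> is_cond_exp M T (\<lambda>\<omega>. (Z \<omega> - cond_exp_on M T Z \<omega>)\<^sup>2) V"

text \<open>Vectors indexed by a finite set \<open>I\<close> are elements of \<open>I \<rightarrow>\<^sub>E UNIV\<close>, matrices indexed by
  \<open>I \<times> I\<close> are binary functions of which only the values on \<open>I \<times> I\<close> matter.
  In \<open>weak_conv_on\<close>, continuity refers to the product topology, i.e. the usual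
  topology of \<open>\<real>\<^sup>I\<close>. The normal law is given by its characteristic
  function, so that a singular covariance matrix is allowed.\<close>

definition weak_conv_on ::
    "'i set \<Rightarrow> (nat \<Rightarrow> ('i \<Rightarrow> real) measure) \<Rightarrow> ('i \<Rightarrow> real) measure \<Rightarrow> bool" where
  "weak_conv_on I \<nu>s \<nu> \<longleftrightarrow>
     (\<forall>g :: ('i \<Rightarrow> real) \<Rightarrow> real.
        continuous_on (I \<rightarrow>\<^sub>E UNIV) g \<longrightarrow> bounded (g ` (I \<rightarrow>\<^sub>E UNIV)) \<longrightarrow>
        (\<lambda>n. \<integral>x. g x \<partial>\<nu>s n) \<longlonglongrightarrow> (\<integral>x. g x \<partial>\<nu>))"

definition is_normal_law ::
    "'i set \<Rightarrow> ('i \<Rightarrow> real) \<Rightarrow> ('i \<Rightarrow> 'i \<Rightarrow> real) \<Rightarrow> ('i \<Rightarrow> real) measure \<Rightarrow> bool" where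
  "is_normal_law I m S N \<longleftrightarrow>
     prob_space N \<and> sets N = sets (PiM I (\<lambda>_. borel)) \<and>
     (\<forall>u :: 'i \<Rightarrow> real.
        (CLINT x|N. iexp (\<Sum>i\<in>I. u i * x i)) =
          iexp (\<Sum>i\<in>I. u i * m i) *
          of_real (exp (- (\<Sum>i\<in>I. \<Sum>j\<in>I. u i * S i j * u j) / 2)))"

definition is_inverse_on :: "'i set \<Rightarrow> ('i \<Rightarrow> 'i \<Rightarrow> real) \<Rightarrow> ('i \<Rightarrow> 'i \<Rightarrow> real) \<Rightarrow> bool" where
  "is_inverse_on I S R \<longleftrightarrow>
     (\<forall>i\<in>I. \<forall>j\<in>I.
        (\<Sum>k\<in>I. S i k * R k j) = (if i = j then 1 else 0) \<and>
        (\<Sum>k\<in>I. R i k * S k j) = (if i = j then 1 else 0))"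

section \<open>The partially linear model and the penalized least squares estimator\<close>

definition pl_fun :: "real ^ 'q \<Rightarrow> (real \<Rightarrow> real) \<Rightarrow> (real ^ 'q) \<times> real \<Rightarrow> real" where
  "pl_fun \<beta> f = (\<lambda>(x, t). \<beta> \<bullet> x + f t)"

definition ppoly_space :: "nat \<Rightarrow> nat \<Rightarrow> (real \<Rightarrow> real) set" where
  "ppoly_space r K =
     {v. \<exists>P :: nat \<Rightarrow> real poly. (\<forall>j\<in>{1..K}. degree (P j) \<le> r - 1) \<and>
        v = (\<lambda>t. \<Sum>j=1..K. poly (P j) t * indicator {(real j - 1) / real K ..< real j / real K} t)}"

text \<open>The partially linear functions of \<open>(x, t)\<close> that use only the coordinates \<open>x\<^sub>i, i \<in> I\<close>,
  with coefficients \<open>a\<close>.\<close>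

definition sub_fun :: "'q set \<Rightarrow> ('q \<Rightarrow> real) \<Rightarrow> (real \<Rightarrow> real) \<Rightarrow> (real ^ 'q::finite) \<times> real \<Rightarrow> real" where
  "sub_fun I a v = (\<lambda>(x, t). (\<Sum>i\<in>I. a i * x $ i) + v t)"

definition approx_space :: "nat \<Rightarrow> 'q::finite set \<Rightarrow> nat \<Rightarrow> ((real ^ 'q) \<times> real \<Rightarrow> real) set" where
  "approx_space r I K = {sub_fun I a v | a v. v \<in> ppoly_space r K}"

definition r_of :: "real \<Rightarrow> nat" where
  "r_of b = nat \<lfloor>(b - 1) / 2\<rfloor>"

definition K_set :: "real \<Rightarrow> nat \<Rightarrow> nat set" where
  "K_set b n =
     {2 ^ k | k. nat \<lfloor>log 2 ((real n / ln (real n)) powr (1 / b))\<rfloor> \<le> k \<and>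
                 k \<le> nat \<lfloor>log 2 ((real n / ln (real n)) powr (1 / 2))\<rfloor>}"

text \<open>A data set \<open>D\<close> consists of the observations \<open>D i = ((x\<^sub>i, t\<^sub>i), y\<^sub>i)\<close> for \<open>i < n\<close>.\<close>

definition emp_contrast :: "nat \<Rightarrow> (nat \<Rightarrow> 'z \<times> real) \<Rightarrow> ('z \<Rightarrow> real) \<Rightarrow> real" where
  "emp_contrast n D u = (\<Sum>i<n. (snd (D i) - u (fst (D i)))\<^sup>2) / real n"

definition pen :: "real \<Rightarrow> 'q set \<Rightarrow> nat \<Rightarrow> nat \<Rightarrow> real" where
  "pen b I n K = 2 * (real (card I) + 1) * real (r_of b) * real K * ln (real n) / real n"

definition pls_fit ::
    "real \<Rightarrow> 'q::finite set \<Rightarrow> nat \<Rightarrow> (nat \<Rightarrow> ((real ^ 'q) \<times> real) \<times> real) \<Rightarrow>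
     nat \<Rightarrow> ((real ^ 'q) \<times> real \<Rightarrow> real) \<Rightarrow> bool" where
  "pls_fit b I n D K u \<longleftrightarrow>
     K \<in> K_set b n \<and> u \<in> approx_space (r_of b) I K \<and>
     (\<forall>K'\<in>K_set b n. \<forall>u'\<in>approx_space (r_of b) I K'.
        emp_contrast n D u + pen b I n K \<le> emp_contrast n D u' + pen b I n K')"

text \<open>For a fit \<open>u\<close> with selected \<open>K\<close>: no other element of the same space attains the same contrast.\<close>

definition ls_unique ::
    "real \<Rightarrow> 'q::finite set \<Rightarrow> nat \<Rightarrow> (nat \<Rightarrow> ((real ^ 'q) \<times> real) \<times> real) \<Rightarrow>
     nat \<Rightarrow> ((real ^ 'q) \<times> real \<Rightarrow> real) \<Rightarrow> bool" where
  "ls_unique b I n D K u \<longleftrightarrow>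
     (\<forall>u'\<in>approx_space (r_of b) I K. emp_contrast n D u' \<le> emp_contrast n D u \<longrightarrow> u' = u)"

text \<open>\<open>bh\<close> is a value of the estimator on the data set \<open>D\<close>. A relation rather than
  a function, because the selected \<open>K\<close> need not be unique; every way of breaking ties is covered.
  The set \<open>\<K>\<close> enters through the \<open>L\<^sub>2\<close> norm with respect to Lebesgue measure on \<open>\<K> \<times> [0,1]\<close>.\<close>

definition pls_estimate ::
    "real \<Rightarrow> (real ^ 'q) set \<Rightarrow> 'q::finite set \<Rightarrow> nat \<Rightarrow>
     (nat \<Rightarrow> ((real ^ 'q) \<times> real) \<times> real) \<Rightarrow> ('q \<Rightarrow> real) \<Rightarrow> bool" where
  "pls_estimate b \<K> I n D bh \<longleftrightarrow>
     (\<exists>K a v. v \<in> ppoly_space (r_of b) K \<and> pls_fit b I n D K (sub_fun I a v) \<and>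
        bh = (\<lambda>j\<in>I.
          if ls_unique b I n D K (sub_fun I a v) \<and>
             L2_norm_of (restrict_space lborel (\<K> \<times> {0..1})) (sub_fun I a v)
               \<le> ereal (2 * exp ((ln (real n))\<^sup>2))
          then a j else 0))"

text \<open>A sequence of estimators of \<open>\<beta>\<close> restricted to \<open>I\<close>, as measurable functions of the data.\<close>

definition pls_procedure ::
    "real \<Rightarrow> (real ^ 'q) set \<Rightarrow> 'q::finite set \<Rightarrow>
     (nat \<Rightarrow> (nat \<Rightarrow> ((real ^ 'q) \<times> real) \<times> real) \<Rightarrow> 'q \<Rightarrow> real) \<Rightarrow> bool" where
  "pls_procedure b \<K> I bhat \<longleftrightarrow>
     (\<forall>n\<ge>2. bhat n \<in> measurable (PiM {..<n} (\<lambda>_. borel)) (PiM I (\<lambda>_. borel)) \<and>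
            (\<forall>D\<in>{..<n} \<rightarrow>\<^sub>E UNIV. pls_estimate b \<K> I n D (bhat n D)))"

definition Sigma_mat ::
    "'a measure \<Rightarrow> ('a \<Rightarrow> real ^ 'q) \<Rightarrow> ('a \<Rightarrow> real) \<Rightarrow> ('q \<Rightarrow> real \<Rightarrow> real) \<Rightarrow>
     'q \<Rightarrow> 'q \<Rightarrow> real" where
  "Sigma_mat M X T \<theta> k j =
     covariance M (\<lambda>\<omega>. X \<omega> $ k) (\<lambda>\<omega>. X \<omega> $ j) -
     covariance M (\<lambda>\<omega>. \<theta> k (T \<omega>)) (\<lambda>\<omega>. \<theta> j (T \<omega>))"

end

(* On an event of probability tending to one, all empirical inner products that occur are under
   control: noise against the space of piecewise polynomials costs the square root of the dimension
   (Gram-Schmidt and second moments suffice), and noise against an approximation error costs the size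
   of that error. On this event the argument is deterministic. Comparing the criterion at the estimate
   with its value at beta and an approximant of f on a suitable intermediate grid gives an in-sample
   risk bound. The normal equations for x_j minus an approximant of theta_j on the selected grid then
   express the error in beta as Sigma^{-1} applied to the mean of W (X - theta(T)), with a remainder
   o(n^{-1/2}): the rates in alpha > 1/2 and gamma > b/4 make every product of two approximation errors
   o(n^{-1/2}). The central limit theorem for the linear term and convergence of cosine integrals give
   the conclusion. Approximability of the Lipschitz classes is a Jackson estimate, proved by averaging
   differences over small steps. *)
theory Submission
  imports Defs "HOL-Real_Asymp.Real_Asymp"
begin

section \<open>Convergence of integrals from convergence on trigonometric functions\<close>

text \<open>Nothing is known about the selected grid except that it belongs to \<open>K_set\<close>,
  so all estimates are uniform over the admissible grids. Dyadic spaces are nested, hence noise need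
  only be tested against the space on the finest grid. Its dimension is about (n / log n)^(1/2), so
  the product of two noise terms has that order, and only the logarithm makes it small against
  n^(1/2). The functions \<theta> j are approximated on the selected grid itself, because the normal
  equations admit only test functions from the selected space; there the coarsest grid is the worst,
  and \<gamma> > b/4 makes the in-sample error o(n^(1/4)). For f no approximation on the selected
  grid is used: the criterion bounds the in-sample error of the whole fit, through a comparison grid
  that may depend on \<alpha> because it occurs in the proof only. An approximation error multiplied
  by a centred factor, the noise or X - \<theta>(T), gains a factor n^(-1/2) over the trivial bound.
  The truncation and the convention for non-unique fits are shown to be inactive on the good
  event.\<close>

inductive trig_fun :: "('a::euclidean_space \<Rightarrow> real) \<Rightarrow> bool" where
  cos: "trig_fun (\<lambda>x. c * cos (u \<bullet> x + a))"
| add: "trig_fun f \<Longrightarrow> trig_fun g \<Longrightarrow> trig_fun (\<lambda>x. f x + g x)"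

lemma trig_fun_const: "trig_fun (\<lambda>x. c)"
  using trig_fun.cos[of c 0 0] by simp

text \<open>The product-to-sum formula for cosines. Closure under products is what brings
  polynomials, and with them Stone-Weierstrass, within reach.\<close>

lemma trig_fun_mult_cos:
  "trig_fun f \<Longrightarrow> trig_fun (\<lambda>x. f x * (c * cos (u \<bullet> x + a)))"
proof (induction rule: trig_fun.induct)
  case (cos c' u' a')
  have "(\<lambda>x. c' * cos (u' \<bullet> x + a') * (c * cos (u \<bullet> x + a))) =
    (\<lambda>x. (c' * c / 2) * cos ((u' - u) \<bullet> x + (a' - a)) + (c' * c / 2) * cos ((u' + u) \<bullet> x + (a' + a)))"
  proof
    fix x
    have *: "(u' - u) \<bullet> x + (a' - a) = (u' \<bullet> x + a') - (u \<bullet> x + a)"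
      "(u' + u) \<bullet> x + (a' + a) = (u' \<bullet> x + a') + (u \<bullet> x + a)"
      by (simp_all add: algebra_simps)
    show "c' * cos (u' \<bullet> x + a') * (c * cos (u \<bullet> x + a)) =
      (c' * c / 2) * cos ((u' - u) \<bullet> x + (a' - a)) + (c' * c / 2) * cos ((u' + u) \<bullet> x + (a' + a))"
      unfolding * cos_add cos_diff by (simp add: field_simps)
  qed
  then show ?case by (simp only:) (intro trig_fun.intros)
next
  case (add f g)
  then show ?case by (simp add: distrib_right trig_fun.add)
qed

lemma trig_fun_mult: "trig_fun g \<Longrightarrow> trig_fun f \<Longrightarrow> trig_fun (\<lambda>x. f x * g x)"
  by (induction rule: trig_fun.induct) (auto simp: distrib_left intro: trig_fun_mult_cos trig_fun.add)

lemma trig_fun_sum: "finite I \<Longrightarrow> (\<And>i. i \<in> I \<Longrightarrow> trig_fun (f i)) \<Longrightarrow> trig_fun (\<lambda>x. \<Sum>i\<in>I. f i x)"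
  by (induction rule: finite_induct) (auto intro: trig_fun_const trig_fun.add)

lemma trig_fun_sin: "trig_fun (\<lambda>x. c * sin (u \<bullet> x))"
proof -
  have "(\<lambda>x. c * sin (u \<bullet> x)) = (\<lambda>x. c * cos (u \<bullet> x + (- pi/2)))"
    unfolding cos_add by simp
  then show ?thesis by (simp only: trig_fun.cos)
qed

text \<open>A linear form in the coordinate sines is a sum of shifted cosines, and trigonometric
  functions form an algebra. So convergence on cosines yields convergence on every polynomial in the
  sines.\<close>

lemma trig_fun_polynomial_sin:
  fixes p :: "'a::euclidean_space \<Rightarrow> real"
  assumes "real_polynomial_function p"
  shows "trig_fun (\<lambda>x::'a. p (\<Sum>i\<in>Basis. sin (c * (x \<bullet> i)) *\<^sub>R i))"
  using assms
proof (induction rule: real_polynomial_function.induct)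
  case (linear f)
  interpret f: bounded_linear f by fact
  have "(\<lambda>x::'a. f (\<Sum>i\<in>Basis. sin (c * (x \<bullet> i)) *\<^sub>R i)) = (\<lambda>x. \<Sum>i\<in>Basis. f i * sin ((c *\<^sub>R i) \<bullet> x))"
    by (simp add: f.sum f.scaleR inner_commute mult.commute)
  then show ?case by (simp only:) (intro trig_fun_sum trig_fun_sin finite_Basis)
qed (auto intro: trig_fun_const trig_fun.add trig_fun_mult)

text \<open>Characteristic functions determine the limit on trigonometric polynomials. A bounded continuous
  \<open>G\<close> is replaced by the function \<open>s \<mapsto> G (arcsin s / c)\<close> on the cube, evaluated at the sines of
  the coordinates: it agrees with \<open>G\<close> near the origin, is bounded by the same constant everywhere,
  and is uniformly close to a polynomial in the sines.\<close>

proposition integral_converges_of_trig: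
  fixes \<nu>s :: "nat \<Rightarrow> 'a::euclidean_space measure" and \<nu> :: "'a measure" and G :: "'a \<Rightarrow> real"
  assumes prob: "\<forall>\<^sub>F n in sequentially. prob_space (\<nu>s n)" "prob_space \<nu>"
    and sets: "\<forall>\<^sub>F n in sequentially. sets (\<nu>s n) = sets borel" "sets \<nu> = sets borel"
    and cos: "\<And>u a. (\<lambda>n. \<integral>x. cos (u \<bullet> x + a) \<partial>\<nu>s n) \<longlonglongrightarrow> (\<integral>x. cos (u \<bullet> x + a) \<partial>\<nu>)"
    and tight: "\<And>e. e > 0 \<Longrightarrow> \<exists>L. \<forall>\<^sub>F n in sequentially. measure (\<nu>s n) {x. norm x > L} \<le> e"
    and G: "continuous_on UNIV G" "\<And>x. \<bar>G x\<bar> \<le> B"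
  shows "(\<lambda>n. \<integral>x. G x \<partial>\<nu>s n) \<longlonglongrightarrow> (\<integral>x. G x \<partial>\<nu>)"
proof -
  have B0: "B \<ge> 0" using G(2)[of 0] by linarith
  \<comment> \<open>A single probability measure is tight by continuity from above, so a hypothesis
    is made for the sequence only.\<close>
  have tight_\<nu>: "\<exists>L. measure \<nu> {x. norm x > L} \<le> e" if e: "e > 0" for e
  proof -
    interpret prob_space \<nu> by fact
    have "(\<lambda>n. measure \<nu> {x. norm x > real n}) \<longlonglongrightarrow> measure \<nu> (\<Inter>n. {x. norm x > real n})"
      by (rule finite_Lim_measure_decseq) (auto simp: sets decseq_def)
    also have "(\<Inter>n. {x::'a. norm x > real n}) = {}"
    proof -
      have "\<not> (\<forall>n. real n < norm x)" for x :: 'a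
        using reals_Archimedean2[of "norm x"] by (auto intro: less_asym)
      then show ?thesis by auto
    qed
    finally have "(\<lambda>n. measure \<nu> {x. norm x > real n}) \<longlonglongrightarrow> 0" by simp
    from order_tendstoD(2)[OF this e] obtain n where "measure \<nu> {x. norm x > real n} < e"
      by (auto simp: eventually_sequentially)
    then show ?thesis by (intro exI[of _ "real n"]) simp
  qed
  have trig: "(\<lambda>n. \<integral>x. q x \<partial>\<nu>s n) \<longlonglongrightarrow> (\<integral>x. q x \<partial>\<nu>) \<and> integrable \<nu> q \<and>
      (\<forall>\<^sub>F n in sequentially. integrable (\<nu>s n) q)" if "trig_fun q" for q
    using that
  proof (induction rule: trig_fun.induct)
    case (cos c u a)
    have i: "integrable m (\<lambda>x. c * cos (u \<bullet> x + a))" if "prob_space m" "sets m = sets borel" for m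
    proof -
      interpret prob_space m by fact
      show ?thesis using that(2)
        by (intro integrable_const_bound[where B="\<bar>c\<bar>"])
           (auto simp: abs_mult mult_left_le cong: measurable_cong_sets)
    qed
    have "\<forall>\<^sub>F n in sequentially. integrable (\<nu>s n) (\<lambda>x. c * cos (u \<bullet> x + a))"
      using prob(1) sets(1) by eventually_elim (rule i)
    moreover have "integrable \<nu> (\<lambda>x. c * cos (u \<bullet> x + a))" using i prob(2) sets(2) by blast
    moreover have "(\<lambda>n. \<integral>x. c * cos (u \<bullet> x + a) \<partial>\<nu>s n) \<longlonglongrightarrow> (\<integral>x. c * cos (u \<bullet> x + a) \<partial>\<nu>)"
      by (simp add: assms(5) tendsto_mult_left)
    ultimately show ?case by blast
  next
    case (add f g)
    have ev: "\<forall>\<^sub>F n in sequentially. integrable (\<nu>s n) f" "\<forall>\<^sub>F n in sequentially. integrable (\<nu>s n) g"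
      using add by auto
    have "(\<lambda>n. (\<integral>x. f x \<partial>\<nu>s n) + (\<integral>x. g x \<partial>\<nu>s n)) \<longlonglongrightarrow> (\<integral>x. f x \<partial>\<nu>) + (\<integral>x. g x \<partial>\<nu>)"
      using add by (intro tendsto_add) auto
    moreover have "\<forall>\<^sub>F n in sequentially. (\<integral>x. f x \<partial>\<nu>s n) + (\<integral>x. g x \<partial>\<nu>s n) = (\<integral>x. f x + g x \<partial>\<nu>s n)"
      using ev by eventually_elim auto
    ultimately have "(\<lambda>n. \<integral>x. f x + g x \<partial>\<nu>s n) \<longlonglongrightarrow> (\<integral>x. f x \<partial>\<nu>) + (\<integral>x. g x \<partial>\<nu>)"
      using Lim_transform_eventually by fast
    moreover have "\<forall>\<^sub>F n in sequentially. integrable (\<nu>s n) (\<lambda>x. f x + g x)"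
      using ev by eventually_elim auto
    ultimately show ?case using add by simp
  qed
  have Gm: "G \<in> borel_measurable borel"
    using G(1) by (rule borel_measurable_continuous_onI)
  show ?thesis
  proof (rule tendstoI)
    fix e0 :: real assume "e0 > 0"
    \<comment> \<open>Replacing \<open>G\<close> by \<open>q\<close> costs
      \<open>e + 2 * B * e\<close> under each of the two measures, and convergence on
      \<open>q\<close> costs \<open>e\<close>; together this is \<open>(3 + 4 * B) * e\<close>, half
      of \<open>e0\<close>.\<close>
    define e where "e = e0 / (8 * B + 6)"
    have e: "e > 0" using \<open>e0 > 0\<close> B0 by (simp add: e_def add_nonneg_pos)
    obtain L1 where L1: "\<forall>\<^sub>F n in sequentially. measure (\<nu>s n) {x. norm x > L1} \<le> e" using tight[OF e] by blast
    obtain L2 where L2: "measure \<nu> {x. norm x > L2} \<le> e" using tight_\<nu>[OF e] by blast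
    define L where "L = max 1 (max L1 L2)"
    have L: "L > 0" "L \<ge> L1" "L \<ge> L2" by (auto simp: L_def)
    \<comment> \<open>With this \<open>c\<close> every coordinate of a point of norm at most
      \<open>L\<close> is scaled into [-pi/2, pi/2], where \<open>arcsin\<close> inverts
      \<open>sin\<close>.\<close>
    define c where "c = pi / (2 * L)"
    have c: "c > 0" "c * L = pi / 2" using L by (auto simp: c_def)
    define Q :: "'a set" where "Q = cbox (- \<Sum>Basis) (\<Sum>Basis)"
    have Q: "s \<in> Q \<longleftrightarrow> (\<forall>i\<in>Basis. -1 \<le> s \<bullet> i \<and> s \<bullet> i \<le> 1)" for s
      by (simp add: Q_def mem_box)
    define H where "H s = G (\<Sum>i\<in>Basis. (arcsin (s \<bullet> i) / c) *\<^sub>R i)" for s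
    define sn where "sn x = (\<Sum>i\<in>Basis. sin (c * (x \<bullet> i)) *\<^sub>R i)" for x :: 'a
    have contH: "continuous_on Q H"
      unfolding H_def
      by (rule continuous_on_compose2[OF G(1)])
         (auto intro!: continuous_intros simp: Q c_def L)
    obtain p where p: "real_polynomial_function p" "\<And>s. s \<in> Q \<Longrightarrow> \<bar>H s - p s\<bar> < e"
      using Stone_Weierstrass_real_polynomial_function[OF _ contH e] by (metis Q_def compact_cbox)
    define q where "q x = p (sn x)" for x
    have tq: "trig_fun q" unfolding q_def sn_def by (rule trig_fun_polynomial_sin[OF p(1)])
    have snQ: "sn x \<in> Q" for x by (auto simp: Q sn_def)
    have q1: "\<bar>H (sn x) - q x\<bar> < e" for x using p(2)[OF snQ] by (simp add: q_def)
    have Hle: "\<bar>H s\<bar> \<le> B" for s by (simp add: H_def G(2))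
    have Heq: "H (sn x) = G x" if "norm x \<le> L" for x
    proof -
      have "arcsin (sin (c * (x \<bullet> i))) / c = x \<bullet> i" if i: "i \<in> Basis" for i
      proof -
        have "\<bar>x \<bullet> i\<bar> \<le> L" using Basis_le_norm[OF i, of x] \<open>norm x \<le> L\<close> by linarith
        then have "\<bar>c * (x \<bullet> i)\<bar> \<le> pi/2" using c by (metis abs_mult abs_of_pos mult_left_mono order_less_imp_le)
        then have "arcsin (sin (c * (x \<bullet> i))) = c * (x \<bullet> i)" by (intro arcsin_sin) (auto simp: abs_le_iff)
        then show ?thesis using c by simp
      qed
      then have "(\<Sum>i\<in>Basis. (arcsin (sn x \<bullet> i) / c) *\<^sub>R i) = x"
        by (simp add: sn_def euclidean_representation cong: sum.cong)
      then show ?thesis by (simp add: H_def)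
    qed
    have diff: "\<bar>G x - q x\<bar> \<le> e + 2 * B * indicator {x. norm x > L} x" for x
    proof (cases "norm x > L")
      case True
      have "\<bar>G x - q x\<bar> \<le> \<bar>G x\<bar> + \<bar>H (sn x)\<bar> + \<bar>H (sn x) - q x\<bar>" by linarith
      also have "\<dots> \<le> B + B + e" using q1[of x] Hle[of "sn x"] G(2)[of x] by linarith
      finally show ?thesis using True by simp
    next
      case False
      then show ?thesis using q1[of x] Heq[of x] by simp
    qed
    have main: "\<bar>(\<integral>x. G x \<partial>m) - (\<integral>x. q x \<partial>m)\<bar> \<le> e + 2 * B * e"
      if m: "prob_space m" "sets m = sets borel" "integrable m q" "measure m {x. norm x > L} \<le> e" for m
    proof -
      interpret prob_space m by fact
      have [measurable]: "G \<in> borel_measurable m" "{x. norm x > L} \<in> sets m"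
        using Gm m(2) by (auto cong: measurable_cong_sets)
      have iG: "integrable m G" by (rule integrable_const_bound[where B=B]) (auto simp: G)
      have ii: "integrable m (\<lambda>x. e + 2 * B * indicator {x. norm x > L} x)"
        using B0 e by (intro integrable_const_bound[where B="e + 2 * B"] AE_I2)
          (auto split: split_indicator)
      have "\<bar>(\<integral>x. G x \<partial>m) - (\<integral>x. q x \<partial>m)\<bar> = \<bar>\<integral>x. G x - q x \<partial>m\<bar>"
        using iG m by simp
      also have "\<dots> \<le> (\<integral>x. \<bar>G x - q x\<bar> \<partial>m)" by (rule integral_abs_bound)
      also have "\<dots> \<le> (\<integral>x. e + 2 * B * indicator {x. norm x > L} x \<partial>m)"
        using iG m(3) ii by (intro integral_mono diff) auto
      also have "\<dots> = e + 2 * B * measure m {x. norm x > L}"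
      proof -
        have "integrable m (indicator {x. norm x > L} :: 'a \<Rightarrow> real)"
          by (rule integrable_const_bound[where B=1]) auto
        then show ?thesis using sets_eq_imp_space_eq[OF m(2)] prob_space by simp
      qed
      also have "\<dots> \<le> e + 2 * B * e" using m(4) B0 by (intro add_left_mono mult_left_mono) auto
      finally show ?thesis .
    qed
    have mono: "measure m {x. norm x > L} \<le> e"
      if "prob_space m" "sets m = sets borel" "measure m {x. norm x > L'} \<le> e" "L' \<le> L" for m :: "'a measure" and L'
    proof -
      interpret prob_space m by fact
      have "measure m {x. norm x > L} \<le> measure m {x. norm x > L'}"
        using that by (intro finite_measure_mono) auto
      then show ?thesis using that by linarith
    qed
    have m2: "\<bar>(\<integral>x. G x \<partial>\<nu>) - (\<integral>x. q x \<partial>\<nu>)\<bar> \<le> e + 2 * B * e"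
      using trig[OF tq] by (intro main prob sets mono[OF _ _ L2]) (auto simp: L)
    have "\<forall>\<^sub>F n in sequentially. \<bar>(\<integral>x. q x \<partial>\<nu>s n) - (\<integral>x. q x \<partial>\<nu>)\<bar> < e"
      using trig[OF tq] e by (auto simp: tendsto_iff dist_real_def)
    moreover have "\<forall>\<^sub>F n in sequentially. integrable (\<nu>s n) q" using trig[OF tq] by blast
    ultimately show "\<forall>\<^sub>F n in sequentially. dist (\<integral>x. G x \<partial>\<nu>s n) (\<integral>x. G x \<partial>\<nu>) < e0"
      using prob(1) sets(1) L1
    proof eventually_elim
      case (elim n)
      have "\<bar>(\<integral>x. G x \<partial>\<nu>s n) - (\<integral>x. q x \<partial>\<nu>s n)\<bar> \<le> e + 2 * B * e"
        using elim by (intro main mono[OF _ _ elim(5)]) (auto simp: L)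
      then have "\<bar>(\<integral>x. G x \<partial>\<nu>s n) - (\<integral>x. G x \<partial>\<nu>)\<bar> < e * (3 + 4 * B)"
        using m2 elim(1) by (simp add: algebra_simps)
      also have "\<dots> \<le> e * (8 * B + 6)" using e B0 by (intro mult_left_mono) auto
      also have "\<dots> = e0" using B0 by (simp add: e_def add_nonneg_eq_0_iff)
      finally show ?case by (simp add: dist_real_def)
    qed
  qed
qed

section \<open>Normal laws and inverses of positive definite matrices\<close>

text \<open>Cholesky elimination, one index at a time. A pivot may be zero, and then
  semidefiniteness forces its whole row to vanish; so no rank assumption is made and singular
  covariances are covered.\<close>

lemma psd_gram:
  fixes S :: "'i \<Rightarrow> 'i \<Rightarrow> real"
  assumes "finite I" "\<And>i j. i \<in> I \<Longrightarrow> j \<in> I \<Longrightarrow> S i j = S j i"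
    and "\<And>u. (\<Sum>i\<in>I. \<Sum>j\<in>I. u i * S i j * u j) \<ge> 0"
  shows "\<exists>(m::nat) C. \<forall>i\<in>I. \<forall>j\<in>I. S i j = (\<Sum>l<m. C i l * C j l)"
  using assms
proof (induction I arbitrary: S rule: finite_induct)
  case empty
  then show ?case by simp
next
  case (insert a I S)
  note sym = insert.prems(1) and psd = insert.prems(2)
  have quad: "(\<Sum>i\<in>insert a I. \<Sum>j\<in>insert a I. u i * S i j * u j) =
      (u a)\<^sup>2 * S a a + 2 * u a * (\<Sum>j\<in>I. S a j * u j) + (\<Sum>i\<in>I. \<Sum>j\<in>I. u i * S i j * u j)" for u
  proof -
    have "(\<Sum>i\<in>I. u i * S i a * u a) = u a * (\<Sum>j\<in>I. S a j * u j)"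
      unfolding sum_distrib_left using sym by (intro sum.cong) auto
    moreover have "(\<Sum>i\<in>I. u a * S a i * u i) = u a * (\<Sum>j\<in>I. S a j * u j)"
      unfolding sum_distrib_left by (intro sum.cong) auto
    ultimately show ?thesis
      using insert.hyps by (simp add: sum.distrib power2_eq_square algebra_simps)
  qed
  have Saa: "S a a \<ge> 0"
  proof -
    have "(\<Sum>j\<in>I. S a j * (if j = a then 1 else 0)) = 0"
      "(\<Sum>i\<in>I. \<Sum>j\<in>I. (if i = a then 1 else 0) * S i j * (if j = a then 1 else 0)) = 0"
      using insert.hyps by (auto intro!: sum.neutral)
    then show ?thesis using psd[of "\<lambda>i. if i = a then 1 else 0"] unfolding quad by simp
  qed
  have Sa0: "S a j = 0" if "S a a = 0" "j \<in> I" for j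
  proof -
    have *: "2 * t * S a j + S j j \<ge> 0" for t
    proof -
      have "(\<Sum>i\<in>I. S a i * (if i = a then t else if i = j then 1 else 0)) = (\<Sum>i\<in>I. if i = j then S a i else 0)"
        using insert.hyps by (intro sum.cong) auto
      also have "\<dots> = S a j" using that insert.hyps by simp
      finally have 1: "(\<Sum>i\<in>I. S a i * (if i = a then t else if i = j then 1 else 0)) = S a j" .
      have "(\<Sum>i\<in>I. \<Sum>k\<in>I. (if i = a then t else if i = j then 1 else 0) * S i k * (if k = a then t else if k = j then 1 else 0))
          = (\<Sum>i\<in>I. \<Sum>k\<in>I. if k = j then (if i = j then S i k else 0) else 0)"
        using insert.hyps by (intro sum.cong) auto
      also have "\<dots> = S j j" using that insert.hyps by simp
      finally show ?thesis
        using psd[of "\<lambda>i. if i = a then t else if i = j then 1 else 0"] that 1 unfolding quad by simp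
    qed
    show ?thesis
    proof (rule ccontr)
      assume "S a j \<noteq> 0"
      \<comment> \<open>For this \<open>t\<close> the left side of the inequality equals -1.\<close>
      with *[of "- (S j j + 1) / (2 * S a j)"] show False by (simp add: field_simps)
    qed
  qed
  \<comment> \<open>Schur complement of the pivot. For \<open>S a a = 0\<close> the quotient is 0 by
    convention, in agreement with the vanishing row.\<close>
  define S' where "S' i j = S i j - S i a * S a j / S a a" for i j
  have "\<exists>(m::nat) C. \<forall>i\<in>I. \<forall>j\<in>I. S' i j = (\<Sum>l<m. C i l * C j l)"
  proof (rule insert.IH)
    fix i j assume "i \<in> I" "j \<in> I"
    then show "S' i j = S' j i" using sym by (simp add: S'_def mult.commute)
  next
    fix u
    define s where "s = (\<Sum>j\<in>I. S a j * u j)"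
    \<comment> \<open>For a positive pivot this value at \<open>a\<close> minimizes the form, so
      that the full form at \<open>u'\<close> equals the reduced form at \<open>u\<close>.\<close>
    define u' where "u' = u(a := - s / S a a)"
    have "(\<Sum>i\<in>I. \<Sum>j\<in>I. u i * S' i j * u j) =
        (\<Sum>i\<in>I. \<Sum>j\<in>I. u i * S i j * u j) - (\<Sum>i\<in>I. \<Sum>j\<in>I. (S a i * u i) * (S a j * u j) / S a a)"
      unfolding sum_subtractf[symmetric] S'_def using sym
      by (intro sum.cong) (auto simp: algebra_simps)
    also have "(\<Sum>i\<in>I. \<Sum>j\<in>I. (S a i * u i) * (S a j * u j) / S a a) = s * s / S a a"
      by (simp add: s_def sum_product sum_divide_distrib)
    also have "(\<Sum>i\<in>I. \<Sum>j\<in>I. u i * S i j * u j) - s * s / S a a =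
      (\<Sum>i\<in>insert a I. \<Sum>j\<in>insert a I. u' i * S i j * u' j)"
    proof -
      have "(\<Sum>j\<in>I. S a j * u' j) = s" "(\<Sum>i\<in>I. \<Sum>j\<in>I. u' i * S i j * u' j) = (\<Sum>i\<in>I. \<Sum>j\<in>I. u i * S i j * u j)"
        using insert.hyps unfolding s_def u'_def by (auto intro!: sum.cong)
      then show ?thesis unfolding quad by (simp add: u'_def power2_eq_square field_simps)
    qed
    finally show "(\<Sum>i\<in>I. \<Sum>j\<in>I. u i * S' i j * u j) \<ge> 0" using psd by simp
  qed
  then obtain m :: nat and C where C: "\<And>i j. i \<in> I \<Longrightarrow> j \<in> I \<Longrightarrow> S' i j = (\<Sum>l<m. C i l * C j l)"
    by blast
  define D where "D i l = (if i = a then (if l = m then sqrt (S a a) else 0)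
      else if l = m then S i a / sqrt (S a a) else C i l)" for i l
  have "S i j = (\<Sum>l<Suc m. D i l * D j l)" if ij: "i \<in> insert a I" "j \<in> insert a I" for i j
  proof -
    consider "i = a" "j = a" | "i = a" "j \<in> I" "j \<noteq> a" | "j = a" "i \<in> I" "i \<noteq> a" | "i \<in> I" "j \<in> I" "i \<noteq> a" "j \<noteq> a"
      using ij insert.hyps by auto
    then show ?thesis
    proof cases
      case 1
      then show ?thesis using Saa by (simp add: D_def)
    next
      case 2
      then show ?thesis using Saa Sa0[of j] sym[of a j] by (auto simp: D_def)
    next
      case 3
      then show ?thesis using Saa Sa0[of i] sym[of a i] by (auto simp: D_def)
    next
      case 4
      have "(\<Sum>l<Suc m. D i l * D j l) = S' i j + S i a / sqrt (S a a) * (S j a / sqrt (S a a))"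
        using 4 C by (simp add: D_def)
      also have "S i a / sqrt (S a a) * (S j a / sqrt (S a a)) = S i a * S a j / S a a"
        using Saa sym[of a j] 4 by simp
      finally show ?thesis by (simp add: S'_def)
    qed
  qed
  then show ?case by blast
qed

text \<open>The image of a standard Gaussian vector under a Gram factor \<open>C\<close> of
  \<open>S\<close>; independence of the coordinates turns its characteristic function into a
  product. Since \<open>C\<close> may have any rank, a singular \<open>S\<close>, even
  \<open>S = 0\<close>, is allowed.\<close>

lemma ex_normal_law:
  fixes S :: "'i \<Rightarrow> 'i \<Rightarrow> real"
  assumes I: "finite I" and "\<And>i j. i \<in> I \<Longrightarrow> j \<in> I \<Longrightarrow> S i j = S j i"
    and "\<And>u. (\<Sum>i\<in>I. \<Sum>j\<in>I. u i * S i j * u j) \<ge> 0"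
  shows "\<exists>N. is_normal_law I (\<lambda>_. 0) S N"
proof -
  obtain m :: nat and C where C: "\<And>i j. i \<in> I \<Longrightarrow> j \<in> I \<Longrightarrow> S i j = (\<Sum>l<m. C i l * C j l)"
    using psd_gram[OF assms] by blast
  define P where "P = PiM {..<m} (\<lambda>_. std_normal_distribution)"
  define L where "L = (\<lambda>z. \<lambda>i\<in>I. \<Sum>l<m. C i l * z l)"
  define N where "N = distr P (PiM I (\<lambda>_. borel)) L"
  interpret std: prob_space std_normal_distribution by (rule prob_space_normal_density) simp
  interpret PS: product_prob_space "\<lambda>_. std_normal_distribution" "{..<m}" by standard
  interpret P: prob_space P unfolding P_def by (intro prob_space_PiM std.prob_space_axioms)
  have Pm[measurable]: "(\<lambda>z. z l) \<in> borel_measurable P" if "l < m" for l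
    unfolding P_def using that measurable_component_singleton[of l "{..<m}" "\<lambda>_. std_normal_distribution"]
    by (simp cong: measurable_cong_sets)
  have Lm[measurable]: "L \<in> measurable P (PiM I (\<lambda>_. borel))"
    unfolding L_def by (intro measurable_restrict borel_measurable_sum borel_measurable_times borel_measurable_const) auto
  have "(CLINT x|N. iexp (\<Sum>i\<in>I. u i * x i)) = of_real (exp (- (\<Sum>i\<in>I. \<Sum>j\<in>I. u i * S i j * u j) / 2))" for u
  proof -
    define c where "c l = (\<Sum>i\<in>I. u i * C i l)" for l
    have "(CLINT x|N. iexp (\<Sum>i\<in>I. u i * x i)) = (CLINT z|P. iexp (\<Sum>i\<in>I. u i * L z i))"
      unfolding N_def by (rule integral_distr) measurable
    also have "\<dots> = (CLINT z|P. (\<Prod>l<m. iexp (c l * z l)))"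
    proof (rule Bochner_Integration.integral_cong[OF refl])
      fix z
      have "(\<Sum>i\<in>I. u i * L z i) = (\<Sum>i\<in>I. \<Sum>l<m. u i * C i l * z l)"
        by (simp add: L_def sum_distrib_left mult.assoc)
      also have "\<dots> = (\<Sum>l<m. c l * z l)"
        unfolding c_def sum_distrib_right by (rule sum.swap)
      finally show "iexp (\<Sum>i\<in>I. u i * L z i) = (\<Prod>l<m. iexp (c l * z l))"
        by (simp add: exp_sum sum_distrib_left)
    qed
    also have "\<dots> = (\<Prod>l<m. (CLINT x|std_normal_distribution. iexp (c l * x)))"
      unfolding P_def by (rule PS.product_integral_prod)
        (auto intro!: std.integrable_const_bound[where B=1] AE_I2)
    also have "\<dots> = (\<Prod>l<m. of_real (exp (- ((c l)\<^sup>2) / 2)))"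
      using char_std_normal_distribution by (simp add: char_def fun_eq_iff)
    also have "\<dots> = of_real (exp (\<Sum>l<m. - ((c l)\<^sup>2) / 2))"
      by (simp add: exp_sum)
    also have "(\<Sum>l<m. - ((c l)\<^sup>2) / 2) = - (\<Sum>l<m. (c l)\<^sup>2) / 2"
      by (simp add: sum_divide_distrib sum_negf)
    also have "(\<Sum>l<m. (c l)\<^sup>2) = (\<Sum>l<m. \<Sum>i\<in>I. \<Sum>j\<in>I. u i * C i l * (u j * C j l))"
      by (simp add: c_def power2_eq_square sum_product)
    also have "\<dots> = (\<Sum>i\<in>I. \<Sum>j\<in>I. \<Sum>l<m. u i * C i l * (u j * C j l))"
      by (subst sum.swap) (intro sum.cong refl sum.swap)
    also have "\<dots> = (\<Sum>i\<in>I. \<Sum>j\<in>I. u i * S i j * u j)"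
      by (intro sum.cong) (auto simp: C sum_distrib_left sum_distrib_right algebra_simps)
    finally show ?thesis .
  qed
  moreover have "prob_space N" unfolding N_def by (rule P.prob_space_distr) measurable
  moreover have "sets N = sets (PiM I (\<lambda>_. borel))" by (simp add: N_def)
  ultimately show ?thesis unfolding is_normal_law_def by (intro exI[of _ N]) simp
qed

text \<open>Filling up \<open>S\<close> by the identity outside \<open>I\<close> gives a matrix over
  the whole index type with trivial kernel, to which matrix inversion applies. The inverse is
  semidefinite because its form at \<open>u\<close> is the form of \<open>S\<close> at
  \<open>R u\<close>.\<close>

lemma pd_inverse:
  fixes S :: "'q::finite \<Rightarrow> 'q \<Rightarrow> real"
  assumes sym: "\<And>i j. i \<in> I \<Longrightarrow> j \<in> I \<Longrightarrow> S i j = S j i"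
    and pd: "\<And>u. \<exists>i\<in>I. u i \<noteq> 0 \<Longrightarrow> (\<Sum>i\<in>I. \<Sum>j\<in>I. u i * S i j * u j) > 0"
  shows "\<exists>R. is_inverse_on I S R \<and> (\<forall>i\<in>I. \<forall>j\<in>I. R i j = R j i) \<and>
    (\<forall>u. (\<Sum>i\<in>I. \<Sum>j\<in>I. u i * R i j * u j) \<ge> 0)"
proof -
  define A :: "real^'q^'q" where "A = (\<chi> i j. if i \<in> I \<and> j \<in> I then S i j else if i = j then 1 else 0)"
  have row: "(\<Sum>k\<in>UNIV. A $ i $ k * x k) = (\<Sum>k\<in>I. S i k * x k)" if "i \<in> I" for i x
  proof -
    have "(\<Sum>k\<in>UNIV. A $ i $ k * x k) = (\<Sum>k\<in>I. A $ i $ k * x k)"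
      using that by (intro sum.mono_neutral_right) (auto simp: A_def)
    then show ?thesis using that by (simp add: A_def cong: sum.cong)
  qed
  have col: "(\<Sum>k\<in>UNIV. x k * A $ k $ j) = (\<Sum>k\<in>I. x k * S k j)" if "j \<in> I" for j x
  proof -
    have "(\<Sum>k\<in>UNIV. x k * A $ k $ j) = (\<Sum>k\<in>I. x k * A $ k $ j)"
      using that by (intro sum.mono_neutral_right) (auto simp: A_def)
    then show ?thesis using that by (simp add: A_def cong: sum.cong)
  qed
  have "x = 0" if x: "A *v x = 0" for x
  proof -
    have 1: "x $ i = 0" if "i \<notin> I" for i
    proof -
      have "(A *v x) $ i = (\<Sum>j\<in>UNIV. (if i = j then 1 else 0) * x $ j)"
        using that by (simp add: A_def matrix_vector_mult_def)
      also have "\<dots> = (\<Sum>j\<in>UNIV. if i = j then x $ j else 0)"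
        by (intro sum.cong) auto
      also have "\<dots> = x $ i" by simp
      finally show ?thesis using x by simp
    qed
    have 2: "(\<Sum>j\<in>I. S i j * x $ j) = 0" if "i \<in> I" for i
      using row[OF that, of "\<lambda>k. x $ k"] x by (simp add: matrix_vector_mult_def vec_eq_iff)
    have "(\<Sum>i\<in>I. \<Sum>j\<in>I. x $ i * S i j * x $ j) = (\<Sum>i\<in>I. x $ i * (\<Sum>j\<in>I. S i j * x $ j))"
      by (simp add: sum_distrib_left mult.assoc)
    also have "\<dots> = 0" by (simp add: 2)
    finally have "\<forall>i\<in>I. x $ i = 0" using pd[of "\<lambda>i. x $ i"] by fastforce
    with 1 show "x = 0" by (metis vec_eq_iff zero_index)
  qed
  then have "\<exists>B. B ** A = mat 1" unfolding matrix_left_invertible_ker by blast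
  then have "invertible A" by (simp add: invertible_left_inverse)
  then obtain B where B: "A ** B = mat 1" "B ** A = mat 1" unfolding invertible_def by blast
  define R where "R i j = B $ i $ j" for i j
  have SR: "(\<Sum>k\<in>I. S i k * R k j) = (if i = j then 1 else 0)" if "i \<in> I" "j \<in> I" for i j
    using row[OF that(1), of "\<lambda>k. R k j"] B(1)
    by (auto simp: R_def matrix_matrix_mult_def vec_eq_iff mat_def)
  have RS: "(\<Sum>k\<in>I. R i k * S k j) = (if i = j then 1 else 0)" if "i \<in> I" "j \<in> I" for i j
    using col[OF that(2), of "\<lambda>k. R i k"] B(2)
    by (auto simp: R_def matrix_matrix_mult_def vec_eq_iff mat_def)
  have fin: "finite I" by simp
  have Rsym: "R i j = R j i" if ij: "i \<in> I" "j \<in> I" for i j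
  proof -
    have "R i j = (\<Sum>k\<in>I. if k = j then R i k else 0)" using ij fin by simp
    also have "\<dots> = (\<Sum>k\<in>I. R i k * (if k = j then 1 else 0))" by (intro sum.cong) auto
    also have "\<dots> = (\<Sum>k\<in>I. R i k * (\<Sum>l\<in>I. R j l * S l k))"
      using ij RS by (intro sum.cong) auto
    also have "\<dots> = (\<Sum>k\<in>I. \<Sum>l\<in>I. R j l * (R i k * S k l))"
      unfolding sum_distrib_left using sym by (intro sum.cong) auto
    also have "\<dots> = (\<Sum>l\<in>I. R j l * (\<Sum>k\<in>I. R i k * S k l))"
      by (subst sum.swap) (simp add: sum_distrib_left)
    also have "\<dots> = (\<Sum>l\<in>I. R j l * (if i = l then 1 else 0))"
      using ij RS by (intro sum.cong) auto
    also have "\<dots> = (\<Sum>l\<in>I. if i = l then R j l else 0)" by (intro sum.cong) auto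
    also have "\<dots> = R j i" using ij fin by simp
    finally show ?thesis .
  qed
  have "(\<Sum>i\<in>I. \<Sum>j\<in>I. u i * R i j * u j) \<ge> 0" for u
  proof -
    define w where "w i = (\<Sum>j\<in>I. R i j * u j)" for i
    have Sw: "(\<Sum>j\<in>I. S i j * w j) = u i" if "i \<in> I" for i
    proof -
      have "(\<Sum>j\<in>I. S i j * w j) = (\<Sum>j\<in>I. \<Sum>k\<in>I. S i j * R j k * u k)"
        by (simp add: w_def sum_distrib_left mult.assoc)
      also have "\<dots> = (\<Sum>k\<in>I. (\<Sum>j\<in>I. S i j * R j k) * u k)"
        by (subst sum.swap) (simp add: sum_distrib_right)
      also have "\<dots> = (\<Sum>k\<in>I. (if i = k then 1 else 0) * u k)" using that SR by (intro sum.cong) auto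
      also have "\<dots> = (\<Sum>k\<in>I. if i = k then u k else 0)" by (intro sum.cong) auto
      also have "\<dots> = u i" using that fin by simp
      finally show ?thesis .
    qed
    have "(\<Sum>i\<in>I. \<Sum>j\<in>I. u i * R i j * u j) = (\<Sum>i\<in>I. w i * u i)"
      unfolding w_def sum_distrib_right by (intro sum.cong refl) (simp add: algebra_simps)
    also have "\<dots> = (\<Sum>i\<in>I. \<Sum>j\<in>I. w i * S i j * w j)"
      using Sw by (simp add: sum_distrib_left[symmetric] mult.assoc)
    also have "\<dots> \<ge> 0"
    proof (cases "\<exists>i\<in>I. w i \<noteq> 0")
      case True
      then show ?thesis using pd[of w] by simp
    qed (auto intro!: sum_nonneg)
    finally show ?thesis by simp
  qed
  with SR RS Rsym show ?thesis unfolding is_inverse_on_def by (intro exI[of _ R]) auto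
qed

section \<open>A Jackson estimate for piecewise polynomials\<close>

primrec fd :: "nat \<Rightarrow> (nat \<Rightarrow> real) \<Rightarrow> nat \<Rightarrow> real" where
  "fd 0 a i = a i"
| "fd (Suc l) a i = fd l a (Suc i) - fd l a i"

lemma fd_fd: "fd m (fd k a) = fd (m + k) a"
  by (induction m) (auto simp: fun_eq_iff)

lemma fd_shift: "fd l (\<lambda>i. a (i + s)) j = fd l a (j + s)"
  by (induction l arbitrary: j) auto

lemma fd_expand: "fd k a i = (\<Sum>j\<le>k. (- 1) ^ (k - j) * of_nat (k choose j) * a (i + j))"
proof (induction k arbitrary: i)
  case (Suc k)
  let ?c = "\<lambda>k j. (- 1) ^ (k - j) * real (k choose j)"
  have "(\<Sum>j\<le>Suc k. ?c (Suc k) j * a (i + j)) =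
      ?c (Suc k) 0 * a i + (\<Sum>j\<le>k. ?c (Suc k) (Suc j) * a (i + Suc j))"
    by (subst sum.atMost_Suc_shift) simp
  also have "(\<Sum>j\<le>k. ?c (Suc k) (Suc j) * a (i + Suc j)) =
      (\<Sum>j\<le>k. ?c k j * a (Suc i + j)) + (\<Sum>j\<le>k. (- 1) ^ (k - j) * real (k choose Suc j) * a (i + Suc j))"
    by (simp add: sum.distrib[symmetric] algebra_simps)
  also have "(\<Sum>j\<le>k. (- 1) ^ (k - j) * real (k choose Suc j) * a (i + Suc j)) =
      - (\<Sum>j<k. ?c k (Suc j) * a (i + Suc j))"
  proof -
    have "(\<Sum>j\<le>k. (- 1) ^ (k - j) * real (k choose Suc j) * a (i + Suc j)) =
        (\<Sum>j<k. (- 1) ^ (k - j) * real (k choose Suc j) * a (i + Suc j))"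
      by (intro sum.mono_neutral_right) (auto simp: binomial_eq_0)
    also have "\<dots> = (\<Sum>j<k. - (?c k (Suc j) * a (i + Suc j)))"
    proof (intro sum.cong refl)
      fix j assume "j \<in> {..<k}"
      then have "k - j = Suc (k - Suc j)" by auto
      then show "(- 1) ^ (k - j) * real (k choose Suc j) * a (i + Suc j) = - (?c k (Suc j) * a (i + Suc j))"
        by simp
    qed
    finally show ?thesis by (simp add: sum_negf)
  qed
  also have "?c (Suc k) 0 * a i + ((\<Sum>j\<le>k. ?c k j * a (Suc i + j)) + - (\<Sum>j<k. ?c k (Suc j) * a (i + Suc j))) =
      (\<Sum>j\<le>k. ?c k j * a (Suc i + j)) - (\<Sum>j\<le>k. ?c k j * a (i + j))"
    by (cases k) (simp_all add: sum.atMost_Suc_shift lessThan_Suc_atMost del: sum.atMost_Suc)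
  finally show ?case using Suc.IH by simp
qed simp

lemma newton_forward: "a i = (\<Sum>l\<le>i. of_nat (i choose l) * fd l a 0)"
proof (induction i arbitrary: a)
  case (Suc i)
  have "a (Suc i) = (\<Sum>l\<le>i. of_nat (i choose l) * fd l (\<lambda>i. a (i + 1)) 0)"
    using Suc.IH[of "\<lambda>i. a (i + 1)"] by simp
  also have "\<dots> = (\<Sum>l\<le>i. of_nat (i choose l) * fd l a 0) + (\<Sum>l\<le>i. of_nat (i choose l) * fd (Suc l) a 0)"
    by (simp only: fd_shift) (simp add: sum.distrib[symmetric] algebra_simps)
  also have "(\<Sum>l\<le>i. of_nat (i choose l) * fd l a 0) = (\<Sum>l\<le>Suc i. of_nat (i choose l) * fd l a 0)"
    by (simp add: binomial_eq_0)
  also have "\<dots> = fd 0 a 0 + (\<Sum>l\<le>i. of_nat (i choose Suc l) * fd (Suc l) a 0)"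
    by (subst sum.atMost_Suc_shift) simp
  finally show ?case
    by (subst sum.atMost_Suc_shift) (simp add: sum.distrib[symmetric] algebra_simps)
qed simp

lemma abs_fd_le: "\<bar>fd m c j\<bar> \<le> 2 ^ m * (\<Sum>i\<le>m. \<bar>c (j + i)\<bar>)"
proof (induction m arbitrary: j)
  case (Suc m)
  have "\<bar>fd (Suc m) c j\<bar> \<le> \<bar>fd m c (Suc j)\<bar> + \<bar>fd m c j\<bar>" by simp
  also have "\<dots> \<le> 2 ^ m * (\<Sum>i\<le>m. \<bar>c (Suc j + i)\<bar>) + 2 ^ m * (\<Sum>i\<le>m. \<bar>c (j + i)\<bar>)"
    by (rule add_mono[OF Suc.IH[of "Suc j"] Suc.IH[of j]])
  also have "\<dots> \<le> 2 ^ m * (\<Sum>i\<le>Suc m. \<bar>c (j + i)\<bar>) + 2 ^ m * (\<Sum>i\<le>Suc m. \<bar>c (j + i)\<bar>)"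
  proof -
    have "(\<Sum>i\<le>m. \<bar>c (Suc j + i)\<bar>) \<le> (\<Sum>i\<le>Suc m. \<bar>c (j + i)\<bar>)"
      by (subst sum.atMost_Suc_shift) simp
    moreover have "(\<Sum>i\<le>m. \<bar>c (j + i)\<bar>) \<le> (\<Sum>i\<le>Suc m. \<bar>c (j + i)\<bar>)" by simp
    ultimately show ?thesis by (intro add_mono mult_left_mono) simp_all
  qed
  finally show ?case by simp
qed simp

text \<open>The omitted terms have order l between k and i, and each such difference is an (l -
  k)-th difference of the k-th differences inside the window. One factor 2^M comes from expanding
  it, the other from the row sum of the binomial coefficients.\<close>

lemma newton_error:
  assumes "i < M"
  shows "\<bar>a i - (\<Sum>l<k. of_nat (i choose l) * fd l a 0)\<bar> \<le> 4 ^ M * (\<Sum>i'<M - k. \<bar>fd k a i'\<bar>)"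
proof -
  let ?F = "\<Sum>i'<M - k. \<bar>fd k a i'\<bar>"
  have F0: "?F \<ge> 0" by (intro sum_nonneg) auto
  \<comment> \<open>The range is padded with vanishing binomials, since i may be smaller than
    k.\<close>
  have "(\<Sum>l\<le>i. of_nat (i choose l) * fd l a 0) = (\<Sum>l\<in>{..i} \<union> {..<k}. of_nat (i choose l) * fd l a 0)"
    by (intro sum.mono_neutral_left) (auto simp: binomial_eq_0)
  also have "{..i} \<union> {..<k} = {..<k} \<union> {k..i}" by auto
  also have "(\<Sum>l\<in>\<dots>. of_nat (i choose l) * fd l a 0) =
      (\<Sum>l<k. of_nat (i choose l) * fd l a 0) + (\<Sum>l=k..i. of_nat (i choose l) * fd l a 0)"
    by (intro sum.union_disjoint) auto
  finally have "a i - (\<Sum>l<k. of_nat (i choose l) * fd l a 0) = (\<Sum>l=k..i. of_nat (i choose l) * fd l a 0)"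
    using newton_forward[of a i] by simp
  also have "\<bar>\<dots>\<bar> \<le> (\<Sum>l=k..i. \<bar>of_nat (i choose l) * fd l a 0\<bar>)" by (rule sum_abs)
  also have "\<dots> \<le> (\<Sum>l=k..i. of_nat (i choose l) * (2 ^ M * ?F))"
  proof (rule sum_mono)
    fix l assume l: "l \<in> {k..i}"
    have "\<bar>fd l a 0\<bar> = \<bar>fd (l - k) (fd k a) 0\<bar>" using l by (simp add: fd_fd)
    also have "\<dots> \<le> 2 ^ (l - k) * (\<Sum>i'\<le>l - k. \<bar>fd k a i'\<bar>)" using abs_fd_le[of "l - k" "fd k a" 0] by simp
    also have "\<dots> \<le> 2 ^ M * ?F"
      using l assms by (intro mult_mono power_increasing sum_mono2) (auto intro: sum_nonneg)
    finally show "\<bar>of_nat (i choose l) * fd l a 0\<bar> \<le> of_nat (i choose l) * (2 ^ M * ?F)"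
      by (simp add: abs_mult mult_left_mono)
  qed
  also have "\<dots> \<le> (\<Sum>l\<le>i. of_nat (i choose l) * (2 ^ M * ?F))"
    using F0 by (intro sum_mono2) auto
  also have "\<dots> = 2 ^ i * (2 ^ M * ?F)"
    by (simp add: sum_distrib_right[symmetric] choose_row_sum flip: of_nat_sum)
  also have "\<dots> \<le> 2 ^ M * (2 ^ M * ?F)"
    using assms F0 by (intro mult_right_mono power_increasing) auto
  also have "\<dots> = 4 ^ M * ?F" by (simp flip: power_mult_distrib)
  finally show ?thesis .
qed

definition binom_poly :: "nat \<Rightarrow> real poly" where
  "binom_poly l = smult (1 / fact l) (\<Prod>i<l. [:- of_nat i, 1:])"

lemma poly_binom_poly: "poly (binom_poly l) (of_nat i) = of_nat (i choose l)"
  by (simp add: binom_poly_def binomial_gbinomial gbinomial_prod_rev poly_prod lessThan_atLeast0)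

lemma degree_binom_poly: "degree (binom_poly l) \<le> l"
proof -
  have "degree (\<Prod>i<l. [:- of_nat i, 1::real:]) \<le> (\<Sum>i<l. degree [:- of_nat i, 1::real:])"
    using degree_prod_sum_le[of "{..<l}" "\<lambda>i. [:- of_nat i, 1::real:]"] by (simp add: o_def)
  then show ?thesis by (simp add: binom_poly_def)
qed

text \<open>The data to be fitted are cell averages, hence increments of a primitive. By Pascal's
  rule the increments of this polynomial at the integers are the Newton sums of \<open>a\<close>
  truncated at order k; its derivative, of degree below k, will be the fit.\<close>

definition newton_prim :: "nat \<Rightarrow> (nat \<Rightarrow> real) \<Rightarrow> real poly" where
  "newton_prim k a = (\<Sum>l<k. smult (fd l a 0) (binom_poly (Suc l)))"

lemma degree_newton_prim: "degree (newton_prim k a) \<le> k"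
  unfolding newton_prim_def
  by (intro degree_sum_le) (auto intro!: order.trans[OF degree_smult_le] order.trans[OF degree_binom_poly])

lemma newton_prim_diff:
  "poly (newton_prim k a) (of_nat (Suc i)) - poly (newton_prim k a) (of_nat i) = (\<Sum>l<k. of_nat (i choose l) * fd l a 0)"
  unfolding newton_prim_def poly_sum poly_smult poly_binom_poly sum_subtractf[symmetric]
  by (intro sum.cong) (auto simp: algebra_simps)

text \<open>Lagrange interpolation: k values determine the polynomial, and every factor of a basis
  polynomial at \<open>t\<close> is at most \<Lambda> * s / s.\<close>

lemma poly_bound_of_points:
  fixes p :: "real poly"
  assumes deg: "degree p < k" and sep: "\<And>i j. i < k \<Longrightarrow> j < k \<Longrightarrow> i \<noteq> j \<Longrightarrow> \<bar>x i - x j\<bar> \<ge> s"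
    and s: "s > 0" and near: "\<And>i. i < k \<Longrightarrow> \<bar>t - x i\<bar> \<le> \<Lambda> * s" and \<Lambda>: "\<Lambda> \<ge> 1"
    and m: "\<And>i. i < k \<Longrightarrow> \<bar>poly p (x i)\<bar> \<le> m"
  shows "\<bar>poly p t\<bar> \<le> k * \<Lambda> ^ k * m"
proof -
  have k: "k > 0" using deg by simp
  have m0: "m \<ge> 0" using m[of 0] k by linarith
  have inj: "inj_on x {..<k}" using sep s by (fastforce simp: inj_on_def)
  define B where "B i = (\<Prod>j\<in>{..<k} - {i}. smult (1 / (x i - x j)) [:- x j, 1:])" for i
  define L where "L = (\<Sum>i<k. smult (poly p (x i)) (B i))"
  have B: "poly (B i) (x j) = (if i = j then 1 else 0)" if "i < k" "j < k" for i j
  proof (cases "i = j")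
    case True
    have "poly (B i) (x i) = (\<Prod>j\<in>{..<k} - {i}. (1::real))"
      unfolding B_def poly_prod
    proof (intro prod.cong refl)
      fix j assume "j \<in> {..<k} - {i}"
      then have "x i - x j \<noteq> 0" using that inj by (auto simp: inj_on_def)
      then show "poly (smult (1 / (x i - x j)) [:- x j, 1:]) (x i) = 1"
        by (simp add: diff_divide_distrib[symmetric])
    qed
    then show ?thesis using True by simp
  next
    case False
    then show ?thesis unfolding B_def poly_prod using that by (auto intro!: prod_zero bexI[of _ j])
  qed
  have degB: "degree (B i) < k" if "i < k" for i
  proof -
    have "degree (B i) \<le> (\<Sum>j\<in>{..<k} - {i}. degree (smult (1 / (x i - x j)) [:- x j, 1:]))"
      unfolding B_def by (rule degree_prod_sum_le[unfolded o_def]) simp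
    also have "\<dots> \<le> (\<Sum>j\<in>{..<k} - {i}. 1)" by (intro sum_mono) auto
    also have "\<dots> < k" using that by simp
    finally show ?thesis .
  qed
  have "p = L"
  proof (rule poly_eqI_degree[where A = "x ` {..<k}"])
    fix y assume "y \<in> x ` {..<k}"
    then obtain j where j: "j < k" "y = x j" by auto
    have "poly L y = (\<Sum>i<k. if i = j then poly p (x i) else 0)"
      unfolding L_def poly_sum j(2) using B j by (intro sum.cong) auto
    then show "poly p y = poly L y" using j by simp
  next
    show "degree p < card (x ` {..<k})" using deg inj by (simp add: card_image)
    have "degree L < k" unfolding L_def using k degB
      by (intro degree_sum_less) (auto intro: le_less_trans[OF degree_smult_le])
    then show "degree L < card (x ` {..<k})" using inj by (simp add: card_image)
  qed
  have Bt: "\<bar>poly (B i) t\<bar> \<le> \<Lambda> ^ k" if "i < k" for i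
  proof -
    have "\<bar>poly (B i) t\<bar> = (\<Prod>j\<in>{..<k} - {i}. \<bar>(t - x j) / (x i - x j)\<bar>)"
      unfolding B_def poly_prod abs_prod by (intro prod.cong refl) (simp add: diff_divide_distrib)
    also have "\<dots> \<le> (\<Prod>j\<in>{..<k} - {i}. \<Lambda>)"
    proof (intro prod_mono conjI)
      fix j assume j: "j \<in> {..<k} - {i}"
      have "\<bar>t - x j\<bar> / \<bar>x i - x j\<bar> \<le> (\<Lambda> * s) / s"
        using near[of j] sep[of i j] j that s \<Lambda> by (intro frac_le) auto
      then show "\<bar>(t - x j) / (x i - x j)\<bar> \<le> \<Lambda>" using s by (simp add: abs_divide)
    qed auto
    also have "\<dots> = \<Lambda> ^ (k - 1)" using that by simp
    also have "\<dots> \<le> \<Lambda> ^ k" using \<Lambda> by (intro power_increasing) auto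
    finally show ?thesis .
  qed
  have "\<bar>poly p t\<bar> \<le> (\<Sum>i<k. \<bar>poly p (x i) * poly (B i) t\<bar>)"
    by (subst \<open>p = L\<close>) (simp add: L_def poly_sum sum_abs)
  also have "\<dots> \<le> (\<Sum>i<k. m * \<Lambda> ^ k)"
    unfolding abs_mult using m Bt m0 by (intro sum_mono mult_mono) auto
  finally show ?thesis by (simp add: mult.commute mult.left_commute)
qed

section \<open>Dyadic cells and averages over them\<close>

definition dcell :: "nat \<Rightarrow> nat \<Rightarrow> real set" where
  "dcell j I = {real I / 2 ^ j ..< (real I + 1) / 2 ^ j}"

definition dind :: "nat \<Rightarrow> real \<Rightarrow> nat" where
  "dind j t = nat \<lfloor>2 ^ j * t\<rfloor>"

definition davg :: "nat \<Rightarrow> (real \<Rightarrow> real) \<Rightarrow> nat \<Rightarrow> real" where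
  "davg j G I = 2 ^ j * (LINT t:dcell j I|lborel. G t)"

lemma dcell_sets[measurable]: "dcell j I \<in> sets borel"
  by (simp add: dcell_def)

lemma dind_measurable[measurable]: "dind j \<in> measurable borel (count_space UNIV)"
  unfolding dind_def by measurable

lemma mem_dcell_iff: "t \<in> dcell j I \<longleftrightarrow> 0 \<le> t \<and> dind j t = I"
proof (cases "0 \<le> t")
  case True
  have "dind j t = I \<longleftrightarrow> \<lfloor>2 ^ j * t\<rfloor> = int I" unfolding dind_def using True by auto
  also have "\<dots> \<longleftrightarrow> real I \<le> 2 ^ j * t \<and> 2 ^ j * t < real I + 1"
    unfolding floor_eq_iff by simp
  also have "\<dots> \<longleftrightarrow> t \<in> dcell j I" by (auto simp: dcell_def field_simps)
  finally show ?thesis using True by simp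
next
  case False
  then have "t < real I / 2 ^ j" by (smt (verit) divide_nonneg_pos of_nat_0_le_iff zero_less_power)
  then show ?thesis using False by (simp add: dcell_def)
qed

lemma dind_less: "t < 1 \<Longrightarrow> dind j t < 2 ^ j"
proof -
  assume "t < 1"
  then have "2 ^ j * t < 2 ^ j" by simp
  then have "\<lfloor>2 ^ j * t\<rfloor> < 2 ^ j" by (simp add: floor_less_iff)
  then show ?thesis unfolding dind_def by (simp add: nat_less_iff)
qed

lemma dind_div: "0 \<le> t \<Longrightarrow> i \<le> j \<Longrightarrow> dind i t = dind j t div 2 ^ (j - i)"
proof -
  assume t: "0 \<le> t" "i \<le> j"
  have "(2::real) ^ j = 2 ^ i * 2 ^ (j - i)" using t by (simp flip: power_add)
  then have "\<lfloor>2 ^ i * t\<rfloor> = \<lfloor>(2 ^ j * t) / real_of_int (2 ^ (j - i))\<rfloor>" by simp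
  also have "\<dots> = \<lfloor>2 ^ j * t\<rfloor> div 2 ^ (j - i)"
    by (rule floor_divide_real_eq_div) simp
  finally show ?thesis unfolding dind_def using t by (simp add: nat_div_distrib nat_power_eq)
qed

lemma emeasure_dcell: "emeasure lborel (dcell j I) = ennreal (1 / 2 ^ j)"
  unfolding dcell_def by (subst emeasure_lborel_Ico) (auto simp: field_simps)

lemma indicator_unit_dcell:
  "indicator {0..<1} t = (\<Sum>I<2 ^ j. indicator (dcell j I) t :: ennreal)"
proof (cases "t \<in> {0..<1}")
  case True
  then have "(\<Sum>I<2 ^ j. indicator (dcell j I) t :: ennreal) = (\<Sum>I<2 ^ j. if I = dind j t then 1 else 0)"
    by (intro sum.cong) (auto simp: mem_dcell_iff indicator_def)
  then show ?thesis using True dind_less[of t j] by simp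
next
  case False
  have "t < 1" if "t \<in> dcell j I" "I < 2 ^ j" for I
  proof -
    have "real I + 1 \<le> 2 ^ j" using that(2) by (metis Suc_leI add.commute of_nat_Suc of_nat_le_iff of_nat_numeral of_nat_power)
    then have "(real I + 1) / 2 ^ j \<le> 1" by simp
    moreover have "t < (real I + 1) / 2 ^ j" using that(1) by (auto simp: dcell_def)
    ultimately show ?thesis by linarith
  qed
  moreover have "0 \<le> t" if "t \<in> dcell j I" for I using that by (simp add: mem_dcell_iff)
  ultimately show ?thesis using False by (auto simp: indicator_def)
qed

lemma dcell_subset: "I < 2 ^ j \<Longrightarrow> dcell j I \<subseteq> {0..<1}"
proof
  fix t assume "I < 2 ^ j" "t \<in> dcell j I"
  then have "(\<Sum>I<2 ^ j. indicator (dcell j I) t :: ennreal) \<noteq> 0" by (auto simp: sum_nonneg_eq_0_iff intro!: bexI[of _ I])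
  then show "t \<in> {0..<1}" unfolding indicator_unit_dcell[symmetric] by (auto simp: indicator_def split: if_splits)
qed

lemma nn_integral_unit_dcell:
  assumes [measurable]: "F \<in> borel_measurable borel"
  shows "(\<integral>\<^sup>+t\<in>{0..<1}. F t \<partial>lborel) = (\<Sum>I<2 ^ j. \<integral>\<^sup>+t\<in>dcell j I. F t \<partial>lborel)"
  unfolding indicator_unit_dcell[of _ j] sum_distrib_left
  by (rule nn_integral_sum) measurable

lemma nn_integral_step:
  "(\<integral>\<^sup>+t\<in>{0..<1}. \<phi> (dind j t) \<partial>lborel) = (\<Sum>I<2 ^ j. \<phi> I * ennreal (1 / 2 ^ j))"
proof -
  have "(\<integral>\<^sup>+t\<in>{0..<1}. \<phi> (dind j t) \<partial>lborel) = (\<Sum>I<2 ^ j. \<integral>\<^sup>+t\<in>dcell j I. \<phi> (dind j t) \<partial>lborel)"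
    by (rule nn_integral_unit_dcell) measurable
  also have "\<dots> = (\<Sum>I<2 ^ j. \<integral>\<^sup>+t\<in>dcell j I. \<phi> I \<partial>lborel)"
    by (intro sum.cong nn_integral_cong refl) (auto simp: mem_dcell_iff indicator_def)
  also have "\<dots> = (\<Sum>I<2 ^ j. \<phi> I * ennreal (1 / 2 ^ j))"
    by (simp add: nn_integral_cmult_indicator emeasure_dcell)
  finally show ?thesis .
qed

lemma set_integrable_dcell:
  assumes "set_integrable lborel {0..<1} f" "I < 2 ^ j"
  shows "set_integrable lborel (dcell j I) (f :: real \<Rightarrow> real)"
  using assms(1) by (rule set_integrable_subset) (use dcell_subset[OF assms(2)] in auto)

lemma davg_diff:
  assumes "set_integrable lborel {0..<1} f" "set_integrable lborel {0..<1} g" "I < 2 ^ j"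
  shows "davg j (\<lambda>t. f t - g t) I = davg j f I - davg j g I"
  unfolding davg_def using assms
  by (simp add: set_integral_diff set_integrable_dcell right_diff_distrib)

lemma davg_const: "davg j (\<lambda>_. c) I = c"
proof -
  have "measure lborel (dcell j I) = 1 / 2 ^ j" by (simp add: measure_def emeasure_dcell)
  then show ?thesis by (simp add: davg_def set_lebesgue_integral_def emeasure_dcell)
qed

lemma abs_davg_le:
  assumes f: "set_integrable lborel {0..<1} f" and I: "I < 2 ^ j" and b: "\<And>t. t \<in> dcell j I \<Longrightarrow> \<bar>f t\<bar> \<le> e"
  shows "\<bar>davg j f I\<bar> \<le> e"
proof -
  note i = set_integrable_dcell[OF f I]
  have "\<bar>LINT t:dcell j I|lborel. f t\<bar> \<le> (LINT t:dcell j I|lborel. \<bar>f t\<bar>)"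
    using set_integral_norm_bound[OF i] by simp
  also have "\<dots> \<le> (LINT t:dcell j I|lborel. e)"
    using set_integrable_abs[OF i] b by (intro set_integral_mono) (auto simp: set_integrable_def emeasure_dcell)
  finally have "2 ^ j * \<bar>LINT t:dcell j I|lborel. f t\<bar> \<le> davg j (\<lambda>_. e) I"
    unfolding davg_def by (intro mult_left_mono) auto
  then show ?thesis unfolding davg_const by (simp add: davg_def abs_mult)
qed

lemma nn_davg_le:
  assumes f: "set_integrable lborel {0..<1} f" and I: "I < 2 ^ j"
  shows "ennreal \<bar>davg j f I\<bar> * ennreal (1 / 2 ^ j) \<le> (\<integral>\<^sup>+t\<in>dcell j I. ennreal \<bar>f t\<bar> \<partial>lborel)"
proof -
  note i = set_integrable_dcell[OF f I]
  have "ennreal \<bar>davg j f I\<bar> * ennreal (1 / 2 ^ j) = ennreal \<bar>LINT t:dcell j I|lborel. f t\<bar>"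
    by (simp add: davg_def abs_mult flip: ennreal_mult)
  also have "\<dots> \<le> (\<integral>\<^sup>+t. ennreal (norm (indicator (dcell j I) t *\<^sub>R f t)) \<partial>lborel)"
    using integral_norm_bound_ennreal[of lborel "\<lambda>t. indicator (dcell j I) t *\<^sub>R f t"] i
    by (simp add: set_integrable_def set_lebesgue_integral_def)
  also have "\<dots> = (\<integral>\<^sup>+t\<in>dcell j I. ennreal \<bar>f t\<bar> \<partial>lborel)"
    by (intro nn_integral_cong) (auto simp: indicator_def)
  finally show ?thesis .
qed

lemma L1_davg_le:
  assumes f: "set_integrable lborel {0..<1} f" and [measurable]: "f \<in> borel_measurable borel"
  shows "(\<integral>\<^sup>+t\<in>{0..<1}. ennreal \<bar>davg j f (dind j t)\<bar> \<partial>lborel) \<le> (\<integral>\<^sup>+t\<in>{0..<1}. ennreal \<bar>f t\<bar> \<partial>lborel)"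
proof -
  have "(\<integral>\<^sup>+t\<in>{0..<1}. ennreal \<bar>davg j f (dind j t)\<bar> \<partial>lborel) = (\<Sum>I<2 ^ j. ennreal \<bar>davg j f I\<bar> * ennreal (1 / 2 ^ j))"
    by (rule nn_integral_step)
  also have "\<dots> \<le> (\<Sum>I<2 ^ j. \<integral>\<^sup>+t\<in>dcell j I. ennreal \<bar>f t\<bar> \<partial>lborel)"
    by (intro sum_mono nn_davg_le f) auto
  also have "\<dots> = (\<integral>\<^sup>+t\<in>{0..<1}. ennreal \<bar>f t\<bar> \<partial>lborel)"
    by (rule nn_integral_unit_dcell[symmetric]) measurable
  finally show ?thesis .
qed

lemma L1_davg_continuous:
  assumes f: "continuous_on UNIV f" and e: "e > (0::real)"
  shows "\<forall>\<^sub>F j in sequentially. (\<integral>\<^sup>+t\<in>{0..<1}. ennreal \<bar>davg j f (dind j t) - f t\<bar> \<partial>lborel) \<le> ennreal e"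
proof -
  have "uniformly_continuous_on {0..1} f"
    by (rule compact_uniformly_continuous) (use f in \<open>auto intro: continuous_on_subset\<close>)
  then obtain \<delta> where \<delta>: "\<delta> > 0" "\<And>x y. x \<in> {0..1} \<Longrightarrow> y \<in> {0..1} \<Longrightarrow> dist y x < \<delta> \<Longrightarrow> dist (f y) (f x) < e"
    unfolding uniformly_continuous_on_def using e by metis
  have "(\<lambda>j. (1/2) ^ j) \<longlonglongrightarrow> (0::real)" by (rule LIMSEQ_realpow_zero) auto
  then have "\<forall>\<^sub>F j in sequentially. (1/2) ^ j < \<delta>" using \<delta>(1) by (rule order_tendstoD)
  then show ?thesis
  proof eventually_elim
    case (elim j)
    have i: "set_integrable lborel {0..<1} f"
      by (rule set_integrable_subset[OF borel_integrable_atLeastAtMost'[OF continuous_on_subset[OF f], of 0 1]]) auto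
    have *: "\<bar>davg j f (dind j t) - f t\<bar> \<le> e" if t: "t \<in> {0..<1}" for t
    proof -
      have "dind j t < 2 ^ j" using t by (intro dind_less) auto
      have c: "set_integrable lborel {0..<1} (\<lambda>s::real. f t)"
      proof -
        have "integrable lborel (indicat_real {0..<1::real})" by (intro integrable_real_indicator) auto
        then show ?thesis by (simp add: set_integrable_def)
      qed
      have "davg j f (dind j t) - f t = davg j (\<lambda>s. f s - f t) (dind j t)"
        using davg_diff[OF i c \<open>dind j t < 2 ^ j\<close>] by (simp add: davg_const)
      also have "\<bar>\<dots>\<bar> \<le> e"
      proof (rule abs_davg_le)
        show "set_integrable lborel {0..<1} (\<lambda>s. f s - f t)" using i c by (rule set_integral_diff)
        fix s assume s: "s \<in> dcell j (dind j t)"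
        have "t \<in> dcell j (dind j t)" using t by (simp add: mem_dcell_iff)
        then have "\<bar>s - t\<bar> < 1 / 2 ^ j" using s by (auto simp: dcell_def add_divide_distrib)
        moreover have "s \<in> {0..<1}" using dcell_subset[OF \<open>dind j t < 2 ^ j\<close>] s by auto
        ultimately have "dist (f s) (f t) < e"
          using t elim by (intro \<delta>(2)) (auto simp: dist_real_def power_one_over)
        then show "\<bar>f s - f t\<bar> \<le> e" by (simp add: dist_real_def)
      qed fact
      finally show ?thesis .
    qed
    have "(\<integral>\<^sup>+t\<in>{0..<1}. ennreal \<bar>davg j f (dind j t) - f t\<bar> \<partial>lborel) \<le> (\<integral>\<^sup>+t\<in>{0..<1::real}. ennreal e \<partial>lborel)"
      using * by (intro nn_integral_mono) (auto simp: indicator_def intro: ennreal_leI)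
    also have "\<dots> = ennreal e" by (simp add: nn_integral_cmult_indicator)
    finally show ?case .
  qed
qed

text \<open>Measurability provides an almost everywhere limit of continuous functions but no
  domination. Values are therefore first clipped at a level \<open>B\<close>; the clipped
  approximants stay continuous and are dominated.\<close>

lemma L1_approx_continuous:
  fixes f :: "real \<Rightarrow> real"
  assumes f: "set_integrable lborel {0..<1} f" and [measurable]: "f \<in> borel_measurable borel" and e: "e > 0"
  shows "\<exists>g. continuous_on UNIV g \<and> (\<integral>\<^sup>+t\<in>{0..<1}. ennreal \<bar>f t - g t\<bar> \<partial>lborel) \<le> ennreal e"
proof -
  define cl where "cl B x = max (- B) (min B x)" for B x :: real
  have clm[measurable]: "cl B \<in> borel_measurable borel" for B unfolding cl_def by measurable
  have intf: "integrable lborel (\<lambda>t. indicator {0..<1} t * f t)" using f by (simp add: set_integrable_def)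
  have "(\<lambda>B. \<integral>t. \<bar>indicator {0..<1} t * (f t - cl (real B) (f t))\<bar> \<partial>lborel) \<longlonglongrightarrow> (\<integral>t. 0 \<partial>(lborel :: real measure))"
  proof (rule integral_dominated_convergence)
    show "integrable lborel (\<lambda>t. \<bar>indicator {0..<1} t * f t\<bar>)" using intf by (rule integrable_abs)
    show "AE t in lborel. (\<lambda>B. \<bar>indicator {0..<1} t * (f t - cl (real B) (f t))\<bar>) \<longlonglongrightarrow> 0"
    proof (intro AE_I2)
      fix t
      obtain n :: nat where n: "\<bar>f t\<bar> \<le> real n" using real_arch_simple by blast
      have "\<bar>indicator {0..<1} t * (f t - cl (real B) (f t))\<bar> = 0" if "B \<ge> n" for B
      proof -
        have "\<bar>f t\<bar> \<le> real B" using n that by linarith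
        then have "cl (real B) (f t) = f t" by (auto simp: cl_def)
        then show ?thesis by simp
      qed
      then show "(\<lambda>B. \<bar>indicator {0..<1} t * (f t - cl (real B) (f t))\<bar>) \<longlonglongrightarrow> 0"
        by (intro tendsto_eventually) (auto simp: eventually_sequentially)
    qed
    show "AE t in lborel. norm \<bar>indicator {0..<1} t * (f t - cl (real B) (f t))\<bar> \<le> \<bar>indicator {0..<1} t * f t\<bar>" for B
      by (intro AE_I2) (auto simp: cl_def indicator_def)
  qed measurable
  then have "\<forall>\<^sub>F B in sequentially. (\<integral>t. \<bar>indicator {0..<1} t * (f t - cl (real B) (f t))\<bar> \<partial>lborel) < e / 2"
    using e by (intro order_tendstoD) auto
  then obtain B :: nat where B: "(\<integral>t. \<bar>indicator {0..<1} t * (f t - cl (real B) (f t))\<bar> \<partial>lborel) < e / 2"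
    by (auto simp: eventually_sequentially)
  have "f \<in> borel_measurable (lebesgue_on UNIV)" by (intro measurable_restrict_space1 measurable_completion) simp
  then have "f measurable_on UNIV" by (subst measurable_on_iff_borel_measurable) auto
  then obtain N g where N: "negligible N" and g: "\<And>n. continuous_on UNIV (g n)"
    and lim: "\<And>x. x \<notin> N \<Longrightarrow> (\<lambda>n. g n x) \<longlonglongrightarrow> f x"
    unfolding measurable_on_def by auto
  have [measurable]: "g n \<in> borel_measurable borel" for n using g by (rule borel_measurable_continuous_onI)
  have contcl: "continuous_on UNIV (cl B)" for B unfolding cl_def by (intro continuous_intros)
  have NAE: "AE t in lborel. t \<notin> N"
  proof -
    have "AE t in lebesgue. t \<notin> N" using N by (intro AE_not_in) (simp add: negligible_iff_null_sets)
    then show ?thesis by (simp add: AE_completion_iff)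
  qed
  have "(\<lambda>n. \<integral>t. \<bar>indicator {0..<1} t * (cl B (f t) - cl B (g n t))\<bar> \<partial>lborel) \<longlonglongrightarrow> (\<integral>t. 0 \<partial>(lborel :: real measure))"
  proof (rule integral_dominated_convergence)
    show "integrable lborel (\<lambda>t. 2 * real B * indicator {0..<1::real} t)" by simp
    show "AE t in lborel. (\<lambda>n. \<bar>indicator {0..<1} t * (cl B (f t) - cl B (g n t))\<bar>) \<longlonglongrightarrow> 0"
      using NAE
    proof eventually_elim
      case (elim t)
      have "(\<lambda>n. cl B (g n t)) \<longlonglongrightarrow> cl B (f t)"
        using continuous_on_tendsto_compose[OF contcl lim[OF elim]] by simp
      then have "(\<lambda>n. \<bar>indicator {0..<1} t * (cl B (f t) - cl B (g n t))\<bar>) \<longlonglongrightarrow> \<bar>indicator {0..<1} t * (cl B (f t) - cl B (f t))\<bar>"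
        by (intro tendsto_intros)
      then show ?case by simp
    qed
    have "\<bar>cl B x - cl B y\<bar> \<le> 2 * real B" for x y by (auto simp: cl_def)
    then show "AE t in lborel. norm \<bar>indicator {0..<1} t * (cl B (f t) - cl B (g n t))\<bar> \<le> 2 * real B * indicator {0..<1} t" for n
      by (intro AE_I2) (auto simp: indicator_def)
  qed measurable
  then have "\<forall>\<^sub>F n in sequentially. (\<integral>t. \<bar>indicator {0..<1} t * (cl B (f t) - cl B (g n t))\<bar> \<partial>lborel) < e / 2"
    using e by (intro order_tendstoD) auto
  then obtain n where n: "(\<integral>t. \<bar>indicator {0..<1} t * (cl B (f t) - cl B (g n t))\<bar> \<partial>lborel) < e / 2"
    by (auto simp: eventually_sequentially)
  have clint: "integrable lborel (\<lambda>t. indicator {0..<1} t * cl B (h t))" if [measurable]: "h \<in> borel_measurable borel" for h :: "real \<Rightarrow> real"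
  proof -
    have "integrable lborel (\<lambda>t. real B * indicat_real {0..<1::real} t)"
      by (intro integrable_mult_right integrable_real_indicator) auto
    then show ?thesis by (rule Bochner_Integration.integrable_bound) (auto simp: cl_def indicator_def)
  qed
  have i1: "integrable lborel (\<lambda>t. \<bar>indicator {0..<1} t * (f t - cl B (f t))\<bar>)"
    using intf clint[of f] by (auto simp: right_diff_distrib)
  have i2: "integrable lborel (\<lambda>t. \<bar>indicator {0..<1} t * (cl B (f t) - cl B (g n t))\<bar>)"
    using clint[of "g n"] clint[of f] by (auto simp: right_diff_distrib)
  have "(\<integral>\<^sup>+t\<in>{0..<1}. ennreal \<bar>f t - cl B (g n t)\<bar> \<partial>lborel) \<le>
     (\<integral>\<^sup>+t. ennreal (\<bar>indicator {0..<1} t * (f t - cl B (f t))\<bar> + \<bar>indicator {0..<1} t * (cl B (f t) - cl B (g n t))\<bar>) \<partial>lborel)"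
    by (intro nn_integral_mono) (auto simp: indicator_def simp del: ennreal_plus intro!: ennreal_leI)
  also have "\<dots> = ennreal (\<integral>t. \<bar>indicator {0..<1} t * (f t - cl B (f t))\<bar> + \<bar>indicator {0..<1} t * (cl B (f t) - cl B (g n t))\<bar> \<partial>lborel)"
    by (intro nn_integral_eq_integral Bochner_Integration.integrable_add i1 i2) auto
  also have "\<dots> \<le> ennreal e"
    using B n i1 i2 by (intro ennreal_leI) (simp add: Bochner_Integration.integral_add)
  finally have "(\<integral>\<^sup>+t\<in>{0..<1}. ennreal \<bar>f t - cl B (g n t)\<bar> \<partial>lborel) \<le> ennreal e" .
  moreover have "continuous_on UNIV (\<lambda>t. cl B (g n t))"
    by (rule continuous_on_compose2[OF contcl g]) auto
  ultimately show ?thesis by blast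
qed

text \<open>Averaging contracts L1 and converges uniformly on continuous functions, so density of
  the latter suffices. The three terms are the average of f - g, the error for g, and f - g
  itself.\<close>

lemma L1_davg_tendsto:
  fixes f :: "real \<Rightarrow> real"
  assumes f: "set_integrable lborel {0..<1} f" and [measurable]: "f \<in> borel_measurable borel" and e: "e > (0::real)"
  shows "\<forall>\<^sub>F j in sequentially. (\<integral>\<^sup>+t\<in>{0..<1}. ennreal \<bar>davg j f (dind j t) - f t\<bar> \<partial>lborel) \<le> ennreal (3 * e)"
proof -
  obtain g where g: "continuous_on UNIV g" and fg: "(\<integral>\<^sup>+t\<in>{0..<1}. ennreal \<bar>f t - g t\<bar> \<partial>lborel) \<le> ennreal e"
    using L1_approx_continuous[OF assms] by blast
  have [measurable]: "g \<in> borel_measurable borel" using g by (rule borel_measurable_continuous_onI)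
  have ig: "set_integrable lborel {0..<1} g"
    by (rule set_integrable_subset[OF borel_integrable_atLeastAtMost'[OF continuous_on_subset[OF g], of 0 1]]) auto
  have ifg: "set_integrable lborel {0..<1} (\<lambda>t. f t - g t)" using f ig by (rule set_integral_diff)
  show ?thesis using L1_davg_continuous[OF g e]
  proof eventually_elim
    case (elim j)
    have "(\<integral>\<^sup>+t\<in>{0..<1}. ennreal \<bar>davg j f (dind j t) - f t\<bar> \<partial>lborel) \<le>
      (\<integral>\<^sup>+t. (ennreal \<bar>davg j (\<lambda>t. f t - g t) (dind j t)\<bar> * indicator {0..<1} t +
          ennreal \<bar>davg j g (dind j t) - g t\<bar> * indicator {0..<1} t) + ennreal \<bar>f t - g t\<bar> * indicator {0..<1} t \<partial>lborel)"
    proof (rule nn_integral_mono)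
      fix t :: real
      show "ennreal \<bar>davg j f (dind j t) - f t\<bar> * indicator {0..<1} t \<le>
          (ennreal \<bar>davg j (\<lambda>t. f t - g t) (dind j t)\<bar> * indicator {0..<1} t +
          ennreal \<bar>davg j g (dind j t) - g t\<bar> * indicator {0..<1} t) + ennreal \<bar>f t - g t\<bar> * indicator {0..<1} t"
      proof (cases "t \<in> {0..<1}")
        case True
        then have "davg j (\<lambda>t. f t - g t) (dind j t) = davg j f (dind j t) - davg j g (dind j t)"
          by (intro davg_diff f ig dind_less) auto
        then show ?thesis using True by (simp flip: ennreal_plus)
      qed simp
    qed
    also have "\<dots> = (\<integral>\<^sup>+t\<in>{0..<1}. ennreal \<bar>davg j (\<lambda>t. f t - g t) (dind j t)\<bar> \<partial>lborel) +
       (\<integral>\<^sup>+t\<in>{0..<1}. ennreal \<bar>davg j g (dind j t) - g t\<bar> \<partial>lborel) + (\<integral>\<^sup>+t\<in>{0..<1}. ennreal \<bar>f t - g t\<bar> \<partial>lborel)"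
      by (simp add: nn_integral_add)
    also have "\<dots> \<le> ennreal e + ennreal e + ennreal e"
      by (intro add_mono elim fg order.trans[OF L1_davg_le[OF ifg] fg]) measurable
    also have "\<dots> = ennreal (3 * e)" using e by (simp flip: ennreal_plus)
    finally show ?case .
  qed
qed

text \<open>Reduces an L2 estimate to estimates of cell averages on all fine levels: the averages
  converge in L1, hence almost everywhere along a subsequence, and Fatou's lemma applies. Square
  integrability of \<open>f\<close> is a conclusion here.\<close>

lemma L2_le_of_davg:
  fixes f :: "real \<Rightarrow> real"
  assumes f: "set_integrable lborel {0..<1} f" and [measurable]: "f \<in> borel_measurable borel"
    and bound: "\<And>j. j \<ge> j0 \<Longrightarrow> (\<integral>\<^sup>+t\<in>{0..<1}. ennreal ((davg j f (dind j t))\<^sup>2) \<partial>lborel) \<le> B"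
  shows "(\<integral>\<^sup>+t\<in>{0..<1}. ennreal ((f t)\<^sup>2) \<partial>lborel) \<le> B"
proof -
  define u where "u j t = indicator {0..<1} t * (davg j f (dind j t) - f t)" for j t
  have um[measurable]: "u j \<in> borel_measurable borel" for j unfolding u_def by measurable
  have nn: "(\<integral>\<^sup>+t. ennreal (norm (u j t)) \<partial>lborel) = (\<integral>\<^sup>+t\<in>{0..<1}. ennreal \<bar>davg j f (dind j t) - f t\<bar> \<partial>lborel)" for j
    by (intro nn_integral_cong) (auto simp: u_def indicator_def)
  have fin: "(\<integral>\<^sup>+t\<in>{0..<1}. ennreal \<bar>f t\<bar> \<partial>lborel) < \<infinity>"
    using f unfolding set_integrable_def integrable_iff_bounded
    by (auto elim!: le_less_trans[rotated] intro!: nn_integral_mono simp: indicator_def)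
  have int: "integrable lborel (u j)" for j
  proof (rule integrableI_bounded)
    have "(\<integral>\<^sup>+t. ennreal (norm (u j t)) \<partial>lborel) \<le>
      (\<integral>\<^sup>+t. ennreal \<bar>davg j f (dind j t)\<bar> * indicator {0..<1} t + ennreal \<bar>f t\<bar> * indicator {0..<1} t \<partial>lborel)"
      by (intro nn_integral_mono) (auto simp: u_def indicator_def simp flip: ennreal_plus)
    also have "\<dots> = (\<integral>\<^sup>+t\<in>{0..<1}. ennreal \<bar>davg j f (dind j t)\<bar> \<partial>lborel) + (\<integral>\<^sup>+t\<in>{0..<1}. ennreal \<bar>f t\<bar> \<partial>lborel)"
      by (rule nn_integral_add) measurable
    also have "\<dots> < \<infinity>" using le_less_trans[OF L1_davg_le[OF f] fin, of j] fin by simp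
    finally show "(\<integral>\<^sup>+t. ennreal (norm (u j t)) \<partial>lborel) < \<infinity>" .
  qed measurable
  have "(\<lambda>j. \<integral>t. norm (u j t) \<partial>lborel) \<longlonglongrightarrow> 0"
  proof (rule tendstoI)
    fix e :: real assume e: "e > 0"
    have "\<forall>\<^sub>F j in sequentially. (\<integral>\<^sup>+t\<in>{0..<1}. ennreal \<bar>davg j f (dind j t) - f t\<bar> \<partial>lborel) \<le> ennreal (3 * (e / 6))"
      by (rule L1_davg_tendsto[OF f]) (use e in auto)
    then show "\<forall>\<^sub>F j in sequentially. dist (\<integral>t. norm (u j t) \<partial>lborel) 0 < e"
    proof eventually_elim
      case (elim j)
      have "ennreal (\<integral>t. norm (u j t) \<partial>lborel) \<le> ennreal (e / 2)"
        using elim nn_integral_eq_integral[OF integrable_norm[OF int[of j]]] nn[of j] by simp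
      then have "(\<integral>t. norm (u j t) \<partial>lborel) \<le> e / 2" using e by (subst (asm) ennreal_le_iff) auto
      moreover have "(\<integral>t. norm (u j t) \<partial>lborel) \<ge> 0" by simp
      ultimately show ?case using e by (simp add: dist_real_def)
    qed
  qed
  from tendsto_L1_AE_subseq[OF int this] obtain r where r: "strict_mono r" and
    lim: "AE t in lborel. (\<lambda>n. u (r n) t) \<longlonglongrightarrow> 0" by blast
  have "(\<integral>\<^sup>+t\<in>{0..<1}. ennreal ((f t)\<^sup>2) \<partial>lborel) \<le>
    (\<integral>\<^sup>+t. liminf (\<lambda>n. ennreal ((davg (r n) f (dind (r n) t))\<^sup>2) * indicator {0..<1} t) \<partial>lborel)"
  proof (rule nn_integral_mono_AE, use lim in eventually_elim)
    case (elim t)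
    show ?case
    proof (cases "t \<in> {0..<1}")
      case True
      then have "(\<lambda>n. u (r n) t + f t) \<longlonglongrightarrow> 0 + f t" using elim by (intro tendsto_add) auto
      then have "(\<lambda>n. davg (r n) f (dind (r n) t)) \<longlonglongrightarrow> f t" using True by (simp add: u_def)
      then have "(\<lambda>n. ennreal ((davg (r n) f (dind (r n) t))\<^sup>2)) \<longlonglongrightarrow> ennreal ((f t)\<^sup>2)"
        by (intro tendsto_ennrealI tendsto_power)
      from lim_imp_Liminf[OF _ this] show ?thesis using True by simp
    qed simp
  qed
  also have "\<dots> \<le> liminf (\<lambda>n. \<integral>\<^sup>+t\<in>{0..<1}. ennreal ((davg (r n) f (dind (r n) t))\<^sup>2) \<partial>lborel)"
    by (rule nn_integral_liminf) measurable
  also have "\<dots> \<le> limsup (\<lambda>n. \<integral>\<^sup>+t\<in>{0..<1}. ennreal ((davg (r n) f (dind (r n) t))\<^sup>2) \<partial>lborel)"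
    by (rule Liminf_le_Limsup) simp
  also have "\<dots> \<le> B"
  proof (rule Limsup_bounded)
    show "\<forall>\<^sub>F n in sequentially. (\<integral>\<^sup>+t\<in>{0..<1}. ennreal ((davg (r n) f (dind (r n) t))\<^sup>2) \<partial>lborel) \<le> B"
      using eventually_ge_at_top[of j0]
    proof eventually_elim
      case (elim n)
      then have "r n \<ge> j0" using seq_suble[OF r, of n] by linarith
      then show ?case by (rule bound)
    qed
  qed
  finally show ?thesis .
qed

lemma powr_half_power: "(1 / 2 ^ j) powr \<gamma> = ((1/2) powr \<gamma>) ^ j" for \<gamma> :: real
proof -
  have "(1 / 2 ^ j) powr \<gamma> = ((1/2) powr real j) powr \<gamma>" by (simp add: powr_realpow power_one_over)
  also have "\<dots> = ((1/2) powr \<gamma>) powr real j" by (simp add: powr_powr mult.commute)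
  also have "\<dots> = ((1/2) powr \<gamma>) ^ j" by (rule powr_realpow) simp
  finally show ?thesis .
qed

lemma LINT_poly_pderiv:
  assumes "x \<le> y"
  shows "(LINT t:{x..<y}|lborel. poly (pderiv p) t) = poly p y - poly p (x::real)"
    "set_integrable lborel {x..<y} (poly (pderiv p))"
proof -
  have [measurable]: "poly (pderiv p) \<in> borel_measurable borel"
    by (intro borel_measurable_continuous_onI continuous_intros)
  have i: "set_integrable lborel {x..y} (poly (pderiv p))"
    by (intro borel_integrable_atLeastAtMost' continuous_intros)
  then show "set_integrable lborel {x..<y} (poly (pderiv p))"
    by (rule set_integrable_subset) auto
  have "(LINT t:{x..<y}|lborel. poly (pderiv p) t) = (LINT t:{x..y}|lborel. poly (pderiv p) t)"
    unfolding set_lebesgue_integral_def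
  proof (rule integral_cong_AE)
    have "AE t in lborel. t \<noteq> y" by (rule AE_lborel_singleton)
    then show "AE t in lborel. indicat_real {x..<y} t *\<^sub>R poly (pderiv p) t = indicat_real {x..y} t *\<^sub>R poly (pderiv p) t"
      by eventually_elim (auto simp: indicator_def)
  qed measurable
  also have "\<dots> = poly p y - poly p x"
    unfolding set_lebesgue_integral_def
  proof (rule integral_FTC_atLeastAtMost[OF assms])
    show "(poly p has_vector_derivative poly (pderiv p) t) (at t within {x..y})" for t
      using DERIV_subset[OF poly_DERIV[of p t], of "{x..y}"]
      by (simp add: has_real_derivative_iff_has_vector_derivative)
    show "continuous_on {x..y} (poly (pderiv p))" by (intro continuous_intros)
  qed
  finally show "(LINT t:{x..<y}|lborel. poly (pderiv p) t) = poly p y - poly p x" .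
qed

section \<open>Local polynomial fits to dyadic averages on all levels\<close>

locale jackson =
  fixes G :: "real \<Rightarrow> real" and k m :: nat and A \<gamma> :: real
  assumes G_meas[measurable]: "G \<in> borel_measurable borel"
    and G_int: "set_integrable lborel {0..1} G"
    and k: "k \<ge> 1" and m: "4 * k \<le> 2 ^ m" and A: "A \<ge> 0" and \<gamma>: "\<gamma> > 0"
    and diff: "\<And>s::real. s > 0 \<Longrightarrow> k * s \<le> 1 \<Longrightarrow>
      (\<integral>\<^sup>+t\<in>{0..1 - k * s}. ennreal ((fwd_diff k s G t)\<^sup>2) \<partial>lborel) \<le> ennreal ((A * s powr \<gamma>)\<^sup>2)"
begin

text \<open>A cell is fitted through its \<open>M\<close> subcells. The condition
  \<open>4 * k \<le> M\<close> leaves k pairwise non-adjacent subcells in each half of a cell, which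
  are needed to compare the fit on a cell with the fits on its halves.\<close>

definition "M = (2::nat) ^ m"
definition "\<rho> = (1/2::real) powr \<gamma>"
abbreviation "a j \<equiv> davg j G"

lemma M_pos: "M > 0" "4 * k \<le> M" "2 ^ m = M" unfolding M_def by (simp, rule m, simp)

lemma \<rho>: "0 < \<rho>" "\<rho> < 1" using powr_less_mono2[of \<gamma> "1/2" 1] \<gamma> unfolding \<rho>_def by simp_all

lemma G_int1: "set_integrable lborel {0..<1} G"
  using G_int by (rule set_integrable_subset) auto

lemma davg_refine:
  assumes "I < 2 ^ j"
  shows "2 * a j I = a (Suc j) (2 * I) + a (Suc j) (2 * I + 1)"
proof -
  have e: "dcell j I = dcell (Suc j) (2 * I) \<union> dcell (Suc j) (2 * I + 1)"
  proof (rule set_eqI)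
    fix t
    have "0 \<le> t \<Longrightarrow> dind j t = dind (Suc j) t div 2" using dind_div[of t j "Suc j"] by simp
    then show "t \<in> dcell j I \<longleftrightarrow> t \<in> dcell (Suc j) (2 * I) \<union> dcell (Suc j) (2 * I + 1)"
      by (auto simp: mem_dcell_iff)
  qed
  have d: "dcell (Suc j) (2 * I) \<inter> dcell (Suc j) (2 * I + 1) = {}" by (auto simp: mem_dcell_iff)
  have "(LINT t:dcell j I|lborel. G t) = (LINT t:dcell (Suc j) (2 * I)|lborel. G t) + (LINT t:dcell (Suc j) (2 * I + 1)|lborel. G t)"
    unfolding e by (rule set_integral_Un[OF d]) (use assms in \<open>auto intro!: set_integrable_dcell[OF G_int1]\<close>)
  then show ?thesis by (simp add: davg_def algebra_simps)
qed

text \<open>Averaging commutes with the shift by one cell, so k-th differences of neighbouring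
  averages are averages of k-th differences of \<open>G\<close> with the dyadic step. Through this
  identity the smoothness of \<open>G\<close> acts on the averages.\<close>

lemma fd_davg:
  assumes "I + k < 2 ^ j"
  shows "fd k (a j) I = 2 ^ j * (LINT t:dcell j I|lborel. fwd_diff k (1 / 2 ^ j) G t)"
proof -
  let ?s = "\<lambda>i. real i * (1 / 2 ^ j)"
  have ind: "indicator (dcell j (I + i)) (?s i + t) = (indicator (dcell j I) t :: real)" for i t
    by (auto simp: dcell_def indicator_def add_divide_distrib)
  have int: "integrable lborel (\<lambda>t. indicator (dcell j I) t * G (t + ?s i))" if "i \<le> k" for i
  proof -
    have "integrable lborel (\<lambda>t. indicator (dcell j (I + i)) t * G t)"
      using set_integrable_dcell[OF G_int1, of "I + i" j] assms that by (simp add: set_integrable_def)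
    from lborel_integrable_real_affine[OF this, of 1 "?s i"] show ?thesis
      by (simp only: mult_1 ind) (simp add: add.commute)
  qed
  have avg: "a j (I + i) = 2 ^ j * (\<integral>t. indicator (dcell j I) t * G (t + ?s i) \<partial>lborel)" for i
  proof -
    have "(\<integral>t. indicator (dcell j (I + i)) t * G t \<partial>lborel) =
        (\<integral>t. indicator (dcell j (I + i)) (?s i + 1 * t) * G (?s i + 1 * t) \<partial>lborel)"
      by (subst lborel_integral_real_affine[where c=1 and t="?s i"]) simp_all
    also have "\<dots> = (\<integral>t. indicator (dcell j I) t * G (t + ?s i) \<partial>lborel)"
      by (simp only: mult_1 ind) (simp add: add.commute)
    finally show ?thesis by (simp add: davg_def set_lebesgue_integral_def)
  qed
  have "fd k (a j) I = 2 ^ j * (\<Sum>i\<le>k. (- 1) ^ (k - i) * of_nat (k choose i) * (\<integral>t. indicator (dcell j I) t * G (t + ?s i) \<partial>lborel))"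
    by (simp only: fd_expand avg sum_distrib_left) (simp add: mult.left_commute)
  also have "(\<Sum>i\<le>k. (- 1) ^ (k - i) * of_nat (k choose i) * (\<integral>t. indicator (dcell j I) t * G (t + ?s i) \<partial>lborel)) =
      (\<integral>t. (\<Sum>i\<le>k. (- 1) ^ (k - i) * of_nat (k choose i) * (indicator (dcell j I) t * G (t + ?s i))) \<partial>lborel)"
    using int by (subst Bochner_Integration.integral_sum) (auto simp del: times_divide_eq_right)
  also have "\<dots> = (LINT t:dcell j I|lborel. fwd_diff k (1 / 2 ^ j) G t)"
    unfolding set_lebesgue_integral_def fwd_diff_def
    by (intro Bochner_Integration.integral_cong) (auto simp: sum_distrib_left algebra_simps intro!: sum.cong)
  finally show ?thesis .
qed

lemma fwd_diff_measurable[measurable]: "fwd_diff k s G \<in> borel_measurable borel"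
proof -
  have "(\<lambda>t. \<Sum>i\<le>k. (- 1) ^ (k - i) * real (k choose i) * G (t + real i * s)) \<in> borel_measurable borel"
    by (intro borel_measurable_sum borel_measurable_times borel_measurable_const) measurable
  then show ?thesis unfolding fwd_diff_def[abs_def] by simp
qed

lemma fd_sq:
  assumes "I + k < 2 ^ j"
  shows "ennreal ((fd k (a j) I)\<^sup>2) \<le> ennreal (2 ^ j) * (\<integral>\<^sup>+t\<in>dcell j I. ennreal ((fwd_diff k (1 / 2 ^ j) G t)\<^sup>2) \<partial>lborel)"
proof -
  let ?f = "fwd_diff k (1 / 2 ^ j) G" and ?D = "dcell j I"
  let ?L = "LINT t:?D|lborel. ?f t"
  have "ennreal \<bar>?L\<bar> \<le> (\<integral>\<^sup>+t. ennreal \<bar>?f t\<bar> * indicator ?D t \<partial>lborel)"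
  proof (cases "set_integrable lborel ?D ?f")
    case True
    have "ennreal \<bar>?L\<bar> \<le> (\<integral>\<^sup>+t. ennreal (norm (indicator ?D t *\<^sub>R ?f t)) \<partial>lborel)"
      using integral_norm_bound_ennreal[of lborel "\<lambda>t. indicator ?D t *\<^sub>R ?f t"] True
      by (simp add: set_integrable_def set_lebesgue_integral_def)
    also have "\<dots> = (\<integral>\<^sup>+t. ennreal \<bar>?f t\<bar> * indicator ?D t \<partial>lborel)"
      by (intro nn_integral_cong) (auto simp: indicator_def)
    finally show ?thesis .
  next
    case False
    \<comment> \<open>The Bochner integral of a non-integrable function is 0.\<close>
    then show ?thesis unfolding set_lebesgue_integral_def set_integrable_def by (simp add: not_integrable_integral_eq)
  qed
  then have "(ennreal \<bar>?L\<bar>)\<^sup>2 \<le> (\<integral>\<^sup>+t. (ennreal \<bar>?f t\<bar> * indicator ?D t) * indicator ?D t \<partial>lborel)\<^sup>2"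
  proof (intro power_mono)
    have "(\<integral>\<^sup>+t. ennreal \<bar>?f t\<bar> * indicator ?D t \<partial>lborel) = (\<integral>\<^sup>+t. (ennreal \<bar>?f t\<bar> * indicator ?D t) * indicator ?D t \<partial>lborel)"
      by (intro nn_integral_cong) (auto simp: indicator_def)
    then show "ennreal \<bar>?L\<bar> \<le> (\<integral>\<^sup>+t. (ennreal \<bar>?f t\<bar> * indicator ?D t) * indicator ?D t \<partial>lborel)"
      using \<open>ennreal \<bar>?L\<bar> \<le> _\<close> by simp
  qed auto
  also have "\<dots> \<le> (\<integral>\<^sup>+t. (ennreal \<bar>?f t\<bar> * indicator ?D t)\<^sup>2 \<partial>lborel) * (\<integral>\<^sup>+t. (indicator ?D t)\<^sup>2 \<partial>lborel)"
    by (rule Cauchy_Schwarz_nn_integral) measurable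
  also have "(\<integral>\<^sup>+t. (ennreal \<bar>?f t\<bar> * indicator ?D t)\<^sup>2 \<partial>lborel) = (\<integral>\<^sup>+t\<in>?D. ennreal ((?f t)\<^sup>2) \<partial>lborel)"
    by (intro nn_integral_cong) (auto simp: indicator_def ennreal_power)
  also have "(\<integral>\<^sup>+t. (indicator ?D t)\<^sup>2 \<partial>lborel) = ennreal (1 / 2 ^ j)"
  proof -
    have "(\<lambda>t. (indicator ?D t)\<^sup>2 :: ennreal) = indicator ?D" by (auto simp: indicator_def fun_eq_iff)
    then show ?thesis by (simp add: emeasure_dcell)
  qed
  finally have 1: "(ennreal \<bar>?L\<bar>)\<^sup>2 \<le> (\<integral>\<^sup>+t\<in>?D. ennreal ((?f t)\<^sup>2) \<partial>lborel) * ennreal (1 / 2 ^ j)" .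
  have "ennreal ((fd k (a j) I)\<^sup>2) = ennreal (2 ^ j * 2 ^ j) * (ennreal \<bar>?L\<bar>)\<^sup>2"
    by (simp add: fd_davg[OF assms] ennreal_power power_mult_distrib power2_eq_square[of "2 ^ j"] flip: ennreal_mult)
  also have "\<dots> \<le> ennreal (2 ^ j * 2 ^ j) * ((\<integral>\<^sup>+t\<in>?D. ennreal ((?f t)\<^sup>2) \<partial>lborel) * ennreal (1 / 2 ^ j))"
    by (intro mult_left_mono 1) auto
  also have "\<dots> = (ennreal (2 ^ j * 2 ^ j) * ennreal (1 / 2 ^ j)) * (\<integral>\<^sup>+t\<in>?D. ennreal ((?f t)\<^sup>2) \<partial>lborel)"
    by (simp only: mult_ac)
  also have "ennreal (2 ^ j * 2 ^ j) * ennreal (1 / 2 ^ j) = ennreal (2 ^ j)"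
    by (subst ennreal_mult[symmetric]) auto
  finally show ?thesis .
qed

text \<open>The cells that have k further cells to their right lie in the interval on which the k-th
  difference with step \<open>1 / 2 ^ j\<close> is controlled, so the squares add up to a single
  integral over it.\<close>

lemma sum_fd_sq: "(\<Sum>I<2 ^ j - k. (fd k (a j) I)\<^sup>2) \<le> 2 ^ j * (A * \<rho> ^ j)\<^sup>2"
proof (cases "k < 2 ^ j")
  case True
  let ?f = "fwd_diff k (1 / 2 ^ j) G"
  have sub: "indicator (\<Union>I<2 ^ j - k. dcell j I) t \<le> (indicator {0..1 - k * (1 / 2 ^ j)} t :: ennreal)" for t
  proof -
    have "t \<le> 1 - k * (1 / 2 ^ j)" if t: "t \<in> dcell j I" and I: "I < 2 ^ j - k" for I
    proof -
      have "real I + 1 + real k \<le> 2 ^ j"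
        using I by (metis Suc_leI add.commute add_Suc less_diff_conv of_nat_Suc of_nat_add of_nat_le_iff of_nat_numeral of_nat_power)
      then have "(real I + 1 + real k) / 2 ^ j \<le> 1" by simp
      then have "(real I + 1) / 2 ^ j \<le> 1 - k * (1 / 2 ^ j)" by (simp add: add_divide_distrib)
      then show ?thesis using t unfolding dcell_def by (auto simp del: times_divide_eq_right)
    qed
    then show ?thesis by (auto simp: indicator_def mem_dcell_iff simp del: times_divide_eq_right)
  qed
  have "ennreal (\<Sum>I<2 ^ j - k. (fd k (a j) I)\<^sup>2) = (\<Sum>I<2 ^ j - k. ennreal ((fd k (a j) I)\<^sup>2))"
    by (rule sum_ennreal[symmetric]) auto
  also have "\<dots> \<le> (\<Sum>I<2 ^ j - k. ennreal (2 ^ j) * (\<integral>\<^sup>+t\<in>dcell j I. ennreal ((?f t)\<^sup>2) \<partial>lborel))"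
    by (intro sum_mono fd_sq) auto
  also have "\<dots> = ennreal (2 ^ j) * (\<integral>\<^sup>+t. (\<Sum>I<2 ^ j - k. ennreal ((?f t)\<^sup>2) * indicator (dcell j I) t) \<partial>lborel)"
    by (subst nn_integral_sum) (auto simp: sum_distrib_left)
  also have "\<dots> = ennreal (2 ^ j) * (\<integral>\<^sup>+t. ennreal ((?f t)\<^sup>2) * indicator (\<Union>I<2 ^ j - k. dcell j I) t \<partial>lborel)"
    unfolding sum_distrib_left[symmetric]
    by (subst indicator_UN_disjoint) (auto simp: disjoint_family_on_def mem_dcell_iff)
  also have "\<dots> \<le> ennreal (2 ^ j) * (\<integral>\<^sup>+t\<in>{0..1 - k * (1 / 2 ^ j)}. ennreal ((?f t)\<^sup>2) \<partial>lborel)"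
    by (intro mult_left_mono nn_integral_mono sub) auto
  also have "\<dots> \<le> ennreal (2 ^ j) * ennreal ((A * (1 / 2 ^ j) powr \<gamma>)\<^sup>2)"
  proof -
    have "real k \<le> 2 ^ j" using True by (metis of_nat_le_iff of_nat_numeral of_nat_power less_imp_le)
    then have "real k * (1 / 2 ^ j) \<le> 1" by (simp add: field_simps)
    from mult_left_mono[OF diff[OF _ this], of "ennreal (2 ^ j)"] show ?thesis by simp
  qed
  also have "\<dots> = ennreal (2 ^ j * (A * \<rho> ^ j)\<^sup>2)"
    by (simp add: powr_half_power \<rho>_def flip: ennreal_mult)
  finally show ?thesis by (subst (asm) ennreal_le_iff) auto
qed simp

text \<open>A k-th difference involves k + 1 consecutive averages; the range \<open>M - k\<close>
  keeps all of them inside the cell \<open>c\<close>.\<close>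

definition F :: "nat \<Rightarrow> nat \<Rightarrow> real" where
  "F \<kappa> c = (\<Sum>i<M - k. \<bar>fd k (a (\<kappa> + m)) (i + c * M)\<bar>)"

lemma F_nonneg: "F \<kappa> c \<ge> 0" unfolding F_def by (intro sum_nonneg) auto

text \<open>Cauchy-Schwarz within a cell costs a factor \<open>M\<close>. The windows of different
  cells are disjoint, and taking the differences on the finer level \<open>\<kappa> + m\<close> only
  helps, as \<open>\<rho> < 1\<close>.\<close>

lemma F_sq: "(\<Sum>c<2 ^ \<kappa>. (F \<kappa> c)\<^sup>2 * (1 / 2 ^ \<kappa>)) \<le> (M * A * \<rho> ^ \<kappa>)\<^sup>2"
proof -
  let ?x = "\<lambda>I. (fd k (a (\<kappa> + m)) I)\<^sup>2"
  have "(\<Sum>c<2 ^ \<kappa>. (F \<kappa> c)\<^sup>2) \<le> (\<Sum>c<2 ^ \<kappa>. M * (\<Sum>i<M - k. ?x (i + c * M)))"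
  proof (rule sum_mono)
    fix c
    have "(F \<kappa> c)\<^sup>2 = (\<Sum>i<M - k. 1 * \<bar>fd k (a (\<kappa> + m)) (i + c * M)\<bar>)\<^sup>2" by (simp add: F_def)
    also have "\<dots> \<le> (\<Sum>i<M - k. 1\<^sup>2) * (\<Sum>i<M - k. \<bar>fd k (a (\<kappa> + m)) (i + c * M)\<bar>\<^sup>2)"
      by (rule Cauchy_Schwarz_ineq_sum)
    also have "\<dots> \<le> M * (\<Sum>i<M - k. ?x (i + c * M))"
      by (auto intro!: mult_right_mono sum_nonneg)
    finally show "(F \<kappa> c)\<^sup>2 \<le> M * (\<Sum>i<M - k. ?x (i + c * M))" .
  qed
  also have "\<dots> = M * (\<Sum>c<2 ^ \<kappa>. \<Sum>i<M - k. ?x (i + c * M))" by (simp add: sum_distrib_left)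
  finally have outer: "(\<Sum>c<2 ^ \<kappa>. (F \<kappa> c)\<^sup>2) \<le> M * (\<Sum>c<2 ^ \<kappa>. \<Sum>i<M - k. ?x (i + c * M))" .
  have "(\<Sum>c<2 ^ \<kappa>. \<Sum>i<M - k. ?x (i + c * M)) = (\<Sum>(c, i)\<in>{..<2 ^ \<kappa>} \<times> {..<M - k}. ?x (i + c * M))"
    by (rule sum.cartesian_product)
  also have "\<dots> =
      (\<Sum>I\<in>(\<lambda>(c, i). i + c * M) ` ({..<2 ^ \<kappa>} \<times> {..<M - k}). ?x I)"
  proof -
    have "inj_on (\<lambda>(c, i). i + c * M) ({..<2 ^ \<kappa>} \<times> {..<M - k})"
    proof (rule inj_onI, clarsimp)
      fix c i c' i' assume i: "i < M - k" "i' < M - k" and e: "i + c * M = i' + c' * M"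
      have "i < M" "i' < M" using i by auto
      then have "(i + c * M) div M = c" "(i' + c' * M) div M = c'" by auto
      then have "c = c'" using e by simp
      then show "c = c' \<and> i = i'" using e by simp
    qed
    from sum.reindex[OF this, of ?x] show ?thesis by (simp add: o_def case_prod_unfold)
  qed
  also have "\<dots> \<le> (\<Sum>I<2 ^ (\<kappa> + m) - k. ?x I)"
  proof (rule sum_mono2)
    show "(\<lambda>(c, i). i + c * M) ` ({..<2 ^ \<kappa>} \<times> {..<M - k}) \<subseteq> {..<2 ^ (\<kappa> + m) - k}"
    proof clarsimp
      fix c i :: nat assume c: "c < 2 ^ \<kappa>" and i: "i < M - k"
      have "(c + 1) * M \<le> 2 ^ \<kappa> * M" using c by (intro mult_right_mono) auto
      then show "i + c * M < 2 ^ (\<kappa> + m) - k" using i by (simp add: power_add M_pos)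
    qed
  qed auto
  also have "\<dots> \<le> 2 ^ (\<kappa> + m) * (A * \<rho> ^ (\<kappa> + m))\<^sup>2" by (rule sum_fd_sq)
  also have "\<dots> \<le> 2 ^ (\<kappa> + m) * (A * \<rho> ^ \<kappa>)\<^sup>2"
    using \<rho> A by (intro mult_left_mono power_mono power_decreasing) auto
  also have "\<dots> = 2 ^ \<kappa> * M * (A * \<rho> ^ \<kappa>)\<^sup>2" by (simp add: power_add M_def)
  finally have "(\<Sum>c<2 ^ \<kappa>. \<Sum>i<M - k. ?x (i + c * M)) \<le> 2 ^ \<kappa> * M * (A * \<rho> ^ \<kappa>)\<^sup>2" .
  from order.trans[OF outer mult_left_mono[OF this, of "real M"]]
  have *: "(\<Sum>c<2 ^ \<kappa>. (F \<kappa> c)\<^sup>2) \<le> M * (2 ^ \<kappa> * M * (A * \<rho> ^ \<kappa>)\<^sup>2)" by simp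
  have "(\<Sum>c<2 ^ \<kappa>. (F \<kappa> c)\<^sup>2 * (1 / 2 ^ \<kappa>)) \<le> M * (2 ^ \<kappa> * M * (A * \<rho> ^ \<kappa>)\<^sup>2) * (1 / 2 ^ \<kappa>)"
    unfolding sum_distrib_right[symmetric] by (intro mult_right_mono *) auto
  also have "\<dots> = (M * A * \<rho> ^ \<kappa>)\<^sup>2" by (simp add: power2_eq_square)
  finally show ?thesis .
qed

text \<open>A primitive rather than the fit itself: its increments over subcells reproduce the
  integrals of \<open>G\<close> up to a multiple of \<open>F\<close>. The substitution sends the
  subcell boundaries of cell \<open>c\<close> to 0, 1, ..., \<open>M\<close>, where the Newton
  polynomial lives.\<close>

definition P :: "nat \<Rightarrow> nat \<Rightarrow> real poly" where
  "P \<kappa> c = smult (1 / 2 ^ (\<kappa> + m)) (pcompose (newton_prim k (\<lambda>i. a (\<kappa> + m) (i + c * M))) [:- real (c * M), 2 ^ (\<kappa> + m):])"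

definition Q :: "nat \<Rightarrow> nat \<Rightarrow> real poly" where
  "Q \<kappa> c = pderiv (P \<kappa> c)"

lemma degree_Q: "degree (Q \<kappa> c) \<le> k - 1"
proof -
  have "degree (P \<kappa> c) \<le> k"
    unfolding P_def using degree_newton_prim[of k] by (simp add: degree_pcompose)
  then show ?thesis by (simp add: Q_def degree_pderiv)
qed

lemma P_avg:
  assumes "i < M"
  shows "\<bar>a (\<kappa> + m) (i + c * M) - 2 ^ (\<kappa> + m) *
     (poly (P \<kappa> c) ((real (i + c * M) + 1) / 2 ^ (\<kappa> + m)) - poly (P \<kappa> c) (real (i + c * M) / 2 ^ (\<kappa> + m)))\<bar> \<le> 4 ^ M * F \<kappa> c"
proof -
  let ?j = "\<kappa> + m" and ?b = "\<lambda>i. a (\<kappa> + m) (i + c * M)"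
  have "2 ^ ?j * (poly (P \<kappa> c) ((real (i + c * M) + 1) / 2 ^ ?j) - poly (P \<kappa> c) (real (i + c * M) / 2 ^ ?j)) =
      poly (newton_prim k ?b) (of_nat (Suc i)) - poly (newton_prim k ?b) (of_nat i)"
    by (simp add: P_def poly_pcompose right_diff_distrib add.commute)
  also have "\<dots> = (\<Sum>l<k. of_nat (i choose l) * fd l ?b 0)" by (rule newton_prim_diff)
  finally have e: "2 ^ ?j * (poly (P \<kappa> c) ((real (i + c * M) + 1) / 2 ^ ?j) - poly (P \<kappa> c) (real (i + c * M) / 2 ^ ?j)) =
     (\<Sum>l<k. of_nat (i choose l) * fd l ?b 0)" .
  show ?thesis unfolding e F_def using newton_error[OF assms, of ?b k] by (simp add: fd_shift)
qed

end

context jackson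
begin

definition "C1 = real k * real M ^ k * 4 ^ M"

lemma C1_nonneg: "C1 \<ge> 0" by (simp add: C1_def)

text \<open>Both fits are tested on a subcell of the parent. It is one of the data cells of the
  parent and the union of two adjacent data cells of the child, whose averages
  \<open>davg_refine\<close> combines; hence the increments of the two primitives nearly
  agree.\<close>

lemma child_avg:
  assumes c': "c' < 2 ^ Suc \<kappa>" and i: "2 * i < M"
  defines "I \<equiv> c' * (M div 2) + i" and "D \<equiv> P \<kappa> (c' div 2) - P (Suc \<kappa>) c'"
  shows "\<bar>2 ^ (\<kappa> + m) * (poly D ((real I + 1) / 2 ^ (\<kappa> + m)) - poly D (real I / 2 ^ (\<kappa> + m)))\<bar>
    \<le> 4 ^ M * (F \<kappa> (c' div 2) + F (Suc \<kappa>) c')"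
proof -
  let ?j = "\<kappa> + m" and ?c = "c' div 2" and ?h = "M div 2"
  have "m \<noteq> 0" using m k by (cases m) auto
  then have "even M" by (simp add: M_def)
  then have h: "2 * ?h = M" by simp
  have I1: "((c' mod 2) * ?h + i) + ?c * M = I"
  proof -
    have "2 * ?c + c' mod 2 = c'" by simp
    then have "c' * ?h = (2 * ?c + c' mod 2) * ?h" by (simp only:)
    also have "\<dots> = ?c * (2 * ?h) + (c' mod 2) * ?h" by (simp only: distrib_right mult.assoc mult.left_commute)
    finally show ?thesis by (simp add: I_def h)
  qed
  have i1: "(c' mod 2) * ?h + i < M"
  proof -
    have "(c' mod 2) * ?h \<le> 1 * ?h" by (intro mult_right_mono) auto
    then show ?thesis using h i by linarith
  qed
  have "c' * M = 2 * (c' * ?h)" using h by (metis mult.left_commute)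
  then have I2: "2 * i + c' * M = 2 * I" by (simp add: I_def)
  have I_less: "I < 2 ^ ?j"
  proof -
    have "(c' + 1) * ?h \<le> 2 ^ Suc \<kappa> * ?h" using c' by (intro mult_right_mono) auto
    also have "\<dots> = 2 ^ \<kappa> * (2 * ?h)" by simp
    also have "\<dots> = 2 ^ ?j" by (simp add: h power_add M_pos)
    finally show ?thesis using i h by (simp add: I_def)
  qed
  define p0 where "p0 = poly (P (Suc \<kappa>) c') (real I / 2 ^ ?j)"
  define p1 where "p1 = poly (P (Suc \<kappa>) c') ((2 * real I + 1) / 2 ^ Suc ?j)"
  define p2 where "p2 = poly (P (Suc \<kappa>) c') ((real I + 1) / 2 ^ ?j)"
  have e1: "\<bar>a ?j I - 2 ^ ?j * (poly (P \<kappa> ?c) ((real I + 1) / 2 ^ ?j) - poly (P \<kappa> ?c) (real I / 2 ^ ?j))\<bar> \<le> 4 ^ M * F \<kappa> ?c"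
    using P_avg[OF i1, of \<kappa> ?c] unfolding I1 .
  have q0: "real (2 * I) / 2 ^ Suc ?j = real I / 2 ^ ?j" by simp
  have q1: "real (2 * I) + 1 = 2 * real I + 1" "real (1 + 2 * I) = 2 * real I + 1" by simp_all
  have q2: "(2 * real I + 1 + 1) / 2 ^ Suc ?j = (real I + 1) / 2 ^ ?j" by (simp add: field_simps)
  have e2: "\<bar>a (Suc ?j) (2 * I) - 2 ^ Suc ?j * (p1 - p0)\<bar> \<le> 4 ^ M * F (Suc \<kappa>) c'"
    using P_avg[OF i, of "Suc \<kappa>" c'] unfolding I2 p0_def p1_def add_Suc q0 q1 .
  have i3: "1 + 2 * i < M" using i h by presburger
  have I3: "(1 + 2 * i) + c' * M = 1 + 2 * I" using I2 by simp
  have "\<bar>a (Suc ?j) (1 + 2 * I) - 2 ^ Suc ?j * (p2 - p1)\<bar> \<le> 4 ^ M * F (Suc \<kappa>) c'"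
    using P_avg[OF i3, of "Suc \<kappa>" c'] unfolding I3 p1_def p2_def add_Suc q1 q2 .
  then have e3: "\<bar>a (Suc ?j) (2 * I + 1) - 2 ^ Suc ?j * (p2 - p1)\<bar> \<le> 4 ^ M * F (Suc \<kappa>) c'"
    by (simp only: add.commute[of 1 "2 * I"])
  have r: "2 * a ?j I = a (Suc ?j) (2 * I) + a (Suc ?j) (2 * I + 1)"
    by (rule davg_refine[OF I_less])
  have "2 * \<bar>a ?j I - 2 ^ ?j * (p2 - p0)\<bar> = \<bar>(a (Suc ?j) (2 * I) - 2 ^ Suc ?j * (p1 - p0)) + (a (Suc ?j) (2 * I + 1) - 2 ^ Suc ?j * (p2 - p1))\<bar>"
  proof -
    have "(a (Suc ?j) (2 * I) - 2 ^ Suc ?j * (p1 - p0)) + (a (Suc ?j) (2 * I + 1) - 2 ^ Suc ?j * (p2 - p1)) =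
       2 * (a ?j I - 2 ^ ?j * (p2 - p0))"
      using r by (simp add: algebra_simps)
    then show ?thesis by (simp only: abs_mult)
  qed
  also have "\<dots> \<le> 2 * (4 ^ M * F (Suc \<kappa>) c')" using e2 e3 by linarith
  finally have e4: "\<bar>a ?j I - 2 ^ ?j * (p2 - p0)\<bar> \<le> 4 ^ M * F (Suc \<kappa>) c'" by simp
  have "2 ^ ?j * (poly D ((real I + 1) / 2 ^ ?j) - poly D (real I / 2 ^ ?j)) =
      (a ?j I - 2 ^ ?j * (p2 - p0)) - (a ?j I - 2 ^ ?j * (poly (P \<kappa> ?c) ((real I + 1) / 2 ^ ?j) - poly (P \<kappa> ?c) (real I / 2 ^ ?j)))"
    by (simp add: D_def p0_def p2_def algebra_simps)
  then show ?thesis using e1 e4 unfolding distrib_left by linarith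
qed

text \<open>In every second subcell of the half cell the mean value theorem yields a point where the
  derivative of \<open>D\<close> is no larger than the scaled increment. Skipping every other
  subcell keeps these k points one subcell length apart, and Lagrange interpolation carries the
  bound to the whole half cell.\<close>

lemma child_cmp:
  assumes c': "c' < 2 ^ Suc \<kappa>" and t: "t \<in> dcell (Suc \<kappa>) c'"
  shows "\<bar>poly (Q \<kappa> (c' div 2)) t - poly (Q (Suc \<kappa>) c') t\<bar> \<le> C1 * (F \<kappa> (c' div 2) + F (Suc \<kappa>) c')"
proof -
  let ?j = "\<kappa> + m" and ?h = "M div 2"
  define D where "D = P \<kappa> (c' div 2) - P (Suc \<kappa>) c'"
  define B where "B = 4 ^ M * (F \<kappa> (c' div 2) + F (Suc \<kappa>) c')"
  have "m \<noteq> 0" using m k by (cases m) auto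
  then have "even M" by (simp add: M_def)
  then have h: "2 * ?h = M" by simp
  have "\<exists>\<xi>. real (c' * ?h + 2 * i) / 2 ^ ?j < \<xi> \<and> \<xi> < (real (c' * ?h + 2 * i) + 1) / 2 ^ ?j \<and> \<bar>poly (pderiv D) \<xi>\<bar> \<le> B"
    if i: "i < k" for i
  proof -
    let ?I = "c' * ?h + 2 * i"
    have "2 * (2 * i) < M" using i M_pos(2) by linarith
    from child_avg[OF c' this] have b: "\<bar>2 ^ ?j * (poly D ((real ?I + 1) / 2 ^ ?j) - poly D (real ?I / 2 ^ ?j))\<bar> \<le> B"
      unfolding D_def B_def .
    have "real ?I / 2 ^ ?j < (real ?I + 1) / 2 ^ ?j" by (intro divide_strict_right_mono) auto
    from poly_MVT[OF this, of D] obtain \<xi> where \<xi>: "real ?I / 2 ^ ?j < \<xi>" "\<xi> < (real ?I + 1) / 2 ^ ?j"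
      and e: "poly D ((real ?I + 1) / 2 ^ ?j) - poly D (real ?I / 2 ^ ?j) = ((real ?I + 1) / 2 ^ ?j - real ?I / 2 ^ ?j) * poly (pderiv D) \<xi>"
      by blast
    have "(real ?I + 1) / 2 ^ ?j - real ?I / 2 ^ ?j = 1 / 2 ^ ?j" by (simp add: diff_divide_distrib[symmetric])
    then have "2 ^ ?j * (poly D ((real ?I + 1) / 2 ^ ?j) - poly D (real ?I / 2 ^ ?j)) = poly (pderiv D) \<xi>"
      unfolding e by simp
    then show ?thesis using b \<xi> by (intro exI[of _ \<xi>]) auto
  qed
  then obtain x where x1: "\<And>i. i < k \<Longrightarrow> real (c' * ?h + 2 * i) / 2 ^ ?j < x i"
    and x2: "\<And>i. i < k \<Longrightarrow> x i < (real (c' * ?h + 2 * i) + 1) / 2 ^ ?j"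
    and xB: "\<And>i. i < k \<Longrightarrow> \<bar>poly (pderiv D) (x i)\<bar> \<le> B"
    by metis
  have sep: "x i - x i' \<ge> 1 / 2 ^ ?j" if "i' < i" "i < k" for i i'
  proof -
    have "1 / 2 ^ ?j + (real (c' * ?h + 2 * i') + 1) / 2 ^ ?j \<le> real (c' * ?h + 2 * i) / 2 ^ ?j"
    proof -
      have "1 + (real (c' * ?h + 2 * i') + 1) \<le> real (c' * ?h + 2 * i)" using that by simp
      then show ?thesis unfolding add_divide_distrib[symmetric] by (intro divide_right_mono) auto
    qed
    then show ?thesis using x1[of i] x2[of i'] that by auto
  qed
  have pow: "(2::real) ^ ?j = 2 ^ Suc \<kappa> * real ?h"
  proof -
    have "real M = 2 * real ?h" using h by (metis of_nat_mult of_nat_numeral)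
    moreover have "(2::real) ^ ?j = 2 ^ \<kappa> * real M" by (simp add: power_add M_def)
    ultimately show ?thesis by simp
  qed
  have h0: "real ?h > 0" using h M_pos(1) by (cases ?h) auto
  have "\<bar>poly (pderiv D) t\<bar> \<le> real k * real M ^ k * B"
  proof (rule poly_bound_of_points)
    have "degree (Q \<kappa> (c' div 2) - Q (Suc \<kappa>) c') \<le> k - 1" by (intro degree_diff_le degree_Q)
    then show "degree (pderiv D) < k" using k by (simp add: D_def pderiv_diff Q_def)
    show "1 / 2 ^ ?j \<le> \<bar>x i - x i'\<bar>" if "i < k" "i' < k" "i \<noteq> i'" for i i'
      using sep[of i i'] sep[of i' i] that by (cases "i < i'") auto
    show "\<bar>t - x i\<bar> \<le> real M * (1 / 2 ^ ?j)" if "i < k" for i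
    proof -
      have a1: "real c' / 2 ^ Suc \<kappa> \<le> x i"
      proof -
        have "real c' / 2 ^ Suc \<kappa> = real (c' * ?h) / 2 ^ ?j" using h0 by (simp add: pow)
        also have "\<dots> \<le> real (c' * ?h + 2 * i) / 2 ^ ?j" by (intro divide_right_mono) auto
        finally show ?thesis using x1[OF that] by simp
      qed
      have a2: "x i \<le> (real c' + 1) / 2 ^ Suc \<kappa>"
      proof -
        have "2 * i + 1 \<le> ?h" using that M_pos(2) h by linarith
        then have "real (c' * ?h + 2 * i) + 1 \<le> (real c' + 1) * ?h" by (simp add: algebra_simps)
        then have "(real (c' * ?h + 2 * i) + 1) / 2 ^ ?j \<le> (real c' + 1) * ?h / 2 ^ ?j" by (intro divide_right_mono) auto
        also have "\<dots> = (real c' + 1) / 2 ^ Suc \<kappa>" using h0 by (simp add: pow)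
        finally show ?thesis using x2[OF that] by simp
      qed
      have "\<bar>t - x i\<bar> \<le> 1 / 2 ^ Suc \<kappa>"
        using a1 a2 t by (auto simp: dcell_def add_divide_distrib)
      also have "\<dots> = real ?h / 2 ^ ?j" using h0 by (simp add: pow)
      also have "\<dots> \<le> real M * (1 / 2 ^ ?j)" using h by (simp add: divide_right_mono)
      finally show ?thesis .
    qed
  qed (use xB M_pos in auto)
  then show ?thesis by (simp add: B_def D_def C1_def Q_def pderiv_diff mult.assoc)
qed

section \<open>Gluing the local fits and summing over levels\<close>

definition v :: "nat \<Rightarrow> real \<Rightarrow> real" where
  "v \<kappa> t = (\<Sum>c<2 ^ \<kappa>. poly (Q \<kappa> c) t * indicator (dcell \<kappa> c) t)"

definition FF :: "nat \<Rightarrow> real \<Rightarrow> real" where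
  "FF \<kappa> t = F \<kappa> (dind \<kappa> t)"

lemma FF_nonneg: "FF \<kappa> t \<ge> 0" by (simp add: FF_def F_nonneg)

lemma v_eq: "t \<in> {0..<1} \<Longrightarrow> v \<kappa> t = poly (Q \<kappa> (dind \<kappa> t)) t"
proof -
  assume t: "t \<in> {0..<1}"
  have "v \<kappa> t = (\<Sum>c<2 ^ \<kappa>. if c = dind \<kappa> t then poly (Q \<kappa> c) t else 0)"
    unfolding v_def using t by (intro sum.cong) (auto simp: mem_dcell_iff indicator_def)
  then show ?thesis using t dind_less[of t \<kappa>] by simp
qed

lemma v_ppoly: "v \<kappa> \<in> ppoly_space k (2 ^ \<kappa>)"
  unfolding ppoly_space_def
proof (intro CollectI exI[of _ "\<lambda>j. Q \<kappa> (j - 1)"] conjI ballI degree_Q)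
  have "v \<kappa> t = (\<Sum>j=1..2 ^ \<kappa>. poly (Q \<kappa> (j - 1)) t * indicator {(real j - 1) / real (2 ^ \<kappa>)..<real j / real (2 ^ \<kappa>)} t)" for t
    unfolding One_nat_def sum.atLeast1_atMost_eq v_def by (intro sum.cong) (auto simp: dcell_def add.commute)
  then show "v \<kappa> = (\<lambda>t. \<Sum>j=1..2 ^ \<kappa>. poly (Q \<kappa> (j - 1)) t * indicator {(real j - 1) / real (2 ^ \<kappa>)..<real j / real (2 ^ \<kappa>)} t)"
    by blast
qed

lemma v_step: "t \<in> {0..<1} \<Longrightarrow> \<bar>v (Suc \<kappa>) t - v \<kappa> t\<bar> \<le> C1 * (FF \<kappa> t + FF (Suc \<kappa>) t)"
proof -
  assume t: "t \<in> {0..<1}"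
  have d: "dind (Suc \<kappa>) t div 2 = dind \<kappa> t" using dind_div[of t \<kappa> "Suc \<kappa>"] t by simp
  have "\<bar>poly (Q \<kappa> (dind (Suc \<kappa>) t div 2)) t - poly (Q (Suc \<kappa>) (dind (Suc \<kappa>) t)) t\<bar>
      \<le> C1 * (F \<kappa> (dind (Suc \<kappa>) t div 2) + F (Suc \<kappa>) (dind (Suc \<kappa>) t))"
    by (rule child_cmp) (use t dind_less[of t "Suc \<kappa>"] in \<open>auto simp: mem_dcell_iff\<close>)
  then show ?thesis using t unfolding d by (simp add: v_eq FF_def abs_minus_commute)
qed

text \<open>The subtracted \<open>FF n t\<close> keeps the induction exact: inner levels enter two
  successive steps, the last level only one so far.\<close>

lemma v_telescope:
  assumes t: "t \<in> {0..<1}" and "\<kappa> \<le> n"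
  shows "\<bar>v n t - v \<kappa> t\<bar> \<le> C1 * (2 * (\<Sum>i=\<kappa>..n. FF i t) - FF n t)"
  using assms(2)
proof (induction n rule: dec_induct)
  case base
  then show ?case using C1_nonneg FF_nonneg by simp
next
  case (step n)
  have "\<bar>v (Suc n) t - v \<kappa> t\<bar> \<le> \<bar>v (Suc n) t - v n t\<bar> + \<bar>v n t - v \<kappa> t\<bar>" by linarith
  also have "\<dots> \<le> C1 * (FF n t + FF (Suc n) t) + C1 * (2 * (\<Sum>i=\<kappa>..n. FF i t) - FF n t)"
    using v_step[OF t, of n] step.IH by linarith
  finally show ?case using step.hyps by (simp add: algebra_simps)
qed

lemma v_measurable[measurable]: "v \<kappa> \<in> borel_measurable borel"
proof -
  have [measurable]: "poly p \<in> borel_measurable borel" for p :: "real poly"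
    by (intro borel_measurable_continuous_onI continuous_intros)
  show ?thesis unfolding v_def by measurable
qed

lemma v_int: "set_integrable lborel {0..<1} (v \<kappa>)"
proof -
  have "set_integrable lborel {0..<1} (\<lambda>t. poly (Q \<kappa> c) t * indicator (dcell \<kappa> c) t)" for c
  proof -
    have "set_integrable lborel {0..1::real} (poly (Q \<kappa> c))"
      by (intro borel_integrable_atLeastAtMost' continuous_intros)
    then have "set_integrable lborel {0..<1} (poly (Q \<kappa> c))" by (rule set_integrable_subset) auto
    then have "integrable lborel (\<lambda>t. indicator (dcell \<kappa> c) t *\<^sub>R (indicator {0..<1} t *\<^sub>R poly (Q \<kappa> c) t))"
      unfolding set_integrable_def by (rule integrable_mult_indicator[rotated]) simp
    then show ?thesis unfolding set_integrable_def by (simp add: mult_ac)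
  qed
  then have "integrable lborel (\<lambda>t. \<Sum>c<2 ^ \<kappa>. indicator {0..<1} t *\<^sub>R (poly (Q \<kappa> c) t * indicator (dcell \<kappa> c) t))"
    unfolding set_integrable_def by (intro Bochner_Integration.integrable_sum) auto
  then show ?thesis unfolding set_integrable_def v_def by (simp only: scaleR_sum_right)
qed

definition "C2 = 4 ^ M + 2 * C1"

text \<open>On a cell of level \<open>n + m\<close> the function \<open>v n\<close> is one
  polynomial and its average is an increment of \<open>P\<close>, so the averages of
  \<open>G\<close> and \<open>v n\<close> differ by a multiple of \<open>F\<close>. The rest is the
  telescoped sum, which does not vary on that cell because \<open>FF i\<close> is a step function on
  level i at most n.\<close>

lemma davg_error:
  assumes t: "t \<in> {0..<1}" and \<kappa>: "\<kappa> \<le> n"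
  shows "\<bar>davg (n + m) (\<lambda>s. G s - v \<kappa> s) (dind (n + m) t)\<bar> \<le> C2 * (\<Sum>i=\<kappa>..n. FF i t)"
proof -
  let ?J = "n + m"
  define I where "I = dind ?J t"
  define c where "c = dind n t"
  have I: "I < 2 ^ ?J" unfolding I_def using t by (intro dind_less) auto
  have same: "dind i s = dind i t" if "s \<in> dcell ?J I" "i \<le> ?J" for i s
    using that t by (simp add: mem_dcell_iff dind_div[of _ i ?J] I_def)
  have c: "c = I div M" using t unfolding c_def I_def by (simp add: dind_div[of t n ?J] M_def)
  have sub: "dcell ?J I \<subseteq> {0..<1}" by (rule dcell_subset[OF I])
  have "davg ?J (v n) I = 2 ^ ?J * (LINT s:dcell ?J I|lborel. poly (pderiv (P n c)) s)"
    unfolding davg_def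
    using same[of _ n] sub by (auto intro!: set_lebesgue_integral_cong simp: v_eq c_def Q_def subset_iff)
  also have "\<dots> = 2 ^ ?J * (poly (P n c) ((real I + 1) / 2 ^ ?J) - poly (P n c) (real I / 2 ^ ?J))"
    unfolding dcell_def by (subst LINT_poly_pderiv) (auto intro!: divide_right_mono)
  finally have vn: "davg ?J (v n) I = 2 ^ ?J * (poly (P n c) ((real I + 1) / 2 ^ ?J) - poly (P n c) (real I / 2 ^ ?J))" .
  have "I mod M < M" "I mod M + c * M = I" using M_pos(1) by (auto simp: c)
  from P_avg[OF this(1), of n c, unfolded this(2)]
  have e1: "\<bar>davg ?J (\<lambda>s. G s - v n s) I\<bar> \<le> 4 ^ M * FF n t"
    by (simp add: davg_diff[OF G_int1 v_int I] vn FF_def c_def)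
  have e2: "\<bar>davg ?J (\<lambda>s. v n s - v \<kappa> s) I\<bar> \<le> 2 * C1 * (\<Sum>i=\<kappa>..n. FF i t)"
  proof (rule abs_davg_le[OF set_integral_diff(1)[OF v_int v_int] I])
    fix s assume s: "s \<in> dcell ?J I"
    have "FF i s = FF i t" if "i \<in> {\<kappa>..n}" for i using same[OF s, of i] that by (simp add: FF_def)
    then have "(\<Sum>i=\<kappa>..n. FF i s) = (\<Sum>i=\<kappa>..n. FF i t)" by simp
    moreover have "\<bar>v n s - v \<kappa> s\<bar> \<le> C1 * (2 * (\<Sum>i=\<kappa>..n. FF i s) - FF n s)"
      by (rule v_telescope) (use s sub \<kappa> in auto)
    moreover have "C1 * FF n s \<ge> 0" using C1_nonneg FF_nonneg by simp
    ultimately show "\<bar>v n s - v \<kappa> s\<bar> \<le> 2 * C1 * (\<Sum>i=\<kappa>..n. FF i t)" by (simp add: algebra_simps)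
  qed
  have "davg ?J (\<lambda>s. G s - v \<kappa> s) I = davg ?J (\<lambda>s. G s - v n s) I + davg ?J (\<lambda>s. v n s - v \<kappa> s) I"
    by (simp add: davg_diff[OF _ _ I] G_int1 v_int)
  moreover have "FF n t \<le> (\<Sum>i=\<kappa>..n. FF i t)" using \<kappa> FF_nonneg by (intro member_le_sum) auto
  then have "4 ^ M * FF n t \<le> 4 ^ M * (\<Sum>i=\<kappa>..n. FF i t)" by (intro mult_left_mono) auto
  ultimately show ?thesis using e1 e2 unfolding I_def C2_def by (simp only: distrib_right)
qed

lemma sum_geometric_le: "(\<Sum>i=\<kappa>..n. \<rho> ^ (i - \<kappa>)) \<le> 1 / (1 - \<rho>)"
proof -
  have "(\<Sum>i=\<kappa>..n. \<rho> ^ (i - \<kappa>)) \<le> (\<Sum>l\<le>n. \<rho> ^ l)"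
  proof -
    have "(\<Sum>i=\<kappa>..n. \<rho> ^ (i - \<kappa>)) = (\<Sum>l\<in>(\<lambda>i. i - \<kappa>) ` {\<kappa>..n}. \<rho> ^ l)"
      by (subst sum.reindex) (auto simp: inj_on_def)
    also have "\<dots> \<le> (\<Sum>l\<le>n. \<rho> ^ l)" using \<rho> by (intro sum_mono2) auto
    finally show ?thesis .
  qed
  also have "\<dots> \<le> (\<Sum>l. \<rho> ^ l)" using \<rho> by (intro sum_le_suminf) auto
  also have "\<dots> = 1 / (1 - \<rho>)" using \<rho> by (intro suminf_geometric) auto
  finally show ?thesis .
qed

definition "C3 = C2 * M * A / (1 - \<rho>)"

theorem approx: "(\<integral>\<^sup>+t\<in>{0..<1}. ennreal ((G t - v \<kappa> t)\<^sup>2) \<partial>lborel) \<le> ennreal ((C3 * \<rho> ^ \<kappa>)\<^sup>2)"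
proof (rule L2_le_of_davg[of _ "\<kappa> + m"])
  show "set_integrable lborel {0..<1} (\<lambda>t. G t - v \<kappa> t)" by (intro set_integral_diff G_int1 v_int)
  show "(\<lambda>t. G t - v \<kappa> t) \<in> borel_measurable borel" by measurable
next
  fix j assume "\<kappa> + m \<le> j"
  then obtain n where j: "j = n + m" and n: "\<kappa> \<le> n" by (metis add.commute add.assoc le_Suc_ex le_add1)
  \<comment> \<open>Weights for Cauchy-Schwarz over the levels. As
    \<open>\<rho> ^ (2 * i) / w i\<close> equals \<open>\<rho> ^ (2 * \<kappa>) * w i\<close>, the
    sum over arbitrarily many levels stays bounded by a geometric series.\<close>
  define w where "w i = \<rho> ^ (i - \<kappa>)" for i
  have w: "w i > 0" for i using \<rho> by (simp add: w_def)
  have ptw: "(davg j (\<lambda>t. G t - v \<kappa> t) (dind j t))\<^sup>2 \<le> (\<Sum>i=\<kappa>..n. C2\<^sup>2 / (1 - \<rho>) / w i * (FF i t)\<^sup>2)"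
    if t: "t \<in> {0..<1}" for t
  proof -
    have "(\<Sum>i=\<kappa>..n. FF i t)\<^sup>2 = (\<Sum>i=\<kappa>..n. sqrt (w i) * (FF i t / sqrt (w i)))\<^sup>2"
      using w by (intro arg_cong[where f="\<lambda>x. x\<^sup>2"] sum.cong) (auto simp: less_imp_neq[OF w, symmetric])
    also have "\<dots> \<le> (\<Sum>i=\<kappa>..n. (sqrt (w i))\<^sup>2) * (\<Sum>i=\<kappa>..n. (FF i t / sqrt (w i))\<^sup>2)"
      by (rule Cauchy_Schwarz_ineq_sum)
    also have "\<dots> = (\<Sum>i=\<kappa>..n. w i) * (\<Sum>i=\<kappa>..n. (FF i t)\<^sup>2 / w i)"
      using w by (simp add: power_divide less_imp_le)
    also have "\<dots> \<le> 1 / (1 - \<rho>) * (\<Sum>i=\<kappa>..n. (FF i t)\<^sup>2 / w i)"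
      using w sum_geometric_le[of \<kappa> n] by (intro mult_right_mono sum_nonneg) (auto simp: w_def less_imp_le)
    finally have 1: "(\<Sum>i=\<kappa>..n. FF i t)\<^sup>2 \<le> 1 / (1 - \<rho>) * (\<Sum>i=\<kappa>..n. (FF i t)\<^sup>2 / w i)" .
    have "(davg j (\<lambda>t. G t - v \<kappa> t) (dind j t))\<^sup>2 \<le> (C2 * (\<Sum>i=\<kappa>..n. FF i t))\<^sup>2"
      using davg_error[OF t n] unfolding j by (simp add: abs_le_square_iff[symmetric])
    also have "\<dots> = C2\<^sup>2 * (\<Sum>i=\<kappa>..n. FF i t)\<^sup>2" by (rule power_mult_distrib)
    also have "\<dots> \<le> C2\<^sup>2 * (1 / (1 - \<rho>) * (\<Sum>i=\<kappa>..n. (FF i t)\<^sup>2 / w i))"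
      by (intro mult_left_mono 1) auto
    also have "\<dots> = (\<Sum>i=\<kappa>..n. C2\<^sup>2 / (1 - \<rho>) / w i * (FF i t)\<^sup>2)"
      by (simp add: sum_distrib_left)
    finally show ?thesis .
  qed
  have coef: "C2\<^sup>2 / (1 - \<rho>) / w i \<ge> 0" for i using \<rho> w[of i] by simp
  have FFi: "(\<integral>\<^sup>+t\<in>{0..<1}. ennreal ((FF i t)\<^sup>2) \<partial>lborel) \<le> ennreal ((M * A * \<rho> ^ i)\<^sup>2)" for i
  proof -
    have "(\<integral>\<^sup>+t\<in>{0..<1}. ennreal ((FF i t)\<^sup>2) \<partial>lborel) = (\<Sum>c<2 ^ i. ennreal ((F i c)\<^sup>2) * ennreal (1 / 2 ^ i))"
      unfolding FF_def by (rule nn_integral_step)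
    also have "\<dots> = ennreal (\<Sum>c<2 ^ i. (F i c)\<^sup>2 * (1 / 2 ^ i))"
      by (subst sum_ennreal[symmetric]) (auto simp flip: ennreal_mult)
    also have "\<dots> \<le> ennreal ((M * A * \<rho> ^ i)\<^sup>2)" by (intro ennreal_leI F_sq)
    finally show ?thesis .
  qed
  have [measurable]: "FF i \<in> borel_measurable borel" for i unfolding FF_def by measurable
  have "(\<integral>\<^sup>+t\<in>{0..<1}. ennreal ((davg j (\<lambda>t. G t - v \<kappa> t) (dind j t))\<^sup>2) \<partial>lborel) \<le>
      (\<integral>\<^sup>+t. (\<Sum>i=\<kappa>..n. ennreal (C2\<^sup>2 / (1 - \<rho>) / w i) * (ennreal ((FF i t)\<^sup>2) * indicator {0..<1} t)) \<partial>lborel)"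
  proof (rule nn_integral_mono)
    fix t :: real
    show "ennreal ((davg j (\<lambda>t. G t - v \<kappa> t) (dind j t))\<^sup>2) * indicator {0..<1} t \<le>
        (\<Sum>i=\<kappa>..n. ennreal (C2\<^sup>2 / (1 - \<rho>) / w i) * (ennreal ((FF i t)\<^sup>2) * indicator {0..<1} t))"
    proof (cases "t \<in> {0..<1}")
      case True
      have "ennreal ((davg j (\<lambda>t. G t - v \<kappa> t) (dind j t))\<^sup>2) \<le> ennreal (\<Sum>i=\<kappa>..n. C2\<^sup>2 / (1 - \<rho>) / w i * (FF i t)\<^sup>2)"
        by (intro ennreal_leI ptw True)
      also have "\<dots> = (\<Sum>i=\<kappa>..n. ennreal (C2\<^sup>2 / (1 - \<rho>) / w i * (FF i t)\<^sup>2))"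
        by (rule sum_ennreal[symmetric]) (intro mult_nonneg_nonneg coef zero_le_power2)
      also have "\<dots> = (\<Sum>i=\<kappa>..n. ennreal (C2\<^sup>2 / (1 - \<rho>) / w i) * ennreal ((FF i t)\<^sup>2))"
        by (intro sum.cong refl ennreal_mult coef) auto
      finally show ?thesis using True by simp
    qed simp
  qed
  also have "\<dots> = (\<Sum>i=\<kappa>..n. ennreal (C2\<^sup>2 / (1 - \<rho>) / w i) * (\<integral>\<^sup>+t\<in>{0..<1}. ennreal ((FF i t)\<^sup>2) \<partial>lborel))"
    by (subst nn_integral_sum, measurable) (intro sum.cong refl nn_integral_cmult, measurable)
  also have "\<dots> \<le> (\<Sum>i=\<kappa>..n. ennreal (C2\<^sup>2 / (1 - \<rho>) / w i) * ennreal ((M * A * \<rho> ^ i)\<^sup>2))"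
    by (intro sum_mono mult_left_mono FFi) auto
  also have "\<dots> = (\<Sum>i=\<kappa>..n. ennreal (C2\<^sup>2 / (1 - \<rho>) * (M * A)\<^sup>2 * (\<rho> ^ \<kappa>)\<^sup>2 * w i))"
  proof (intro sum.cong refl)
    fix i assume i: "i \<in> {\<kappa>..n}"
    have "\<rho> ^ i = \<rho> ^ \<kappa> * w i" using i by (simp add: w_def flip: power_add)
    then have "C2\<^sup>2 / (1 - \<rho>) / w i * (M * A * \<rho> ^ i)\<^sup>2 = C2\<^sup>2 / (1 - \<rho>) * (M * A)\<^sup>2 * (\<rho> ^ \<kappa>)\<^sup>2 * w i"
      using w[of i] by (simp add: power2_eq_square)
    then show "ennreal (C2\<^sup>2 / (1 - \<rho>) / w i) * ennreal ((M * A * \<rho> ^ i)\<^sup>2) = ennreal (C2\<^sup>2 / (1 - \<rho>) * (M * A)\<^sup>2 * (\<rho> ^ \<kappa>)\<^sup>2 * w i)"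
      using coef by (simp flip: ennreal_mult)
  qed
  also have "\<dots> = ennreal (\<Sum>i=\<kappa>..n. C2\<^sup>2 / (1 - \<rho>) * (M * A)\<^sup>2 * (\<rho> ^ \<kappa>)\<^sup>2 * w i)"
    using \<rho> w by (intro sum_ennreal) (auto intro!: mult_nonneg_nonneg simp: less_imp_le)
  also have "\<dots> \<le> ennreal ((C3 * \<rho> ^ \<kappa>)\<^sup>2)"
  proof (rule ennreal_leI)
    have "(\<Sum>i=\<kappa>..n. C2\<^sup>2 / (1 - \<rho>) * (M * A)\<^sup>2 * (\<rho> ^ \<kappa>)\<^sup>2 * w i) =
        C2\<^sup>2 / (1 - \<rho>) * (M * A)\<^sup>2 * (\<rho> ^ \<kappa>)\<^sup>2 * (\<Sum>i=\<kappa>..n. w i)"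
      by (simp add: sum_distrib_left)
    also have "\<dots> \<le> C2\<^sup>2 / (1 - \<rho>) * (M * A)\<^sup>2 * (\<rho> ^ \<kappa>)\<^sup>2 * (1 / (1 - \<rho>))"
      using \<rho> sum_geometric_le[of \<kappa> n] by (intro mult_left_mono) (auto simp: w_def intro!: mult_nonneg_nonneg divide_nonneg_nonneg)
    also have "\<dots> = (C3 * \<rho> ^ \<kappa>)\<^sup>2"
      by (simp add: C3_def power_mult_distrib power_divide power2_eq_square[of "1 - \<rho>"])
    finally show "(\<Sum>i=\<kappa>..n. C2\<^sup>2 / (1 - \<rho>) * (M * A)\<^sup>2 * (\<rho> ^ \<kappa>)\<^sup>2 * w i) \<le> (C3 * \<rho> ^ \<kappa>)\<^sup>2" .
  qed
  finally show "(\<integral>\<^sup>+t\<in>{0..<1}. ennreal ((davg j (\<lambda>t. G t - v \<kappa> t) (dind j t))\<^sup>2) \<partial>lborel) \<le> ennreal ((C3 * \<rho> ^ \<kappa>)\<^sup>2)" .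
qed

end

theorem jackson_ppoly:
  fixes G :: "real \<Rightarrow> real" and k :: nat and A \<gamma> :: real
  assumes "G \<in> borel_measurable borel" "set_integrable lborel {0..1} G" "k \<ge> 1" "A \<ge> 0" "\<gamma> > 0"
    and "\<And>s::real. s > 0 \<Longrightarrow> k * s \<le> 1 \<Longrightarrow>
      (\<integral>\<^sup>+t\<in>{0..1 - k * s}. ennreal ((fwd_diff k s G t)\<^sup>2) \<partial>lborel) \<le> ennreal ((A * s powr \<gamma>)\<^sup>2)"
  shows "\<exists>C. \<forall>\<kappa>. \<exists>v\<in>ppoly_space k (2 ^ \<kappa>).
    (\<integral>\<^sup>+t\<in>{0..<1}. ennreal ((G t - v t)\<^sup>2) \<partial>lborel) \<le> ennreal (C * (2 ^ \<kappa>) powr (- 2 * \<gamma>))"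
proof -
  have "real (4 * k) < 2 ^ (4 * k)" by (metis of_nat_less_iff of_nat_numeral of_nat_power less_exp)
  then have "4 * k \<le> 2 ^ (4 * k)" using less_exp[of "4 * k"] by linarith
  then interpret jackson G k "4 * k" A \<gamma> by unfold_locales (use assms in auto)
  have "(C3 * \<rho> ^ \<kappa>)\<^sup>2 = C3\<^sup>2 * (2 ^ \<kappa>) powr (- 2 * \<gamma>)" for \<kappa>
  proof -
    have "\<rho> ^ \<kappa> = (2 ^ \<kappa>) powr (- \<gamma>)"
      using powr_half_power[of \<kappa> \<gamma>] by (simp add: \<rho>_def powr_minus powr_divide divide_simps)
    then show ?thesis by (simp add: power_mult_distrib power2_eq_square flip: powr_add)
  qed
  then show ?thesis using approx v_ppoly by (intro exI[of _ "C3\<^sup>2"]) metis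
qed

section \<open>Noise against a finite-dimensional space\<close>

definition ip :: "nat \<Rightarrow> (nat \<Rightarrow> real) \<Rightarrow> (nat \<Rightarrow> real) \<Rightarrow> real" where
  "ip n x y = (\<Sum>i<n. x i * y i)"

lemma ip_commute: "ip n x y = ip n y x" by (simp add: ip_def mult.commute)

lemma ip_self_nonneg: "ip n x x \<ge> 0" by (simp add: ip_def sum_nonneg)

lemma ip_self_eq_0: "ip n x x = 0 \<Longrightarrow> i < n \<Longrightarrow> x i = 0"
  unfolding ip_def by (subst (asm) sum_nonneg_eq_0_iff) auto

lemma ip_sum_left: "ip n (\<lambda>i. \<Sum>m\<in>L. c m * e m i) y = (\<Sum>m\<in>L. c m * ip n (e m) y)"
proof -
  have "ip n (\<lambda>i. \<Sum>m\<in>L. c m * e m i) y = (\<Sum>i<n. \<Sum>m\<in>L. c m * (e m i * y i))"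
    by (simp add: ip_def sum_distrib_right mult.assoc)
  also have "\<dots> = (\<Sum>m\<in>L. c m * ip n (e m) y)"
    by (subst sum.swap) (simp add: ip_def sum_distrib_left)
  finally show ?thesis .
qed

lemma ip_cong: "(\<And>i. i < n \<Longrightarrow> x i = x' i) \<Longrightarrow> (\<And>i. i < n \<Longrightarrow> y i = y' i) \<Longrightarrow> ip n x y = ip n x' y'"
  unfolding ip_def by (intro sum.cong) auto

lemma ip_add_left: "ip n (\<lambda>i. x i + y i) z = ip n x z + ip n y z"
  by (simp add: ip_def sum.distrib distrib_right)

lemma ip_diff_left: "ip n (\<lambda>i. x i - y i) z = ip n x z - ip n y z"
  by (simp add: ip_def sum_subtractf left_diff_distrib)

lemma ip_divide_left: "ip n (\<lambda>i. x i / c) z = ip n x z / c"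
  by (simp add: ip_def sum_divide_distrib)

text \<open>The Gram-Schmidt vectors are allowed to vanish, so that no rank assumption is needed; they
  depend measurably on a parameter.\<close>

lemma gram_schmidt_measurable:
  fixes b :: "'l \<Rightarrow> 'w \<Rightarrow> nat \<Rightarrow> real"
  assumes "finite L" "\<And>l i. l \<in> L \<Longrightarrow> i < n \<Longrightarrow> (\<lambda>\<omega>. b l \<omega> i) \<in> borel_measurable Ms"
  shows "\<exists>e. (\<forall>l\<in>L. \<forall>i<n. (\<lambda>\<omega>. e l \<omega> i) \<in> borel_measurable Ms) \<and>
    (\<forall>\<omega>. (\<forall>l\<in>L. \<forall>l'\<in>L. l \<noteq> l' \<longrightarrow> ip n (e l \<omega>) (e l' \<omega>) = 0) \<and>
         (\<forall>l\<in>L. ip n (e l \<omega>) (e l \<omega>) = 0 \<or> ip n (e l \<omega>) (e l \<omega>) = 1) \<and>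
         (\<forall>l\<in>L. \<forall>i<n. b l \<omega> i = (\<Sum>m\<in>L. ip n (b l \<omega>) (e m \<omega>) * e m \<omega> i)))"
  using assms
proof (induction L rule: finite_induct)
  case empty
  then show ?case by auto
next
  case (insert a L)
  have "\<And>l i. l \<in> L \<Longrightarrow> i < n \<Longrightarrow> (\<lambda>\<omega>. b l \<omega> i) \<in> borel_measurable Ms" using insert.prems by simp
  from insert.IH[OF this] obtain e where e: "(\<forall>l\<in>L. \<forall>i<n. (\<lambda>\<omega>. e l \<omega> i) \<in> borel_measurable Ms) \<and>
    (\<forall>\<omega>. (\<forall>l\<in>L. \<forall>l'\<in>L. l \<noteq> l' \<longrightarrow> ip n (e l \<omega>) (e l' \<omega>) = 0) \<and>
         (\<forall>l\<in>L. ip n (e l \<omega>) (e l \<omega>) = 0 \<or> ip n (e l \<omega>) (e l \<omega>) = 1) \<and>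
         (\<forall>l\<in>L. \<forall>i<n. b l \<omega> i = (\<Sum>m\<in>L. ip n (b l \<omega>) (e m \<omega>) * e m \<omega> i)))" ..
  have em: "\<And>l i. l \<in> L \<Longrightarrow> i < n \<Longrightarrow> (\<lambda>\<omega>. e l \<omega> i) \<in> borel_measurable Ms"
    and orth: "\<And>\<omega> l l'. l \<in> L \<Longrightarrow> l' \<in> L \<Longrightarrow> l \<noteq> l' \<Longrightarrow> ip n (e l \<omega>) (e l' \<omega>) = 0"
    and norm: "\<And>\<omega> l. l \<in> L \<Longrightarrow> ip n (e l \<omega>) (e l \<omega>) = 0 \<or> ip n (e l \<omega>) (e l \<omega>) = 1"
    using e by blast+
  have repr: "\<And>\<omega> l i. l \<in> L \<Longrightarrow> i < n \<Longrightarrow> b l \<omega> i = (\<Sum>m\<in>L. ip n (b l \<omega>) (e m \<omega>) * e m \<omega> i)"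
    using e by simp
  define u where "u = (\<lambda>\<omega> i. b a \<omega> i - (\<Sum>m\<in>L. ip n (b a \<omega>) (e m \<omega>) * e m \<omega> i))"
  \<comment> \<open>For \<open>u = 0\<close> the quotient is 0, so a dependent vector contributes a
    zero vector to the frame.\<close>
  define ea where "ea = (\<lambda>\<omega> i. u \<omega> i / sqrt (ip n (u \<omega>) (u \<omega>)))"
  define e' where "e' = e(a := ea)"
  have e'L: "e' l = e l" if "l \<in> L" for l using that insert.hyps by (auto simp: e'_def)
  have e'a: "e' a = ea" by (simp add: e'_def)
  have ipm: "(\<lambda>\<omega>. ip n (x \<omega>) (y \<omega>)) \<in> borel_measurable Ms"
    if "\<And>i. i < n \<Longrightarrow> (\<lambda>\<omega>. x \<omega> i) \<in> borel_measurable Ms" "\<And>i. i < n \<Longrightarrow> (\<lambda>\<omega>. y \<omega> i) \<in> borel_measurable Ms" for x y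
    unfolding ip_def using that by (intro borel_measurable_sum borel_measurable_times) auto
  have um: "(\<lambda>\<omega>. u \<omega> i) \<in> borel_measurable Ms" if "i < n" for i
    unfolding u_def using that insert.prems em
    by (intro borel_measurable_diff borel_measurable_sum borel_measurable_times ipm) auto
  have eam: "(\<lambda>\<omega>. ea \<omega> i) \<in> borel_measurable Ms" if "i < n" for i
    unfolding ea_def using that um
    by (intro borel_measurable_divide measurable_compose[OF ipm borel_measurable_sqrt]) auto
  have ue: "ip n (u \<omega>) (e l \<omega>) = 0" if l: "l \<in> L" for \<omega> l
  proof -
    have "ip n (u \<omega>) (e l \<omega>) = ip n (b a \<omega>) (e l \<omega>) - (\<Sum>m\<in>L. ip n (b a \<omega>) (e m \<omega>) * ip n (e m \<omega>) (e l \<omega>))"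
      unfolding u_def ip_diff_left ip_sum_left ..
    also have "(\<Sum>m\<in>L. ip n (b a \<omega>) (e m \<omega>) * ip n (e m \<omega>) (e l \<omega>)) =
        (\<Sum>m\<in>L. if m = l then ip n (b a \<omega>) (e l \<omega>) * ip n (e l \<omega>) (e l \<omega>) else 0)"
      using orth l by (intro sum.cong) auto
    also have "\<dots> = ip n (b a \<omega>) (e l \<omega>) * ip n (e l \<omega>) (e l \<omega>)" using l insert.hyps by simp
    also have "\<dots> = ip n (b a \<omega>) (e l \<omega>)"
    proof (cases "ip n (e l \<omega>) (e l \<omega>) = 0")
      case True
      then have "ip n (b a \<omega>) (e l \<omega>) = ip n (b a \<omega>) (\<lambda>_. 0)" by (intro ip_cong refl) (rule ip_self_eq_0)
      then show ?thesis by (simp add: ip_def)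
    next
      case False
      then show ?thesis using norm[OF l, of \<omega>] by simp
    qed
    finally show ?thesis by simp
  qed
  have eae: "ip n (ea \<omega>) (e l \<omega>) = 0" if l: "l \<in> L" for \<omega> l
    unfolding ea_def ip_divide_left by (simp add: ue[OF l])
  have eaea: "ip n (ea \<omega>) (ea \<omega>) = 0 \<or> ip n (ea \<omega>) (ea \<omega>) = 1" for \<omega>
  proof -
    have "ip n (ea \<omega>) (ea \<omega>) = ip n (u \<omega>) (u \<omega>) / sqrt (ip n (u \<omega>) (u \<omega>)) / sqrt (ip n (u \<omega>) (u \<omega>))"
      unfolding ea_def ip_divide_left by (subst ip_commute) (simp add: ip_divide_left)
    also have "\<dots> = ip n (u \<omega>) (u \<omega>) / ip n (u \<omega>) (u \<omega>)" using ip_self_nonneg[of n "u \<omega>"] by simp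
    finally show ?thesis by (cases "ip n (u \<omega>) (u \<omega>) = 0") auto
  qed
  have bl_ea: "ip n (b l \<omega>) (ea \<omega>) = 0" if l: "l \<in> L" for \<omega> l
  proof -
    have "ip n (b l \<omega>) (ea \<omega>) = ip n (\<lambda>i. \<Sum>m\<in>L. ip n (b l \<omega>) (e m \<omega>) * e m \<omega> i) (ea \<omega>)"
      by (intro ip_cong refl) (rule repr[OF l])
    also have "\<dots> = 0" unfolding ip_sum_left using eae by (auto simp: ip_commute intro!: sum.neutral)
    finally show ?thesis .
  qed
  have ba_ea: "ip n (b a \<omega>) (ea \<omega>) * ea \<omega> i = u \<omega> i" if i: "i < n" for \<omega> i
  proof -
    have "ip n (b a \<omega>) (ea \<omega>) = ip n (\<lambda>i. u \<omega> i + (\<Sum>m\<in>L. ip n (b a \<omega>) (e m \<omega>) * e m \<omega> i)) (ea \<omega>)"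
      by (intro ip_cong refl) (simp add: u_def)
    also have "\<dots> = ip n (u \<omega>) (ea \<omega>)"
      unfolding ip_add_left ip_sum_left using eae by (auto simp: ip_commute intro!: sum.neutral)
    also have "\<dots> = ip n (u \<omega>) (u \<omega>) / sqrt (ip n (u \<omega>) (u \<omega>))"
      by (subst ip_commute) (simp add: ea_def ip_divide_left)
    finally have "ip n (b a \<omega>) (ea \<omega>) * ea \<omega> i = u \<omega> i * (ip n (u \<omega>) (u \<omega>) / ip n (u \<omega>) (u \<omega>))"
      using ip_self_nonneg[of n "u \<omega>"] by (simp add: ea_def)
    then show ?thesis using ip_self_eq_0[of n "u \<omega>" i] i by (cases "ip n (u \<omega>) (u \<omega>) = 0") auto
  qed
  show ?case
  proof (intro exI[of _ e'] conjI allI ballI impI)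
    fix l i assume "l \<in> insert a L" "i < n"
    then show "(\<lambda>\<omega>. e' l \<omega> i) \<in> borel_measurable Ms" using e'L e'a em eam by (cases "l = a") auto
  next
    fix \<omega> l l' assume "l \<in> insert a L" "l' \<in> insert a L" "l \<noteq> l'"
    then show "ip n (e' l \<omega>) (e' l' \<omega>) = 0"
      using orth[of l l' \<omega>] eae[of l \<omega>] eae[of l' \<omega>] e'L e'a by (auto simp: ip_commute)
  next
    fix \<omega> l assume "l \<in> insert a L"
    then show "ip n (e' l \<omega>) (e' l \<omega>) = 0 \<or> ip n (e' l \<omega>) (e' l \<omega>) = 1"
      using norm[of l \<omega>] eaea[of \<omega>] e'L e'a by auto
  next
    fix \<omega> l i assume l: "l \<in> insert a L" and i: "i < n"
    have "(\<Sum>m\<in>insert a L. ip n (b l \<omega>) (e' m \<omega>) * e' m \<omega> i) =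
      ip n (b l \<omega>) (ea \<omega>) * ea \<omega> i + (\<Sum>m\<in>L. ip n (b l \<omega>) (e m \<omega>) * e m \<omega> i)"
      using insert.hyps e'a e'L by simp
    also have "\<dots> = b l \<omega> i"
      using l i bl_ea[of l \<omega>] repr[of l i \<omega>] ba_ea[of i \<omega>] by (cases "l \<in> L") (auto simp: u_def)
    finally show "b l \<omega> i = (\<Sum>m\<in>insert a L. ip n (b l \<omega>) (e' m \<omega>) * e' m \<omega> i)" ..
  qed
qed

text \<open>Conditionally on \<open>pr\<close> the noise is centred with variance at most
  \<open>C\<close>. Test functions bounded by 1 express this without conditional expectations, and
  they suffice because the coefficients met below are entries of orthonormal or zero vectors. The
  two main instances are X - \<theta>(T) given T and the error given the regressors.\<close>

locale noise = prob_space \<nu> for \<nu> :: "'v measure" +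
  fixes \<epsilon> :: "'v \<Rightarrow> real" and pr :: "'v \<Rightarrow> 'z" and Nz :: "'z measure" and C :: real
  assumes \<epsilon>[measurable]: "\<epsilon> \<in> borel_measurable \<nu>" and \<epsilon>2: "integrable \<nu> (\<lambda>x. (\<epsilon> x)\<^sup>2)"
    and pr[measurable]: "pr \<in> measurable \<nu> Nz"
    and orth: "\<And>\<phi>. \<phi> \<in> borel_measurable Nz \<Longrightarrow> (\<And>z. \<bar>\<phi> z\<bar> \<le> 1) \<Longrightarrow> (\<integral>x. \<epsilon> x * \<phi> (pr x) \<partial>\<nu>) = 0"
    and var: "\<And>\<phi>. \<phi> \<in> borel_measurable Nz \<Longrightarrow> (\<And>z. 0 \<le> \<phi> z \<and> \<phi> z \<le> 1) \<Longrightarrow>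
      (\<integral>x. (\<epsilon> x)\<^sup>2 * \<phi> (pr x) \<partial>\<nu>) \<le> C * (\<integral>x. \<phi> (pr x) \<partial>\<nu>)"
    and C: "C \<ge> 0"
begin

abbreviation "Pn n \<equiv> PiM {..<n::nat} (\<lambda>_. \<nu>)"
abbreviation "Dz n \<omega> \<equiv> (\<lambda>k\<in>{..<n::nat}. pr (\<omega> k))"

lemma Pn_prob: "prob_space (PiM I (\<lambda>_. \<nu>))"
  by (intro prob_space_PiM prob_space_axioms)

lemma component_measurable[measurable]: "i < n \<Longrightarrow> (\<lambda>\<omega>. \<omega> i) \<in> measurable (Pn n) \<nu>"
  by (intro measurable_component_singleton) auto

lemma Dz_measurable[measurable]: "(\<lambda>\<omega>. Dz n \<omega>) \<in> measurable (Pn n) (PiM {..<n} (\<lambda>_. Nz))"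
  by (intro measurable_restrict measurable_compose[OF component_measurable pr]) auto

lemma integrable_component:
  fixes f :: "'v \<Rightarrow> real"
  assumes "integrable \<nu> f" "i < n"
  shows "integrable (Pn n) (\<lambda>\<omega>. f (\<omega> i))" "(\<integral>\<omega>. f (\<omega> i) \<partial>Pn n) = (\<integral>x. f x \<partial>\<nu>)"
proof -
  have d: "distr (Pn n) \<nu> (\<lambda>\<omega>. \<omega> i) = \<nu>"
    using assms(2) by (intro distr_PiM_component prob_space_axioms) auto
  have m: "(\<lambda>\<omega>. \<omega> i) \<in> measurable (Pn n) \<nu>" using assms(2) by (intro measurable_component_singleton) auto
  show "integrable (Pn n) (\<lambda>\<omega>. f (\<omega> i))"
    using integrable_distr_eq[OF m, of f] assms(1) unfolding d by auto
  show "(\<integral>\<omega>. f (\<omega> i) \<partial>Pn n) = (\<integral>x. f x \<partial>\<nu>)"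
    using integral_distr[OF m, of f] assms(1) unfolding d by auto
qed

lemma cross_integrable:
  assumes "i < n" "j < n" and [measurable]: "c \<in> borel_measurable (PiM {..<n::nat} (\<lambda>_. Nz))" and b: "\<And>z. \<bar>c z\<bar> \<le> 1"
  shows "integrable (Pn n) (\<lambda>\<omega>. \<epsilon> (\<omega> i) * \<epsilon> (\<omega> j) * c (Dz n \<omega>))"
proof (rule Bochner_Integration.integrable_bound)
  show "integrable (Pn n) (\<lambda>\<omega>. ((\<epsilon> (\<omega> i))\<^sup>2 + (\<epsilon> (\<omega> j))\<^sup>2) / 2)"
    using integrable_component(1)[OF \<epsilon>2 assms(1)] integrable_component(1)[OF \<epsilon>2 assms(2)] by simp
  show "(\<lambda>\<omega>. \<epsilon> (\<omega> i) * \<epsilon> (\<omega> j) * c (Dz n \<omega>)) \<in> borel_measurable (Pn n)"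
    by (intro borel_measurable_times measurable_compose[OF component_measurable \<epsilon>] measurable_compose[OF Dz_measurable assms(3)] assms(1,2))
  show "AE \<omega> in Pn n. norm (\<epsilon> (\<omega> i) * \<epsilon> (\<omega> j) * c (Dz n \<omega>)) \<le> norm (((\<epsilon> (\<omega> i))\<^sup>2 + (\<epsilon> (\<omega> j))\<^sup>2) / 2)"
  proof (rule AE_I2)
    fix \<omega>
    have "\<bar>\<epsilon> (\<omega> i) * \<epsilon> (\<omega> j) * c (Dz n \<omega>)\<bar> \<le> \<bar>\<epsilon> (\<omega> i) * \<epsilon> (\<omega> j)\<bar> * 1"
      unfolding abs_mult[of _ "c (Dz n \<omega>)"] by (intro mult_left_mono b) auto
    also have "\<dots> \<le> ((\<epsilon> (\<omega> i))\<^sup>2 + (\<epsilon> (\<omega> j))\<^sup>2) / 2"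
    proof -
      have "0 \<le> (\<bar>\<epsilon> (\<omega> i)\<bar> - \<bar>\<epsilon> (\<omega> j)\<bar>)\<^sup>2" by simp
      then show ?thesis by (simp add: power2_diff abs_mult)
    qed
    finally show "norm (\<epsilon> (\<omega> i) * \<epsilon> (\<omega> j) * c (Dz n \<omega>)) \<le> norm (((\<epsilon> (\<omega> i))\<^sup>2 + (\<epsilon> (\<omega> j))\<^sup>2) / 2)" by simp
  qed
qed

lemma split_coordinate:
  fixes f :: "(nat \<Rightarrow> 'v) \<Rightarrow> real"
  assumes "i < n" "integrable (Pn n) f"
  shows "(\<integral>\<omega>. f \<omega> \<partial>Pn n) = (\<integral>x. (\<integral>y. f (x(i:=y)) \<partial>\<nu>) \<partial>PiM ({..<n} - {i}) (\<lambda>_. \<nu>))"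
proof -
  interpret product_sigma_finite "\<lambda>_::nat. \<nu>" by standard
  have e: "insert i ({..<n} - {i}) = {..<n}" using assms(1) by auto
  show ?thesis using product_integral_insert[of "{..<n} - {i}" i f] assms(2) unfolding e by simp
qed

lemma section_measurable:
  assumes x: "x \<in> space (PiM ({..<n} - {i}) (\<lambda>_. \<nu>))" and c[measurable]: "c \<in> borel_measurable (PiM {..<n::nat} (\<lambda>_. Nz))"
  shows "(\<lambda>z. c (\<lambda>k\<in>{..<n}. if k = i then z else pr (x k))) \<in> borel_measurable Nz"
    and "c (Dz n (x(i := y))) = c (\<lambda>k\<in>{..<n}. if k = i then pr y else pr (x k))"
proof -
  have "(\<lambda>z. \<lambda>k\<in>{..<n}. if k = i then z else pr (x k)) \<in> measurable Nz (PiM {..<n::nat} (\<lambda>_. Nz))"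
  proof (rule measurable_restrict)
    fix k assume k: "k \<in> {..<n}"
    show "(\<lambda>z. if k = i then z else pr (x k)) \<in> measurable Nz Nz"
    proof (cases "k = i")
      case False
      then have "x k \<in> space \<nu>" using x k by (auto simp: space_PiM PiE_iff)
      then have "pr (x k) \<in> space Nz" by (rule measurable_space[OF pr])
      then show ?thesis using False by simp
    qed simp
  qed
  then show "(\<lambda>z. c (\<lambda>k\<in>{..<n}. if k = i then z else pr (x k))) \<in> borel_measurable Nz"
    by (rule measurable_compose[OF _ c])
  show "c (Dz n (x(i := y))) = c (\<lambda>k\<in>{..<n}. if k = i then pr y else pr (x k))"
    by (rule arg_cong[where f=c]) (auto simp: fun_eq_iff restrict_def)
qed

text \<open>Coordinate i is integrated first: the other noise factor is then a constant, and
  \<open>c\<close> depends on that coordinate through \<open>pr\<close> alone, so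
  \<open>orth\<close> applies to the section.\<close>

lemma cross_zero:
  assumes i: "i < n" and j: "j < n" and ij: "i \<noteq> j" and c[measurable]: "c \<in> borel_measurable (PiM {..<n::nat} (\<lambda>_. Nz))"
    and b: "\<And>z. \<bar>c z\<bar> \<le> 1"
  shows "(\<integral>\<omega>. \<epsilon> (\<omega> i) * \<epsilon> (\<omega> j) * c (Dz n \<omega>) \<partial>Pn n) = 0"
proof -
  have "(\<integral>\<omega>. \<epsilon> (\<omega> i) * \<epsilon> (\<omega> j) * c (Dz n \<omega>) \<partial>Pn n) =
    (\<integral>x. (\<integral>y. \<epsilon> ((x(i:=y)) i) * \<epsilon> ((x(i:=y)) j) * c (Dz n (x(i:=y))) \<partial>\<nu>) \<partial>PiM ({..<n} - {i}) (\<lambda>_. \<nu>))"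
    by (rule split_coordinate[OF i cross_integrable[OF i j c b]])
  also have "\<dots> = (\<integral>x. 0 \<partial>PiM ({..<n} - {i}) (\<lambda>_. \<nu>))"
  proof (rule Bochner_Integration.integral_cong[OF refl])
    fix x assume x: "x \<in> space (PiM ({..<n} - {i}) (\<lambda>_. \<nu>))"
    let ?\<phi> = "\<lambda>z. c (\<lambda>k\<in>{..<n}. if k = i then z else pr (x k))"
    have "(\<integral>y. \<epsilon> ((x(i:=y)) i) * \<epsilon> ((x(i:=y)) j) * c (Dz n (x(i:=y))) \<partial>\<nu>) = (\<integral>y. \<epsilon> (x j) * (\<epsilon> y * ?\<phi> (pr y)) \<partial>\<nu>)"
    proof (rule Bochner_Integration.integral_cong[OF refl])
      fix y
      show "\<epsilon> ((x(i:=y)) i) * \<epsilon> ((x(i:=y)) j) * c (Dz n (x(i:=y))) = \<epsilon> (x j) * (\<epsilon> y * ?\<phi> (pr y))"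
        using ij by (subst section_measurable(2)[OF x c]) simp
    qed
    also have "\<dots> = \<epsilon> (x j) * (\<integral>y. \<epsilon> y * ?\<phi> (pr y) \<partial>\<nu>)" by simp
    also have "(\<integral>y. \<epsilon> y * ?\<phi> (pr y) \<partial>\<nu>) = 0"
      by (rule orth[OF section_measurable(1)[OF x c] b])
    finally show "(\<integral>y. \<epsilon> ((x(i:=y)) i) * \<epsilon> ((x(i:=y)) j) * c (Dz n (x(i:=y))) \<partial>\<nu>) = 0" by (simp only: mult_zero_right)
  qed
  finally show ?thesis by simp
qed

lemma diag_le:
  assumes i: "i < n" and c[measurable]: "c \<in> borel_measurable (PiM {..<n::nat} (\<lambda>_. Nz))" and b: "\<And>z. 0 \<le> c z \<and> c z \<le> 1"
  shows "(\<integral>\<omega>. \<epsilon> (\<omega> i) * \<epsilon> (\<omega> i) * c (Dz n \<omega>) \<partial>Pn n) \<le> C * (\<integral>\<omega>. c (Dz n \<omega>) \<partial>Pn n)"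
proof -
  interpret Pn: prob_space "Pn n" by (rule Pn_prob)
  have b': "\<bar>c z\<bar> \<le> 1" for z using b[of z] by auto
  have i1: "integrable (Pn n) (\<lambda>\<omega>. \<epsilon> (\<omega> i) * \<epsilon> (\<omega> i) * c (Dz n \<omega>))" by (rule cross_integrable[OF i i c b'])
  have i2: "integrable (Pn n) (\<lambda>\<omega>. C * c (Dz n \<omega>))"
    by (intro integrable_mult_right Pn.integrable_const_bound[where B=1]) (use b' in auto)
  have "(\<integral>\<omega>. C * c (Dz n \<omega>) - \<epsilon> (\<omega> i) * \<epsilon> (\<omega> i) * c (Dz n \<omega>) \<partial>Pn n) =
    (\<integral>x. (\<integral>y. C * c (Dz n (x(i:=y))) - \<epsilon> ((x(i:=y)) i) * \<epsilon> ((x(i:=y)) i) * c (Dz n (x(i:=y))) \<partial>\<nu>) \<partial>PiM ({..<n} - {i}) (\<lambda>_. \<nu>))"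
    by (rule split_coordinate[OF i]) (intro Bochner_Integration.integrable_diff i1 i2)
  also have "\<dots> \<ge> 0"
  proof (rule integral_nonneg_AE, rule AE_I2)
    fix x assume x: "x \<in> space (PiM ({..<n} - {i}) (\<lambda>_. \<nu>))"
    let ?\<phi> = "\<lambda>z. c (\<lambda>k\<in>{..<n}. if k = i then z else pr (x k))"
    note m[measurable] = section_measurable(1)[OF x c]
    have j1: "integrable \<nu> (\<lambda>y. C * ?\<phi> (pr y))"
      by (intro integrable_mult_right integrable_const_bound[where B=1]) (use b' in auto)
    have j2: "integrable \<nu> (\<lambda>y. (\<epsilon> y)\<^sup>2 * ?\<phi> (pr y))"
    proof (rule Bochner_Integration.integrable_bound[OF \<epsilon>2])
      show "AE y in \<nu>. norm ((\<epsilon> y)\<^sup>2 * ?\<phi> (pr y)) \<le> norm ((\<epsilon> y)\<^sup>2)"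
        using b b' by (intro AE_I2) (auto simp: abs_mult intro!: mult_left_le)
    qed measurable
    have "(\<integral>y. C * c (Dz n (x(i:=y))) - \<epsilon> ((x(i:=y)) i) * \<epsilon> ((x(i:=y)) i) * c (Dz n (x(i:=y))) \<partial>\<nu>) =
        (\<integral>y. C * ?\<phi> (pr y) - (\<epsilon> y)\<^sup>2 * ?\<phi> (pr y) \<partial>\<nu>)"
    proof (rule Bochner_Integration.integral_cong[OF refl])
      fix y
      show "C * c (Dz n (x(i:=y))) - \<epsilon> ((x(i:=y)) i) * \<epsilon> ((x(i:=y)) i) * c (Dz n (x(i:=y))) = C * ?\<phi> (pr y) - (\<epsilon> y)\<^sup>2 * ?\<phi> (pr y)"
        unfolding section_measurable(2)[OF x c] by (simp add: power2_eq_square)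
    qed
    also have "\<dots> = C * (\<integral>y. ?\<phi> (pr y) \<partial>\<nu>) - (\<integral>y. (\<epsilon> y)\<^sup>2 * ?\<phi> (pr y) \<partial>\<nu>)"
      using j1 j2 by (simp add: Bochner_Integration.integral_diff)
    also have "\<dots> \<ge> 0" using var[OF m] b by simp
    finally show "0 \<le> (\<integral>y. C * c (Dz n (x(i:=y))) - \<epsilon> ((x(i:=y)) i) * \<epsilon> ((x(i:=y)) i) * c (Dz n (x(i:=y))) \<partial>\<nu>)" .
  qed
  finally show ?thesis using i1 i2 by (simp add: Bochner_Integration.integral_diff)
qed

text \<open>Coefficients that depend on the design only act like constants: off-diagonal terms
  vanish and diagonal terms carry at most the variance \<open>C\<close>.\<close>

lemma quadratic:
  assumes c[measurable]: "\<And>i. i < n \<Longrightarrow> c i \<in> borel_measurable (PiM {..<n::nat} (\<lambda>_. Nz))"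
    and b: "\<And>i z. i < n \<Longrightarrow> \<bar>c i z\<bar> \<le> 1"
  shows "integrable (Pn n) (\<lambda>\<omega>. (\<Sum>i<n. \<epsilon> (\<omega> i) * c i (Dz n \<omega>))\<^sup>2)" (is ?int)
    and "(\<integral>\<omega>. (\<Sum>i<n. \<epsilon> (\<omega> i) * c i (Dz n \<omega>))\<^sup>2 \<partial>Pn n) \<le> C * (\<integral>\<omega>. (\<Sum>i<n. (c i (Dz n \<omega>))\<^sup>2) \<partial>Pn n)" (is ?le)
proof -
  interpret Pn: prob_space "Pn n" by (rule Pn_prob)
  have bb: "\<bar>c i z * c j z\<bar> \<le> 1" if "i < n" "j < n" for i j z
    unfolding abs_mult using mult_mono[OF b[OF that(1)] b[OF that(2)]] by simp
  have cm[measurable]: "(\<lambda>z. c i z * c j z) \<in> borel_measurable (PiM {..<n::nat} (\<lambda>_. Nz))" if "i < n" "j < n" for i j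
    using that by measurable
  have ex: "(\<Sum>i<n. \<epsilon> (\<omega> i) * c i (Dz n \<omega>))\<^sup>2 =
      (\<Sum>i<n. \<Sum>j<n. \<epsilon> (\<omega> i) * \<epsilon> (\<omega> j) * (c i (Dz n \<omega>) * c j (Dz n \<omega>)))" for \<omega>
    by (simp add: power2_eq_square sum_product mult_ac)
  have int: "integrable (Pn n) (\<lambda>\<omega>. \<epsilon> (\<omega> i) * \<epsilon> (\<omega> j) * (c i (Dz n \<omega>) * c j (Dz n \<omega>)))" if "i < n" "j < n" for i j
    using cross_integrable[OF that cm[OF that] bb[OF that]] .
  then show ?int unfolding ex by (intro Bochner_Integration.integrable_sum) auto
  have intc: "integrable (Pn n) (\<lambda>\<omega>. c i (Dz n \<omega>) * c i (Dz n \<omega>))" if "i < n" for i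
    using cm[OF that that] bb[OF that that]
    by (intro Pn.integrable_const_bound[where B=1] measurable_compose[of "\<lambda>\<omega>. Dz n \<omega>" "Pn n" _ "\<lambda>z. c i z * c i z"]) auto
  have "(\<integral>\<omega>. (\<Sum>i<n. \<epsilon> (\<omega> i) * c i (Dz n \<omega>))\<^sup>2 \<partial>Pn n) =
    (\<Sum>i<n. \<Sum>j<n. \<integral>\<omega>. \<epsilon> (\<omega> i) * \<epsilon> (\<omega> j) * (c i (Dz n \<omega>) * c j (Dz n \<omega>)) \<partial>Pn n)"
    unfolding ex using int by (subst Bochner_Integration.integral_sum, force intro!: Bochner_Integration.integrable_sum)
      (intro sum.cong refl Bochner_Integration.integral_sum, auto)
  also have "\<dots> = (\<Sum>i<n. \<Sum>j<n. if j = i then (\<integral>\<omega>. \<epsilon> (\<omega> i) * \<epsilon> (\<omega> i) * (c i (Dz n \<omega>) * c i (Dz n \<omega>)) \<partial>Pn n) else 0)"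
    using cross_zero[OF _ _ _ cm bb] by (intro sum.cong) auto
  also have "\<dots> = (\<Sum>i<n. \<integral>\<omega>. \<epsilon> (\<omega> i) * \<epsilon> (\<omega> i) * (c i (Dz n \<omega>) * c i (Dz n \<omega>)) \<partial>Pn n)" by simp
  also have "\<dots> \<le> (\<Sum>i<n. C * (\<integral>\<omega>. c i (Dz n \<omega>) * c i (Dz n \<omega>) \<partial>Pn n))"
  proof (rule sum_mono)
    fix i assume "i \<in> {..<n}"
    then have i: "i < n" by simp
    show "(\<integral>\<omega>. \<epsilon> (\<omega> i) * \<epsilon> (\<omega> i) * (c i (Dz n \<omega>) * c i (Dz n \<omega>)) \<partial>Pn n) \<le> C * (\<integral>\<omega>. c i (Dz n \<omega>) * c i (Dz n \<omega>) \<partial>Pn n)"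
      using diag_le[OF i cm[OF i i]] bb[OF i i] by (auto simp: abs_le_iff)
  qed
  also have "\<dots> = C * (\<integral>\<omega>. (\<Sum>i<n. (c i (Dz n \<omega>))\<^sup>2) \<partial>Pn n)"
    using intc by (simp add: sum_distrib_left power2_eq_square)
  finally show ?le .
qed

text \<open>\<open>A\<close> is the length of the projection of the noise onto the span of the basis
  functions at the sample points. The orthonormal frame depends on the design only, so every
  component has second moment at most \<open>C\<close>; the supremum over the span is then just
  Cauchy-Schwarz, without any chaining or union bound.\<close>

theorem sup_bound:
  fixes b :: "'l \<Rightarrow> 'z \<Rightarrow> real"
  assumes L: "finite L" and bm[measurable]: "\<And>l. l \<in> L \<Longrightarrow> b l \<in> borel_measurable Nz"
  shows "\<exists>A. A \<in> borel_measurable (Pn n) \<and> (\<forall>\<omega>. A \<omega> \<ge> 0) \<and> integrable (Pn n) (\<lambda>\<omega>. (A \<omega>)\<^sup>2) \<and>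
    (\<integral>\<omega>. (A \<omega>)\<^sup>2 \<partial>Pn n) \<le> C * card L \<and>
    (\<forall>\<omega> \<kappa> w. (\<forall>i<n. w i = (\<Sum>l\<in>L. \<kappa> l * b l (pr (\<omega> i)))) \<longrightarrow>
       \<bar>\<Sum>i<n. \<epsilon> (\<omega> i) * w i\<bar> \<le> A \<omega> * sqrt (\<Sum>i<n. (w i)\<^sup>2))"
proof -
  interpret Pn: prob_space "Pn n" by (rule Pn_prob)
  have "\<exists>e. (\<forall>l\<in>L. \<forall>i<n. (\<lambda>z. e l z i) \<in> borel_measurable (PiM {..<n::nat} (\<lambda>_. Nz))) \<and>
    (\<forall>z. (\<forall>l\<in>L. \<forall>l'\<in>L. l \<noteq> l' \<longrightarrow> ip n (e l z) (e l' z) = 0) \<and>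
         (\<forall>l\<in>L. ip n (e l z) (e l z) = 0 \<or> ip n (e l z) (e l z) = 1) \<and>
         (\<forall>l\<in>L. \<forall>i<n. b l (z i) = (\<Sum>m\<in>L. ip n (\<lambda>i. b l (z i)) (e m z) * e m z i)))"
    by (rule gram_schmidt_measurable[OF L]) measurable
  then obtain e where e: "(\<forall>l\<in>L. \<forall>i<n. (\<lambda>z. e l z i) \<in> borel_measurable (PiM {..<n::nat} (\<lambda>_. Nz))) \<and>
    (\<forall>z. (\<forall>l\<in>L. \<forall>l'\<in>L. l \<noteq> l' \<longrightarrow> ip n (e l z) (e l' z) = 0) \<and>
         (\<forall>l\<in>L. ip n (e l z) (e l z) = 0 \<or> ip n (e l z) (e l z) = 1) \<and>
         (\<forall>l\<in>L. \<forall>i<n. b l (z i) = (\<Sum>m\<in>L. ip n (\<lambda>i. b l (z i)) (e m z) * e m z i)))" ..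
  have em: "\<And>l i. l \<in> L \<Longrightarrow> i < n \<Longrightarrow> (\<lambda>z. e l z i) \<in> borel_measurable (PiM {..<n::nat} (\<lambda>_. Nz))"
    and norm: "\<And>z l. l \<in> L \<Longrightarrow> ip n (e l z) (e l z) = 0 \<or> ip n (e l z) (e l z) = 1"
    using e by blast+
  have repr: "\<And>z l i. l \<in> L \<Longrightarrow> i < n \<Longrightarrow> b l (z i) = (\<Sum>m\<in>L. ip n (\<lambda>i. b l (z i)) (e m z) * e m z i)"
    using e by simp
  have e1: "\<bar>e l z i\<bar> \<le> 1" if "l \<in> L" "i < n" for l z i
  proof -
    have "(e l z i)\<^sup>2 \<le> ip n (e l z) (e l z)"
      unfolding ip_def power2_eq_square using that by (intro member_le_sum[of i "{..<n}" "\<lambda>i. e l z i * e l z i"]) auto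
    then have "(e l z i)\<^sup>2 \<le> 1" using norm[OF that(1), of z] by auto
    then show ?thesis by (simp add: abs_square_le_1)
  qed
  define x where "x l \<omega> = (\<Sum>i<n. \<epsilon> (\<omega> i) * e l (Dz n \<omega>) i)" for l \<omega>
  define A where "A \<omega> = sqrt (\<Sum>l\<in>L. (x l \<omega>)\<^sup>2)" for \<omega>
  have A2: "(A \<omega>)\<^sup>2 = (\<Sum>l\<in>L. (x l \<omega>)\<^sup>2)" for \<omega> unfolding A_def by (simp add: sum_nonneg)
  have xm: "x l \<in> borel_measurable (Pn n)" if "l \<in> L" for l
    unfolding x_def
  proof (intro borel_measurable_sum borel_measurable_times)
    fix i assume i: "i \<in> {..<n}"
    show "(\<lambda>\<omega>. \<epsilon> (\<omega> i)) \<in> borel_measurable (Pn n)" using i by measurable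
    show "(\<lambda>\<omega>. e l (Dz n \<omega>) i) \<in> borel_measurable (Pn n)"
      by (rule measurable_compose[OF _ em]) (use i that in \<open>auto intro!: measurable_restrict\<close>)
  qed
  have Am: "A \<in> borel_measurable (Pn n)" unfolding A_def using xm by (intro measurable_compose[OF _ borel_measurable_sqrt] borel_measurable_sum) auto
  have xint: "integrable (Pn n) (\<lambda>\<omega>. (x l \<omega>)\<^sup>2)" and xle: "(\<integral>\<omega>. (x l \<omega>)\<^sup>2 \<partial>Pn n) \<le> C" if l: "l \<in> L" for l
  proof -
    note q = quadratic[of n "\<lambda>i z. e l z i", OF em[OF l] e1[OF l]]
    show "integrable (Pn n) (\<lambda>\<omega>. (x l \<omega>)\<^sup>2)" unfolding x_def by (rule q(1))
    have "(\<integral>\<omega>. (x l \<omega>)\<^sup>2 \<partial>Pn n) \<le> C * (\<integral>\<omega>. (\<Sum>i<n. (e l (Dz n \<omega>) i)\<^sup>2) \<partial>Pn n)" unfolding x_def by (rule q(2))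
    also have "(\<integral>\<omega>. (\<Sum>i<n. (e l (Dz n \<omega>) i)\<^sup>2) \<partial>Pn n) \<le> (\<integral>\<omega>. 1 \<partial>Pn n)"
    proof (rule integral_mono')
      show "(\<Sum>i<n. (e l (Dz n \<omega>) i)\<^sup>2) \<le> 1" for \<omega>
        using norm[OF l, of "Dz n \<omega>"] by (auto simp: ip_def power2_eq_square)
    qed auto
    finally show "(\<integral>\<omega>. (x l \<omega>)\<^sup>2 \<partial>Pn n) \<le> C" using C Pn.prob_space by (simp add: mult_left_mono)
  qed
  have bound: "\<bar>\<Sum>i<n. \<epsilon> (\<omega> i) * w i\<bar> \<le> A \<omega> * sqrt (\<Sum>i<n. (w i)\<^sup>2)"
    if w: "\<forall>i<n. w i = (\<Sum>l\<in>L. \<kappa> l * b l (pr (\<omega> i)))" for \<omega> \<kappa> w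
  proof -
    let ?z = "Dz n \<omega>"
    define d where "d m = ip n w (e m ?z)" for m
    have rep: "w i = (\<Sum>m\<in>L. d m * e m ?z i)" if i: "i < n" for i
    proof -
      have bz: "b l (pr (\<omega> i)) = (\<Sum>m\<in>L. ip n (\<lambda>i. b l (?z i)) (e m ?z) * e m ?z i)" if "l \<in> L" for l
        using repr[OF that i, of ?z] i by simp
      have "w i = (\<Sum>l\<in>L. \<Sum>m\<in>L. \<kappa> l * (ip n (\<lambda>i. b l (?z i)) (e m ?z) * e m ?z i))"
        using w i bz by (simp add: sum_distrib_left)
      also have "\<dots> = (\<Sum>m\<in>L. (\<Sum>l\<in>L. \<kappa> l * ip n (\<lambda>i. b l (?z i)) (e m ?z)) * e m ?z i)"
        by (subst sum.swap) (simp add: sum_distrib_right mult.assoc)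
      also have "\<dots> = (\<Sum>m\<in>L. d m * e m ?z i)"
      proof (intro sum.cong refl)
        fix m
        have "(\<Sum>l\<in>L. \<kappa> l * ip n (\<lambda>i. b l (?z i)) (e m ?z)) = ip n (\<lambda>i. \<Sum>l\<in>L. \<kappa> l * b l (?z i)) (e m ?z)"
          by (rule ip_sum_left[symmetric])
        also have "\<dots> = d m" unfolding d_def using w by (intro ip_cong) auto
        finally show "(\<Sum>l\<in>L. \<kappa> l * ip n (\<lambda>i. b l (?z i)) (e m ?z)) * e m ?z i = d m * e m ?z i" by simp
      qed
      finally show ?thesis .
    qed
    have "ip n w w = ip n (\<lambda>i. \<Sum>m\<in>L. d m * e m ?z i) w" by (intro ip_cong rep refl)
    also have "\<dots> = (\<Sum>m\<in>L. (d m)\<^sup>2)" unfolding ip_sum_left by (simp add: d_def ip_commute power2_eq_square)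
    finally have d2: "(\<Sum>m\<in>L. (d m)\<^sup>2) = (\<Sum>i<n. (w i)\<^sup>2)" by (simp add: ip_def power2_eq_square)
    have "(\<Sum>i<n. \<epsilon> (\<omega> i) * w i) = ip n w (\<lambda>i. \<epsilon> (\<omega> i))" by (simp add: ip_def mult.commute)
    also have "\<dots> = ip n (\<lambda>i. \<Sum>m\<in>L. d m * e m ?z i) (\<lambda>i. \<epsilon> (\<omega> i))" by (intro ip_cong rep refl)
    also have "\<dots> = (\<Sum>m\<in>L. d m * x m \<omega>)" unfolding ip_sum_left by (simp add: x_def ip_def mult.commute)
    finally have "(\<Sum>i<n. \<epsilon> (\<omega> i) * w i)\<^sup>2 \<le> (\<Sum>m\<in>L. (d m)\<^sup>2) * (\<Sum>m\<in>L. (x m \<omega>)\<^sup>2)"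
      by (simp add: Cauchy_Schwarz_ineq_sum)
    also have "\<dots> = (A \<omega> * sqrt (\<Sum>i<n. (w i)\<^sup>2))\<^sup>2"
      unfolding d2 A2[symmetric] by (simp add: power_mult_distrib sum_nonneg)
    finally show ?thesis by (rule abs_le_square_iff[THEN iffD2, THEN order.trans]) (simp add: A_def sum_nonneg)
  qed
  show ?thesis
  proof (intro exI[of _ A] conjI Am allI impI)
    show "A \<omega> \<ge> 0" for \<omega> by (simp add: A_def sum_nonneg)
    show "integrable (Pn n) (\<lambda>\<omega>. (A \<omega>)\<^sup>2)" unfolding A2 using xint by (intro Bochner_Integration.integrable_sum) auto
    have "(\<integral>\<omega>. (A \<omega>)\<^sup>2 \<partial>Pn n) = (\<Sum>l\<in>L. \<integral>\<omega>. (x l \<omega>)\<^sup>2 \<partial>Pn n)"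
      unfolding A2 using xint by (intro Bochner_Integration.integral_sum) auto
    also have "\<dots> \<le> (\<Sum>l\<in>L. C)" by (intro sum_mono xle)
    finally show "(\<integral>\<omega>. (A \<omega>)\<^sup>2 \<partial>Pn n) \<le> C * card L" by (simp add: mult.commute)
  qed (rule bound)
qed

end

text \<open>The case of a trivial design: for constant \<open>pr\<close> the conditions on the noise
  reduce to mean zero, with \<open>C\<close> the second moment.\<close>

lemma iid_sum_square:
  fixes \<psi> :: "'v \<Rightarrow> real" and n :: nat
  assumes "prob_space \<nu>" "\<psi> \<in> borel_measurable \<nu>" "integrable \<nu> (\<lambda>x. (\<psi> x)\<^sup>2)" "(\<integral>x. \<psi> x \<partial>\<nu>) = 0"
  shows "integrable (PiM {..<n} (\<lambda>_. \<nu>)) (\<lambda>\<omega>. (\<Sum>i<n::nat. \<psi> (\<omega> i))\<^sup>2)"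
    and "(\<integral>\<omega>. (\<Sum>i<n. \<psi> (\<omega> i))\<^sup>2 \<partial>PiM {..<n} (\<lambda>_. \<nu>)) \<le> n * (\<integral>x. (\<psi> x)\<^sup>2 \<partial>\<nu>)"
proof -
  interpret prob_space \<nu> by fact
  interpret noise \<nu> \<psi> "\<lambda>_. ()" "count_space UNIV" "\<integral>x. (\<psi> x)\<^sup>2 \<partial>\<nu>"
    by unfold_locales (use assms in \<open>auto simp: prob_space\<close>)
  interpret Pn: prob_space "Pn n" by (rule Pn_prob)
  note q = quadratic[of n "\<lambda>_ _. 1"]
  show "integrable (PiM {..<n} (\<lambda>_. \<nu>)) (\<lambda>\<omega>. (\<Sum>i<n. \<psi> (\<omega> i))\<^sup>2)" using q(1) by simp
  show "(\<integral>\<omega>. (\<Sum>i<n. \<psi> (\<omega> i))\<^sup>2 \<partial>PiM {..<n} (\<lambda>_. \<nu>)) \<le> n * (\<integral>x. (\<psi> x)\<^sup>2 \<partial>\<nu>)"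
    using q(2) Pn.prob_space by (simp add: mult.commute)
qed

lemma iid_sum_integral:
  fixes \<psi> :: "'v \<Rightarrow> real" and n :: nat
  assumes "prob_space \<nu>" "integrable \<nu> \<psi>"
  shows "integrable (PiM {..<n} (\<lambda>_. \<nu>)) (\<lambda>\<omega>. \<Sum>i<n. \<psi> (\<omega> i))"
    and "(\<integral>\<omega>. (\<Sum>i<n. \<psi> (\<omega> i)) \<partial>PiM {..<n} (\<lambda>_. \<nu>)) = n * (\<integral>x. \<psi> x \<partial>\<nu>)"
proof -
  interpret prob_space \<nu> by fact
  \<comment> \<open>Zero noise; the locale is opened only for its transfer of integrals to the
    product space.\<close>
  interpret noise \<nu> "\<lambda>_. 0" "\<lambda>_. ()" "count_space UNIV" 0
    by unfold_locales auto
  show "integrable (PiM {..<n} (\<lambda>_. \<nu>)) (\<lambda>\<omega>. \<Sum>i<n. \<psi> (\<omega> i))"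
    using integrable_component(1)[OF assms(2)] by (intro Bochner_Integration.integrable_sum) auto
  show "(\<integral>\<omega>. (\<Sum>i<n. \<psi> (\<omega> i)) \<partial>PiM {..<n} (\<lambda>_. \<nu>)) = n * (\<integral>x. \<psi> x \<partial>\<nu>)"
    using integrable_component[OF assms(2)] by (subst Bochner_Integration.integral_sum) auto
qed

section \<open>Piecewise polynomials\<close>

lemma mem_cell_iff:
  assumes "K > 0"
  shows "t \<in> {real c / real K..<(real c + 1) / real K} \<longleftrightarrow> 0 \<le> t \<and> nat \<lfloor>real K * t\<rfloor> = c"
proof (cases "0 \<le> t")
  case True
  then have "nat \<lfloor>real K * t\<rfloor> = c \<longleftrightarrow> \<lfloor>real K * t\<rfloor> = int c" by auto
  also have "\<dots> \<longleftrightarrow> real c \<le> real K * t \<and> real K * t < real c + 1"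
    unfolding floor_eq_iff by simp
  also have "\<dots> \<longleftrightarrow> t \<in> {real c / real K..<(real c + 1) / real K}" using assms by (auto simp: field_simps)
  finally show ?thesis using True by simp
next
  case False
  then have "t < real c / real K" using assms by (smt (verit) divide_nonneg_nonneg of_nat_0_le_iff)
  then show ?thesis using False by simp
qed

lemma nat_floor_less: "K > 0 \<Longrightarrow> t < 1 \<Longrightarrow> nat \<lfloor>real K * t\<rfloor> < K"
proof -
  assume "K > 0" "t < 1"
  then have "real K * t < real K" by simp
  then have "\<lfloor>real K * t\<rfloor> < int K" by (simp add: floor_less_iff)
  then show ?thesis using \<open>K > 0\<close> by (simp add: nat_less_iff)
qed

lemma ppoly_sum_eq:
  assumes K: "K > 0"
  shows "(\<Sum>j=1..K. poly (P j) t * indicator {(real j - 1) / real K ..< real j / real K} t) =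
    (if 0 \<le> t \<and> t < 1 then poly (P (Suc (nat \<lfloor>real K * t\<rfloor>))) t else 0)"
proof -
  have "(\<Sum>j=1..K. poly (P j) t * indicator {(real j - 1) / real K ..< real j / real K} t) =
    (\<Sum>c<K. poly (P (Suc c)) t * indicator {real c / real K ..< (real c + 1) / real K} t)"
    unfolding One_nat_def sum.atLeast1_atMost_eq by (intro sum.cong) (auto simp: add.commute)
  also have "\<dots> = (\<Sum>c<K. if c = nat \<lfloor>real K * t\<rfloor> then (if 0 \<le> t then poly (P (Suc c)) t else 0) else 0)"
    using mem_cell_iff[OF K, of t] by (intro sum.cong) (auto simp: indicator_def simp del: atLeastLessThan_iff)
  also have "\<dots> = (if nat \<lfloor>real K * t\<rfloor> < K \<and> 0 \<le> t then poly (P (Suc (nat \<lfloor>real K * t\<rfloor>))) t else 0)"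
    by (simp add: sum.delta)
  also have "nat \<lfloor>real K * t\<rfloor> < K \<and> 0 \<le> t \<longleftrightarrow> 0 \<le> t \<and> t < 1"
  proof -
    have "t < 1" if "nat \<lfloor>real K * t\<rfloor> < K" "0 \<le> t"
    proof -
      have "\<lfloor>real K * t\<rfloor> < int K" using that by linarith
      then have "real K * t < real K" by (simp add: floor_less_iff)
      then show ?thesis using K by simp
    qed
    then show ?thesis using nat_floor_less[OF K] by auto
  qed
  finally show ?thesis .
qed

text \<open>Trades the sum of indicators for a cell index, so that linear combinations and
  refinements become operations on the family \<open>P\<close>.\<close>

lemma ppoly_iff:
  assumes K: "K > 0"
  shows "v \<in> ppoly_space r K \<longleftrightarrow> (\<exists>P. (\<forall>j<K. degree (P j) \<le> r - 1) \<and>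
    v = (\<lambda>t. if 0 \<le> t \<and> t < 1 then poly (P (nat \<lfloor>real K * t\<rfloor>)) t else 0))"
proof
  assume "v \<in> ppoly_space r K"
  then obtain P where P: "\<forall>j\<in>{1..K}. degree (P j) \<le> r - 1"
    and v: "v = (\<lambda>t. \<Sum>j=1..K. poly (P j) t * indicator {(real j - 1) / real K ..< real j / real K} t)"
    unfolding ppoly_space_def by blast
  show "\<exists>P. (\<forall>j<K. degree (P j) \<le> r - 1) \<and>
    v = (\<lambda>t. if 0 \<le> t \<and> t < 1 then poly (P (nat \<lfloor>real K * t\<rfloor>)) t else 0)"
    using P unfolding v ppoly_sum_eq[OF K] by (intro exI[of _ "\<lambda>c. P (Suc c)"]) auto
next
  assume "\<exists>P. (\<forall>j<K. degree (P j) \<le> r - 1) \<and>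
    v = (\<lambda>t. if 0 \<le> t \<and> t < 1 then poly (P (nat \<lfloor>real K * t\<rfloor>)) t else 0)"
  then obtain P where P: "\<forall>j<K. degree (P j) \<le> r - 1"
    and v: "v = (\<lambda>t. if 0 \<le> t \<and> t < 1 then poly (P (nat \<lfloor>real K * t\<rfloor>)) t else 0)" by blast
  show "v \<in> ppoly_space r K"
    unfolding ppoly_space_def
  proof (intro CollectI exI[of _ "\<lambda>j. P (j - 1)"] conjI ballI)
    show "degree (P (j - 1)) \<le> r - 1" if "j \<in> {1..K}" for j using P that by auto
    show "v = (\<lambda>t. \<Sum>j=1..K. poly (P (j - 1)) t * indicator {(real j - 1) / real K ..< real j / real K} t)"
      unfolding ppoly_sum_eq[OF K] v by (auto simp: fun_eq_iff)
  qed
qed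

lemma ppoly_lincomb:
  assumes K: "K > 0" and "u \<in> ppoly_space r K" "v \<in> ppoly_space r K"
  shows "(\<lambda>t. a * u t + b * v t) \<in> ppoly_space r K"
proof -
  obtain P Q where "\<forall>j<K. degree (P j) \<le> r - 1" "\<forall>j<K. degree (Q j) \<le> r - 1"
    and "u = (\<lambda>t. if 0 \<le> t \<and> t < 1 then poly (P (nat \<lfloor>real K * t\<rfloor>)) t else 0)"
    and "v = (\<lambda>t. if 0 \<le> t \<and> t < 1 then poly (Q (nat \<lfloor>real K * t\<rfloor>)) t else 0)"
    using assms(2,3) unfolding ppoly_iff[OF K] by blast
  then show ?thesis
    unfolding ppoly_iff[OF K]
    by (intro exI[of _ "\<lambda>j. smult a (P j) + smult b (Q j)"])
       (auto simp: fun_eq_iff intro!: degree_add_le order.trans[OF degree_smult_le])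
qed

lemma ppoly_mono_degree: "r \<le> r' \<Longrightarrow> ppoly_space r K \<subseteq> ppoly_space r' K"
  unfolding ppoly_space_def by (force intro: order.trans[OF _ diff_le_mono])

text \<open>Cell \<open>j\<close> of the finer grid lies in cell \<open>j div m\<close> of the
  coarser one. This nesting lets a noise bound on the finest grid serve all grids.\<close>

lemma ppoly_refine:
  assumes K: "K > 0" and m: "m > 0"
  shows "ppoly_space r K \<subseteq> ppoly_space r (K * m)"
proof
  fix v assume "v \<in> ppoly_space r K"
  then obtain P where P: "\<forall>j<K. degree (P j) \<le> r - 1"
    and v: "v = (\<lambda>t. if 0 \<le> t \<and> t < 1 then poly (P (nat \<lfloor>real K * t\<rfloor>)) t else 0)"
    unfolding ppoly_iff[OF K] by blast
  have *: "nat \<lfloor>real K * t\<rfloor> = nat \<lfloor>real (K * m) * t\<rfloor> div m" for t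
  proof -
    have "\<lfloor>real K * t\<rfloor> = \<lfloor>(real (K * m) * t) / real_of_int (int m)\<rfloor>" using m by simp
    also have "\<dots> = \<lfloor>real (K * m) * t\<rfloor> div int m" by (rule floor_divide_real_eq_div) simp
    finally show ?thesis using nat_div_distrib'[of "int m" "\<lfloor>real (K * m) * t\<rfloor>"] by simp
  qed
  show "v \<in> ppoly_space r (K * m)"
    unfolding ppoly_iff[OF mult_pos_pos[OF K m]]
  proof (intro exI[of _ "\<lambda>j. P (j div m)"] conjI allI impI)
    fix j assume "j < K * m"
    then have "j div m < K" using m by (simp add: less_mult_imp_div_less)
    then show "degree (P (j div m)) \<le> r - 1" using P by blast
  next
    show "v = (\<lambda>t. if 0 \<le> t \<and> t < 1 then poly (P (nat \<lfloor>real (K * m) * t\<rfloor> div m)) t else 0)"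
      unfolding v by (rule ext, subst *, rule refl)
  qed
qed

lemma ppoly_measurable: "v \<in> ppoly_space r K \<Longrightarrow> v \<in> borel_measurable borel"
proof -
  assume "v \<in> ppoly_space r K"
  then obtain P where v: "v = (\<lambda>t. \<Sum>j=1..K. poly (P j) t * indicator {(real j - 1) / real K ..< real j / real K} t)"
    unfolding ppoly_space_def by blast
  have [measurable]: "poly p \<in> borel_measurable borel" for p :: "real poly"
    by (intro borel_measurable_continuous_onI continuous_intros)
  show ?thesis unfolding v by measurable
qed

definition ppoly_basis :: "nat \<Rightarrow> nat \<times> nat \<Rightarrow> real \<Rightarrow> real" where
  "ppoly_basis K = (\<lambda>(j, m) t. t ^ m * indicator {(real j - 1) / real K ..< real j / real K} t)"

lemma ppoly_basis_measurable[measurable]: "ppoly_basis K l \<in> borel_measurable borel"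
  unfolding ppoly_basis_def case_prod_unfold by measurable

lemma ppoly_span:
  assumes r: "r \<ge> 1" and "v \<in> ppoly_space r K"
  shows "\<exists>\<kappa>. \<forall>t. v t = (\<Sum>l\<in>{1..K} \<times> {..<r}. \<kappa> l * ppoly_basis K l t)"
proof -
  obtain P where P: "\<forall>j\<in>{1..K}. degree (P j) \<le> r - 1"
    and v: "v = (\<lambda>t. \<Sum>j=1..K. poly (P j) t * indicator {(real j - 1) / real K ..< real j / real K} t)"
    using assms(2) unfolding ppoly_space_def by blast
  have "v t = (\<Sum>l\<in>{1..K} \<times> {..<r}. coeff (P (fst l)) (snd l) * ppoly_basis K l t)" for t
  proof -
    have "v t = (\<Sum>j=1..K. (\<Sum>m<r. coeff (P j) m * t ^ m) * indicator {(real j - 1) / real K ..< real j / real K} t)"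
      unfolding v
    proof (intro sum.cong refl)
      fix j assume "j \<in> {1..K}"
      then have d: "degree (P j) \<le> r - 1" using P by blast
      have "poly (P j) t = (\<Sum>m\<le>r - 1. coeff (P j) m * t ^ m)" 
        unfolding poly_altdef by (rule sum.mono_neutral_left) (use d in \<open>auto simp: coeff_eq_0\<close>)
      also have "{..r - 1} = {..<r}" using r by auto
      finally show "poly (P j) t * indicator {(real j - 1) / real K ..< real j / real K} t =
        (\<Sum>m<r. coeff (P j) m * t ^ m) * indicator {(real j - 1) / real K ..< real j / real K} t" by simp
    qed
    also have "\<dots> = (\<Sum>j=1..K. \<Sum>m<r. coeff (P j) m * ppoly_basis K (j, m) t)"
      by (simp add: ppoly_basis_def sum_distrib_right mult.assoc)
    also have "\<dots> = (\<Sum>(j, m)\<in>{1..K} \<times> {..<r}. coeff (P j) m * ppoly_basis K (j, m) t)"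
      by (rule sum.cartesian_product)
    finally show ?thesis by (simp add: case_prod_unfold)
  qed
  note * = this
  show ?thesis
  proof (rule exI[of _ "\<lambda>l. coeff (P (fst l)) (snd l)"], rule allI)
    fix t
    show "v t = (\<Sum>l\<in>{1..K} \<times> {..<r}. coeff (P (fst l)) (snd l) * ppoly_basis K l t)" by (rule *)
  qed
qed

text \<open>Every second of the 2r equal parts of a cell supplies a sample point, because the first
  of the \<open>m\<close> fine cells in that part is hit. These r points are one part length apart
  and determine the polynomial on the cell, so Lagrange interpolation applies with \<Lambda> =
  2r.\<close>

lemma ppoly_bound_of_points:
  assumes r: "r \<ge> 1" and K: "K > 0" and m: "m > 0" and v: "v \<in> ppoly_space r K"
    and hit: "\<And>g. g < 2 * r * (K * m) \<Longrightarrow> \<exists>i<n. x i \<in> {real g / real (2 * r * (K * m)) ..< (real g + 1) / real (2 * r * (K * m))}"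
    and B: "\<And>i. i < n \<Longrightarrow> \<bar>v (x i)\<bar> \<le> B" and B0: "B \<ge> 0"
  shows "\<bar>v t\<bar> \<le> real r * (2 * real r) ^ r * B"
proof (cases "0 \<le> t \<and> t < 1")
  case False
  then show ?thesis using v B0 unfolding ppoly_iff[OF K] by auto
next
  case True
  obtain P where P: "\<And>j. j < K \<Longrightarrow> degree (P j) \<le> r - 1"
    and ve: "v = (\<lambda>t. if 0 \<le> t \<and> t < 1 then poly (P (nat \<lfloor>real K * t\<rfloor>)) t else 0)"
    using v unfolding ppoly_iff[OF K] by blast
  define c where "c = nat \<lfloor>real K * t\<rfloor>"
  have c: "c < K" unfolding c_def using True K by (intro nat_floor_less) auto
  define s where "s = 1 / (2 * real r * real K)"
  have s: "s > 0" using r K by (simp add: s_def)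
  have K1: "1 / real K = 2 * real r * s" using r K by (simp add: s_def)
  have cell: "\<exists>i<n. real (2 * r * c + 2 * l) * s \<le> x i \<and> x i < (real (2 * r * c + 2 * l) + 1) * s" if l: "l < r" for l
  proof -
    let ?g = "2 * r * c + 2 * l"
    have "?g < 2 * r * (c + 1)" using l by simp
    also have "\<dots> \<le> 2 * r * K" using c by (intro mult_left_mono) auto
    finally have "?g * m < 2 * r * K * m" using m by simp
    then have "?g * m < 2 * r * (K * m)" by (simp add: mult.assoc)
    from hit[OF this] obtain i where i: "i < n"
      and xi: "real (?g * m) / real (2 * r * (K * m)) \<le> x i" "x i < (real (?g * m) + 1) / real (2 * r * (K * m))" by auto
    have "real (?g * m) / real (2 * r * (K * m)) = real ?g * s" using m by (simp add: s_def)
    moreover have "(real (?g * m) + 1) / real (2 * r * (K * m)) \<le> (real ?g + 1) * s"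
    proof -
      have "(real (?g * m) + 1) / real (2 * r * (K * m)) \<le> (real ?g + 1) * real m / real (2 * r * (K * m))"
        using m by (intro divide_right_mono) (auto simp: distrib_right)
      also have "\<dots> = (real ?g + 1) * s" using m by (simp add: s_def)
      finally show ?thesis .
    qed
    ultimately show ?thesis using i xi by (intro exI[of _ i]) auto
  qed
  define pt where "pt l = (SOME i. i < n \<and> real (2 * r * c + 2 * l) * s \<le> x i \<and> x i < (real (2 * r * c + 2 * l) + 1) * s)" for l
  have pt: "pt l < n" "real (2 * r * c + 2 * l) * s \<le> x (pt l)" "x (pt l) < (real (2 * r * c + 2 * l) + 1) * s" if "l < r" for l
    using someI_ex[OF cell[OF that]] unfolding pt_def by auto
  have in_cell: "real c / real K \<le> x (pt l) \<and> x (pt l) < (real c + 1) / real K" if l: "l < r" for l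
  proof
    have "real c / real K = real (2 * r * c) * s" using K r by (simp add: s_def field_simps)
    also have "\<dots> \<le> real (2 * r * c + 2 * l) * s" using s by (intro mult_right_mono) auto
    finally show "real c / real K \<le> x (pt l)" using pt(2)[OF l] by linarith
    have "real (2 * r * c + 2 * l) + 1 \<le> real (2 * r * c + 2 * r)" using l by linarith
    then have "(real (2 * r * c + 2 * l) + 1) * s \<le> real (2 * r * c + 2 * r) * s" using s by (intro mult_right_mono) auto
    also have "\<dots> = (real c + 1) / real K" using K r by (simp add: s_def field_simps)
    finally show "x (pt l) < (real c + 1) / real K" using pt(3)[OF l] by linarith
  qed
  have vpt: "v (x (pt l)) = poly (P c) (x (pt l))" if l: "l < r" for l
  proof -
    have 1: "0 \<le> x (pt l)" "nat \<lfloor>real K * x (pt l)\<rfloor> = c" using mem_cell_iff[OF K, of "x (pt l)" c] in_cell[OF l] by auto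
    have "(real c + 1) / real K \<le> 1" using c K by simp
    then have "x (pt l) < 1" using in_cell[OF l] by linarith
    then show ?thesis using 1 by (simp add: ve)
  qed
  have t_cell: "real c / real K \<le> t \<and> t < (real c + 1) / real K"
    using mem_cell_iff[OF K, of t c] True by (auto simp: c_def)
  have sep: "x (pt l) - x (pt l') \<ge> s" if "l' < l" "l < r" for l l'
  proof -
    have "real (2 * r * c + 2 * l') + 1 + 1 \<le> real (2 * r * c + 2 * l)" using that by linarith
    then have "(real (2 * r * c + 2 * l') + 1 + 1) * s \<le> real (2 * r * c + 2 * l) * s" using s by (intro mult_right_mono) auto
    then have "(real (2 * r * c + 2 * l') + 1) * s + s \<le> real (2 * r * c + 2 * l) * s" by (simp only: distrib_right mult_1)
    then show ?thesis using pt(2)[of l] pt(3)[of l'] that by linarith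
  qed
  have "\<bar>poly (P c) t\<bar> \<le> real r * (2 * real r) ^ r * B"
  proof (rule poly_bound_of_points[where x = "\<lambda>l. x (pt l)" and s = s])
    show "degree (P c) < r" using P[OF c] r by linarith
    show "s \<le> \<bar>x (pt l) - x (pt l')\<bar>" if "l < r" "l' < r" "l \<noteq> l'" for l l'
      using sep[of l l'] sep[of l' l] that by (cases "l < l'") auto
    show "\<bar>t - x (pt l)\<bar> \<le> 2 * real r * s" if "l < r" for l
      using in_cell[OF that] t_cell unfolding K1[symmetric] by (auto simp: add_divide_distrib)
    show "\<bar>poly (P c) (x (pt l))\<bar> \<le> B" if "l < r" for l
      using B[OF pt(1)[OF that]] vpt[OF that] by simp
  qed (use s r in auto)
  then show ?thesis using True by (simp add: ve c_def)
qed

section \<open>Least squares on a good event\<close>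

definition nm :: "nat \<Rightarrow> (nat \<Rightarrow> real) \<Rightarrow> real" where
  "nm n w = sqrt (\<Sum>i<n. (w i)\<^sup>2)"

lemma nm_L2_set: "nm n w = L2_set w {..<n}" by (simp add: nm_def L2_set_def)

lemma nm_nonneg: "nm n w \<ge> 0" by (simp add: nm_def sum_nonneg)

lemma nm_triangle: "nm n (\<lambda>i. u i + w i) \<le> nm n u + nm n w"
  unfolding nm_L2_set by (rule L2_set_triangle_ineq)

lemma nm_sq: "(nm n w)\<^sup>2 = ip n w w" by (simp add: nm_def ip_def sum_nonneg power2_eq_square)

lemma nm_scale: "nm n (\<lambda>i. c * w i) = \<bar>c\<bar> * nm n w"
  by (simp add: nm_def power_mult_distrib sum_distrib_left[symmetric] real_sqrt_mult)

lemma nm_minus: "nm n (\<lambda>i. - w i) = nm n w" by (simp add: nm_def)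

lemma nm_cong: "(\<And>i. i < n \<Longrightarrow> u i = w i) \<Longrightarrow> nm n u = nm n w"
  unfolding nm_def by (auto intro!: arg_cong[where f=sqrt] sum.cong)

lemma nm_sum_le: "finite L \<Longrightarrow> nm n (\<lambda>i. \<Sum>m\<in>L. u m i) \<le> (\<Sum>m\<in>L. nm n (u m))"
proof (induction L rule: finite_induct)
  case empty
  then show ?case by (simp add: nm_def)
next
  case (insert a L)
  then have "nm n (\<lambda>i. \<Sum>m\<in>insert a L. u m i) \<le> nm n (u a) + nm n (\<lambda>i. \<Sum>m\<in>L. u m i)"
    using nm_triangle[of n "u a"] by simp
  then show ?case using insert by simp
qed

lemma ip_le_nm: "\<bar>ip n u w\<bar> \<le> nm n u * nm n w"
proof -
  have "\<bar>ip n u w\<bar> \<le> (\<Sum>i<n. \<bar>u i\<bar> * \<bar>w i\<bar>)"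
    unfolding ip_def by (rule order.trans[OF sum_abs]) (simp add: abs_mult)
  also have "\<dots> \<le> nm n u * nm n w" unfolding nm_L2_set by (rule L2_set_mult_ineq)
  finally show ?thesis .
qed

lemma ip_add_right: "ip n z (\<lambda>i. x i + y i) = ip n z x + ip n z y"
  by (simp add: ip_def sum.distrib distrib_left)

text \<open>Applying \<open>R\<close> turns the perturbed system into an equation for
  \<open>d\<close> whose error contains the l1 size of \<open>d\<close> itself. After summation over
  \<open>I\<close> the factor of that size is at most 1/2 by \<open>small\<close>, so it is
  absorbed; this gives the a priori bound.\<close>

lemma lin_solve:
  fixes G \<Sigma> R :: "'q \<Rightarrow> 'q \<Rightarrow> real" and d s :: "'q \<Rightarrow> real" and n \<zeta> \<kappa> \<rho> Rm :: real
  assumes I: "finite I" and n: "n > 0"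
    and inv: "\<And>k l. k \<in> I \<Longrightarrow> l \<in> I \<Longrightarrow> (\<Sum>j\<in>I. \<Sigma> k j * R j l) = (if k = l then 1 else 0)"
    and Rm: "\<And>l. l \<in> I \<Longrightarrow> (\<Sum>j\<in>I. \<bar>R j l\<bar>) \<le> Rm" and Rm0: "Rm \<ge> 0"
    and eq: "\<And>j. j \<in> I \<Longrightarrow> \<bar>(\<Sum>k\<in>I. d k * G k j) - s j\<bar> \<le> \<rho> + (\<Sum>k\<in>I. \<bar>d k\<bar>) * \<kappa>"
    and G: "\<And>k j. k \<in> I \<Longrightarrow> j \<in> I \<Longrightarrow> \<bar>G k j - n * \<Sigma> k j\<bar> \<le> n * \<zeta>"
    and nn: "\<rho> \<ge> 0" "\<kappa> \<ge> 0" "\<zeta> \<ge> 0"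
    and s: "\<And>j. j \<in> I \<Longrightarrow> \<bar>s j\<bar> \<le> sm" "sm \<ge> 0"
    and small: "Rm * card I * (\<kappa> + n * \<zeta>) / n \<le> 1 / 2"
  shows "l \<in> I \<Longrightarrow> \<bar>d l - (\<Sum>j\<in>I. R j l * s j) / n\<bar> \<le> Rm * (\<rho> + (\<Sum>k\<in>I. \<bar>d k\<bar>) * (\<kappa> + n * \<zeta>)) / n"
    and "(\<Sum>k\<in>I. \<bar>d k\<bar>) \<le> 2 * Rm * card I * (sm + \<rho>) / n"
proof -
  define D where "D = (\<Sum>k\<in>I. \<bar>d k\<bar>)"
  have D0: "D \<ge> 0" by (simp add: D_def sum_nonneg)
  define y where "y j = (\<Sum>k\<in>I. d k * \<Sigma> k j)" for j
  have y: "\<bar>n * y j - s j\<bar> \<le> \<rho> + D * (\<kappa> + n * \<zeta>)" if j: "j \<in> I" for j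
  proof -
    have "n * y j = (\<Sum>k\<in>I. d k * G k j) - (\<Sum>k\<in>I. d k * (G k j - n * \<Sigma> k j))"
      by (simp add: y_def sum_distrib_left sum_subtractf right_diff_distrib algebra_simps)
    moreover have "\<bar>\<Sum>k\<in>I. d k * (G k j - n * \<Sigma> k j)\<bar> \<le> D * (n * \<zeta>)"
      unfolding D_def sum_distrib_right
      by (rule order.trans[OF sum_abs]) (auto simp: abs_mult intro!: sum_mono mult_left_mono G j)
    ultimately show ?thesis using eq[OF j] unfolding D_def[symmetric] distrib_left by linarith
  qed
  have dl: "d l = (\<Sum>j\<in>I. R j l * y j)" if l: "l \<in> I" for l
  proof -
    have "(\<Sum>j\<in>I. R j l * y j) = (\<Sum>j\<in>I. \<Sum>k\<in>I. d k * (\<Sigma> k j * R j l))"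
      by (simp add: y_def sum_distrib_left mult_ac)
    also have "\<dots> = (\<Sum>k\<in>I. d k * (\<Sum>j\<in>I. \<Sigma> k j * R j l))" by (subst sum.swap) (simp add: sum_distrib_left)
    also have "\<dots> = (\<Sum>k\<in>I. if k = l then d k else 0)" using inv l by (intro sum.cong) auto
    finally show ?thesis using l I by simp
  qed
  show main: "\<bar>d l - (\<Sum>j\<in>I. R j l * s j) / n\<bar> \<le> Rm * (\<rho> + (\<Sum>k\<in>I. \<bar>d k\<bar>) * (\<kappa> + n * \<zeta>)) / n" if l: "l \<in> I" for l
  proof -
    have E0: "\<rho> + D * (\<kappa> + n * \<zeta>) \<ge> 0" using nn D0 n by simp
    have "d l - (\<Sum>j\<in>I. R j l * s j) / n = (\<Sum>j\<in>I. R j l * (n * y j - s j)) / n"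
      using n by (simp add: dl[OF l] sum_subtractf right_diff_distrib diff_divide_distrib sum_distrib_left sum_divide_distrib mult_ac)
    also have "\<bar>\<dots>\<bar> \<le> Rm * (\<rho> + D * (\<kappa> + n * \<zeta>)) / n"
    proof -
      have "\<bar>\<Sum>j\<in>I. R j l * (n * y j - s j)\<bar> \<le> (\<Sum>j\<in>I. \<bar>R j l\<bar> * (\<rho> + D * (\<kappa> + n * \<zeta>)))"
        by (rule order.trans[OF sum_abs]) (auto simp: abs_mult intro!: sum_mono mult_left_mono y)
      also have "\<dots> \<le> Rm * (\<rho> + D * (\<kappa> + n * \<zeta>))"
        unfolding sum_distrib_right[symmetric] by (intro mult_right_mono Rm l E0)
      finally show ?thesis using n by (simp add: abs_divide divide_right_mono)
    qed
    finally show ?thesis by (simp add: D_def)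
  qed
  have each: "\<bar>d l\<bar> \<le> Rm * (sm + \<rho>) / n + Rm * (D * (\<kappa> + n * \<zeta>)) / n" if l: "l \<in> I" for l
  proof -
    have "\<bar>\<Sum>j\<in>I. R j l * s j\<bar> \<le> (\<Sum>j\<in>I. \<bar>R j l\<bar> * sm)"
      by (rule order.trans[OF sum_abs]) (auto simp: abs_mult intro!: sum_mono mult_left_mono s)
    also have "\<dots> \<le> Rm * sm" unfolding sum_distrib_right[symmetric] by (intro mult_right_mono Rm l s)
    finally have "\<bar>(\<Sum>j\<in>I. R j l * s j) / n\<bar> \<le> Rm * sm / n" using n by (simp add: abs_divide divide_right_mono)
    then have "\<bar>d l\<bar> \<le> Rm * sm / n + Rm * (\<rho> + D * (\<kappa> + n * \<zeta>)) / n"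
      using main[OF l] unfolding D_def[symmetric] by linarith
    then show ?thesis by (simp add: distrib_left add_divide_distrib)
  qed
  have "D \<le> (\<Sum>l\<in>I. Rm * (sm + \<rho>) / n + Rm * (D * (\<kappa> + n * \<zeta>)) / n)"
    unfolding D_def[of] by (intro sum_mono each[unfolded D_def])
  also have "\<dots> = Rm * card I * (sm + \<rho>) / n + D * (Rm * card I * (\<kappa> + n * \<zeta>) / n)"
    by (simp add: distrib_left algebra_simps)
  also have "\<dots> \<le> Rm * card I * (sm + \<rho>) / n + D * (1 / 2)"
    by (intro add_left_mono mult_left_mono small D0)
  finally show "(\<Sum>k\<in>I. \<bar>d k\<bar>) \<le> 2 * Rm * card I * (sm + \<rho>) / n"
    unfolding D_def[symmetric] by (simp add: field_simps)
qed

text \<open>All randomness is condensed into these inequalities. \<open>V\<close> is the space on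
  the finest grid; \<open>A\<close> and \<open>B\<close> bound the noises X - \<theta>(T) and W
  against it, \<open>p\<close> and \<open>\<tau>\<close> are in-sample approximation errors,
  \<open>z\<close> bounds products of such errors with X - \<theta>(T), \<open>\<zeta>\<close> is
  the error of the Gram matrix and \<open>sm\<close> bounds the leading linear term.\<close>

locale pl_design =
  fixes n :: nat and I :: "'q::finite set" and x :: "nat \<Rightarrow> 'q \<Rightarrow> real" and t W :: "nat \<Rightarrow> real"
    and \<theta> :: "'q \<Rightarrow> real \<Rightarrow> real" and f :: "real \<Rightarrow> real" and V :: "(real \<Rightarrow> real) set"
    and \<phi> :: "'q \<Rightarrow> real \<Rightarrow> real" and f0 :: "real \<Rightarrow> real"
    and \<Sigma> R :: "'q \<Rightarrow> 'q \<Rightarrow> real"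
    and A B B0 p \<tau> z \<zeta> sm Rm :: real
  assumes n: "n > 0"
    and V: "\<And>a b u w. u \<in> V \<Longrightarrow> w \<in> V \<Longrightarrow> (\<lambda>t. a * u t + b * w t) \<in> V"
    and \<phi>: "\<And>j. j \<in> I \<Longrightarrow> \<phi> j \<in> V" and f0: "f0 \<in> V"
    and A: "\<And>j w. j \<in> I \<Longrightarrow> w \<in> V \<Longrightarrow> \<bar>ip n (\<lambda>i. x i j - \<theta> j (t i)) (\<lambda>i. w (t i))\<bar> \<le> A * nm n (\<lambda>i. w (t i))"
    and B: "\<And>c w. w \<in> V \<Longrightarrow> \<bar>ip n W (\<lambda>i. (\<Sum>j\<in>I. c j * x i j) + w (t i))\<bar> \<le> B * nm n (\<lambda>i. (\<Sum>j\<in>I. c j * x i j) + w (t i))"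
    and p: "nm n (\<lambda>i. f0 (t i) - f (t i)) \<le> p"
    and \<tau>N: "\<And>j. j \<in> I \<Longrightarrow> nm n (\<lambda>i. \<theta> j (t i) - \<phi> j (t i)) \<le> \<tau>"
    and z2: "\<And>j. j \<in> I \<Longrightarrow> \<bar>ip n (\<lambda>i. f0 (t i) - f (t i)) (\<lambda>i. x i j - \<theta> j (t i))\<bar> \<le> z"
    and z3: "\<And>j k. j \<in> I \<Longrightarrow> k \<in> I \<Longrightarrow> \<bar>ip n (\<lambda>i. \<theta> k (t i) - \<phi> k (t i)) (\<lambda>i. x i j - \<theta> j (t i))\<bar> \<le> z"
    and G: "\<And>k j. k \<in> I \<Longrightarrow> j \<in> I \<Longrightarrow> \<bar>ip n (\<lambda>i. x i k - \<theta> k (t i)) (\<lambda>i. x i j - \<theta> j (t i)) - real n * \<Sigma> k j\<bar> \<le> real n * \<zeta>"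
    and sm: "\<And>j. j \<in> I \<Longrightarrow> \<bar>ip n W (\<lambda>i. x i j - \<theta> j (t i))\<bar> \<le> sm"
    and B0: "\<And>j i. j \<in> I \<Longrightarrow> i < n \<Longrightarrow> \<bar>x i j - \<theta> j (t i)\<bar> \<le> B0"
    and nn: "A \<ge> 0" "B \<ge> 0" "B0 \<ge> 0" "p \<ge> 0" "\<tau> \<ge> 0" "z \<ge> 0" "\<zeta> \<ge> 0" "sm \<ge> 0" "Rm \<ge> 0"
    and inv: "\<And>k l. k \<in> I \<Longrightarrow> l \<in> I \<Longrightarrow> (\<Sum>j\<in>I. \<Sigma> k j * R j l) = (if k = l then 1 else 0)"
    and Rm: "\<And>l. l \<in> I \<Longrightarrow> (\<Sum>j\<in>I. \<bar>R j l\<bar>) \<le> Rm"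
    and small: "Rm * card I * ((z + A * (B0 * sqrt n + \<tau>)) + n * \<zeta>) / n \<le> 1 / 2"
begin

abbreviation "\<xi> j \<equiv> (\<lambda>i. x i j - \<theta> j (t i))"
abbreviation "h d w \<equiv> (\<lambda>i. (\<Sum>k\<in>I. d k * x i k) + w (t i))"
definition "\<kappa> = z + A * (B0 * sqrt n + \<tau>)"

lemma \<kappa>0: "\<kappa> \<ge> 0" using nn by (simp add: \<kappa>_def)

lemma V_sum: "finite L \<Longrightarrow> (\<And>m. m \<in> L \<Longrightarrow> u m \<in> V) \<Longrightarrow> (\<lambda>t. \<Sum>m\<in>L. c m * u m t) \<in> V"
proof (induction L rule: finite_induct)
  case empty
  then show ?case using V[OF f0 f0, of 0 0] by simp
next
  case (insert a L)
  then show ?case using V[of "u a" "\<lambda>t. \<Sum>m\<in>L. c m * u m t" "c a" 1] by simp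
qed

lemma nm_\<xi>: "j \<in> I \<Longrightarrow> nm n (\<xi> j) \<le> B0 * sqrt n"
proof -
  assume j: "j \<in> I"
  have "(\<Sum>i<n. (\<xi> j i)\<^sup>2) \<le> (\<Sum>i<n. B0\<^sup>2)"
  proof (rule sum_mono)
    fix i assume "i \<in> {..<n}"
    then have "\<bar>\<xi> j i\<bar> \<le> \<bar>B0\<bar>" using B0[OF j, of i] nn by auto
    then show "(\<xi> j i)\<^sup>2 \<le> B0\<^sup>2" by (simp add: abs_le_square_iff)
  qed
  then have "nm n (\<xi> j) \<le> sqrt (real n * B0\<^sup>2)" unfolding nm_def by simp
  then show ?thesis using nn by (simp add: real_sqrt_mult mult.commute)
qed

text \<open>Each x k is split into \<open>\<xi> k\<close>, the approximation error of \<theta> k and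
  an element of \<open>V\<close>. The elements of \<open>V\<close> join \<open>w\<close>, and
  \<open>\<xi> j\<close> is almost orthogonal to \<open>V\<close>. The norm of the combined element
  is recovered from the total by the triangle inequality, which produces the terms with
  \<open>\<kappa>\<close>.\<close>

lemma lin_bound:
  assumes w: "w \<in> V" and j: "j \<in> I"
  shows "\<bar>(\<Sum>k\<in>I. d k * ip n (\<xi> k) (\<xi> j)) - ip n (h d w) (\<xi> j)\<bar> \<le> A * nm n (h d w) + (\<Sum>k\<in>I. \<bar>d k\<bar>) * \<kappa>"
proof -
  let ?D = "\<Sum>k\<in>I. \<bar>d k\<bar>"
  define vv where "vv = (\<lambda>t. 1 * (\<Sum>k\<in>I. d k * \<phi> k t) + 1 * w t)"
  have vv: "vv \<in> V" unfolding vv_def by (intro V V_sum w \<phi>) auto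
  define a where "a i = (\<Sum>k\<in>I. d k * \<xi> k i)" for i
  define c where "c i = (\<Sum>k\<in>I. d k * (\<theta> k (t i) - \<phi> k (t i)))" for i
  have h: "h d w i = (a i + c i) + vv (t i)" for i
  proof -
    have "(\<Sum>k\<in>I. d k * x i k) = a i + c i + (\<Sum>k\<in>I. d k * \<phi> k (t i))"
      unfolding a_def c_def sum.distrib[symmetric] by (intro sum.cong) (auto simp: algebra_simps)
    then show ?thesis by (simp add: vv_def)
  qed
  have na: "nm n a \<le> ?D * (B0 * sqrt n)"
  proof -
    have "nm n a \<le> (\<Sum>k\<in>I. nm n (\<lambda>i. d k * \<xi> k i))" unfolding a_def[abs_def] by (rule nm_sum_le) simp
    also have "\<dots> \<le> (\<Sum>k\<in>I. \<bar>d k\<bar> * (B0 * sqrt n))" unfolding nm_scale by (intro sum_mono mult_left_mono nm_\<xi>) auto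
    finally show ?thesis by (simp add: sum_distrib_right)
  qed
  have nc: "nm n c \<le> ?D * \<tau>"
  proof -
    have "nm n c \<le> (\<Sum>k\<in>I. nm n (\<lambda>i. d k * (\<theta> k (t i) - \<phi> k (t i))))" unfolding c_def[abs_def] by (rule nm_sum_le) simp
    also have "\<dots> \<le> (\<Sum>k\<in>I. \<bar>d k\<bar> * \<tau>)" unfolding nm_scale by (intro sum_mono mult_left_mono \<tau>N) auto
    finally show ?thesis by (simp add: sum_distrib_right)
  qed
  have nvv: "nm n (\<lambda>i. vv (t i)) \<le> nm n (h d w) + ?D * (B0 * sqrt n + \<tau>)"
  proof -
    have "nm n (\<lambda>i. vv (t i)) = nm n (\<lambda>i. h d w i + - (a i + c i))" by (intro nm_cong) (simp add: h)
    also have "\<dots> \<le> nm n (h d w) + nm n (\<lambda>i. - (a i + c i))" by (rule nm_triangle)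
    also have "nm n (\<lambda>i. - (a i + c i)) \<le> nm n a + nm n c" unfolding nm_minus by (rule nm_triangle)
    finally show ?thesis using na nc by (simp add: distrib_left)
  qed
  have ia: "ip n a (\<xi> j) = (\<Sum>k\<in>I. d k * ip n (\<xi> k) (\<xi> j))" unfolding a_def[abs_def] by (rule ip_sum_left)
  have ic: "\<bar>ip n c (\<xi> j)\<bar> \<le> ?D * z"
  proof -
    have "ip n c (\<xi> j) = (\<Sum>k\<in>I. d k * ip n (\<lambda>i. \<theta> k (t i) - \<phi> k (t i)) (\<xi> j))"
      unfolding c_def[abs_def] by (rule ip_sum_left)
    also have "\<bar>\<dots>\<bar> \<le> (\<Sum>k\<in>I. \<bar>d k\<bar> * z)"
      by (rule order.trans[OF sum_abs]) (auto simp: abs_mult intro!: sum_mono mult_left_mono z3 j)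
    finally show ?thesis by (simp add: sum_distrib_right)
  qed
  have "ip n (h d w) (\<xi> j) = ip n (\<lambda>i. (a i + c i) + vv (t i)) (\<xi> j)" by (intro ip_cong) (simp_all add: h)
  also have "\<dots> = ip n a (\<xi> j) + ip n c (\<xi> j) + ip n (\<lambda>i. vv (t i)) (\<xi> j)" by (simp add: ip_add_left)
  finally have e: "(\<Sum>k\<in>I. d k * ip n (\<xi> k) (\<xi> j)) - ip n (h d w) (\<xi> j) = - ip n c (\<xi> j) - ip n (\<xi> j) (\<lambda>i. vv (t i))"
    by (simp add: ia ip_commute[of n "\<lambda>i. vv (t i)"])
  have "\<bar>ip n (\<xi> j) (\<lambda>i. vv (t i))\<bar> \<le> A * nm n (\<lambda>i. vv (t i))" by (rule A[OF j vv])
  also have "\<dots> \<le> A * (nm n (h d w) + ?D * (B0 * sqrt n + \<tau>))" by (intro mult_left_mono nvv nn)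
  finally show ?thesis unfolding e \<kappa>_def using ic by (simp add: algebra_simps)
qed

lemma solve:
  assumes eq: "\<And>j. j \<in> I \<Longrightarrow> \<bar>(\<Sum>k\<in>I. d k * ip n (\<xi> k) (\<xi> j)) - s j\<bar> \<le> \<rho> + (\<Sum>k\<in>I. \<bar>d k\<bar>) * \<kappa>"
    and s: "\<And>j. j \<in> I \<Longrightarrow> \<bar>s j\<bar> \<le> smx" "smx \<ge> 0" and \<rho>: "\<rho> \<ge> 0"
  shows "l \<in> I \<Longrightarrow> \<bar>d l - (\<Sum>j\<in>I. R j l * s j) / n\<bar> \<le> Rm * (\<rho> + (\<Sum>k\<in>I. \<bar>d k\<bar>) * (\<kappa> + n * \<zeta>)) / n"
    and "(\<Sum>k\<in>I. \<bar>d k\<bar>) \<le> 2 * Rm * card I * (smx + \<rho>) / n"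
  using lin_solve[where I=I and n="real n" and \<Sigma>=\<Sigma> and R=R and Rm=Rm and d=d and s=s and \<rho>=\<rho> and \<kappa>=\<kappa> and \<zeta>=\<zeta>
      and G = "\<lambda>k j. ip n (\<xi> k) (\<xi> j)" and sm=smx]
    n inv Rm nn eq G s \<rho> \<kappa>0 small[folded \<kappa>_def] by auto

text \<open>A function vanishing on the sample solves the linear system with zero right-hand side
  and zero error, and the a priori bound for its coefficients is then zero.\<close>

lemma coef_unique:
  assumes w: "w \<in> V" and 0: "\<And>i. i < n \<Longrightarrow> h d w i = 0" and l: "l \<in> I"
  shows "d l = 0"
proof -
  have nm0: "nm n (h d w) = 0" unfolding nm_def using 0 by simp
  have ip0: "ip n (h d w) (\<xi> j) = 0" for j using ip_le_nm[of n "h d w" "\<xi> j"] nm0 by simp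
  have "(\<Sum>k\<in>I. \<bar>d k\<bar>) \<le> 2 * Rm * card I * (0 + 0) / n"
  proof (rule solve(2)[where s = "\<lambda>_. 0"])
    show "\<bar>(\<Sum>k\<in>I. d k * ip n (\<xi> k) (\<xi> j)) - 0\<bar> \<le> 0 + (\<Sum>k\<in>I. \<bar>d k\<bar>) * \<kappa>" if "j \<in> I" for j
      using lin_bound[OF w that, of d] unfolding nm0 ip0 by simp
  qed auto
  then have "(\<Sum>k\<in>I. \<bar>d k\<bar>) = 0" by (simp add: sum_nonneg antisym)
  then show ?thesis using l by (simp add: sum_nonneg_eq_0_iff)
qed

context
  fixes \<beta> a :: "'q \<Rightarrow> real" and v :: "real \<Rightarrow> real" and \<phi>K :: "'q \<Rightarrow> real \<Rightarrow> real" and pn :: real and y :: "nat \<Rightarrow> real"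
  assumes v: "v \<in> V" and y: "\<And>i. i < n \<Longrightarrow> y i = (\<Sum>j\<in>I. \<beta> j * x i j) + f (t i) + W i"
    and pn: "pn \<ge> 0"
    and min: "(\<Sum>i<n. (y i - ((\<Sum>j\<in>I. a j * x i j) + v (t i)))\<^sup>2) \<le>
              (\<Sum>i<n. (y i - ((\<Sum>j\<in>I. \<beta> j * x i j) + f0 (t i)))\<^sup>2) + pn"
begin

abbreviation "er \<equiv> (\<lambda>i. (\<Sum>j\<in>I. (a j - \<beta> j) * x i j) + (v (t i) - f (t i)))"
abbreviation "v' \<equiv> (\<lambda>t. 1 * v t + (- 1) * f0 t)"

lemma v'V: "v' \<in> V" by (intro V v f0)

lemma er_h: "er i = h (\<lambda>j. a j - \<beta> j) v' i + (f0 (t i) - f (t i))" by simp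

text \<open>Basic inequality of penalized least squares against the competitor (\<beta>, f0). The
  product of W with the bias f0 - f occurs on both sides and cancels, so W meets only the difference
  of two elements of the approximating space.\<close>

lemma risk: "nm n er \<le> 2 * B + p + sqrt pn"
proof -
  let ?g = "h (\<lambda>j. a j - \<beta> j) v'" and ?b = "\<lambda>i. f0 (t i) - f (t i)"
  have sq_diff: "(u - w)\<^sup>2 = w * w - 2 * (u * w) + u * u" for u w :: real
    by (simp add: power2_eq_square algebra_simps)
  have 1: "(\<Sum>i<n. (y i - ((\<Sum>j\<in>I. a j * x i j) + v (t i)))\<^sup>2) = ip n er er - 2 * ip n W er + ip n W W"
  proof -
    have "(\<Sum>i<n. (y i - ((\<Sum>j\<in>I. a j * x i j) + v (t i)))\<^sup>2) = (\<Sum>i<n. er i * er i - 2 * (W i * er i) + W i * W i)"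
    proof (intro sum.cong refl)
      fix i assume "i \<in> {..<n}"
      then have q: "y i - ((\<Sum>j\<in>I. a j * x i j) + v (t i)) = W i - er i"
        using y[of i] by (simp add: left_diff_distrib sum_subtractf)
      show "(y i - ((\<Sum>j\<in>I. a j * x i j) + v (t i)))\<^sup>2 = er i * er i - 2 * (W i * er i) + W i * W i"
        unfolding q by (rule sq_diff)
    qed
    then show ?thesis by (simp add: ip_def sum.distrib sum_subtractf sum_distrib_left)
  qed
  have 2: "(\<Sum>i<n. (y i - ((\<Sum>j\<in>I. \<beta> j * x i j) + f0 (t i)))\<^sup>2) = ip n ?b ?b - 2 * ip n W ?b + ip n W W"
  proof -
    have "(\<Sum>i<n. (y i - ((\<Sum>j\<in>I. \<beta> j * x i j) + f0 (t i)))\<^sup>2) = (\<Sum>i<n. ?b i * ?b i - 2 * (W i * ?b i) + W i * W i)"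
      using y by (intro sum.cong refl) (simp add: power2_eq_square algebra_simps)
    then show ?thesis by (simp add: ip_def sum.distrib sum_subtractf sum_distrib_left)
  qed
  have 3: "ip n W er = ip n W ?g + ip n W ?b" unfolding er_h ip_add_right[symmetric] ..
  have g: "nm n ?g \<le> nm n er + p"
  proof -
    have "nm n ?g = nm n (\<lambda>i. er i + - ?b i)" by (intro nm_cong) simp
    also have "\<dots> \<le> nm n er + nm n (\<lambda>i. - ?b i)" by (rule nm_triangle)
    finally show ?thesis using p unfolding nm_minus by linarith
  qed
  have "ip n W ?g \<le> B * nm n ?g" using B[OF v'V, of "\<lambda>j. a j - \<beta> j"] by linarith
  also have "\<dots> \<le> B * (nm n er + p)" by (intro mult_left_mono g nn)
  finally have 4: "ip n W ?g \<le> B * (nm n er + p)" .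
  have b2: "ip n ?b ?b \<le> p\<^sup>2" unfolding nm_sq[symmetric] by (intro power_mono p nm_nonneg)
  let ?e = "nm n er"
  have "?e\<^sup>2 \<le> p\<^sup>2 + 2 * (B * (?e + p)) + pn"
    using min 1 2 3 4 b2 nm_sq[of n er] by linarith
  \<comment> \<open>Completing the square in \<open>?e\<close>.\<close>
  then have "(?e - B)\<^sup>2 \<le> (p + B)\<^sup>2 + pn"
    by (simp add: power2_eq_square algebra_simps)
  also have "\<dots> \<le> (p + B + sqrt pn)\<^sup>2"
  proof -
    have "(p + B + sqrt pn)\<^sup>2 = (p + B)\<^sup>2 + pn + 2 * (p + B) * sqrt pn" using pn by (simp add: power2_sum)
    then show ?thesis using nn pn by simp
  qed
  finally have "\<bar>?e - B\<bar> \<le> \<bar>p + B + sqrt pn\<bar>" by (simp add: abs_le_square_iff)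
  then show ?thesis using nn pn by (auto simp: abs_le_iff abs_of_nonneg)
qed

text \<open>The test function x j - \<phi>K j is \<open>\<xi> j\<close> plus the approximation error
  of \<theta> j. In \<rho>, the two terms z come from W against that error and from f0 - f against
  \<open>\<xi> j\<close>, the term e * \<tau> from the residual of the fit against that error, and A
  * (e + p) from \<open>lin_bound\<close>.\<close>

lemma coef_bound:
  assumes normal: "\<And>j. j \<in> I \<Longrightarrow> ip n (\<lambda>i. y i - ((\<Sum>j\<in>I. a j * x i j) + v (t i))) (\<lambda>i. x i j - \<phi>K j (t i)) = 0"
    and \<tau>K: "\<And>j. j \<in> I \<Longrightarrow> nm n (\<lambda>i. \<theta> j (t i) - \<phi>K j (t i)) \<le> \<tau>"
    and z1: "\<And>j. j \<in> I \<Longrightarrow> \<bar>ip n W (\<lambda>i. \<theta> j (t i) - \<phi>K j (t i))\<bar> \<le> z"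
    and e: "2 * B + p + sqrt pn \<le> e"
  defines "\<rho> \<equiv> 2 * z + e * \<tau> + A * (e + p)"
  shows "l \<in> I \<Longrightarrow> \<bar>(a l - \<beta> l) - (\<Sum>j\<in>I. R j l * ip n W (\<xi> j)) / n\<bar> \<le> Rm * (\<rho> + (\<Sum>k\<in>I. \<bar>a k - \<beta> k\<bar>) * (\<kappa> + n * \<zeta>)) / n"
    and "(\<Sum>k\<in>I. \<bar>a k - \<beta> k\<bar>) \<le> 2 * Rm * card I * (sm + \<rho>) / n"
proof -
  let ?g = "h (\<lambda>j. a j - \<beta> j) v'" and ?b = "\<lambda>i. f0 (t i) - f (t i)"
  have ee: "nm n er \<le> e" using risk e by linarith
  have e0: "e \<ge> 0" using ee nm_nonneg order.trans by blast
  have \<rho>0: "\<rho> \<ge> 0" unfolding \<rho>_def using nn e0 by simp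
  have g: "nm n ?g \<le> e + p"
  proof -
    have "nm n ?g = nm n (\<lambda>i. er i + - ?b i)" by (intro nm_cong) simp
    also have "\<dots> \<le> nm n er + nm n (\<lambda>i. - ?b i)" by (rule nm_triangle)
    finally show ?thesis using p ee unfolding nm_minus by linarith
  qed
  have eq: "\<bar>(\<Sum>k\<in>I. (a k - \<beta> k) * ip n (\<xi> k) (\<xi> j)) - ip n W (\<xi> j)\<bar> \<le> \<rho> + (\<Sum>k\<in>I. \<bar>a k - \<beta> k\<bar>) * \<kappa>" if j: "j \<in> I" for j
  proof -
    let ?q = "\<lambda>i. \<theta> j (t i) - \<phi>K j (t i)"
    have "ip n (\<lambda>i. W i - er i) (\<lambda>i. \<xi> j i + ?q i) = 0"
    proof -
      have "ip n (\<lambda>i. W i - er i) (\<lambda>i. \<xi> j i + ?q i) =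
        ip n (\<lambda>i. y i - ((\<Sum>j\<in>I. a j * x i j) + v (t i))) (\<lambda>i. x i j - \<phi>K j (t i))"
        using y by (intro ip_cong) (simp_all add: left_diff_distrib sum_subtractf)
      then show ?thesis using normal[OF j] by simp
    qed
    then have 1: "ip n W (\<xi> j) + ip n W ?q = ip n er (\<xi> j) + ip n er ?q"
      unfolding ip_diff_left ip_add_right by linarith
    have 2: "ip n er (\<xi> j) = ip n ?g (\<xi> j) + ip n ?b (\<xi> j)"
      unfolding ip_add_left[symmetric] by (intro ip_cong) simp_all
    have 3: "\<bar>ip n er ?q\<bar> \<le> e * \<tau>"
      using ip_le_nm[of n er ?q] mult_mono[OF ee \<tau>K[OF j] e0 nm_nonneg] by linarith
    have 4: "\<bar>(\<Sum>k\<in>I. (a k - \<beta> k) * ip n (\<xi> k) (\<xi> j)) - ip n ?g (\<xi> j)\<bar> \<le> A * nm n ?g + (\<Sum>k\<in>I. \<bar>a k - \<beta> k\<bar>) * \<kappa>"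
      by (rule lin_bound[OF v'V j])
    have 5: "A * nm n ?g \<le> A * (e + p)" by (intro mult_left_mono g nn)
    show ?thesis using 1 2 3 4 5 z1[OF j] z2[OF j] unfolding \<rho>_def by linarith
  qed
  show "l \<in> I \<Longrightarrow> \<bar>(a l - \<beta> l) - (\<Sum>j\<in>I. R j l * ip n W (\<xi> j)) / n\<bar> \<le> Rm * (\<rho> + (\<Sum>k\<in>I. \<bar>a k - \<beta> k\<bar>) * (\<kappa> + n * \<zeta>)) / n"
    by (rule solve(1)[OF eq sm nn(8) \<rho>0])
  show "(\<Sum>k\<in>I. \<bar>a k - \<beta> k\<bar>) \<le> 2 * Rm * card I * (sm + \<rho>) / n"
    by (rule solve(2)[OF eq sm nn(8) \<rho>0])
qed

end

end

section \<open>Lipschitz balls and independence\<close>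

text \<open>Independence within each sequence and between the two sequences factorizes the
  probability of every finite family of rectangles, and rectangles form an intersection-stable
  generator for pairs.\<close>

lemma (in prob_space) pair_indep_vars:
  fixes U :: "nat \<Rightarrow> 'a \<Rightarrow> 'b::second_countable_topology" and W :: "nat \<Rightarrow> 'a \<Rightarrow> 'c::second_countable_topology"
  assumes U: "indep_vars (\<lambda>_. borel) U UNIV" and W: "indep_vars (\<lambda>_. borel) W UNIV"
    and UW: "indep_set
          (sets (vimage_algebra (space M) (\<lambda>\<omega> i. U i \<omega>) (PiM UNIV (\<lambda>_. borel))))
          (sets (vimage_algebra (space M) (\<lambda>\<omega> i. W i \<omega>) (PiM UNIV (\<lambda>_. borel))))"
  shows "indep_vars (\<lambda>_. borel) (\<lambda>i \<omega>. (U i \<omega>, W i \<omega>)) UNIV"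
    and "distr M borel (U i) \<Otimes>\<^sub>M distr M borel (W i) = distr M (borel \<Otimes>\<^sub>M borel) (\<lambda>\<omega>. (U i \<omega>, W i \<omega>))"
proof -
  have Um[measurable]: "U i \<in> borel_measurable M" and Wm[measurable]: "W i \<in> borel_measurable M" for i
    using U W unfolding indep_vars_def by auto
  have alg: "{\<omega>\<in>space M. \<forall>j\<in>J. Z j \<omega> \<in> A j} \<in> sets (vimage_algebra (space M) (\<lambda>\<omega> i. Z i \<omega>) (PiM UNIV (\<lambda>_. borel)))"
    if "finite J" "\<And>j. A j \<in> sets borel" for J :: "nat set" and A :: "nat \<Rightarrow> 'x::topological_space set" and Z :: "nat \<Rightarrow> 'a \<Rightarrow> 'x"
  proof -
    have "{f \<in> space (PiM UNIV (\<lambda>_. borel)). \<forall>j\<in>J. f j \<in> A j} \<in> sets (PiM UNIV (\<lambda>_. borel :: 'x measure))"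
      by (rule sets.sets_Collect_finite_All[OF _ that(1)]) (use that in measurable)
    from in_vimage_algebra[OF this, of "\<lambda>\<omega> i. Z i \<omega>" "space M"]
    show ?thesis by (rule back_subst[of "\<lambda>S. S \<in> _"]) (auto simp: space_PiM)
  qed
  have split: "prob {\<omega>\<in>space M. \<forall>j\<in>J. U j \<omega> \<in> A j \<and> W j \<omega> \<in> B j} =
      (\<Prod>j\<in>J. prob {\<omega>\<in>space M. U j \<omega> \<in> A j}) * (\<Prod>j\<in>J. prob {\<omega>\<in>space M. W j \<omega> \<in> B j})"
    if J: "finite J" "J \<noteq> {}" and A: "\<And>j. A j \<in> sets borel" and B: "\<And>j. B j \<in> sets borel" for J A B
  proof -
    have "prob {\<omega>\<in>space M. \<forall>j\<in>J. U j \<omega> \<in> A j \<and> W j \<omega> \<in> B j} =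
      prob ({\<omega>\<in>space M. \<forall>j\<in>J. U j \<omega> \<in> A j} \<inter> {\<omega>\<in>space M. \<forall>j\<in>J. W j \<omega> \<in> B j})"
      by (intro arg_cong[where f=prob]) auto
    also have "\<dots> = prob {\<omega>\<in>space M. \<forall>j\<in>J. U j \<omega> \<in> A j} * prob {\<omega>\<in>space M. \<forall>j\<in>J. W j \<omega> \<in> B j}"
      by (rule indep_setD[OF UW]) (auto intro!: alg J A B)
    also have "prob {\<omega>\<in>space M. \<forall>j\<in>J. U j \<omega> \<in> A j} = (\<Prod>j\<in>J. prob {\<omega>\<in>space M. U j \<omega> \<in> A j})"
    proof -
      have "{\<omega>\<in>space M. \<forall>j\<in>J. U j \<omega> \<in> A j} = (\<Inter>j\<in>J. U j -` A j \<inter> space M)" using J by auto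
      then show ?thesis using indep_varsD[OF U J(2,1)] A by (simp add: vimage_def Int_def conj_commute)
    qed
    also have "prob {\<omega>\<in>space M. \<forall>j\<in>J. W j \<omega> \<in> B j} = (\<Prod>j\<in>J. prob {\<omega>\<in>space M. W j \<omega> \<in> B j})"
    proof -
      have "{\<omega>\<in>space M. \<forall>j\<in>J. W j \<omega> \<in> B j} = (\<Inter>j\<in>J. W j -` B j \<inter> space M)" using J by auto
      then show ?thesis using indep_varsD[OF W J(2,1)] B by (simp add: vimage_def Int_def conj_commute)
    qed
    finally show ?thesis .
  qed
  define F where "F i = {{\<omega>\<in>space M. U i \<omega> \<in> A \<and> W i \<omega> \<in> B} | A B. A \<in> sets borel \<and> B \<in> sets borel}" for i
  have "indep_sets F UNIV"
  proof (rule indep_setsI)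
    show "F i \<subseteq> events" for i unfolding F_def by auto
  next
    fix S :: "nat \<Rightarrow> 'a set" and J :: "nat set" assume J: "J \<noteq> {}" "finite J" and "\<forall>j\<in>J. S j \<in> F j"
    then have "\<forall>j\<in>J. \<exists>A B. S j = {\<omega>\<in>space M. U j \<omega> \<in> A \<and> W j \<omega> \<in> B} \<and> A \<in> sets borel \<and> B \<in> sets borel"
      unfolding F_def by blast
    from bchoice[OF this] obtain A0 where "\<forall>j\<in>J. \<exists>B. S j = {\<omega>\<in>space M. U j \<omega> \<in> A0 j \<and> W j \<omega> \<in> B} \<and> A0 j \<in> sets borel \<and> B \<in> sets borel" ..
    from bchoice[OF this] obtain B0 where S0: "\<forall>j\<in>J. S j = {\<omega>\<in>space M. U j \<omega> \<in> A0 j \<and> W j \<omega> \<in> B0 j} \<and> A0 j \<in> sets borel \<and> B0 j \<in> sets borel" ..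
    \<comment> \<open>Outside \<open>J\<close> the chosen sets are arbitrary; \<open>UNIV\<close>
      makes them measurable for every index.\<close>
    define A where "A j = (if j \<in> J then A0 j else UNIV)" for j
    define B where "B j = (if j \<in> J then B0 j else UNIV)" for j
    have S: "\<And>j. j \<in> J \<Longrightarrow> S j = {\<omega>\<in>space M. U j \<omega> \<in> A j \<and> W j \<omega> \<in> B j}"
      and A: "\<And>j. A j \<in> sets borel" and B: "\<And>j. B j \<in> sets borel"
      using S0 by (auto simp: A_def B_def)
    have "(\<Inter>j\<in>J. S j) = {\<omega>\<in>space M. \<forall>j\<in>J. U j \<omega> \<in> A j \<and> W j \<omega> \<in> B j}" using S J by auto
    then have "prob (\<Inter>j\<in>J. S j) = (\<Prod>j\<in>J. prob {\<omega>\<in>space M. U j \<omega> \<in> A j} * prob {\<omega>\<in>space M. W j \<omega> \<in> B j})"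
      using split[OF J(2,1) A B] by (simp add: prod.distrib)
    also have "\<dots> = (\<Prod>j\<in>J. prob (S j))"
    proof (intro prod.cong refl)
      fix j assume j: "j \<in> J"
      show "prob {\<omega>\<in>space M. U j \<omega> \<in> A j} * prob {\<omega>\<in>space M. W j \<omega> \<in> B j} = prob (S j)"
        using split[of "{j}" A B] A B S[OF j] by simp
    qed
    finally show "prob (\<Inter>j\<in>J. S j) = (\<Prod>j\<in>J. prob (S j))" .
  qed
  then have ind: "indep_sets (\<lambda>i. sigma_sets (space M) (F i)) UNIV"
  proof (rule indep_sets_sigma)
    fix i show "Int_stable (F i)"
    proof (rule Int_stableI)
      fix a b assume "a \<in> F i" "b \<in> F i"
      then obtain A B A' B' where "a = {\<omega>\<in>space M. U i \<omega> \<in> A \<and> W i \<omega> \<in> B}" "b = {\<omega>\<in>space M. U i \<omega> \<in> A' \<and> W i \<omega> \<in> B'}"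
        "A \<in> sets borel" "B \<in> sets borel" "A' \<in> sets borel" "B' \<in> sets borel" unfolding F_def by blast
      then show "a \<inter> b \<in> F i" unfolding F_def
        by (intro CollectI exI[of _ "A \<inter> A'"] exI[of _ "B \<inter> B'"]) auto
    qed
  qed
  show "indep_vars (\<lambda>_. borel) (\<lambda>i \<omega>. (U i \<omega>, W i \<omega>)) UNIV"
    unfolding indep_vars_def2
  proof (intro conjI ballI)
    show "(\<lambda>\<omega>. (U i \<omega>, W i \<omega>)) \<in> borel_measurable M" for i by measurable
    show "indep_sets (\<lambda>i. {(\<lambda>\<omega>. (U i \<omega>, W i \<omega>)) -` A \<inter> space M |A. A \<in> sets borel}) UNIV"
    proof (rule indep_sets_mono_sets[OF ind])
      fix i
      have "(\<lambda>\<omega>. (U i \<omega>, W i \<omega>)) \<in> measurable (sigma (space M) (F i)) (borel \<Otimes>\<^sub>M borel)"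
      proof (rule measurable_pair)
        have F: "F i \<subseteq> Pow (space M)" by (auto simp: F_def)
        show "fst \<circ> (\<lambda>\<omega>. (U i \<omega>, W i \<omega>)) \<in> borel_measurable (sigma (space M) (F i))"
        proof (rule measurableI)
          fix A :: "'b set" assume "A \<in> sets borel"
          then have "(fst \<circ> (\<lambda>\<omega>. (U i \<omega>, W i \<omega>))) -` A \<inter> space M \<in> F i"
            unfolding F_def by (intro CollectI exI[of _ A] exI[of _ UNIV]) auto
          then show "(fst \<circ> (\<lambda>\<omega>. (U i \<omega>, W i \<omega>))) -` A \<inter> space (sigma (space M) (F i)) \<in> sets (sigma (space M) (F i))"
            using F by simp
        qed simp
        show "snd \<circ> (\<lambda>\<omega>. (U i \<omega>, W i \<omega>)) \<in> borel_measurable (sigma (space M) (F i))"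
        proof (rule measurableI)
          fix A :: "'c set" assume "A \<in> sets borel"
          then have "(snd \<circ> (\<lambda>\<omega>. (U i \<omega>, W i \<omega>))) -` A \<inter> space M \<in> F i"
            unfolding F_def by (intro CollectI exI[of _ UNIV] exI[of _ A]) auto
          then show "(snd \<circ> (\<lambda>\<omega>. (U i \<omega>, W i \<omega>))) -` A \<inter> space (sigma (space M) (F i)) \<in> sets (sigma (space M) (F i))"
            using F by simp
        qed simp
      qed
      then have m: "(\<lambda>\<omega>. (U i \<omega>, W i \<omega>)) \<in> measurable (sigma (space M) (F i)) borel" by (simp add: borel_prod)
      have F: "F i \<subseteq> Pow (space M)" by (auto simp: F_def)
      show "{(\<lambda>\<omega>. (U i \<omega>, W i \<omega>)) -` A \<inter> space M |A. A \<in> sets borel} \<subseteq> sigma_sets (space M) (F i)"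
        using measurable_sets[OF m] F by (auto simp: sets_measure_of space_measure_of)
    qed
  qed
  show "distr M borel (U i) \<Otimes>\<^sub>M distr M borel (W i) = distr M (borel \<Otimes>\<^sub>M borel) (\<lambda>\<omega>. (U i \<omega>, W i \<omega>))"
  proof -
    interpret DU: prob_space "distr M borel (U i)" by (rule prob_space_distr) simp
    interpret DW: prob_space "distr M borel (W i)" by (rule prob_space_distr) simp
    show ?thesis
    proof (rule pair_measure_eqI[OF DU.sigma_finite_measure_axioms DW.sigma_finite_measure_axioms])
      fix A B assume "A \<in> sets (distr M borel (U i))" "B \<in> sets (distr M borel (W i))"
      then have [measurable]: "A \<in> sets borel" "B \<in> sets borel" by auto
      have "prob {\<omega>\<in>space M. U i \<omega> \<in> A \<and> W i \<omega> \<in> B} = prob {\<omega>\<in>space M. U i \<omega> \<in> A} * prob {\<omega>\<in>space M. W i \<omega> \<in> B}"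
        using split[of "{i}" "\<lambda>_. A" "\<lambda>_. B"] by simp
      then show "emeasure (distr M borel (U i)) A * emeasure (distr M borel (W i)) B =
          emeasure (distr M (borel \<Otimes>\<^sub>M borel) (\<lambda>x. (U i x, W i x))) (A \<times> B)"
        by (simp add: emeasure_distr emeasure_eq_measure vimage_def Int_def conj_commute ennreal_mult[symmetric])
    qed simp
  qed
qed

text \<open>Comparison with Lebesgue measure carries the difference bounds from \<mu>T to
  \<open>lborel\<close>, at the cost of 1 / sqrt c0, and the approximation error back, at the cost
  of c1. The difference bound itself is the choice h = s in the supremum of the seminorm, and
  \<alpha> < r makes its order at most r.\<close>

theorem jackson_Lip_ball:
  fixes \<mu>T :: "real measure" and c0 c1 :: real
  assumes sets[measurable_cong]: "sets \<mu>T = sets borel"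
    and c0: "c0 > 0" and lower: "\<And>\<phi>. \<phi> \<in> borel_measurable borel \<Longrightarrow> ennreal c0 * (\<integral>\<^sup>+t\<in>{0..1}. \<phi> t \<partial>lborel) \<le> (\<integral>\<^sup>+t. \<phi> t \<partial>\<mu>T)"
    and c1: "c1 \<ge> 0" and upper: "\<And>\<phi>. \<phi> \<in> borel_measurable borel \<Longrightarrow> (\<integral>\<^sup>+t. \<phi> t \<partial>\<mu>T) \<le> ennreal c1 * (\<integral>\<^sup>+t\<in>{0..1}. \<phi> t \<partial>lborel)"
    and g: "g \<in> Lip_ball \<mu>T \<alpha> L" and \<alpha>: "0 < \<alpha>" "\<alpha> < real r" and L: "L > 0"
  shows "\<exists>C\<ge>0. \<forall>\<kappa>. \<exists>v\<in>ppoly_space r (2 ^ \<kappa>).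
    (\<integral>\<^sup>+t\<in>{0..1}. ennreal ((g t - v t)\<^sup>2) \<partial>\<mu>T) \<le> ennreal (C * (2 ^ \<kappa>) powr (- 2 * \<alpha>))"
proof -
  \<comment> \<open>Membership in the ball gives measurability of \<open>g\<close> on [0,1] only.
    The cut-off is Borel on the whole line and has the same differences as long as all nodes lie in
    [0,1].\<close>
  define G where "G t = indicator {0..1} t * g t" for t
  define k where "k = nat \<lfloor>\<alpha>\<rfloor> + 1"
  have gm: "g \<in> borel_measurable (restrict_space \<mu>T {0..1})" and gi: "integrable (restrict_space \<mu>T {0..1}) (\<lambda>x. (g x)\<^sup>2)"
    using g unfolding Lip_ball_def Lip_star_def in_L2_def by auto
  have gm': "g \<in> borel_measurable (restrict_space borel {0..1})"
    using gm by (subst measurable_cong_sets[OF sets_restrict_space_cong[OF sets[symmetric]] refl])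
  then have Gm[measurable]: "G \<in> borel_measurable borel"
    using borel_measurable_restrict_space_iff[of "{0..1}" borel g] by (simp add: G_def[abs_def])
  have fin: "(\<integral>\<^sup>+t. ennreal ((G t)\<^sup>2) \<partial>\<mu>T) < \<infinity>"
  proof -
    have "integrable \<mu>T (\<lambda>t. indicator {0..1} t *\<^sub>R (g t)\<^sup>2)"
      using gi by (subst (asm) integrable_restrict_space) (auto simp: sets)
    moreover have "indicator {0..1} t *\<^sub>R (g t)\<^sup>2 = (G t)\<^sup>2" for t by (auto simp: G_def indicator_def)
    ultimately show ?thesis unfolding integrable_iff_bounded by simp
  qed
  have "set_integrable lborel {0..1} G"
  proof -
    have f2: "(\<integral>\<^sup>+t\<in>{0..1}. ennreal ((G t)\<^sup>2) \<partial>lborel) < \<infinity>"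
    proof -
      have "ennreal c0 * (\<integral>\<^sup>+t\<in>{0..1}. ennreal ((G t)\<^sup>2) \<partial>lborel) < \<infinity>"
        by (rule le_less_trans[OF lower fin]) measurable
      then show ?thesis using c0 by (auto simp: ennreal_mult_less_top)
    qed
    have "(\<integral>\<^sup>+t. ennreal (norm (indicator {0..1} t *\<^sub>R G t)) \<partial>lborel) \<le>
        (\<integral>\<^sup>+t. indicator {0..1} t + ennreal ((G t)\<^sup>2) * indicator {0..1} t \<partial>lborel)"
    proof (rule nn_integral_mono)
      fix t :: real
      have "\<bar>G t\<bar> \<le> 1 + (G t)\<^sup>2"
        using sum_power2_ge_zero[of "\<bar>G t\<bar> - 1/2" 0] by (simp add: power2_eq_square algebra_simps)
      then have "ennreal \<bar>G t\<bar> \<le> ennreal (1 + (G t)\<^sup>2)" by (rule ennreal_leI)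
      also have "\<dots> = 1 + ennreal ((G t)\<^sup>2)" by simp
      finally show "ennreal (norm (indicator {0..1} t *\<^sub>R G t)) \<le> indicator {0..1} t + ennreal ((G t)\<^sup>2) * indicator {0..1} t"
        by (auto simp: indicator_def)
    qed
    also have "\<dots> = 1 + (\<integral>\<^sup>+t\<in>{0..1}. ennreal ((G t)\<^sup>2) \<partial>lborel)"
      by (subst nn_integral_add) auto
    also have "\<dots> < \<infinity>" using f2 by simp
    finally show ?thesis unfolding set_integrable_def by (intro integrableI_bounded) auto
  qed
  moreover have "(\<integral>\<^sup>+t\<in>{0..1 - k * s}. ennreal ((fwd_diff k s G t)\<^sup>2) \<partial>lborel) \<le> ennreal ((L / sqrt c0 * s powr \<alpha>)\<^sup>2)"
    if s: "s > 0" "real k * s \<le> 1" for s :: real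
  proof -
    let ?R = "restrict_space \<mu>T {0..1 - of_nat k * s}"
    have "ereal (s powr - \<alpha>) * modulus_L2 \<mu>T k g s \<le> lip_seminorm \<mu>T \<alpha> g"
      unfolding lip_seminorm_def k_def by (rule SUP_upper) (use s in auto)
    also have "\<dots> \<le> ereal L" using g by (auto simp: Lip_ball_def)
    finally have 1: "ereal (s powr - \<alpha>) * modulus_L2 \<mu>T k g s \<le> ereal L" .
    have "L2_norm_of ?R (fwd_diff k s g) \<le> modulus_L2 \<mu>T k g s"
      unfolding modulus_L2_def by (rule SUP_upper) (use s in auto)
    then have "ereal (s powr - \<alpha>) * L2_norm_of ?R (fwd_diff k s g) \<le> ereal (s powr - \<alpha>) * modulus_L2 \<mu>T k g s"
      by (intro ereal_mult_left_mono) auto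
    then have 2: "ereal (s powr - \<alpha>) * L2_norm_of ?R (fwd_diff k s g) \<le> ereal L" using 1 by (rule order.trans)
    \<comment> \<open>Outside L2 the norm is infinite, which the finite seminorm excludes.\<close>
    have in2: "in_L2 ?R (fwd_diff k s g)"
    proof (rule ccontr)
      assume "\<not> ?thesis"
      then have "ereal (s powr - \<alpha>) * \<infinity> \<le> ereal L" using 2 by (simp add: L2_norm_of_def)
      then show False using s by simp
    qed
    then have "ereal (s powr - \<alpha> * sqrt (\<integral>t. (fwd_diff k s g t)\<^sup>2 \<partial>?R)) \<le> ereal L"
      using 2 by (simp add: L2_norm_of_def)
    then have "s powr - \<alpha> * sqrt (\<integral>t. (fwd_diff k s g t)\<^sup>2 \<partial>?R) \<le> L" by simp
    then have 3: "sqrt (\<integral>t. (fwd_diff k s g t)\<^sup>2 \<partial>?R) \<le> L * s powr \<alpha>"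
      using s by (simp add: powr_minus field_simps)
    have 4: "(\<integral>t. (fwd_diff k s g t)\<^sup>2 \<partial>?R) \<le> (L * s powr \<alpha>)\<^sup>2"
      using power_mono[OF 3, of 2] by (simp add: real_sqrt_ge_zero)
    have eqG: "fwd_diff k s g t = fwd_diff k s G t" if "t \<in> {0..1 - real k * s}" for t
    proof -
      have "real i * s \<le> real k * s" if "i \<le> k" for i using that s by (intro mult_right_mono) auto
      moreover have "0 \<le> real i * s" for i using s by simp
      ultimately have "t + real i * s \<in> {0..1}" if "i \<le> k" for i
        using that \<open>t \<in> _\<close> add_nonneg_nonneg[of t "real i * s"] by (smt (verit) atLeastAtMost_iff)
      then show ?thesis unfolding fwd_diff_def G_def by (intro sum.cong) auto
    qed
    have fm[measurable]: "fwd_diff k s G \<in> borel_measurable borel"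
    proof -
      have "(\<lambda>t. \<Sum>i\<le>k. (- 1) ^ (k - i) * real (k choose i) * G (t + real i * s)) \<in> borel_measurable borel"
        by (intro borel_measurable_sum borel_measurable_times borel_measurable_const) measurable
      then show ?thesis unfolding fwd_diff_def[abs_def] by simp
    qed
    have "ennreal c0 * (\<integral>\<^sup>+t\<in>{0..1 - k * s}. ennreal ((fwd_diff k s G t)\<^sup>2) \<partial>lborel) =
        ennreal c0 * (\<integral>\<^sup>+t\<in>{0..1}. (ennreal ((fwd_diff k s G t)\<^sup>2) * indicator {0..1 - k * s} t) \<partial>lborel)"
    proof -
      have "0 \<le> real k * s" using s by simp
      then have "ennreal ((fwd_diff k s G t)\<^sup>2) * indicator {0..1 - k * s} t =
          (ennreal ((fwd_diff k s G t)\<^sup>2) * indicator {0..1 - k * s} t) * indicator {0..1} t" for t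
        by (cases "t \<in> {0..1 - k * s}") (auto simp: indicator_def)
      then show ?thesis by simp
    qed
    also have "\<dots> \<le> (\<integral>\<^sup>+t. ennreal ((fwd_diff k s G t)\<^sup>2) * indicator {0..1 - k * s} t \<partial>\<mu>T)"
      by (rule lower) measurable
    also have "\<dots> = (\<integral>\<^sup>+t. ennreal ((fwd_diff k s g t)\<^sup>2) * indicator {0..1 - k * s} t \<partial>\<mu>T)"
      using eqG by (intro nn_integral_cong) (auto simp: indicator_def)
    also have "\<dots> = (\<integral>\<^sup>+t. ennreal ((fwd_diff k s g t)\<^sup>2) \<partial>?R)"
      by (subst nn_integral_restrict_space) (auto simp: sets)
    also have "\<dots> = ennreal (\<integral>t. (fwd_diff k s g t)\<^sup>2 \<partial>?R)"
      using in2 by (intro nn_integral_eq_integral) (auto simp: in_L2_def)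
    also have "\<dots> \<le> ennreal ((L * s powr \<alpha>)\<^sup>2)" by (intro ennreal_leI 4)
    finally have "ennreal (1 / c0) * (ennreal c0 * (\<integral>\<^sup>+t\<in>{0..1 - k * s}. ennreal ((fwd_diff k s G t)\<^sup>2) \<partial>lborel)) \<le>
        ennreal (1 / c0) * ennreal ((L * s powr \<alpha>)\<^sup>2)" by (intro mult_left_mono) auto
    also have "ennreal (1 / c0) * ennreal ((L * s powr \<alpha>)\<^sup>2) = ennreal ((L / sqrt c0 * s powr \<alpha>)\<^sup>2)"
      using c0 by (simp add: power_mult_distrib power_divide flip: ennreal_mult)
    finally show ?thesis using c0 by (simp add: mult.assoc[symmetric] flip: ennreal_mult)
  qed
  ultimately obtain C where C: "\<And>\<kappa>. \<exists>v\<in>ppoly_space k (2 ^ \<kappa>).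
      (\<integral>\<^sup>+t\<in>{0..<1}. ennreal ((G t - v t)\<^sup>2) \<partial>lborel) \<le> ennreal (C * (2 ^ \<kappa>) powr (- 2 * \<alpha>))"
    using jackson_ppoly[of G k "L / sqrt c0" \<alpha>] \<alpha> L c0 by (auto simp: k_def)
  have kr: "k \<le> r"
  proof -
    have "\<lfloor>\<alpha>\<rfloor> < int r" using \<alpha> by (simp add: floor_less_iff)
    then show ?thesis using \<alpha> by (simp add: k_def nat_less_iff Suc_le_eq)
  qed
  show ?thesis
  proof (intro exI[of _ "c1 * \<bar>C\<bar>"] conjI allI)
    show "c1 * \<bar>C\<bar> \<ge> 0" using c1 by simp
    fix \<kappa>
    obtain v where v: "v \<in> ppoly_space k (2 ^ \<kappa>)"
      and le: "(\<integral>\<^sup>+t\<in>{0..<1}. ennreal ((G t - v t)\<^sup>2) \<partial>lborel) \<le> ennreal (C * (2 ^ \<kappa>) powr (- 2 * \<alpha>))"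
      using C by blast
    have [measurable]: "v \<in> borel_measurable borel" using v by (rule ppoly_measurable)
    have "(\<integral>\<^sup>+t\<in>{0..1}. ennreal ((g t - v t)\<^sup>2) \<partial>\<mu>T) = (\<integral>\<^sup>+t\<in>{0..1}. ennreal ((G t - v t)\<^sup>2) \<partial>\<mu>T)"
      by (intro nn_integral_cong) (auto simp: G_def indicator_def)
    also have "\<dots> \<le> ennreal c1 * (\<integral>\<^sup>+t\<in>{0..1}. (ennreal ((G t - v t)\<^sup>2) * indicator {0..1} t) \<partial>lborel)"
      by (rule upper) measurable
    also have "(\<integral>\<^sup>+t\<in>{0..1}. (ennreal ((G t - v t)\<^sup>2) * indicator {0..1} t) \<partial>lborel) = (\<integral>\<^sup>+t\<in>{0..<1}. ennreal ((G t - v t)\<^sup>2) \<partial>lborel)"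
    proof (rule nn_integral_cong_AE)
      \<comment> \<open>The cells cover [0,1) only; the missing point 1 is a null set.\<close>
      have "AE t in lborel. t \<noteq> (1::real)" by (rule AE_lborel_singleton)
      then show "AE t in lborel. ennreal ((G t - v t)\<^sup>2) * indicator {0..1} t * indicator {0..1} t = ennreal ((G t - v t)\<^sup>2) * indicator {0..<1} t"
        by eventually_elim (auto simp: indicator_def)
    qed
    also have "ennreal c1 * \<dots> \<le> ennreal c1 * ennreal (\<bar>C\<bar> * (2 ^ \<kappa>) powr (- 2 * \<alpha>))"
      by (intro mult_left_mono order.trans[OF le] ennreal_leI mult_right_mono) auto
    also have "\<dots> = ennreal (c1 * \<bar>C\<bar> * (2 ^ \<kappa>) powr (- 2 * \<alpha>))"
      using c1 by (simp add: mult.assoc flip: ennreal_mult)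
    finally show "\<exists>v\<in>ppoly_space r (2 ^ \<kappa>).
        (\<integral>\<^sup>+t\<in>{0..1}. ennreal ((g t - v t)\<^sup>2) \<partial>\<mu>T) \<le> ennreal (c1 * \<bar>C\<bar> * (2 ^ \<kappa>) powr (- 2 * \<alpha>))"
      using v ppoly_mono_degree[OF kr] by blast
  qed
qed

text \<open>Union bound over the sets, with 1 - q at most exp (- q) for each single miss.\<close>

lemma (in prob_space) miss_prob:
  fixes m n :: nat and q :: real
  assumes T[measurable]: "T \<in> borel_measurable M" and S: "\<And>g. g < m \<Longrightarrow> S g \<in> sets (borel :: real measure)"
    and q: "\<And>g. g < m \<Longrightarrow> prob {v\<in>space M. T v \<in> S g} \<ge> q"
  shows "{\<omega>\<in>space (PiM {..<n::nat} (\<lambda>_. M)). \<exists>g<m. \<forall>i<n. T (\<omega> i) \<notin> S g} \<in> sets (PiM {..<n} (\<lambda>_. M))" (is "?B \<in> _")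
    and "measure (PiM {..<n} (\<lambda>_. M)) {\<omega>\<in>space (PiM {..<n::nat} (\<lambda>_. M)). \<exists>g<m. \<forall>i<n. T (\<omega> i) \<notin> S g} \<le> m * exp (- (n * q))"
proof -
  let ?P = "PiM {..<n::nat} (\<lambda>_. M)"
  interpret P: prob_space ?P by (intro prob_space_PiM prob_space_axioms)
  interpret PS: product_sigma_finite "\<lambda>_::nat. M" by standard
  let ?N = "\<lambda>g. {v\<in>space M. T v \<notin> S g}"
  have N: "?N g \<in> sets M" if "g < m" for g using S[OF that] by measurable
  have B: "?B = (\<Union>g<m. PiE {..<n} (\<lambda>_. ?N g))" by (simp add: set_eq_iff space_PiM PiE_iff) blast
  have PN: "PiE {..<n} (\<lambda>_. ?N g) \<in> sets ?P" if "g < m" for g using N[OF that] by (intro sets_PiM_I_finite) auto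
  show Bs: "?B \<in> sets ?P" unfolding B by (rule sets.finite_UN) (use PN in simp_all)
  have le: "measure ?P (PiE {..<n} (\<lambda>_. ?N g)) \<le> exp (- (n * q))" if g: "g < m" for g
  proof -
    have Sg[measurable]: "S g \<in> sets borel" by (rule S[OF g])
    have "prob (?N g) = 1 - prob {v\<in>space M. T v \<in> S g}"
      using prob_neg[of "\<lambda>v. T v \<in> S g"] by simp
    then have 1: "prob (?N g) \<le> exp (- q)" using q[OF g] exp_ge_add_one_self[of "- q"] by linarith
    have "emeasure ?P (PiE {..<n} (\<lambda>_. ?N g)) = (\<Prod>i<n. emeasure M (?N g))"
      by (rule PS.emeasure_PiM) (use N[OF g] in auto)
    also have "\<dots> = ennreal (prob (?N g) ^ n)" by (simp add: emeasure_eq_measure ennreal_power)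
    finally have "measure ?P (PiE {..<n} (\<lambda>_. ?N g)) = prob (?N g) ^ n" by (simp add: measure_def)
    also have "\<dots> \<le> exp (- q) ^ n" by (intro power_mono 1) auto
    also have "\<dots> = exp (- (n * q))" by (simp add: exp_of_nat_mult[symmetric])
    finally show ?thesis .
  qed
  have "measure ?P ?B \<le> (\<Sum>g<m. measure ?P (PiE {..<n} (\<lambda>_. ?N g)))"
    unfolding B using PN by (intro P.finite_measure_subadditive_finite) auto
  also have "\<dots> \<le> (\<Sum>g<m. exp (- (n * q)))" by (intro sum_mono le) auto
  finally show "measure ?P ?B \<le> m * exp (- (n * q))" by simp
qed

text \<open>\<open>Q\<close> holds off measurable sets of vanishing probability; \<open>Q\<close> itself need not be measurable.\<close>

definition whp :: "(nat \<Rightarrow> 'v measure) \<Rightarrow> (nat \<Rightarrow> 'v \<Rightarrow> bool) \<Rightarrow> bool" where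
  "whp P Q \<longleftrightarrow> (\<exists>B. (\<forall>n. B n \<in> sets (P n)) \<and> (\<lambda>n. measure (P n) (B n)) \<longlonglongrightarrow> 0 \<and>
     (\<forall>\<^sub>F n in sequentially. \<forall>\<omega>\<in>space (P n) - B n. Q n \<omega>))"

lemma whp_mono: "whp P Q \<Longrightarrow> (\<forall>\<^sub>F n in sequentially. \<forall>\<omega>\<in>space (P n). Q n \<omega> \<longrightarrow> Q' n \<omega>) \<Longrightarrow> whp P Q'"
proof -
  assume "whp P Q" and ev: "\<forall>\<^sub>F n in sequentially. \<forall>\<omega>\<in>space (P n). Q n \<omega> \<longrightarrow> Q' n \<omega>"
  then obtain B where B: "\<forall>n. B n \<in> sets (P n)" "(\<lambda>n. measure (P n) (B n)) \<longlonglongrightarrow> 0"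
    "\<forall>\<^sub>F n in sequentially. \<forall>\<omega>\<in>space (P n) - B n. Q n \<omega>" unfolding whp_def by blast
  have "\<forall>\<^sub>F n in sequentially. \<forall>\<omega>\<in>space (P n) - B n. Q' n \<omega>"
    using B(3) ev by eventually_elim auto
  then show ?thesis unfolding whp_def using B(1,2) by blast
qed

lemma whp_conj:
  assumes "\<And>n. prob_space (P n)" "whp P Q" "whp P Q'"
  shows "whp P (\<lambda>n \<omega>. Q n \<omega> \<and> Q' n \<omega>)"
proof -
  obtain B where B: "\<And>n. B n \<in> sets (P n)" "(\<lambda>n. measure (P n) (B n)) \<longlonglongrightarrow> 0"
    "\<forall>\<^sub>F n in sequentially. \<forall>\<omega>\<in>space (P n) - B n. Q n \<omega>" using assms(2) unfolding whp_def by blast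
  obtain B' where B': "\<And>n. B' n \<in> sets (P n)" "(\<lambda>n. measure (P n) (B' n)) \<longlonglongrightarrow> 0"
    "\<forall>\<^sub>F n in sequentially. \<forall>\<omega>\<in>space (P n) - B' n. Q' n \<omega>" using assms(3) unfolding whp_def by blast
  have lim: "(\<lambda>n. measure (P n) (B n \<union> B' n)) \<longlonglongrightarrow> 0"
  proof (rule tendsto_sandwich[of "\<lambda>_. 0" _ _ "\<lambda>n. measure (P n) (B n) + measure (P n) (B' n)"])
    show "\<forall>\<^sub>F n in sequentially. measure (P n) (B n \<union> B' n) \<le> measure (P n) (B n) + measure (P n) (B' n)"
      using B(1) B'(1) by (intro always_eventually allI measure_Un_le) auto
    show "(\<lambda>n. measure (P n) (B n) + measure (P n) (B' n)) \<longlonglongrightarrow> 0"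
      using tendsto_add[OF B(2) B'(2)] by simp
  qed auto
  have "\<forall>\<^sub>F n in sequentially. \<forall>\<omega>\<in>space (P n) - (B n \<union> B' n). Q n \<omega> \<and> Q' n \<omega>"
    using B(3) B'(3) by eventually_elim auto
  then show ?thesis unfolding whp_def using lim B(1) B'(1) by (intro exI[of _ "\<lambda>n. B n \<union> B' n"]) auto
qed

lemma whp_ball:
  assumes "\<And>n. prob_space (P n)" "finite J" "\<And>j. j \<in> J \<Longrightarrow> whp P (Q j)"
  shows "whp P (\<lambda>n \<omega>. \<forall>j\<in>J. Q j n \<omega>)"
  using assms(2,3)
proof (induction J rule: finite_induct)
  case empty
  show ?case unfolding whp_def by (intro exI[of _ "\<lambda>_. {}"]) auto
next
  case (insert a J)
  then show ?case using whp_conj[where Q="Q a" and Q'="\<lambda>n \<omega>. \<forall>j\<in>J. Q j n \<omega>", OF assms(1)] by simp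
qed

text \<open>Markov's inequality at the level \<open>l n * \<rho> n\<close> leaves probability at
  most \<open>C / l n\<close>. For those n where \<open>f n\<close> is not integrable the
  exceptional set is taken empty, which keeps it measurable for every n.\<close>

lemma whp_markov:
  fixes f :: "nat \<Rightarrow> 'v \<Rightarrow> real"
  assumes P: "\<And>n. prob_space (P n)" and f: "\<forall>\<^sub>F n in sequentially. integrable (P n) (f n)" and f0: "\<And>n \<omega>. f n \<omega> \<ge> 0"
    and le: "\<forall>\<^sub>F n in sequentially. (\<integral>\<omega>. f n \<omega> \<partial>P n) \<le> C * \<rho> n" and \<rho>: "\<forall>\<^sub>F n in sequentially. \<rho> n > 0"
    and l: "filterlim l at_top sequentially"
  shows "whp P (\<lambda>n \<omega>. f n \<omega> \<le> l n * \<rho> n)"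
proof -
  define B where "B n = (if integrable (P n) (f n) then {\<omega>\<in>space (P n). f n \<omega> \<ge> l n * \<rho> n} else {})" for n
  have Bs: "B n \<in> sets (P n)" for n
  proof (cases "integrable (P n) (f n)")
    case True
    then have [measurable]: "f n \<in> borel_measurable (P n)" by simp
    have "{\<omega>\<in>space (P n). f n \<omega> \<ge> l n * \<rho> n} \<in> sets (P n)" by measurable
    then show ?thesis using True by (simp add: B_def)
  qed (simp add: B_def)
  have l0: "\<forall>\<^sub>F n in sequentially. l n > 0" using l by (auto simp: filterlim_at_top_dense)
  have bound: "\<forall>\<^sub>F n in sequentially. measure (P n) (B n) \<le> C / l n"
    using f le \<rho> l0
  proof eventually_elim
    case (elim n)
    interpret prob_space "P n" by (rule P)
    have "measure (P n) {\<omega>\<in>space (P n). f n \<omega> \<ge> l n * \<rho> n} \<le> (\<integral>\<omega>. f n \<omega> \<partial>P n) / (l n * \<rho> n)"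
      by (rule integral_Markov_inequality_measure[where A = "{}"]) (use elim f0 in auto)
    also have "\<dots> \<le> (C * \<rho> n) / (l n * \<rho> n)" using elim by (intro divide_right_mono) auto
    also have "\<dots> = C / l n" using elim by simp
    finally show ?case using elim by (simp add: B_def)
  qed
  have "(\<lambda>n. C / l n) \<longlonglongrightarrow> 0" using l by (rule real_tendsto_divide_at_top[OF tendsto_const])
  from tendsto_sandwich[OF always_eventually[OF allI[OF measure_nonneg]] bound tendsto_const this]
  have "(\<lambda>n. measure (P n) (B n)) \<longlonglongrightarrow> 0" .
  moreover have "\<forall>\<^sub>F n in sequentially. \<forall>\<omega>\<in>space (P n) - B n. f n \<omega> \<le> l n * \<rho> n"
    using f by eventually_elim (auto simp: B_def)
  ultimately show ?thesis unfolding whp_def using Bs by blast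
qed

section \<open>Events of high probability\<close>

text \<open>One application of Markov's inequality to the sum over the family controls all members
  at once. For errors that decay geometrically over the grids this sum has the order of its largest
  term, so uniformity costs a constant only.\<close>

lemma whp_family_mean:
  fixes \<psi> :: "nat \<Rightarrow> 'k \<Rightarrow> 'v \<Rightarrow> real"
  assumes \<nu>: "prob_space \<nu>" and fin: "\<And>n. finite (S n)" and int: "\<And>n k. integrable \<nu> (\<psi> n k)" and nn: "\<And>n k v. \<psi> n k v \<ge> 0"
    and le: "\<forall>\<^sub>F n in sequentially. (\<Sum>k\<in>S n. n * (\<integral>v. \<psi> n k v \<partial>\<nu>)) \<le> C * \<rho> n"
    and \<rho>: "\<forall>\<^sub>F n in sequentially. \<rho> n > 0" and l: "filterlim l at_top sequentially"
  shows "whp (\<lambda>n. PiM {..<n} (\<lambda>_. \<nu>)) (\<lambda>n \<omega>. \<forall>k\<in>S n. (\<Sum>i<n. \<psi> n k (\<omega> i)) \<le> l n * \<rho> n)"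
proof -
  let ?P = "\<lambda>n::nat. PiM {..<n} (\<lambda>_. \<nu>)"
  let ?f = "\<lambda>n \<omega>. \<Sum>k\<in>S n. \<Sum>i<n. \<psi> n k (\<omega> i)"
  note I = iid_sum_integral[OF \<nu> int]
  have "whp ?P (\<lambda>n \<omega>. ?f n \<omega> \<le> l n * \<rho> n)"
  proof (rule whp_markov[OF _ _ _ _ \<rho> l])
    show "prob_space (?P n)" for n using \<nu> by (intro prob_space_PiM)
    show "\<forall>\<^sub>F n in sequentially. integrable (?P n) (?f n)" by (intro always_eventually allI Bochner_Integration.integrable_sum[OF I(1)])
    show "?f n \<omega> \<ge> 0" for n \<omega> using nn by (intro sum_nonneg)
    have "(\<integral>\<omega>. ?f n \<omega> \<partial>?P n) = (\<Sum>k\<in>S n. n * (\<integral>v. \<psi> n k v \<partial>\<nu>))" for n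
      using I by (subst Bochner_Integration.integral_sum) auto
    then show "\<forall>\<^sub>F n in sequentially. (\<integral>\<omega>. ?f n \<omega> \<partial>?P n) \<le> C * \<rho> n" using le by simp
  qed
  then show ?thesis
  proof (rule whp_mono, intro always_eventually allI ballI impI)
    fix n \<omega> k assume "?f n \<omega> \<le> l n * \<rho> n" "k \<in> S n"
    moreover have "(\<Sum>i<n. \<psi> n k (\<omega> i)) \<le> ?f n \<omega>"
      using \<open>k \<in> S n\<close> fin nn by (intro member_le_sum[of k "S n" "\<lambda>k. \<Sum>i<n. \<psi> n k (\<omega> i)"] sum_nonneg) auto
    ultimately show "(\<Sum>i<n. \<psi> n k (\<omega> i)) \<le> l n * \<rho> n" by linarith
  qed
qed

text \<open>The same device for centred sums: second moments of independent centred terms add up,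
  hence n times the second moment and not its n^2-fold.\<close>

lemma whp_family_square:
  fixes \<psi> :: "nat \<Rightarrow> 'k \<Rightarrow> 'v \<Rightarrow> real"
  assumes \<nu>: "prob_space \<nu>" and fin: "\<And>n. finite (S n)" and m: "\<And>n k. \<psi> n k \<in> borel_measurable \<nu>"
    and int: "\<And>n k. integrable \<nu> (\<lambda>v. (\<psi> n k v)\<^sup>2)" and mean: "\<And>n k. (\<integral>v. \<psi> n k v \<partial>\<nu>) = 0"
    and le: "\<forall>\<^sub>F n in sequentially. (\<Sum>k\<in>S n. n * (\<integral>v. (\<psi> n k v)\<^sup>2 \<partial>\<nu>)) \<le> C * \<rho> n"
    and \<rho>: "\<forall>\<^sub>F n in sequentially. \<rho> n > 0" and l: "filterlim l at_top sequentially"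
  shows "whp (\<lambda>n. PiM {..<n} (\<lambda>_. \<nu>)) (\<lambda>n \<omega>. \<forall>k\<in>S n. \<bar>\<Sum>i<n. \<psi> n k (\<omega> i)\<bar> \<le> sqrt (l n * \<rho> n))"
proof -
  let ?P = "\<lambda>n::nat. PiM {..<n} (\<lambda>_. \<nu>)"
  let ?f = "\<lambda>n \<omega>. \<Sum>k\<in>S n. (\<Sum>i<n. \<psi> n k (\<omega> i))\<^sup>2"
  note I = iid_sum_square[OF \<nu> m int mean]
  have "whp ?P (\<lambda>n \<omega>. ?f n \<omega> \<le> l n * \<rho> n)"
  proof (rule whp_markov[OF _ _ _ _ \<rho> l])
    show "prob_space (?P n)" for n using \<nu> by (intro prob_space_PiM)
    show "\<forall>\<^sub>F n in sequentially. integrable (?P n) (?f n)" using I by (intro always_eventually allI Bochner_Integration.integrable_sum)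
    show "?f n \<omega> \<ge> 0" for n \<omega> by (intro sum_nonneg) auto
    have "(\<integral>\<omega>. ?f n \<omega> \<partial>?P n) \<le> (\<Sum>k\<in>S n. n * (\<integral>v. (\<psi> n k v)\<^sup>2 \<partial>\<nu>))" for n
      using I by (subst Bochner_Integration.integral_sum) (auto intro!: sum_mono)
    with le show "\<forall>\<^sub>F n in sequentially. (\<integral>\<omega>. ?f n \<omega> \<partial>?P n) \<le> C * \<rho> n"
      by (auto elim!: eventually_mono intro: order.trans)
  qed
  then show ?thesis
  proof (rule whp_mono, intro always_eventually allI ballI impI)
    fix n \<omega> k assume f: "?f n \<omega> \<le> l n * \<rho> n" and k: "k \<in> S n"
    have "(\<Sum>i<n. \<psi> n k (\<omega> i))\<^sup>2 \<le> ?f n \<omega>"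
      using k fin by (intro member_le_sum[of k "S n" "\<lambda>k. (\<Sum>i<n. \<psi> n k (\<omega> i))\<^sup>2"]) auto
    then have "(\<Sum>i<n. \<psi> n k (\<omega> i))\<^sup>2 \<le> l n * \<rho> n" using f by linarith
    then show "\<bar>\<Sum>i<n. \<psi> n k (\<omega> i)\<bar> \<le> sqrt (l n * \<rho> n)" by (simp add: real_le_rsqrt)
  qed
qed

text \<open>The random factor of \<open>sup_bound\<close> does not depend on the coefficients, so a
  single use of Markov's inequality covers the whole span.\<close>

lemma (in noise) whp_sup:
  fixes bs :: "nat \<Rightarrow> 'l \<Rightarrow> 'z \<Rightarrow> real"
  assumes fin: "\<And>n. finite (Ls n)" and bm: "\<And>n l. bs n l \<in> borel_measurable Nz"
    and le: "\<forall>\<^sub>F n in sequentially. C * card (Ls n) \<le> C' * \<rho> n"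
    and \<rho>: "\<forall>\<^sub>F n in sequentially. \<rho> n > 0" and l: "filterlim l at_top sequentially"
  shows "whp (\<lambda>n. Pn n) (\<lambda>n \<omega>. \<forall>\<kappa> w. (\<forall>i<n. w i = (\<Sum>l\<in>Ls n. \<kappa> l * bs n l (pr (\<omega> i)))) \<longrightarrow>
       \<bar>\<Sum>i<n. \<epsilon> (\<omega> i) * w i\<bar> \<le> sqrt (l n * \<rho> n) * sqrt (\<Sum>i<n. (w i)\<^sup>2))"
proof -
  have "\<forall>n. \<exists>A. A \<in> borel_measurable (Pn n) \<and> (\<forall>\<omega>. A \<omega> \<ge> 0) \<and> integrable (Pn n) (\<lambda>\<omega>. (A \<omega>)\<^sup>2) \<and>
    (\<integral>\<omega>. (A \<omega>)\<^sup>2 \<partial>Pn n) \<le> C * card (Ls n) \<and>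
    (\<forall>\<omega> \<kappa> w. (\<forall>i<n. w i = (\<Sum>l\<in>Ls n. \<kappa> l * bs n l (pr (\<omega> i)))) \<longrightarrow>
       \<bar>\<Sum>i<n. \<epsilon> (\<omega> i) * w i\<bar> \<le> A \<omega> * sqrt (\<Sum>i<n. (w i)\<^sup>2))"
    by (intro allI sup_bound fin bm)
  from choice[OF this] obtain A where A: "\<And>n. A n \<in> borel_measurable (Pn n) \<and> (\<forall>\<omega>. A n \<omega> \<ge> 0) \<and> integrable (Pn n) (\<lambda>\<omega>. (A n \<omega>)\<^sup>2) \<and>
    (\<integral>\<omega>. (A n \<omega>)\<^sup>2 \<partial>Pn n) \<le> C * card (Ls n) \<and>
    (\<forall>\<omega> \<kappa> w. (\<forall>i<n. w i = (\<Sum>l\<in>Ls n. \<kappa> l * bs n l (pr (\<omega> i)))) \<longrightarrow>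
       \<bar>\<Sum>i<n. \<epsilon> (\<omega> i) * w i\<bar> \<le> A n \<omega> * sqrt (\<Sum>i<n. (w i)\<^sup>2))" by blast
  have "whp (\<lambda>n. Pn n) (\<lambda>n \<omega>. (A n \<omega>)\<^sup>2 \<le> l n * \<rho> n)"
  proof (rule whp_markov[OF _ _ _ _ \<rho> l])
    show "prob_space (Pn n)" for n by (rule Pn_prob)
    show "\<forall>\<^sub>F n in sequentially. integrable (Pn n) (\<lambda>\<omega>. (A n \<omega>)\<^sup>2)" using A by simp
    show "\<forall>\<^sub>F n in sequentially. (\<integral>\<omega>. (A n \<omega>)\<^sup>2 \<partial>Pn n) \<le> C' * \<rho> n"
      using le by eventually_elim (use A in \<open>auto intro: order.trans\<close>)
  qed auto
  then show ?thesis
  proof (rule whp_mono, intro always_eventually allI ballI impI)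
    fix n \<omega> \<kappa> w assume a: "(A n \<omega>)\<^sup>2 \<le> l n * \<rho> n" and w: "\<forall>i<n. w i = (\<Sum>l\<in>Ls n. \<kappa> l * bs n l (pr (\<omega> i)))"
    have "\<bar>\<Sum>i<n. \<epsilon> (\<omega> i) * w i\<bar> \<le> A n \<omega> * sqrt (\<Sum>i<n. (w i)\<^sup>2)" using A w by blast
    also have "\<dots> \<le> sqrt (l n * \<rho> n) * sqrt (\<Sum>i<n. (w i)\<^sup>2)"
      using a by (intro mult_right_mono real_le_rsqrt) (auto simp: sum_nonneg)
    finally show "\<bar>\<Sum>i<n. \<epsilon> (\<omega> i) * w i\<bar> \<le> sqrt (l n * \<rho> n) * sqrt (\<Sum>i<n. (w i)\<^sup>2)" .
  qed
qed

text \<open>A geometric series dominated by the coarsest grid; this is what makes bounds uniform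
  over the random grid affordable.\<close>

lemma sum_dyadic_powr_le:
  fixes g :: real
  assumes "g > 0"
  shows "(\<Sum>\<kappa>=k..k'. (2 ^ \<kappa>) powr (- g)) \<le> (2 ^ k) powr (- g) * (1 / (1 - (1/2) powr g))"
proof -
  define \<rho> where "\<rho> = (1/2::real) powr g"
  have \<rho>: "0 < \<rho>" "\<rho> < 1" using powr_less_mono2[of g "1/2" 1] assms unfolding \<rho>_def by simp_all
  have e: "(2 ^ \<kappa>) powr (- g) = \<rho> ^ \<kappa>" for \<kappa> :: nat
  proof -
    have "(2 ^ \<kappa>) powr (- g) = (1 / 2 ^ \<kappa>) powr g" by (simp add: powr_minus powr_divide divide_simps)
    then show ?thesis by (simp add: powr_half_power \<rho>_def)
  qed
  have "(\<Sum>\<kappa>=k..k'. \<rho> ^ \<kappa>) = (\<Sum>\<kappa>=k..k'. \<rho> ^ k * \<rho> ^ (\<kappa> - k))" by (intro sum.cong) (auto simp flip: power_add)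
  also have "\<dots> = \<rho> ^ k * (\<Sum>l\<in>(\<lambda>\<kappa>. \<kappa> - k) ` {k..k'}. \<rho> ^ l)"
    by (subst sum.reindex) (auto simp: inj_on_def sum_distrib_left)
  also have "(\<Sum>l\<in>(\<lambda>\<kappa>. \<kappa> - k) ` {k..k'}. \<rho> ^ l) \<le> (\<Sum>l. \<rho> ^ l)" using \<rho> by (intro sum_le_suminf) auto
  also have "(\<Sum>l. \<rho> ^ l) = 1 / (1 - \<rho>)" using \<rho> by (intro suminf_geometric) auto
  finally show ?thesis using \<rho> by (simp add: e \<rho>_def[symmetric] mult_left_mono)
qed

section \<open>Dyadic grids of prescribed size\<close>

definition xn :: "nat \<Rightarrow> real" where "xn n = real n / ln (real n)"

text \<open>The grid with \<open>2 ^ kap e n\<close> cells is the dyadic grid with about \<open>(n / log n)\<^sup>e\<close> cells.\<close>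

definition kap :: "real \<Rightarrow> nat \<Rightarrow> nat" where "kap e n = nat \<lfloor>log 2 (xn n powr e)\<rfloor>"

lemma xn_ge_1: "n \<ge> 2 \<Longrightarrow> xn n \<ge> 1"
proof -
  assume n: "n \<ge> 2"
  have "ln (real n) \<le> real n - 1" using n by (intro ln_le_minus_one) auto
  moreover have "ln (real n) > 0" using n by simp
  ultimately show ?thesis unfolding xn_def by (simp add: field_simps)
qed

text \<open>As \<open>xn n\<close> is at least 1, the logarithm is nonnegative and
  \<open>nat\<close> truncates nothing; rounding the exponent down then costs at most a factor
  2.\<close>

lemma kap_bounds:
  assumes n: "n \<ge> 2" and e: "e \<ge> 0"
  shows "2 ^ kap e n \<le> xn n powr e" "xn n powr e / 2 \<le> 2 ^ kap e n"
proof -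
  have x1: "xn n powr e \<ge> 1" using xn_ge_1[OF n] e by (simp add: ge_one_powr_ge_zero)
  then have l0: "log 2 (xn n powr e) \<ge> 0" by (subst zero_le_log_cancel_iff) auto
  have e2: "2 powr (log 2 (xn n powr e)) = xn n powr e" using x1 by (intro powr_log_cancel) auto
  have p: "2 ^ kap e n = 2 powr (real_of_int \<lfloor>log 2 (xn n powr e)\<rfloor>)"
    using l0 by (simp add: kap_def powr_realpow[symmetric])
  have "2 powr (real_of_int \<lfloor>log 2 (xn n powr e)\<rfloor>) \<le> 2 powr (log 2 (xn n powr e))" by (intro powr_mono) auto
  then show "2 ^ kap e n \<le> xn n powr e" unfolding p e2 .
  have "2 powr (log 2 (xn n powr e) - 1) = xn n powr e / 2" unfolding powr_diff e2 by simp
  then have h: "2 powr (log 2 (xn n powr e) - 1) = xn n powr e / 2" .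
  have "2 powr (log 2 (xn n powr e) - 1) \<le> 2 powr (real_of_int \<lfloor>log 2 (xn n powr e)\<rfloor>)"
    by (intro powr_mono) linarith+
  then show "xn n powr e / 2 \<le> 2 ^ kap e n" unfolding p h .
qed

lemma kap_mono: "n \<ge> 2 \<Longrightarrow> 0 \<le> e \<Longrightarrow> e \<le> e' \<Longrightarrow> kap e n \<le> kap e' n"
proof -
  assume n: "n \<ge> 2" and e: "0 \<le> e" "e \<le> e'"
  have "xn n powr e \<le> xn n powr e'" using xn_ge_1[OF n] e by (intro powr_mono) auto
  moreover have "xn n powr e > 0" using xn_ge_1[OF n] by simp
  ultimately have "log 2 (xn n powr e) \<le> log 2 (xn n powr e')" by simp
  then show ?thesis unfolding kap_def by (intro nat_mono floor_mono)
qed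

lemma K_set_kap: "K_set b n = {2 ^ k | k. kap (1 / b) n \<le> k \<and> k \<le> kap (1 / 2) n}"
  by (simp add: K_set_def kap_def xn_def)

lemma kap_powr_le:
  assumes n: "n \<ge> 2" and e: "e \<ge> 0" and g: "g \<ge> 0"
  shows "(2 ^ kap e n) powr (- g) \<le> 2 powr g * xn n powr (- (e * g))"
proof -
  have x: "xn n > 0" using xn_ge_1[OF n] by simp
  have "(2 ^ kap e n) powr (- g) \<le> (xn n powr e / 2) powr (- g)"
    using kap_bounds(2)[OF n e] x g by (intro powr_mono2') auto
  also have "\<dots> = 2 powr g * xn n powr (- (e * g))"
    using x by (simp add: powr_divide powr_powr powr_minus field_simps)
  finally show ?thesis .
qed

text \<open>Any slowly growing factor would do: it turns bounds in mean into bounds in probability.\<close>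

definition ell :: "nat \<Rightarrow> real" where "ell n = ln (real n) powr (1/4)"

lemma ell_at_top: "filterlim ell at_top sequentially"
  unfolding ell_def by real_asymp

lemma whp_AE:
  assumes "\<And>n. AE \<omega> in P n. Q n \<omega>"
  shows "whp P Q"
proof -
  have "\<exists>N. N \<in> null_sets (P n) \<and> {\<omega>\<in>space (P n). \<not> Q n \<omega>} \<subseteq> N" for n
    using assms[of n] by (simp add: eventually_ae_filter) blast
  then obtain N where N: "\<And>n. N n \<in> null_sets (P n)" "\<And>n. {\<omega>\<in>space (P n). \<not> Q n \<omega>} \<subseteq> N n" by metis
  then have m: "(\<lambda>n. measure (P n) (N n)) = (\<lambda>_. 0)" by (auto simp: measure_eq_0_null_sets)
  have "\<forall>n. N n \<in> sets (P n)" using N(1) by blast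
  moreover have "\<forall>n. \<forall>\<omega>\<in>space (P n) - N n. Q n \<omega>" using N(2) by blast
  ultimately show ?thesis unfolding whp_def by (intro exI[of _ N]) (simp add: m)
qed

section \<open>The law of one observation and the events derived from it\<close>

abbreviation xx :: "((real^'q) \<times> real) \<times> real \<Rightarrow> 'q::finite \<Rightarrow> real" where "xx v j \<equiv> fst (fst v) $ j"
abbreviation tt :: "((real^'q::finite) \<times> real) \<times> real \<Rightarrow> real" where "tt v \<equiv> snd (fst v)"

text \<open>The measure \<open>\<nu>\<close> is the law of one observation \<open>((x, t), w)\<close>. The functions \<open>fa \<kappa>\<close> and \<open>ph j \<kappa>\<close> approximate
  \<open>f\<close> and \<open>\<theta> j\<close> on the grid with \<open>2 ^ \<kappa>\<close> cells, and \<open>R\<close> inverts \<open>\<Sigma>\<close> on \<open>I\<close>.\<close>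

locale pl_law = prob_space \<nu> for \<nu> :: "(((real^'q::finite) \<times> real) \<times> real) measure" +
  fixes I :: "'q set" and \<theta> :: "'q \<Rightarrow> real \<Rightarrow> real" and f :: "real \<Rightarrow> real"
    and b B0 c0 s2 \<alpha> \<gamma> Cf C\<theta> :: real and fa :: "nat \<Rightarrow> real \<Rightarrow> real" and ph :: "'q \<Rightarrow> nat \<Rightarrow> real \<Rightarrow> real"
    and \<Sigma> R :: "'q \<Rightarrow> 'q \<Rightarrow> real" and r :: nat
  assumes sets_\<nu>[measurable_cong]: "sets \<nu> = sets borel"
    and \<theta>m[measurable]: "\<And>j. \<theta> j \<in> borel_measurable borel" and fm[measurable]: "f \<in> borel_measurable borel"
    and bnd: "AE v in \<nu>. \<forall>j. \<bar>xx v j\<bar> \<le> B0 \<and> \<bar>xx v j - \<theta> j (tt v)\<bar> \<le> B0" and B0: "B0 > 0"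
    and tc: "\<And>a b. 0 \<le> a \<Longrightarrow> a \<le> b \<Longrightarrow> b \<le> 1 \<Longrightarrow> c0 * (b - a) \<le> prob {v\<in>space \<nu>. tt v \<in> {a..<b}}" and c0: "c0 > 0"
    and orth: "\<And>j \<phi>. \<phi> \<in> borel_measurable borel \<Longrightarrow> integrable \<nu> (\<lambda>v. \<phi> (tt v)) \<Longrightarrow> (\<integral>v. (xx v j - \<theta> j (tt v)) * \<phi> (tt v) \<partial>\<nu>) = 0"
    and W1: "\<And>\<phi>. \<phi> \<in> borel_measurable borel \<Longrightarrow> integrable \<nu> (\<lambda>v. \<phi> (fst v)) \<Longrightarrow> (\<integral>v. snd v * \<phi> (fst v) \<partial>\<nu>) = 0"
    and W2: "\<And>\<phi>. \<phi> \<in> borel_measurable borel \<Longrightarrow> integrable \<nu> (\<lambda>v. \<phi> (fst v)) \<Longrightarrow>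
       integrable \<nu> (\<lambda>v. (snd v)\<^sup>2 * \<phi> (fst v)) \<and> (\<integral>v. (snd v)\<^sup>2 * \<phi> (fst v) \<partial>\<nu>) = s2 * (\<integral>v. \<phi> (fst v) \<partial>\<nu>)"
    and s2: "s2 \<ge> 0" and fL2: "integrable \<nu> (\<lambda>v. (f (tt v))\<^sup>2)"
    and fa: "\<And>\<kappa>. fa \<kappa> \<in> ppoly_space r (2 ^ \<kappa>)" "\<And>\<kappa>. integrable \<nu> (\<lambda>v. (fa \<kappa> (tt v) - f (tt v))\<^sup>2)"
      "\<And>\<kappa>. (\<integral>v. (fa \<kappa> (tt v) - f (tt v))\<^sup>2 \<partial>\<nu>) \<le> Cf * (2 ^ \<kappa>) powr (- (2 * \<alpha>))" and Cf: "Cf \<ge> 0"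
    and ph: "\<And>j \<kappa>. ph j \<kappa> \<in> ppoly_space r (2 ^ \<kappa>)" "\<And>j \<kappa>. integrable \<nu> (\<lambda>v. (\<theta> j (tt v) - ph j \<kappa> (tt v))\<^sup>2)"
      "\<And>j \<kappa>. (\<integral>v. (\<theta> j (tt v) - ph j \<kappa> (tt v))\<^sup>2 \<partial>\<nu>) \<le> C\<theta> * (2 ^ \<kappa>) powr (- (2 * \<gamma>))" and C\<theta>: "C\<theta> \<ge> 0"
    and b: "b \<ge> 3" and r: "r \<ge> 1" and \<alpha>: "\<alpha> > 1/2" and \<gamma>: "\<gamma> > b / 4"
    and \<Sigma>: "\<And>k j. \<Sigma> k j = (\<integral>v. (xx v k - \<theta> k (tt v)) * (xx v j - \<theta> j (tt v)) \<partial>\<nu>)"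
    and inv: "\<And>k l. k \<in> I \<Longrightarrow> l \<in> I \<Longrightarrow> (\<Sum>j\<in>I. \<Sigma> k j * R j l) = (if k = l then 1 else 0)"
begin

text \<open>The estimate is compared with an approximant on a grid of about \<open>(n / log n)\<^sup>\<eta>\<close> cells: \<open>\<eta> < 1/2\<close> makes its
  penalty, and \<open>\<alpha> \<eta> > 1/4\<close> makes its squared bias, small compared with \<open>n\<close> to the power \<open>-1/2\<close>. \<open>Th1\<close> bounds noise against the largest
  approximating space, \<open>Th2\<close> everything that involves an approximation error, and \<open>Th3\<close> centred sums and
  norms of \<open>n\<close> terms.\<close>

definition "\<eta> = max (1/3) ((1/2 + 1/(4 * \<alpha>)) / 2)"
definition "a = min (\<alpha> * \<eta>) (min (\<gamma> / b) ((1 - \<eta>) / 2))"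
abbreviation "J \<equiv> kap (1/2)"
abbreviation "k1 \<equiv> kap (1/b)"
abbreviation "k0 \<equiv> kap \<eta>"
abbreviation "P \<equiv> (\<lambda>n::nat. PiM {..<n} (\<lambda>_. \<nu>))"
definition "\<rho>2 n = real n * xn n powr (- (2 * a))"
definition "Th1 n = sqrt (ell n * xn n powr (1/2))"
definition "Th2 n = sqrt (ell n * \<rho>2 n)"
definition "Th3 n = sqrt (ell n * real n)"

text \<open>\<open>\<eta>\<close> is the midpoint between the two constraints 1/2 and 1 / (4 *
  \<alpha>), which is why \<alpha> > 1/2 is required, raised to 1/3 if necessary. Since 1/b is at
  most 1/3, the comparison grid is then not coarser than the admissible ones.\<close>

lemma \<eta>: "1/3 \<le> \<eta>" "\<eta> < 1/2" "\<alpha> * \<eta> > 1/4"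
proof -
  have "1 / (4 * \<alpha>) < 1/2" using \<alpha> by (simp add: field_simps)
  moreover have "(1/2 + x) / 2 < 1/2" if "x < 1/2" for x :: real using that by simp
  ultimately have "(1/2 + 1/(4 * \<alpha>)) / 2 < 1/2" by blast
  then show "\<eta> < 1/2" unfolding \<eta>_def by (subst max_less_iff_conj) simp
  have "\<alpha> * \<eta> \<ge> \<alpha> * ((1/2 + 1/(4 * \<alpha>)) / 2)" using \<alpha> by (intro mult_left_mono) (auto simp: \<eta>_def)
  also have "\<alpha> * ((1/2 + 1/(4 * \<alpha>)) / 2) = \<alpha> / 4 + 1/8" using \<alpha> by (simp add: field_simps)
  finally show "\<alpha> * \<eta> > 1/4" using \<alpha> by linarith
qed (simp add: \<eta>_def)

text \<open>The largest exponent compatible with three error sources: the bias on the comparison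
  grid, the approximation of \<theta> on the coarsest grid, and the penalty. Being above 1/4 makes
  \<open>\<rho>2 n\<close> smaller than n^(1/2) by a power of n.\<close>

lemma a: "a > 1/4" "a \<le> \<alpha> * \<eta>" "a \<le> \<gamma> / b" "2 * a \<le> 1 - \<eta>"
proof -
  have "\<gamma> / b > 1/4" using \<gamma> b by (simp add: field_simps)
  moreover have "(1 - \<eta>) / 2 > 1/4" using \<eta>(2) by simp
  ultimately show "a > 1/4" using \<eta>(3) unfolding a_def by (simp only: min_less_iff_conj)
  show "a \<le> \<alpha> * \<eta>" "a \<le> \<gamma> / b" unfolding a_def by (simp_all only: min.cobounded1 min_le_iff_disj) simp_all
  have "a \<le> (1 - \<eta>) / 2" unfolding a_def by (simp only: min_le_iff_disj) simp
  then show "2 * a \<le> 1 - \<eta>" by simp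
qed

lemma ev2: "\<forall>\<^sub>F n in sequentially. n \<ge> (2::nat)" by (rule eventually_ge_at_top)

lemma xm[measurable]: "(\<lambda>v. xx v j) \<in> borel_measurable \<nu>"
proof -
  have "(\<lambda>v::((real^'q) \<times> real) \<times> real. xx v j) \<in> borel_measurable borel"
    by (intro borel_measurable_continuous_onI continuous_intros)
  then show ?thesis by (simp cong: measurable_cong_sets)
qed

lemma fstm[measurable]: "fst \<in> measurable \<nu> borel"
proof -
  have "(fst :: ((real^'q) \<times> real) \<times> real \<Rightarrow> _) \<in> borel_measurable borel"
    by (intro borel_measurable_continuous_onI continuous_intros)
  then show ?thesis by (simp cong: measurable_cong_sets)
qed

lemma sndm[measurable]: "snd \<in> borel_measurable \<nu>"
proof -
  have "(snd :: ((real^'q) \<times> real) \<times> real \<Rightarrow> _) \<in> borel_measurable borel"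
    by (intro borel_measurable_continuous_onI continuous_intros)
  then show ?thesis by (simp cong: measurable_cong_sets)
qed

lemma tm[measurable]: "(\<lambda>v. tt v) \<in> borel_measurable \<nu>"
proof -
  have "(\<lambda>v::((real^'q) \<times> real) \<times> real. tt v) \<in> borel_measurable borel"
    by (intro borel_measurable_continuous_onI continuous_intros)
  then show ?thesis by (simp cong: measurable_cong_sets)
qed

lemma x1m[measurable]: "(\<lambda>z::(real^'q) \<times> real. fst z $ j) \<in> borel_measurable borel"
  by (intro borel_measurable_continuous_onI continuous_intros)

lemma t1m[measurable]: "(\<lambda>z::(real^'q) \<times> real. snd z) \<in> borel_measurable borel"
  by (intro borel_measurable_continuous_onI continuous_intros)

lemma fam[measurable]: "fa \<kappa> \<in> borel_measurable borel" and phm[measurable]: "ph j \<kappa> \<in> borel_measurable borel"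
  using ppoly_measurable[OF fa(1)] ppoly_measurable[OF ph(1)] by auto

abbreviation "\<xi> j v \<equiv> xx v j - \<theta> j (tt v)"

lemma P_prob: "prob_space (P n)" by (intro prob_space_PiM prob_space_axioms)

lemma bnd_\<xi>: "AE v in \<nu>. \<bar>\<xi> j v\<bar> \<le> B0" using bnd by eventually_elim auto

lemma \<xi>_int: "integrable \<nu> (\<xi> j)"
  by (rule integrable_const_bound[OF _ , of _ B0]) (use bnd_\<xi> in auto)

lemma \<xi>_mult_int:
  assumes "integrable \<nu> g"
  shows "integrable \<nu> (\<lambda>v. \<xi> j v * (g v :: real))"
proof (rule Bochner_Integration.integrable_bound[of _ "\<lambda>v. B0 * g v"])
  show "integrable \<nu> (\<lambda>v. B0 * g v)" using assms by simp
  show "(\<lambda>v. \<xi> j v * g v) \<in> borel_measurable \<nu>" using assms by measurable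
  show "AE v in \<nu>. norm (\<xi> j v * g v) \<le> norm (B0 * g v)"
    using bnd_\<xi>[of j] by eventually_elim (use B0 in \<open>auto simp: abs_mult intro!: mult_right_mono\<close>)
qed

lemma \<xi>_sq_le:
  assumes g: "integrable \<nu> g" "\<And>v. g v \<ge> 0"
  shows "integrable \<nu> (\<lambda>v. (\<xi> j v)\<^sup>2 * g v)" "(\<integral>v. (\<xi> j v)\<^sup>2 * g v \<partial>\<nu>) \<le> B0\<^sup>2 * (\<integral>v. g v \<partial>\<nu>)"
proof -
  have [measurable]: "g \<in> borel_measurable \<nu>" using g by auto
  have ae: "AE v in \<nu>. (\<xi> j v)\<^sup>2 * g v \<le> B0\<^sup>2 * g v"
    using bnd_\<xi>[of j]
  proof eventually_elim
    case (elim v)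
    then have "(\<xi> j v)\<^sup>2 \<le> B0\<^sup>2" using B0 by (simp add: abs_le_square_iff[symmetric])
    then show ?case using g(2) by (rule mult_right_mono)
  qed
  show i: "integrable \<nu> (\<lambda>v. (\<xi> j v)\<^sup>2 * g v)"
    by (rule Bochner_Integration.integrable_bound[of _ "\<lambda>v. B0\<^sup>2 * g v"]) (use g ae in \<open>auto\<close>)
  have "(\<integral>v. (\<xi> j v)\<^sup>2 * g v \<partial>\<nu>) \<le> (\<integral>v. B0\<^sup>2 * g v \<partial>\<nu>)" by (rule integral_mono_AE[OF i _ ae]) (use g in auto)
  then show "(\<integral>v. (\<xi> j v)\<^sup>2 * g v \<partial>\<nu>) \<le> B0\<^sup>2 * (\<integral>v. g v \<partial>\<nu>)" by simp
qed

lemma L2_imp_int: "g \<in> borel_measurable \<nu> \<Longrightarrow> integrable \<nu> (\<lambda>v. (g v)\<^sup>2) \<Longrightarrow> integrable \<nu> (g :: _ \<Rightarrow> real)"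
  by (rule square_integrable_imp_integrable)

lemma W_L2:
  assumes [measurable]: "\<phi> \<in> borel_measurable borel" and i: "integrable \<nu> (\<lambda>v. (\<phi> (fst v))\<^sup>2)"
  shows "integrable \<nu> (\<lambda>v. (snd v * \<phi> (fst v))\<^sup>2)" "(\<integral>v. (snd v * \<phi> (fst v))\<^sup>2 \<partial>\<nu>) = s2 * (\<integral>v. (\<phi> (fst v))\<^sup>2 \<partial>\<nu>)"
    "(\<integral>v. snd v * \<phi> (fst v) \<partial>\<nu>) = 0"
proof -
  have m: "(\<lambda>z. (\<phi> z)\<^sup>2) \<in> borel_measurable borel" by measurable
  from W2[OF m i] show "integrable \<nu> (\<lambda>v. (snd v * \<phi> (fst v))\<^sup>2)" "(\<integral>v. (snd v * \<phi> (fst v))\<^sup>2 \<partial>\<nu>) = s2 * (\<integral>v. (\<phi> (fst v))\<^sup>2 \<partial>\<nu>)"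
    unfolding power_mult_distrib by (rule conjunct1, rule conjunct2)
  have "integrable \<nu> (\<lambda>v. \<phi> (fst v))" by (rule L2_imp_int[OF _ i]) measurable
  then show "(\<integral>v. snd v * \<phi> (fst v) \<partial>\<nu>) = 0" by (rule W1[OF assms(1)])
qed

lemma xn1: "n \<ge> 2 \<Longrightarrow> xn n powr e > 0" using xn_ge_1[of n] by simp

lemma \<rho>_pos: "\<forall>\<^sub>F n in sequentially. \<rho>2 n > 0" "\<forall>\<^sub>F n in sequentially. xn n powr (1/2) > 0" "\<forall>\<^sub>F n in sequentially. real n > 0"
  using ev2 by (eventually_elim, use xn1 in \<open>auto simp: \<rho>2_def\<close>)+

lemma dim_le: "n \<ge> 2 \<Longrightarrow> real (2 ^ J n) \<le> xn n powr (1/2)"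
  using kap_bounds(1)[of n "1/2"] by simp

text \<open>Given T the residual \<open>\<xi> j\<close> is centred and bounded by \<open>B0\<close>,
  hence noise with design \<open>tt\<close>. The dimension is r times the number of cells of the
  finest grid, and that number is at most \<open>xn n powr (1/2)\<close>, the square of
  \<open>Th1 n\<close> up to \<open>ell n\<close>.\<close>

lemma whp_sup_\<xi>:
  "whp P (\<lambda>n \<omega>. \<forall>v\<in>ppoly_space r (2 ^ J n). \<bar>ip n (\<lambda>i. \<xi> j (\<omega> i)) (\<lambda>i. v (tt (\<omega> i)))\<bar> \<le> Th1 n * nm n (\<lambda>i. v (tt (\<omega> i))))"
proof -
  interpret N: noise \<nu> "\<xi> j" tt borel "B0\<^sup>2"
  proof
    show "\<xi> j \<in> borel_measurable \<nu>" "tt \<in> borel_measurable \<nu>" by measurable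
    show "integrable \<nu> (\<lambda>v. (\<xi> j v)\<^sup>2)" using \<xi>_sq_le(1)[of "\<lambda>_. 1"] by simp
    show "(\<integral>v. \<xi> j v * \<phi> (tt v) \<partial>\<nu>) = 0" if [measurable]: "\<phi> \<in> borel_measurable borel" and "\<And>z. \<bar>\<phi> z\<bar> \<le> 1" for \<phi>
      by (rule orth) (use that in \<open>auto intro!: integrable_const_bound[where B=1]\<close>)
    show "(\<integral>v. (\<xi> j v)\<^sup>2 * \<phi> (tt v) \<partial>\<nu>) \<le> B0\<^sup>2 * (\<integral>v. \<phi> (tt v) \<partial>\<nu>)"
      if [measurable]: "\<phi> \<in> borel_measurable borel" and p: "\<And>z. 0 \<le> \<phi> z \<and> \<phi> z \<le> 1" for \<phi>
      by (rule \<xi>_sq_le(2)) (use p in \<open>auto intro!: integrable_const_bound[where B=1]\<close>)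
  qed simp
  have "whp P (\<lambda>n \<omega>. \<forall>\<kappa> w. (\<forall>i<n. w i = (\<Sum>l\<in>{1..2 ^ J n} \<times> {..<r}. \<kappa> l * ppoly_basis (2 ^ J n) l (tt (\<omega> i)))) \<longrightarrow>
       \<bar>\<Sum>i<n. \<xi> j (\<omega> i) * w i\<bar> \<le> sqrt (ell n * xn n powr (1/2)) * sqrt (\<Sum>i<n. (w i)\<^sup>2))"
  proof (rule N.whp_sup[where C' = "B0\<^sup>2 * r", OF _ _ _ _ ell_at_top])
    show "\<forall>\<^sub>F n in sequentially. B0\<^sup>2 * card ({1..2 ^ J n::nat} \<times> {..<r}) \<le> B0\<^sup>2 * r * xn n powr (1/2)"
      using ev2
    proof eventually_elim
      case (elim n)
      have "B0\<^sup>2 * r * real (2 ^ J n) \<le> B0\<^sup>2 * r * xn n powr (1/2)" by (intro mult_left_mono dim_le elim) auto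
      then show ?case by (simp add: mult_ac)
    qed
  qed (use \<rho>_pos in auto)
  then show ?thesis
  proof (rule whp_mono, intro always_eventually allI ballI impI)
    fix n \<omega> v
    assume H: "\<forall>\<kappa> w. (\<forall>i<n. w i = (\<Sum>l\<in>{1..2 ^ J n} \<times> {..<r}. \<kappa> l * ppoly_basis (2 ^ J n) l (tt (\<omega> i)))) \<longrightarrow>
       \<bar>\<Sum>i<n. \<xi> j (\<omega> i) * w i\<bar> \<le> sqrt (ell n * xn n powr (1/2)) * sqrt (\<Sum>i<n. (w i)\<^sup>2)"
      and v: "v \<in> ppoly_space r (2 ^ J n)"
    obtain \<kappa> where \<kappa>: "\<And>t. v t = (\<Sum>l\<in>{1..2 ^ J n} \<times> {..<r}. \<kappa> l * ppoly_basis (2 ^ J n) l t)"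
      using ppoly_span[OF r v] by blast
    show "\<bar>ip n (\<lambda>i. \<xi> j (\<omega> i)) (\<lambda>i. v (tt (\<omega> i)))\<bar> \<le> Th1 n * nm n (\<lambda>i. v (tt (\<omega> i)))"
      using H[rule_format, of "\<lambda>i. v (tt (\<omega> i))" \<kappa>] \<kappa> by (simp add: ip_def nm_def Th1_def)
  qed
qed

lemma whp_sup_error:
  "whp P (\<lambda>n \<omega>. \<forall>c. \<forall>v\<in>ppoly_space r (2 ^ J n). \<bar>ip n (\<lambda>i. snd (\<omega> i)) (\<lambda>i. (\<Sum>j\<in>I. c j * xx (\<omega> i) j) + v (tt (\<omega> i)))\<bar>
      \<le> Th1 n * nm n (\<lambda>i. (\<Sum>j\<in>I. c j * xx (\<omega> i) j) + v (tt (\<omega> i))))"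
proof -
  interpret N: noise \<nu> snd fst borel s2
  proof
    show "snd \<in> borel_measurable \<nu>" "fst \<in> borel_measurable \<nu>" by measurable
    have "integrable \<nu> (\<lambda>v. (snd v)\<^sup>2 * 1)" by (rule conjunct1[OF W2]) auto
    then show "integrable \<nu> (\<lambda>v. (snd v)\<^sup>2)" by (simp only: mult_1_right)
    show "(\<integral>v. snd v * \<phi> (fst v) \<partial>\<nu>) = 0" if [measurable]: "\<phi> \<in> borel_measurable borel" and "\<And>z. \<bar>\<phi> z\<bar> \<le> 1" for \<phi>
      by (rule W1) (use that in \<open>auto intro!: integrable_const_bound[where B=1]\<close>)
    show "(\<integral>v. (snd v)\<^sup>2 * \<phi> (fst v) \<partial>\<nu>) \<le> s2 * (\<integral>v. \<phi> (fst v) \<partial>\<nu>)"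
      if [measurable]: "\<phi> \<in> borel_measurable borel" and p: "\<And>z. 0 \<le> \<phi> z \<and> \<phi> z \<le> 1" for \<phi>
    proof -
      have "integrable \<nu> (\<lambda>v. \<phi> (fst v))" by (rule integrable_const_bound[where B=1]) (use p in auto)
      from conjunct2[OF W2[OF that(1) this]] show ?thesis by (rule eq_refl)
    qed
  qed (rule s2)
  \<comment> \<open>All coordinate functions are put next to the piecewise monomials; those outside
    \<open>I\<close> will receive coefficient 0.\<close>
  define Ls where "Ls n = (UNIV :: 'q set) <+> ({1..2 ^ J n :: nat} \<times> {..<r})" for n
  define bs where "bs n = case_sum (\<lambda>j z. fst z $ j) (\<lambda>l (z :: (real^'q) \<times> real). ppoly_basis (2 ^ J n) l (snd z))" for n
  have Lsum: "(\<Sum>l\<in>Ls n. g l) = (\<Sum>j\<in>UNIV. g (Inl j)) + (\<Sum>l\<in>{1..2 ^ J n} \<times> {..<r}. g (Inr l))" for g :: "_ \<Rightarrow> real" and n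
    unfolding Ls_def by (subst sum.Plus) auto
  have "whp P (\<lambda>n \<omega>. \<forall>\<kappa> w. (\<forall>i<n. w i = (\<Sum>l\<in>Ls n. \<kappa> l * bs n l (fst (\<omega> i)))) \<longrightarrow>
       \<bar>\<Sum>i<n. snd (\<omega> i) * w i\<bar> \<le> sqrt (ell n * xn n powr (1/2)) * sqrt (\<Sum>i<n. (w i)\<^sup>2))"
  proof (rule N.whp_sup[where C' = "s2 * (CARD('q) + r)", OF _ _ _ _ ell_at_top])
    show "finite (Ls n)" for n unfolding Ls_def by (intro finite_Plus) auto
    show "bs n l \<in> borel_measurable borel" for n l
      unfolding bs_def by (cases l) (auto intro: measurable_compose[OF t1m])
    show "\<forall>\<^sub>F n in sequentially. s2 * card (Ls n) \<le> s2 * (CARD('q) + r) * xn n powr (1/2)"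
      using ev2
    proof eventually_elim
      case (elim n)
      have x1: "1 \<le> xn n powr (1/2)" using xn_ge_1[OF elim] by (simp add: ge_one_powr_ge_zero)
      have "real (card (Ls n)) = CARD('q) * 1 + real r * real (2 ^ J n)" unfolding Ls_def by (subst card_Plus) auto
      also have "\<dots> \<le> CARD('q) * xn n powr (1/2) + r * xn n powr (1/2)"
        by (intro add_mono mult_left_mono dim_le elim) (use x1 in auto)
      finally have "s2 * card (Ls n) \<le> s2 * (CARD('q) * xn n powr (1/2) + r * xn n powr (1/2))" using s2 by (intro mult_left_mono) auto
      then show ?case by (simp add: algebra_simps)
    qed
  qed (use \<rho>_pos in auto)
  then show ?thesis
  proof (rule whp_mono, intro always_eventually allI ballI impI)
    fix n \<omega> c v
    assume H: "\<forall>\<kappa> w. (\<forall>i<n. w i = (\<Sum>l\<in>Ls n. \<kappa> l * bs n l (fst (\<omega> i)))) \<longrightarrow>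
       \<bar>\<Sum>i<n. snd (\<omega> i) * w i\<bar> \<le> sqrt (ell n * xn n powr (1/2)) * sqrt (\<Sum>i<n. (w i)\<^sup>2)"
      and v: "v \<in> ppoly_space r (2 ^ J n)"
    obtain \<kappa> where \<kappa>: "\<And>t. v t = (\<Sum>l\<in>{1..2 ^ J n} \<times> {..<r}. \<kappa> l * ppoly_basis (2 ^ J n) l t)"
      using ppoly_span[OF r v] by blast
    let ?w = "\<lambda>i. (\<Sum>j\<in>I. c j * xx (\<omega> i) j) + v (tt (\<omega> i))"
    have "?w i = (\<Sum>l\<in>Ls n. case_sum (\<lambda>j. if j \<in> I then c j else 0) \<kappa> l * bs n l (fst (\<omega> i)))" for i
    proof -
      have "(\<Sum>j\<in>I. c j * xx (\<omega> i) j) = (\<Sum>j\<in>UNIV. (if j \<in> I then c j else 0) * xx (\<omega> i) j)"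
        by (rule sum.mono_neutral_cong_left) auto
      then show ?thesis unfolding Lsum by (simp add: bs_def \<kappa>)
    qed
    then show "\<bar>ip n (\<lambda>i. snd (\<omega> i)) ?w\<bar> \<le> Th1 n * nm n ?w"
      using H[rule_format, of ?w "case_sum (\<lambda>j. if j \<in> I then c j else 0) \<kappa>"] by (simp add: ip_def nm_def Th1_def)
  qed
qed

lemma rate_f: "\<exists>C. \<forall>\<^sub>F n in sequentially. n * (\<integral>v. (fa (k0 n) (tt v) - f (tt v))\<^sup>2 \<partial>\<nu>) \<le> C * \<rho>2 n"
proof (intro exI[of _ "Cf * 2 powr (2 * \<alpha>)"], use ev2 in eventually_elim)
  case (elim n)
  have "(\<integral>v. (fa (k0 n) (tt v) - f (tt v))\<^sup>2 \<partial>\<nu>) \<le> Cf * (2 ^ k0 n) powr (- (2 * \<alpha>))" by (rule fa)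
  also have "\<dots> \<le> Cf * (2 powr (2 * \<alpha>) * xn n powr (- (\<eta> * (2 * \<alpha>))))"
    using \<eta> \<alpha> by (intro mult_left_mono kap_powr_le elim Cf) auto
  also have "\<dots> \<le> Cf * (2 powr (2 * \<alpha>) * xn n powr (- (2 * a)))"
    using xn_ge_1[OF elim] a(2) Cf by (intro mult_left_mono powr_mono) (auto simp: mult_ac)
  finally have "n * (\<integral>v. (fa (k0 n) (tt v) - f (tt v))\<^sup>2 \<partial>\<nu>) \<le> n * (Cf * (2 powr (2 * \<alpha>) * xn n powr (- (2 * a))))"
    by (intro mult_left_mono) auto
  then show ?case by (simp add: \<rho>2_def mult_ac)
qed

text \<open>The sum over the grids has the order of its coarsest term, xn^(- 2 \<gamma> / b), and a
  \<le> \<gamma> / b puts it within \<open>\<rho>2\<close>. The lower end \<open>k1\<close> of the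
  admissible range thus dictates \<gamma> > b/4.\<close>

lemma rate_\<theta>: "\<exists>C. \<forall>\<^sub>F n in sequentially. (\<Sum>\<kappa>\<in>{k1 n..J n}. n * (\<integral>v. (\<theta> j (tt v) - ph j \<kappa> (tt v))\<^sup>2 \<partial>\<nu>)) \<le> C * \<rho>2 n"
proof -
  define c where "c = 1 / (1 - (1/2) powr (2 * \<gamma>))"
  have \<gamma>0: "\<gamma> > 0" using \<gamma> b by linarith
  have c0: "c \<ge> 0" using powr_less_mono2[of "2 * \<gamma>" "1/2" 1] \<gamma>0 by (simp add: c_def)
  show ?thesis
  proof (intro exI[of _ "C\<theta> * (2 powr (2 * \<gamma>) * c)"], use ev2 in eventually_elim)
    case (elim n)
    have "(\<Sum>\<kappa>\<in>{k1 n..J n}. n * (\<integral>v. (\<theta> j (tt v) - ph j \<kappa> (tt v))\<^sup>2 \<partial>\<nu>)) \<le>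
      (\<Sum>\<kappa>\<in>{k1 n..J n}. n * (C\<theta> * (2 ^ \<kappa>) powr (- (2 * \<gamma>))))"
      by (intro sum_mono mult_left_mono ph) auto
    also have "\<dots> = n * C\<theta> * (\<Sum>\<kappa>\<in>{k1 n..J n}. (2 ^ \<kappa>) powr (- (2 * \<gamma>)))"
      by (simp add: sum_distrib_left mult_ac)
    also have "\<dots> \<le> n * C\<theta> * ((2 ^ k1 n) powr (- (2 * \<gamma>)) * c)"
      using sum_dyadic_powr_le[of "2 * \<gamma>"] \<gamma>0 C\<theta> unfolding c_def by (intro mult_left_mono) auto
    also have "\<dots> \<le> n * C\<theta> * ((2 powr (2 * \<gamma>) * xn n powr (- (1 / b * (2 * \<gamma>)))) * c)"
      using \<gamma>0 b c0 C\<theta> by (intro mult_left_mono mult_right_mono kap_powr_le elim) auto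
    also have "\<dots> \<le> n * C\<theta> * ((2 powr (2 * \<gamma>) * xn n powr (- (2 * a))) * c)"
      using xn_ge_1[OF elim] a(3) C\<theta> c0 by (intro mult_left_mono mult_right_mono powr_mono) auto
    finally show ?case by (simp add: \<rho>2_def mult_ac)
  qed
qed

lemma whp_f_approx: "whp P (\<lambda>n \<omega>. nm n (\<lambda>i. fa (k0 n) (tt (\<omega> i)) - f (tt (\<omega> i))) \<le> Th2 n)"
proof -
  obtain C where C: "\<forall>\<^sub>F n in sequentially. n * (\<integral>v. (fa (k0 n) (tt v) - f (tt v))\<^sup>2 \<partial>\<nu>) \<le> C * \<rho>2 n" using rate_f by blast
  have "whp P (\<lambda>n \<omega>. \<forall>k\<in>{k0 n}. (\<Sum>i<n. (fa k (tt (\<omega> i)) - f (tt (\<omega> i)))\<^sup>2) \<le> ell n * \<rho>2 n)"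
    by (rule whp_family_mean[OF prob_space_axioms _ _ _ _ \<rho>_pos(1) ell_at_top, where \<psi> = "\<lambda>n k v. (fa k (tt v) - f (tt v))\<^sup>2" and C = C])
       (use C fa in auto)
  then show ?thesis by (rule whp_mono) (auto simp: nm_def Th2_def)
qed

lemma whp_\<theta>_approx: "whp P (\<lambda>n \<omega>. \<forall>\<kappa>\<in>{k1 n..J n}. nm n (\<lambda>i. \<theta> j (tt (\<omega> i)) - ph j \<kappa> (tt (\<omega> i))) \<le> Th2 n)"
proof -
  obtain C where C: "\<forall>\<^sub>F n in sequentially. (\<Sum>\<kappa>\<in>{k1 n..J n}. n * (\<integral>v. (\<theta> j (tt v) - ph j \<kappa> (tt v))\<^sup>2 \<partial>\<nu>)) \<le> C * \<rho>2 n" using rate_\<theta> by blast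
  have "whp P (\<lambda>n \<omega>. \<forall>k\<in>{k1 n..J n}. (\<Sum>i<n. (\<theta> j (tt (\<omega> i)) - ph j k (tt (\<omega> i)))\<^sup>2) \<le> ell n * \<rho>2 n)"
    by (rule whp_family_mean[OF prob_space_axioms _ _ _ _ \<rho>_pos(1) ell_at_top, where \<psi> = "\<lambda>n k v. (\<theta> j (tt v) - ph j k (tt v))\<^sup>2" and C = C])
       (use C ph in auto)
  then show ?thesis by (rule whp_mono) (auto simp: nm_def Th2_def)
qed

lemma whp_error_\<theta>_approx: "whp P (\<lambda>n \<omega>. \<forall>\<kappa>\<in>{k1 n..J n}. \<bar>ip n (\<lambda>i. snd (\<omega> i)) (\<lambda>i. \<theta> j (tt (\<omega> i)) - ph j \<kappa> (tt (\<omega> i)))\<bar> \<le> Th2 n)"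
proof -
  obtain C where C: "\<forall>\<^sub>F n in sequentially. (\<Sum>\<kappa>\<in>{k1 n..J n}. n * (\<integral>v. (\<theta> j (tt v) - ph j \<kappa> (tt v))\<^sup>2 \<partial>\<nu>)) \<le> C * \<rho>2 n" using rate_\<theta> by blast
  have q: "integrable \<nu> (\<lambda>v. (snd v * (\<theta> j (tt v) - ph j k (tt v)))\<^sup>2)"
    "(\<integral>v. (snd v * (\<theta> j (tt v) - ph j k (tt v)))\<^sup>2 \<partial>\<nu>) = s2 * (\<integral>v. (\<theta> j (tt v) - ph j k (tt v))\<^sup>2 \<partial>\<nu>)"
    "(\<integral>v. snd v * (\<theta> j (tt v) - ph j k (tt v)) \<partial>\<nu>) = 0" for k
    by (rule W_L2[of "\<lambda>z. \<theta> j (snd z) - ph j k (snd z)", OF _ ph(2)[of j k]], measurable)+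
  have "whp P (\<lambda>n \<omega>. \<forall>k\<in>{k1 n..J n}. \<bar>\<Sum>i<n. snd (\<omega> i) * (\<theta> j (tt (\<omega> i)) - ph j k (tt (\<omega> i)))\<bar> \<le> sqrt (ell n * \<rho>2 n))"
  proof (rule whp_family_square[OF prob_space_axioms _ _ _ _ _ \<rho>_pos(1) ell_at_top, where \<psi> = "\<lambda>n k v. snd v * (\<theta> j (tt v) - ph j k (tt v))" and C = "s2 * C"])
    show "\<forall>\<^sub>F n in sequentially. (\<Sum>k\<in>{k1 n..J n}. n * (\<integral>v. (snd v * (\<theta> j (tt v) - ph j k (tt v)))\<^sup>2 \<partial>\<nu>)) \<le> s2 * C * \<rho>2 n"
      using C
    proof eventually_elim
      case (elim n)
      from mult_left_mono[OF elim s2] show ?case by (simp add: q sum_distrib_left mult_ac)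
    qed
  qed (use q in auto)
  then show ?thesis by (rule whp_mono) (auto simp: ip_def Th2_def)
qed

text \<open>A function of T times \<open>\<xi> j\<close> is centred, so its sum over the sample has
  size n^(1/2) times the L2 norm of the function instead of n times it. This is why the cross terms
  of approximation errors with X - \<theta>(T) are negligible.\<close>

lemma sq_\<xi>: assumes "g \<in> borel_measurable borel" "integrable \<nu> (\<lambda>v. (g (tt v))\<^sup>2)"
  shows "integrable \<nu> (\<lambda>v. (g (tt v) * \<xi> j v)\<^sup>2)" "(\<integral>v. (g (tt v) * \<xi> j v)\<^sup>2 \<partial>\<nu>) \<le> B0\<^sup>2 * (\<integral>v. (g (tt v))\<^sup>2 \<partial>\<nu>)"
    "(\<integral>v. g (tt v) * \<xi> j v \<partial>\<nu>) = 0"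
proof -
  have [measurable]: "g \<in> borel_measurable borel" by fact
  show "integrable \<nu> (\<lambda>v. (g (tt v) * \<xi> j v)\<^sup>2)" "(\<integral>v. (g (tt v) * \<xi> j v)\<^sup>2 \<partial>\<nu>) \<le> B0\<^sup>2 * (\<integral>v. (g (tt v))\<^sup>2 \<partial>\<nu>)"
    using \<xi>_sq_le[OF assms(2), of j] by (simp_all add: power_mult_distrib mult.commute)
  have "integrable \<nu> (\<lambda>v. g (tt v))" by (rule L2_imp_int) (use assms in auto)
  then show "(\<integral>v. g (tt v) * \<xi> j v \<partial>\<nu>) = 0" using orth[OF assms(1), of j] by (simp add: mult.commute)
qed

lemma whp_f_approx_\<xi>: "whp P (\<lambda>n \<omega>. \<bar>ip n (\<lambda>i. fa (k0 n) (tt (\<omega> i)) - f (tt (\<omega> i))) (\<lambda>i. \<xi> j (\<omega> i))\<bar> \<le> Th2 n)"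
proof -
  obtain C where C: "\<forall>\<^sub>F n in sequentially. n * (\<integral>v. (fa (k0 n) (tt v) - f (tt v))\<^sup>2 \<partial>\<nu>) \<le> C * \<rho>2 n" using rate_f by blast
  note q = sq_\<xi>[of "\<lambda>t. fa k t - f t" for k, OF _ fa(2)]
  have "whp P (\<lambda>n \<omega>. \<forall>k\<in>{k0 n}. \<bar>\<Sum>i<n. (fa k (tt (\<omega> i)) - f (tt (\<omega> i))) * \<xi> j (\<omega> i)\<bar> \<le> sqrt (ell n * \<rho>2 n))"
  proof (rule whp_family_square[OF prob_space_axioms _ _ _ _ _ \<rho>_pos(1) ell_at_top, where \<psi> = "\<lambda>n k v. (fa k (tt v) - f (tt v)) * \<xi> j v" and C = "B0\<^sup>2 * C"])
    show "\<forall>\<^sub>F n in sequentially. (\<Sum>k\<in>{k0 n}. n * (\<integral>v. ((fa k (tt v) - f (tt v)) * \<xi> j v)\<^sup>2 \<partial>\<nu>)) \<le> B0\<^sup>2 * C * \<rho>2 n"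
      using C
    proof eventually_elim
      case (elim n)
      have "(\<Sum>k\<in>{k0 n}. n * (\<integral>v. ((fa k (tt v) - f (tt v)) * \<xi> j v)\<^sup>2 \<partial>\<nu>)) \<le> n * (B0\<^sup>2 * (\<integral>v. (fa (k0 n) (tt v) - f (tt v))\<^sup>2 \<partial>\<nu>))"
        using q(2) by (simp add: mult_left_mono)
      then show ?case using mult_left_mono[OF elim, of "B0\<^sup>2"] by (simp add: mult_ac)
    qed
  qed (use q in auto)
  then show ?thesis by (rule whp_mono) (auto simp: ip_def Th2_def)
qed

lemma whp_\<theta>_approx_\<xi>: "whp P (\<lambda>n \<omega>. \<forall>\<kappa>\<in>{k1 n..J n}. \<bar>ip n (\<lambda>i. \<theta> k (tt (\<omega> i)) - ph k \<kappa> (tt (\<omega> i))) (\<lambda>i. \<xi> j (\<omega> i))\<bar> \<le> Th2 n)"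
proof -
  obtain C where C: "\<forall>\<^sub>F n in sequentially. (\<Sum>\<kappa>\<in>{k1 n..J n}. n * (\<integral>v. (\<theta> k (tt v) - ph k \<kappa> (tt v))\<^sup>2 \<partial>\<nu>)) \<le> C * \<rho>2 n" using rate_\<theta> by blast
  note q = sq_\<xi>[of "\<lambda>t. \<theta> k t - ph k \<kappa> t" for \<kappa>, OF _ ph(2)]
  have "whp P (\<lambda>n \<omega>. \<forall>\<kappa>\<in>{k1 n..J n}. \<bar>\<Sum>i<n. (\<theta> k (tt (\<omega> i)) - ph k \<kappa> (tt (\<omega> i))) * \<xi> j (\<omega> i)\<bar> \<le> sqrt (ell n * \<rho>2 n))"
  proof (rule whp_family_square[OF prob_space_axioms _ _ _ _ _ \<rho>_pos(1) ell_at_top, where \<psi> = "\<lambda>n \<kappa> v. (\<theta> k (tt v) - ph k \<kappa> (tt v)) * \<xi> j v" and C = "B0\<^sup>2 * C"])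
    show "\<forall>\<^sub>F n in sequentially. (\<Sum>\<kappa>\<in>{k1 n..J n}. n * (\<integral>v. ((\<theta> k (tt v) - ph k \<kappa> (tt v)) * \<xi> j v)\<^sup>2 \<partial>\<nu>)) \<le> B0\<^sup>2 * C * \<rho>2 n"
      using C
    proof eventually_elim
      case (elim n)
      have "(\<Sum>\<kappa>\<in>{k1 n..J n}. n * (\<integral>v. ((\<theta> k (tt v) - ph k \<kappa> (tt v)) * \<xi> j v)\<^sup>2 \<partial>\<nu>)) \<le>
          (\<Sum>\<kappa>\<in>{k1 n..J n}. n * (B0\<^sup>2 * (\<integral>v. (\<theta> k (tt v) - ph k \<kappa> (tt v))\<^sup>2 \<partial>\<nu>)))"
        using q(2) by (intro sum_mono mult_left_mono) auto
      then show ?case using mult_left_mono[OF elim, of "B0\<^sup>2"] by (simp add: mult_ac sum_distrib_left)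
    qed
  qed (use q in auto)
  then show ?thesis by (rule whp_mono) (auto simp: ip_def Th2_def)
qed

lemma whp_gram: "whp P (\<lambda>n \<omega>. \<bar>ip n (\<lambda>i. \<xi> k (\<omega> i)) (\<lambda>i. \<xi> j (\<omega> i)) - real n * \<Sigma> k j\<bar> \<le> Th3 n)"
proof -
  let ?\<psi> = "\<lambda>v. \<xi> k v * \<xi> j v - \<Sigma> k j"
  have i1: "integrable \<nu> (\<lambda>v. \<xi> k v * \<xi> j v)" by (rule \<xi>_mult_int[OF \<xi>_int])
  have ae: "AE v in \<nu>. norm ((?\<psi> v)\<^sup>2) \<le> (B0\<^sup>2 + \<bar>\<Sigma> k j\<bar>)\<^sup>2"
    using bnd_\<xi>[of j] bnd_\<xi>[of k]
  proof eventually_elim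
    case (elim v)
    have "\<bar>\<xi> k v * \<xi> j v\<bar> \<le> B0 * B0" unfolding abs_mult using elim B0 by (intro mult_mono) auto
    moreover have "\<bar>?\<psi> v\<bar> \<le> \<bar>\<xi> k v * \<xi> j v\<bar> + \<bar>\<Sigma> k j\<bar>" by (rule abs_triangle_ineq4)
    ultimately have "\<bar>?\<psi> v\<bar> \<le> B0\<^sup>2 + \<bar>\<Sigma> k j\<bar>" by (simp only: power2_eq_square)
    from power_mono[OF this, of 2] show ?case by (simp only: power2_abs real_norm_def abs_power2 abs_ge_zero)
  qed
  have i2: "integrable \<nu> (\<lambda>v. (?\<psi> v)\<^sup>2)" by (rule integrable_const_bound[OF ae]) measurable
  have m0: "(\<integral>v. ?\<psi> v \<partial>\<nu>) = 0" using i1 by (simp add: \<Sigma> prob_space)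
  \<comment> \<open>A family with one member; the index \<open>u\<close> is a dummy.\<close>
  have "whp P (\<lambda>n \<omega>. \<forall>u\<in>{0::nat}. \<bar>\<Sum>i<n. ?\<psi> (\<omega> i)\<bar> \<le> sqrt (ell n * real n))"
    by (rule whp_family_square[OF prob_space_axioms _ _ _ _ _ \<rho>_pos(3) ell_at_top, where \<psi> = "\<lambda>n u v. ?\<psi> v" and C = "\<integral>v. (?\<psi> v)\<^sup>2 \<partial>\<nu>"])
       (use i2 m0 in \<open>auto simp: mult.commute\<close>)
  then show ?thesis by (rule whp_mono) (auto simp: ip_def Th3_def sum_subtractf)
qed

lemma whp_score: "whp P (\<lambda>n \<omega>. \<bar>ip n (\<lambda>i. snd (\<omega> i)) (\<lambda>i. \<xi> j (\<omega> i))\<bar> \<le> Th3 n)"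
proof -
  let ?\<psi> = "\<lambda>v. snd v * \<xi> j v"
  have i2: "integrable \<nu> (\<lambda>v. (?\<psi> v)\<^sup>2)"
    using W2[of "\<lambda>z. (fst z $ j - \<theta> j (snd z))\<^sup>2"] \<xi>_sq_le(1)[of "\<lambda>_. 1" j] by (simp add: power_mult_distrib)
  have m0: "(\<integral>v. ?\<psi> v \<partial>\<nu>) = 0" using W1[of "\<lambda>z. fst z $ j - \<theta> j (snd z)"] \<xi>_int[of j] by simp
  have "whp P (\<lambda>n \<omega>. \<forall>u\<in>{0::nat}. \<bar>\<Sum>i<n. ?\<psi> (\<omega> i)\<bar> \<le> sqrt (ell n * real n))"
    by (rule whp_family_square[OF prob_space_axioms _ _ _ _ _ \<rho>_pos(3) ell_at_top, where \<psi> = "\<lambda>n u v. ?\<psi> v" and C = "\<integral>v. (?\<psi> v)\<^sup>2 \<partial>\<nu>"])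
       (use i2 m0 in \<open>auto simp: mult.commute\<close>)
  then show ?thesis by (rule whp_mono) (auto simp: ip_def Th3_def)
qed

lemma whp_f_norm: "whp P (\<lambda>n \<omega>. nm n (\<lambda>i. f (tt (\<omega> i))) \<le> Th3 n)"
proof -
  have "whp P (\<lambda>n \<omega>. \<forall>u\<in>{0::nat}. (\<Sum>i<n. (f (tt (\<omega> i)))\<^sup>2) \<le> ell n * real n)"
    by (rule whp_family_mean[OF prob_space_axioms _ _ _ _ \<rho>_pos(3) ell_at_top, where \<psi> = "\<lambda>n u v. (f (tt v))\<^sup>2" and C = "\<integral>v. (f (tt v))\<^sup>2 \<partial>\<nu>"])
       (use fL2 in \<open>auto simp: mult.commute\<close>)
  then show ?thesis by (rule whp_mono) (auto simp: nm_def Th3_def)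
qed

lemma whp_bounded: "whp P (\<lambda>n \<omega>. \<forall>i<n. \<forall>j. \<bar>xx (\<omega> i) j\<bar> \<le> B0 \<and> \<bar>\<xi> j (\<omega> i)\<bar> \<le> B0)"
proof (rule whp_AE)
  fix n :: nat
  have "AE \<omega> in P n. \<forall>i\<in>{..<n}. \<forall>j. \<bar>xx (\<omega> i) j\<bar> \<le> B0 \<and> \<bar>\<xi> j (\<omega> i)\<bar> \<le> B0"
  proof (rule AE_finite_allI)
    fix i assume i: "i \<in> {..<n}"
    show "AE \<omega> in P n. \<forall>j. \<bar>xx (\<omega> i) j\<bar> \<le> B0 \<and> \<bar>\<xi> j (\<omega> i)\<bar> \<le> B0"
      using AE_PiM_component[of "{..<n}" "\<lambda>_. \<nu>", OF prob_space_axioms i bnd] .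
  qed simp
  then show "AE \<omega> in P n. \<forall>i<n. \<forall>j. \<bar>xx (\<omega> i) j\<bar> \<le> B0 \<and> \<bar>\<xi> j (\<omega> i)\<bar> \<le> B0" by (simp only: Ball_def lessThan_iff)
qed

text \<open>There are of the order of (n / log n)^(1/2) parts, each of probability at least a
  constant times (log n / n)^(1/2), so the union bound is about exp(- c (n log n)^(1/2)) times their
  number. Splitting each cell into 2r parts provides the separated points that interpolation of
  degree r - 1 needs.\<close>

lemma whp_cells_hit: "whp P (\<lambda>n \<omega>. \<forall>g < 2 * r * 2 ^ J n. \<exists>i<n. tt (\<omega> i) \<in> {real g / real (2 * r * 2 ^ J n) ..< (real g + 1) / real (2 * r * 2 ^ J n)})"
proof -
  let ?m = "\<lambda>n. 2 * r * 2 ^ J n"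
  let ?S = "\<lambda>n g. {real g / real (?m n) ..< (real g + 1) / real (?m n)}"
  let ?B = "\<lambda>n. {\<omega>\<in>space (P n). \<exists>g<?m n. \<forall>i<n. tt (\<omega> i) \<notin> ?S n g}"
  have q: "c0 / real (?m n) \<le> prob {v\<in>space \<nu>. tt v \<in> ?S n g}" if "g < ?m n" for n g
  proof -
    have m0: "real (?m n) > 0" using r by simp
    have "real g + 1 \<le> real (?m n)" using that by linarith
    then have "(real g + 1) / real (?m n) \<le> 1" using m0 by (simp del: of_nat_mult of_nat_power)
    then have "c0 * ((real g + 1) / real (?m n) - real g / real (?m n)) \<le> prob {v\<in>space \<nu>. tt v \<in> ?S n g}"
      using m0 by (intro tc) (auto simp: divide_right_mono simp del: of_nat_mult of_nat_power)
    then show ?thesis by (simp add: diff_divide_distrib[symmetric] del: of_nat_mult of_nat_power)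
  qed
  have Sm: "?S n g \<in> sets borel" for n g by simp
  show ?thesis unfolding whp_def
  proof (intro exI[of _ ?B] conjI allI always_eventually ballI impI)
    show "?B n \<in> sets (P n)" for n by (rule miss_prob(1)[OF tm Sm q])
    let ?u = "\<lambda>n. 2 * real r * xn n powr (1/2)"
    show "(\<lambda>n. measure (P n) (?B n)) \<longlonglongrightarrow> 0"
    proof (rule tendsto_sandwich[of "\<lambda>_. 0"])
      show "\<forall>\<^sub>F n in sequentially. measure (P n) (?B n) \<le> ?u n * exp (- (real n * c0 / ?u n))"
        using ev2
      proof eventually_elim
        case (elim n)
        have m: "real (?m n) \<le> ?u n" using mult_left_mono[OF dim_le[OF elim], of "2 * real r"] by simp
        have m0: "real (?m n) > 0" using r by simp
        have "measure (P n) (?B n) \<le> real (?m n) * exp (- (real n * (c0 / real (?m n))))" by (rule miss_prob(2)[OF tm Sm q])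
        also have "\<dots> \<le> ?u n * exp (- (real n * c0 / ?u n))"
        proof (rule mult_mono)
          have "real n * c0 / ?u n \<le> real n * c0 / real (?m n)" using m m0 c0 by (intro divide_left_mono mult_pos_pos order.strict_trans2[OF m0 m]) auto
          then show "exp (- (real n * (c0 / real (?m n)))) \<le> exp (- (real n * c0 / ?u n))" by (simp only: exp_le_cancel_iff neg_le_iff_le times_divide_eq_right)
        qed (use m in auto)
        finally show ?case .
      qed
      have "real r > 0" using r by simp
      then show "(\<lambda>n. ?u n * exp (- (real n * c0 / ?u n))) \<longlonglongrightarrow> 0" using c0 unfolding xn_def by real_asymp
    qed auto
  next
    fix n \<omega> g assume "\<omega> \<in> space (P n) - ?B n" "g < ?m n"
    then show "\<exists>i<n. tt (\<omega> i) \<in> ?S n g" by blast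
  qed
qed

end

section \<open>Asymptotic linearity of the estimator\<close>

lemma sub_fun_lincomb:
  "sub_fun I (\<lambda>k. a k + c * d k) (\<lambda>t. 1 * v t + c * w t) z = sub_fun I a v z + c * sub_fun I d w z"
  by (simp add: sub_fun_def case_prod_unfold distrib_right sum.distrib sum_distrib_left algebra_simps)

lemma minimal_orthogonal:
  fixes e w :: "nat \<Rightarrow> real"
  assumes "\<And>c. (\<Sum>i<n. (e i)\<^sup>2) \<le> (\<Sum>i<n. (e i - c * w i)\<^sup>2)"
  shows "(\<Sum>i<n. e i * w i) = 0"
proof -
  define S where "S = (\<Sum>i<n. e i * w i)"
  define Q where "Q = (\<Sum>i<n. (w i)\<^sup>2)"
  have Q: "Q \<ge> 0" unfolding Q_def by (intro sum_nonneg) auto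
  have *: "2 * c * S \<le> c\<^sup>2 * Q" for c
  proof -
    have "(\<Sum>i<n. (e i - c * w i)\<^sup>2) = (\<Sum>i<n. (e i)\<^sup>2) - 2 * c * S + c\<^sup>2 * Q"
      unfolding S_def Q_def by (simp add: power2_diff power_mult_distrib sum.distrib sum_subtractf sum_distrib_left mult_ac)
    then show ?thesis using assms[of c] by linarith
  qed
  \<comment> \<open>The optimal step would be S / Q; the denominator Q + 1 avoids a separate case Q
    = 0.\<close>
  define c where "c = S / (Q + 1)"
  have S: "S = c * (Q + 1)" using Q by (simp add: c_def)
  have "c\<^sup>2 * (Q + 2) \<le> 0" using *[of c] unfolding S by (simp add: power2_eq_square algebra_simps)
  moreover have "c\<^sup>2 * (Q + 2) \<ge> c\<^sup>2 * 2" using Q by (intro mult_left_mono) auto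
  ultimately have "c\<^sup>2 \<le> 0" by linarith
  then have "S = 0" by (simp add: S)
  then show ?thesis unfolding S_def by simp
qed

text \<open>Within one grid the penalty is constant, so the penalized fit is a least squares fit
  there and no direction of the same space lowers the contrast.\<close>

lemma pls_fit_normal:
  assumes fit: "pls_fit b I n D K (sub_fun I a v)" and n: "n > 0" and K: "K > 0"
    and v: "v \<in> ppoly_space (r_of b) K" and w: "w \<in> ppoly_space (r_of b) K"
  shows "(\<Sum>i<n. (snd (D i) - sub_fun I a v (fst (D i))) * sub_fun I d w (fst (D i))) = 0"
proof (rule minimal_orthogonal)
  fix c
  let ?u = "sub_fun I (\<lambda>k. a k + c * d k) (\<lambda>t. 1 * v t + c * w t)"
  have "?u \<in> approx_space (r_of b) I K" unfolding approx_space_def using ppoly_lincomb[OF K v w, of 1 c] by blast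
  then have "emp_contrast n D (sub_fun I a v) \<le> emp_contrast n D ?u"
    using fit unfolding pls_fit_def by force
  then show "(\<Sum>i<n. (snd (D i) - sub_fun I a v (fst (D i)))\<^sup>2)
      \<le> (\<Sum>i<n. (snd (D i) - sub_fun I a v (fst (D i)) - c * sub_fun I d w (fst (D i)))\<^sup>2)"
    using n by (simp add: emp_contrast_def sub_fun_lincomb[of I a c d v w, simplified] divide_le_cancel diff_diff_eq)
qed

text \<open>By the Pythagorean identity an equally good fit takes the same values on the sample, and
  \<open>inj\<close> turns this into equality of the coefficients on \<open>I\<close> and of the
  functions of t.\<close>

lemma pls_fit_ls_unique:
  assumes fit: "pls_fit b I n D K (sub_fun I a v)" and n: "n > 0" and K: "K > 0"
    and v: "v \<in> ppoly_space (r_of b) K"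
    and inj: "\<And>d w. w \<in> ppoly_space (r_of b) K \<Longrightarrow> (\<And>i. i < n \<Longrightarrow> sub_fun I d w (fst (D i)) = 0) \<Longrightarrow>
       (\<forall>l\<in>I. d l = 0) \<and> w = (\<lambda>_. 0)"
  shows "ls_unique b I n D K (sub_fun I a v)"
  unfolding ls_unique_def
proof (intro ballI impI)
  fix u' assume "u' \<in> approx_space (r_of b) I K" and le: "emp_contrast n D u' \<le> emp_contrast n D (sub_fun I a v)"
  then obtain a' v' where u': "u' = sub_fun I a' v'" and v': "v' \<in> ppoly_space (r_of b) K"
    unfolding approx_space_def by blast
  let ?d = "\<lambda>k. a' k + (- 1) * a k" and ?w = "\<lambda>t. 1 * v' t + (- 1) * v t"
  have w: "?w \<in> ppoly_space (r_of b) K" by (rule ppoly_lincomb[OF K v' v])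
  have dw: "sub_fun I ?d ?w z = u' z - sub_fun I a v z" for z unfolding sub_fun_lincomb u' by simp
  let ?e = "\<lambda>i. snd (D i) - sub_fun I a v (fst (D i))" and ?g = "\<lambda>i. u' (fst (D i)) - sub_fun I a v (fst (D i))"
  have orth: "(\<Sum>i<n. ?e i * ?g i) = 0" using pls_fit_normal[OF fit n K v w, of ?d] unfolding dw .
  have "(\<Sum>i<n. (snd (D i) - u' (fst (D i)))\<^sup>2) = (\<Sum>i<n. (?e i)\<^sup>2 + (?g i)\<^sup>2 - 2 * (?e i * ?g i))"
    by (intro sum.cong refl) (simp add: power2_eq_square algebra_simps)
  also have "\<dots> = (\<Sum>i<n. (?e i)\<^sup>2) + (\<Sum>i<n. (?g i)\<^sup>2)"
    using orth by (simp add: sum.distrib sum_subtractf flip: sum_distrib_left)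
  finally have "(\<Sum>i<n. (?g i)\<^sup>2) \<le> 0"
    using le n by (simp add: emp_contrast_def divide_le_cancel)
  then have "(\<Sum>i<n. (?g i)\<^sup>2) = 0" by (intro antisym sum_nonneg) auto
  then have "\<forall>i<n. ?g i = 0" by (simp add: sum_nonneg_eq_0_iff)
  then have "(\<forall>l\<in>I. ?d l = 0) \<and> ?w = (\<lambda>_. 0)" by (intro inj w) (simp only: dw)
  then have "\<forall>l\<in>I. a' l = a l" "v' = v" by (auto simp: fun_eq_iff)
  then show "u' = sub_fun I a v" unfolding u' sub_fun_def by (auto simp: fun_eq_iff intro!: sum.cong)
qed

text \<open>A uniform bound on the strip, multiplied by the root of its finite volume; it will be
  compared with the truncation threshold.\<close>

lemma L2_norm_sub_fun_le:
  fixes \<K> :: "(real^'q::finite) set"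
  assumes \<K>: "compact \<K>" and x: "\<And>x j. x \<in> \<K> \<Longrightarrow> \<bar>x $ j\<bar> \<le> B0" and v: "v \<in> ppoly_space r K"
    and vb: "\<And>t. \<bar>v t\<bar> \<le> Bv" and a: "(\<Sum>j\<in>I. \<bar>a j\<bar>) \<le> Ba" and B0: "B0 \<ge> 0"
  shows "L2_norm_of (restrict_space lborel (\<K> \<times> {0..1})) (sub_fun I a v) \<le>
    ereal (sqrt (measure lborel (\<K> \<times> {0..1::real})) * (Ba * B0 + Bv))"
proof -
  let ?S = "\<K> \<times> {0..1::real}" and ?u = "sub_fun I a v"
  have cS: "compact ?S" using \<K> by (intro compact_Times) auto
  then have S[measurable]: "?S \<in> sets borel" by (simp add: borel_compact)
  have fin: "emeasure lborel ?S < \<infinity>" using cS by (rule emeasure_compact_finite)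
  have [measurable]: "v \<in> borel_measurable borel" using ppoly_measurable[OF v] .
  have [measurable]: "(\<lambda>z::(real^'q) \<times> real. fst z $ j) \<in> borel_measurable borel" for j
    by (intro borel_measurable_continuous_onI continuous_intros)
  have [measurable]: "(\<lambda>z::(real^'q) \<times> real. snd z) \<in> borel_measurable borel"
    by (intro borel_measurable_continuous_onI continuous_intros)
  have um: "?u \<in> borel_measurable borel" unfolding sub_fun_def case_prod_unfold by measurable
  have ub: "\<bar>?u z\<bar> \<le> Ba * B0 + Bv" if "z \<in> ?S" for z
  proof -
    have "\<bar>\<Sum>i\<in>I. a i * fst z $ i\<bar> \<le> (\<Sum>i\<in>I. \<bar>a i\<bar> * B0)"
      using that x by (intro order.trans[OF sum_abs] sum_mono) (auto simp: abs_mult intro!: mult_left_mono)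
    also have "\<dots> \<le> Ba * B0" unfolding sum_distrib_right[symmetric] using a B0 by (rule mult_right_mono)
    finally show ?thesis using vb[of "snd z"] by (simp add: sub_fun_def case_prod_unfold)
  qed
  interpret finite_measure "restrict_space lborel ?S"
    by (rule finite_measureI) (use fin S in \<open>simp add: space_restrict_space emeasure_restrict_space\<close>)
  have ms: "?u \<in> borel_measurable (restrict_space lborel ?S)" using um by (intro measurable_restrict_space1) simp
  have sq: "(?u z)\<^sup>2 \<le> (Ba * B0 + Bv)\<^sup>2" if "z \<in> ?S" for z
    using power_mono[OF ub[OF that], of 2] by simp
  have int: "integrable (restrict_space lborel ?S) (\<lambda>z. (?u z)\<^sup>2)"
    using ms sq by (intro integrable_const_bound[where B = "(Ba * B0 + Bv)\<^sup>2"]) (auto intro!: AE_I2 simp: space_restrict_space)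
  have "(\<integral>z. (?u z)\<^sup>2 \<partial>restrict_space lborel ?S) \<le> (\<integral>z. (Ba * B0 + Bv)\<^sup>2 \<partial>restrict_space lborel ?S)"
    using int sq by (intro integral_mono) (auto simp: space_restrict_space)
  also have "\<dots> = measure lborel ?S * (Ba * B0 + Bv)\<^sup>2"
    using S by (simp add: space_restrict_space measure_restrict_space)
  finally have "sqrt (\<integral>z. (?u z)\<^sup>2 \<partial>restrict_space lborel ?S) \<le> sqrt (measure lborel ?S * (Ba * B0 + Bv)\<^sup>2)" by simp
  also have "\<dots> = sqrt (measure lborel ?S) * \<bar>Ba * B0 + Bv\<bar>" by (simp add: real_sqrt_mult)
  also have "\<bar>Ba * B0 + Bv\<bar> = Ba * B0 + Bv"
  proof -
    have "Ba \<ge> 0" by (rule order.trans[OF sum_nonneg a]) simp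
    moreover have "Bv \<ge> 0" using vb[of 0] by linarith
    ultimately show ?thesis using B0 by simp
  qed
  finally show ?thesis using ms int by (simp add: L2_norm_of_def in_L2_def)
qed

section \<open>Limits of the error bounds\<close>

context pl_law
begin

text \<open>The bounds of \<open>pl_design\<close> with the thresholds inserted: \<open>ct\<close>
  stems from the square root of the penalty, \<open>ee\<close> bounds the in-sample error,
  \<open>\<rho>\<rho>\<close> and \<open>\<kappa>\<kappa>\<close> are the two error terms of the
  linear system, \<open>DD\<close> bounds the coefficient error in l1, and \<open>eps\<close> is the
  remainder scaled by n^(1/2). The summand \<open>Th3\<close> next to
  \<open>\<kappa>\<kappa>\<close> is the error of the Gram matrix.\<close>

definition "ct = sqrt (2 * (card I + 1) * real r)"
definition "Rmx = (\<Sum>l\<in>I. \<Sum>j\<in>I. \<bar>R j l\<bar>)"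
definition "ee n = 2 * Th1 n + Th2 n + ct * Th2 n"
definition "\<rho>\<rho> n = 2 * Th2 n + ee n * Th2 n + Th1 n * (ee n + Th2 n)"
definition "\<kappa>\<kappa> n = Th2 n + Th1 n * (B0 * sqrt n + Th2 n)"
definition "DD n = 2 * Rmx * card I * (Th3 n + \<rho>\<rho> n) / n"
definition "eps n = sqrt n * (Rmx * (\<rho>\<rho> n + DD n * (\<kappa>\<kappa> n + Th3 n)) / n)"

text \<open>Up to logarithms \<open>Th1\<close> is n^(1/4), \<open>Th2\<close> is n^(1/2 - a) with a
  > 1/4, and \<open>Th3\<close> is n^(1/2). The first limit is the only one without a power of n to
  spare: there \<open>ell\<close> contributes log^(1/4) against log^(-1/2) from the size of the
  finest grid.\<close>

lemma rate_limits:
  "(\<lambda>n. Th1 n * Th1 n / sqrt n) \<longlonglongrightarrow> 0" "(\<lambda>n. Th1 n * Th2 n / sqrt n) \<longlonglongrightarrow> 0"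
  "(\<lambda>n. Th2 n * Th2 n / sqrt n) \<longlonglongrightarrow> 0" "(\<lambda>n. Th2 n / sqrt n) \<longlonglongrightarrow> 0" 
  "(\<lambda>n. sqrt (ell n) * Th1 n / sqrt n) \<longlonglongrightarrow> 0" "(\<lambda>n. sqrt (ell n) * Th2 n / n) \<longlonglongrightarrow> 0"
  "(\<lambda>n. sqrt (ell n) * (Th1 n * Th2 n) / n) \<longlonglongrightarrow> 0" "(\<lambda>n. sqrt (ell n) * Th3 n / n) \<longlonglongrightarrow> 0"
  "(\<lambda>n. Th1 n / n) \<longlonglongrightarrow> 0" "(\<lambda>n. Th2 n / n) \<longlonglongrightarrow> 0" "(\<lambda>n. Th3 n / n) \<longlonglongrightarrow> 0" 
proof -
  define a' where "a' = a"
  have a': "a' > 1/4" using a(1) by (simp add: a'_def)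
  note d = Th1_def Th2_def Th3_def \<rho>2_def ell_def xn_def a'_def[symmetric]
  show "(\<lambda>n. Th1 n * Th1 n / sqrt n) \<longlonglongrightarrow> 0" unfolding d by real_asymp
  show "(\<lambda>n. Th1 n * Th2 n / sqrt n) \<longlonglongrightarrow> 0" unfolding d using a' by real_asymp
  show "(\<lambda>n. Th2 n * Th2 n / sqrt n) \<longlonglongrightarrow> 0" unfolding d using a' by real_asymp
  show "(\<lambda>n. Th2 n / sqrt n) \<longlonglongrightarrow> 0" unfolding d using a' by real_asymp
  show "(\<lambda>n. sqrt (ell n) * Th1 n / sqrt n) \<longlonglongrightarrow> 0" unfolding d using a' by real_asymp
  show "(\<lambda>n. sqrt (ell n) * Th2 n / n) \<longlonglongrightarrow> 0" unfolding d using a' by real_asymp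
  show "(\<lambda>n. sqrt (ell n) * (Th1 n * Th2 n) / n) \<longlonglongrightarrow> 0" unfolding d using a' by real_asymp
  show "(\<lambda>n. sqrt (ell n) * Th3 n / n) \<longlonglongrightarrow> 0" unfolding d using a' by real_asymp
  show "(\<lambda>n. Th1 n / n) \<longlonglongrightarrow> 0" unfolding d using a' by real_asymp
  show "(\<lambda>n. Th2 n / n) \<longlonglongrightarrow> 0" unfolding d using a' by real_asymp
  show "(\<lambda>n. Th3 n / n) \<longlonglongrightarrow> 0" unfolding d using a' by real_asymp
qed

lemma lim_\<rho>: "(\<lambda>n. \<rho>\<rho> n / sqrt n) \<longlonglongrightarrow> 0"
proof -
  have "(\<lambda>n. 2 * (Th2 n / sqrt n) + (4 + ct) * (Th1 n * Th2 n / sqrt n) + (1 + ct) * (Th2 n * Th2 n / sqrt n) + 2 * (Th1 n * Th1 n / sqrt n))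
      \<longlonglongrightarrow> 2 * 0 + (4 + ct) * 0 + (1 + ct) * 0 + 2 * 0" by (intro tendsto_intros rate_limits)
  moreover have "2 * (Th2 n / sqrt n) + (4 + ct) * (Th1 n * Th2 n / sqrt n) + (1 + ct) * (Th2 n * Th2 n / sqrt n) + 2 * (Th1 n * Th1 n / sqrt n) = \<rho>\<rho> n / sqrt n" for n
    by (simp add: \<rho>\<rho>_def ee_def add_divide_distrib[symmetric] algebra_simps)
  ultimately show ?thesis by simp
qed

lemma Th_nonneg: "n \<ge> 2 \<Longrightarrow> Th1 n \<ge> 0" "n \<ge> 2 \<Longrightarrow> Th2 n \<ge> 0" "n \<ge> 2 \<Longrightarrow> Th3 n \<ge> 0"
  by (auto simp: Th1_def Th2_def Th3_def ell_def \<rho>2_def)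

lemma ev_ell: "\<forall>\<^sub>F n in sequentially. ell n \<ge> 1"
  using ell_at_top by (simp add: filterlim_at_top)

text \<open>In \<open>eps\<close> the relative error of the linear system is multiplied by
  \<open>DD\<close>, whose leading term is of order (ell n / n)^(1/2); the factor
  \<open>sqrt (ell n)\<close> anticipates this.\<close>

lemma lim_\<kappa>: "(\<lambda>n. sqrt (ell n) * ((\<kappa>\<kappa> n + Th3 n) / n)) \<longlonglongrightarrow> 0" "(\<lambda>n. (\<kappa>\<kappa> n + Th3 n) / n) \<longlonglongrightarrow> 0"
proof -
  let ?C = "\<lambda>n. (\<kappa>\<kappa> n + Th3 n) / n"
  have "(\<lambda>n. sqrt (ell n) * Th2 n / n + B0 * (sqrt (ell n) * Th1 n / sqrt n) + sqrt (ell n) * (Th1 n * Th2 n) / n + sqrt (ell n) * Th3 n / n)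
      \<longlonglongrightarrow> 0 + B0 * 0 + 0 + 0" by (intro tendsto_intros rate_limits)
  moreover have "sqrt (ell n) * Th2 n / n + B0 * (sqrt (ell n) * Th1 n / sqrt n) + sqrt (ell n) * (Th1 n * Th2 n) / n + sqrt (ell n) * Th3 n / n
      = sqrt (ell n) * ?C n" for n :: nat
  proof -
    have "1 / sqrt n = sqrt n / n" by (simp add: sqrt_divide_self_eq inverse_eq_divide)
    then have "B0 * (sqrt (ell n) * Th1 n / sqrt n) = B0 * (sqrt (ell n) * Th1 n) * (sqrt n / n)" by (metis times_divide_eq_right mult.right_neutral mult.assoc)
    then show ?thesis by (simp add: \<kappa>\<kappa>_def add_divide_distrib[symmetric] algebra_simps)
  qed
  ultimately show l: "(\<lambda>n. sqrt (ell n) * ?C n) \<longlonglongrightarrow> 0" by simp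
  show "?C \<longlonglongrightarrow> 0"
  proof (rule Lim_null_comparison[OF _ l])
    show "\<forall>\<^sub>F n in sequentially. norm (?C n) \<le> sqrt (ell n) * ?C n"
      using ev_ell ev2
    proof eventually_elim
      case (elim n)
      have "?C n \<ge> 0" unfolding \<kappa>\<kappa>_def using Th_nonneg[OF elim(2)] B0 by simp
      moreover have "1 * ?C n \<le> sqrt (ell n) * ?C n" using elim(1) \<open>?C n \<ge> 0\<close> by (intro mult_right_mono) auto
      ultimately show ?case by simp
    qed
  qed
qed

lemma eps_lim: "eps \<longlonglongrightarrow> 0"
proof -
  let ?A = "\<lambda>n. \<rho>\<rho> n / sqrt n" and ?C = "\<lambda>n. (\<kappa>\<kappa> n + Th3 n) / n"
  have "(\<lambda>n. Rmx * (?A n + 2 * Rmx * card I * (sqrt (ell n) * ?C n + ?A n * ?C n))) \<longlonglongrightarrow> Rmx * (0 + 2 * Rmx * card I * (0 + 0 * 0))"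
    by (intro tendsto_intros lim_\<rho> lim_\<kappa>)
  moreover have "\<forall>\<^sub>F n in sequentially. Rmx * (?A n + 2 * Rmx * card I * (sqrt (ell n) * ?C n + ?A n * ?C n)) = eps n"
    using ev2
  proof eventually_elim
    case (elim n)
    have s: "sqrt n * sqrt n = n" "sqrt n > 0" using elim by auto
    have T: "Th3 n = sqrt (ell n) * sqrt n" by (simp add: Th3_def real_sqrt_mult)
    define q where "q = sqrt n"
    have n: "real n = q * q" "q > 0" using s by (auto simp: q_def)
    define T3 where "T3 = Th3 n"
    have e: "sqrt (ell n) = T3 / q" using T n(2) by (simp add: T3_def q_def)
    show ?case unfolding eps_def DD_def q_def[symmetric] T3_def[symmetric] e n(1) using n(2) by (simp add: field_simps)
  qed
  ultimately show ?thesis by (simp add: tendsto_cong)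
qed

lemma DD_lim: "DD \<longlonglongrightarrow> 0"
proof -
  have "(\<lambda>n. 1 / sqrt (real n)) \<longlonglongrightarrow> 0" by real_asymp
  then have "(\<lambda>n. 2 * Rmx * card I * (Th3 n / n + (\<rho>\<rho> n / sqrt n) * (1 / sqrt n))) \<longlonglongrightarrow> 2 * Rmx * card I * (0 + 0 * 0)"
    by (intro tendsto_intros lim_\<rho> rate_limits)
  moreover have "2 * Rmx * card I * (Th3 n / n + (\<rho>\<rho> n / sqrt n) * (1 / sqrt n)) = DD n" for n
    by (simp add: DD_def add_divide_distrib algebra_simps)
  ultimately show ?thesis by simp
qed

text \<open>The left side will bound the L2 norm of the fit. It is o(n), whereas exp (log^2 n)
  exceeds n for large n, so the truncation does not act on the good event.\<close>

lemma bound_lim: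
  "\<forall>\<^sub>F n in sequentially. c1 * ((DD n + c2) * c3 + c4 * (ee n + Th3 n + DD n * c5)) \<le> 2 * exp ((ln (real n))\<^sup>2)"
proof -
  have z: "(\<lambda>n. c / real n) \<longlonglongrightarrow> 0" for c by real_asymp
  have "(\<lambda>n. DD n * (1 / real n)) \<longlonglongrightarrow> 0 * 0" by (intro tendsto_intros DD_lim z)
  then have "(\<lambda>n. c1 * ((DD n * (1 / n) + c2 / n) * c3 + c4 * (2 * (Th1 n / n) + Th2 n / n + ct * (Th2 n / n) + Th3 n / n + DD n * (1 / n) * c5)))
     \<longlonglongrightarrow> c1 * ((0 * 0 + 0) * c3 + c4 * (2 * 0 + 0 + ct * 0 + 0 + 0 * 0 * c5))"
    by (intro tendsto_intros rate_limits z DD_lim)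
  moreover have "c1 * ((DD n * (1 / n) + c2 / n) * c3 + c4 * (2 * (Th1 n / n) + Th2 n / n + ct * (Th2 n / n) + Th3 n / n + DD n * (1 / n) * c5))
     = c1 * ((DD n + c2) * c3 + c4 * (ee n + Th3 n + DD n * c5)) / n" for n
    by (simp add: ee_def add_divide_distrib algebra_simps)
  ultimately have "(\<lambda>n. c1 * ((DD n + c2) * c3 + c4 * (ee n + Th3 n + DD n * c5)) / n) \<longlonglongrightarrow> 0" by simp
  then have "\<forall>\<^sub>F n in sequentially. c1 * ((DD n + c2) * c3 + c4 * (ee n + Th3 n + DD n * c5)) / n < 1"
    by (rule order_tendstoD) simp
  moreover have "\<forall>\<^sub>F n in sequentially. real n \<le> 2 * exp ((ln (real n))\<^sup>2)" by real_asymp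
  ultimately show ?thesis using ev2
  proof eventually_elim
    case (elim n)
    then show ?case by (simp add: divide_less_eq)
  qed
qed

text \<open>The clauses supply the hypotheses of \<open>pl_design\<close>, uniformly over the
  admissible grids. The norm of f and the hit cells serve the truncation and the uniqueness of the
  fit.\<close>

definition "good n \<omega> \<longleftrightarrow>
  (\<forall>j\<in>UNIV. \<forall>v\<in>ppoly_space r (2 ^ J n). \<bar>ip n (\<lambda>i. \<xi> j (\<omega> i)) (\<lambda>i. v (tt (\<omega> i)))\<bar> \<le> Th1 n * nm n (\<lambda>i. v (tt (\<omega> i)))) \<and>
  (\<forall>c. \<forall>v\<in>ppoly_space r (2 ^ J n). \<bar>ip n (\<lambda>i. snd (\<omega> i)) (\<lambda>i. (\<Sum>j\<in>I. c j * xx (\<omega> i) j) + v (tt (\<omega> i)))\<bar>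
      \<le> Th1 n * nm n (\<lambda>i. (\<Sum>j\<in>I. c j * xx (\<omega> i) j) + v (tt (\<omega> i)))) \<and>
  nm n (\<lambda>i. fa (k0 n) (tt (\<omega> i)) - f (tt (\<omega> i))) \<le> Th2 n \<and>
  (\<forall>j\<in>UNIV. \<forall>\<kappa>\<in>{k1 n..J n}. nm n (\<lambda>i. \<theta> j (tt (\<omega> i)) - ph j \<kappa> (tt (\<omega> i))) \<le> Th2 n) \<and>
  (\<forall>j\<in>UNIV. \<forall>\<kappa>\<in>{k1 n..J n}. \<bar>ip n (\<lambda>i. snd (\<omega> i)) (\<lambda>i. \<theta> j (tt (\<omega> i)) - ph j \<kappa> (tt (\<omega> i)))\<bar> \<le> Th2 n) \<and>
  (\<forall>j\<in>UNIV. \<bar>ip n (\<lambda>i. fa (k0 n) (tt (\<omega> i)) - f (tt (\<omega> i))) (\<lambda>i. \<xi> j (\<omega> i))\<bar> \<le> Th2 n) \<and>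
  (\<forall>k\<in>UNIV. \<forall>j\<in>UNIV. \<forall>\<kappa>\<in>{k1 n..J n}. \<bar>ip n (\<lambda>i. \<theta> k (tt (\<omega> i)) - ph k \<kappa> (tt (\<omega> i))) (\<lambda>i. \<xi> j (\<omega> i))\<bar> \<le> Th2 n) \<and>
  (\<forall>k\<in>UNIV. \<forall>j\<in>UNIV. \<bar>ip n (\<lambda>i. \<xi> k (\<omega> i)) (\<lambda>i. \<xi> j (\<omega> i)) - real n * \<Sigma> k j\<bar> \<le> Th3 n) \<and>
  (\<forall>j\<in>UNIV. \<bar>ip n (\<lambda>i. snd (\<omega> i)) (\<lambda>i. \<xi> j (\<omega> i))\<bar> \<le> Th3 n) \<and>
  nm n (\<lambda>i. f (tt (\<omega> i))) \<le> Th3 n \<and>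
  (\<forall>i<n. \<forall>j. \<bar>xx (\<omega> i) j\<bar> \<le> B0 \<and> \<bar>\<xi> j (\<omega> i)\<bar> \<le> B0) \<and>
  (\<forall>g < 2 * r * 2 ^ J n. \<exists>i<n. tt (\<omega> i) \<in> {real g / real (2 * r * 2 ^ J n) ..< (real g + 1) / real (2 * r * 2 ^ J n)})"

lemma whp_good: "whp P good"
  unfolding good_def[abs_def]
  by (intro whp_conj[OF P_prob] whp_ball[OF P_prob finite] whp_sup_\<xi> whp_sup_error whp_f_approx whp_\<theta>_approx whp_error_\<theta>_approx whp_f_approx_\<xi> whp_\<theta>_approx_\<xi> whp_gram whp_score whp_f_norm whp_bounded whp_cells_hit)

text \<open>By the definition of \<open>xn\<close>, the factor log n of the penalty turns xn^\<eta>
  cells into n * xn^(\<eta> - 1), and \<open>2 * a \<le> 1 - \<eta>\<close> places this within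
  \<open>\<rho>2 n\<close>.\<close>

lemma sqrt_pen_le:
  assumes n: "n \<ge> 2" "ell n \<ge> 1" and r: "r = r_of b"
  shows "sqrt (n * pen b I n (2 ^ k0 n)) \<le> ct * Th2 n"
proof -
  let ?c = "2 * (card I + 1) * real r"
  have x: "xn n \<ge> 1" by (rule xn_ge_1[OF n(1)])
  have ln0: "ln (real n) > 0" using n by simp
  have "n * pen b I n (2 ^ k0 n) = ?c * 2 ^ k0 n * ln (real n)" using n by (simp add: pen_def r)
  also have "\<dots> \<le> ?c * xn n powr \<eta> * ln (real n)"
    using \<eta> ln0 by (intro mult_right_mono mult_left_mono kap_bounds n) auto
  also have "\<dots> = ?c * (n * xn n powr (\<eta> - 1))"
  proof -
    have "xn n powr \<eta> = xn n powr (\<eta> - 1) * xn n" using x by (simp add: powr_diff)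
    moreover have "xn n * ln (real n) = n" using ln0 by (simp add: xn_def)
    ultimately show ?thesis by (simp add: mult_ac)
  qed
  also have "\<dots> \<le> ?c * \<rho>2 n"
    unfolding \<rho>2_def using a(4) x by (intro mult_left_mono powr_mono) auto
  also have "\<dots> \<le> ?c * (ell n * \<rho>2 n)"
    using n(2) mult_right_mono[of 1 "ell n" "\<rho>2 n"] by (intro mult_left_mono) (auto simp: \<rho>2_def)
  finally have "sqrt (n * pen b I n (2 ^ k0 n)) \<le> sqrt (?c * (ell n * \<rho>2 n))" by (rule real_sqrt_le_mono)
  then show ?thesis by (simp only: ct_def Th2_def real_sqrt_mult[of ?c])
qed

end

section \<open>Linearization of the estimator on the good event\<close>

context pl_law
begin

lemma estimate_linear:
  fixes \<beta> :: "'q \<Rightarrow> real"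
  assumes g: "good n \<omega>" and n: "n \<ge> 2" and l1: "ell n \<ge> 1"
    and small: "Rmx * card I * ((\<kappa>\<kappa> n + Th3 n) / n) \<le> 1 / 2"
    and rb: "r = r_of b" and \<K>: "compact \<K>" and B1: "\<And>x j. x \<in> \<K> \<Longrightarrow> \<bar>x $ j\<bar> \<le> B1" "B1 \<ge> 0"
    and gam: "sqrt (measure lborel (\<K> \<times> {0..1::real})) * ((DD n + (\<Sum>j\<in>I. \<bar>\<beta> j\<bar>)) * B1 + real r * (2 * real r) ^ r * (ee n + Th3 n + DD n * B0))
        \<le> 2 * exp ((ln (real n))\<^sup>2)"
    and D: "\<And>i. i < n \<Longrightarrow> D i = (fst (\<omega> i), (\<Sum>j\<in>I. \<beta> j * xx (\<omega> i) j) + f (tt (\<omega> i)) + snd (\<omega> i))"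
    and est: "pls_estimate b \<K> I n D bh" and l: "l \<in> I"
  shows "\<bar>sqrt n * (bh l - \<beta> l) - (\<Sum>j\<in>I. R j l * (\<Sum>i<n. snd (\<omega> i) * \<xi> j (\<omega> i))) / sqrt n\<bar> \<le> eps n"
proof -
  have n0: "n > 0" using n by simp
  let ?x = "\<lambda>i j. xx (\<omega> i) j" and ?t = "\<lambda>i. tt (\<omega> i)" and ?W = "\<lambda>i. snd (\<omega> i)"
  let ?V = "ppoly_space r (2 ^ J n)"
  \<comment> \<open>From 1/b \<le> 1/3 \<le> \<eta> < 1/2: the comparison grid is one of the
    admissible grids.\<close>
  have k: "k1 n \<le> k0 n" "k0 n \<le> J n" "k1 n \<le> J n"
  proof -
    have "1 / b \<le> 1 / 3" using b by (simp add: field_simps)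
    then have "1 / b \<le> \<eta>" using \<eta>(1) by linarith
    then show "k1 n \<le> k0 n" "k0 n \<le> J n" using b \<eta> by (auto intro!: kap_mono[OF n])
    then show "k1 n \<le> J n" by simp
  qed
  have sub: "ppoly_space r (2 ^ \<kappa>) \<subseteq> ?V" if "\<kappa> \<le> J n" for \<kappa>
  proof -
    have "ppoly_space r (2 ^ \<kappa>) \<subseteq> ppoly_space r (2 ^ \<kappa> * 2 ^ (J n - \<kappa>))" by (rule ppoly_refine) auto
    then show ?thesis using that by (simp flip: power_add)
  qed
  \<comment> \<open>The three thresholds take the places of the noise and error bounds. The Gram
    error is \<open>Th3 n / n\<close>, because the locale scales it by n.\<close>
  interpret Ds: pl_design n I ?x ?t ?W \<theta> f ?V "\<lambda>j. ph j (J n)" "fa (k0 n)" \<Sigma> R "Th1 n" "Th1 n" B0 "Th2 n" "Th2 n" "Th2 n" "Th3 n / n" "Th3 n" Rmx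
  proof
    show "n > 0" by fact
    show "(\<lambda>t. a * u t + b * w t) \<in> ?V" if "u \<in> ?V" "w \<in> ?V" for a b u w by (rule ppoly_lincomb) (use that in auto)
    show "ph j (J n) \<in> ?V" for j by (rule ph)
    show "fa (k0 n) \<in> ?V" using fa(1) sub[OF k(2)] by blast
    show "(\<Sum>j\<in>I. \<bar>R j l\<bar>) \<le> Rmx" if "l \<in> I" for l
      unfolding Rmx_def using that by (intro member_le_sum[of l I "\<lambda>l. \<Sum>j\<in>I. \<bar>R j l\<bar>"]) (auto intro: sum_nonneg)
    show "Rmx \<ge> 0" unfolding Rmx_def by (intro sum_nonneg) auto
    show "Rmx * card I * (Th2 n + Th1 n * (B0 * sqrt n + Th2 n) + n * (Th3 n / n)) / n \<le> 1 / 2"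
      using small n0 by (simp add: \<kappa>\<kappa>_def)
  qed (use g n0 k B0 Th_nonneg[OF n] inv in \<open>auto simp: good_def\<close>)
  obtain K a v where v: "v \<in> ppoly_space r K" and fit: "pls_fit b I n D K (sub_fun I a v)"
    and bh: "bh = (\<lambda>j\<in>I. if ls_unique b I n D K (sub_fun I a v) \<and>
             L2_norm_of (restrict_space lborel (\<K> \<times> {0..1})) (sub_fun I a v) \<le> ereal (2 * exp ((ln (real n))\<^sup>2))
          then a j else 0)"
    using est unfolding pls_estimate_def rb by blast
  obtain \<kappa> where K: "K = 2 ^ \<kappa>" and \<kappa>: "k1 n \<le> \<kappa>" "\<kappa> \<le> J n"
    using fit unfolding pls_fit_def K_set_kap by blast
  have K0: "K > 0" by (simp add: K)
  have vV: "v \<in> ?V" using v sub[OF \<kappa>(2)] by (auto simp: K)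
  define y where "y i = (\<Sum>j\<in>I. \<beta> j * xx (\<omega> i) j) + f (tt (\<omega> i)) + snd (\<omega> i)" for i
  have Dy: "D i = (fst (\<omega> i), y i)" if "i < n" for i using D[OF that] by (simp add: y_def)
  have sf: "sub_fun I d w (fst (\<omega> i)) = (\<Sum>k\<in>I. d k * xx (\<omega> i) k) + w (tt (\<omega> i))" for d w i
    by (simp add: sub_fun_def case_prod_unfold)
  define pn where "pn = n * pen b I n (2 ^ k0 n)"
  have pn0: "pn \<ge> 0" using n by (simp add: pn_def pen_def)
  have pen0: "pen b I n K \<ge> 0" using n by (simp add: pen_def)
  \<comment> \<open>The competitor is \<beta> with the approximant of f on the comparison grid; the
    nonnegative penalty of the selected grid is dropped on the left.\<close>
  have min: "(\<Sum>i<n. (y i - ((\<Sum>j\<in>I. a j * ?x i j) + v (?t i)))\<^sup>2) \<le> (\<Sum>i<n. (y i - ((\<Sum>j\<in>I. \<beta> j * ?x i j) + fa (k0 n) (?t i)))\<^sup>2) + pn"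
  proof -
    have "2 ^ k0 n \<in> K_set b n" unfolding K_set_kap using k by blast
    moreover have "sub_fun I \<beta> (fa (k0 n)) \<in> approx_space (r_of b) I (2 ^ k0 n)"
      unfolding approx_space_def using fa(1)[of "k0 n"] rb by blast
    ultimately have "emp_contrast n D (sub_fun I a v) + pen b I n K \<le> emp_contrast n D (sub_fun I \<beta> (fa (k0 n))) + pen b I n (2 ^ k0 n)"
      using fit unfolding pls_fit_def by blast
    then have "emp_contrast n D (sub_fun I a v) \<le> emp_contrast n D (sub_fun I \<beta> (fa (k0 n))) + pen b I n (2 ^ k0 n)" using pen0 by linarith
    then have "n * emp_contrast n D (sub_fun I a v) \<le> n * (emp_contrast n D (sub_fun I \<beta> (fa (k0 n))) + pen b I n (2 ^ k0 n))"
      by (intro mult_left_mono) auto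
    moreover have "n * emp_contrast n D (sub_fun I d w) = (\<Sum>i<n. (y i - ((\<Sum>j\<in>I. d j * ?x i j) + w (?t i)))\<^sup>2)" for d w
      using n0 Dy by (simp add: emp_contrast_def sf)
    ultimately show ?thesis by (simp add: pn_def distrib_left)
  qed
  have yeq: "y i = (\<Sum>j\<in>I. \<beta> j * ?x i j) + f (?t i) + ?W i" for i by (simp add: y_def)
  note ctx = vV yeq pn0 min
  have normal: "ip n (\<lambda>i. y i - ((\<Sum>j\<in>I. a j * ?x i j) + v (?t i))) (\<lambda>i. ?x i j - ph j \<kappa> (?t i)) = 0" if j: "j \<in> I" for j
  proof -
    \<comment> \<open>The test function x j - ph j \<kappa>, with a unit coefficient vector and the
      approximant on the grid actually selected; any other grid could leave the space in which the
      fit is minimal.\<close>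
    have w: "(\<lambda>t. (- 1) * ph j \<kappa> t + 0 * ph j \<kappa> t) \<in> ppoly_space (r_of b) K"
      unfolding K rb[symmetric] by (rule ppoly_lincomb[OF _ ph(1) ph(1)]) simp
    have e: "(\<Sum>k\<in>I. (if k = j then 1 else 0) * xx (\<omega> i) k) = xx (\<omega> i) j" for i
    proof -
      have "(\<Sum>k\<in>I. (if k = j then 1 else 0) * xx (\<omega> i) k) = (\<Sum>k\<in>I. if k = j then xx (\<omega> i) k else 0)" by (intro sum.cong) auto
      then show ?thesis using j by simp
    qed
    show ?thesis
      using pls_fit_normal[OF fit n0 K0 v[unfolded rb] w, of "\<lambda>k. if k = j then 1 else 0"]
      by (simp add: ip_def Dy sf e)
  qed
  have e: "2 * Th1 n + Th2 n + sqrt pn \<le> ee n" using sqrt_pen_le[OF n l1 rb] by (simp add: ee_def pn_def)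
  have \<tau>K: "nm n (\<lambda>i. \<theta> j (?t i) - ph j \<kappa> (?t i)) \<le> Th2 n" and z1: "\<bar>ip n ?W (\<lambda>i. \<theta> j (?t i) - ph j \<kappa> (?t i))\<bar> \<le> Th2 n" for j
    using g \<kappa> by (auto simp: good_def)
  have nT: "n * (Th3 n / n) = Th3 n" using n0 by simp
  have DDb: "(\<Sum>k\<in>I. \<bar>a k - \<beta> k\<bar>) \<le> DD n"
    using Ds.coef_bound(2)[OF ctx normal \<tau>K z1 e] by (simp add: DD_def \<rho>\<rho>_def)
  have main: "\<bar>(a l - \<beta> l) - (\<Sum>j\<in>I. R j l * ip n ?W (\<lambda>i. \<xi> j (\<omega> i))) / n\<bar> \<le> Rmx * (\<rho>\<rho> n + DD n * (\<kappa>\<kappa> n + Th3 n)) / n"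
  proof -
    have "\<bar>(a l - \<beta> l) - (\<Sum>j\<in>I. R j l * ip n ?W (\<lambda>i. \<xi> j (\<omega> i))) / n\<bar> \<le> Rmx * (\<rho>\<rho> n + (\<Sum>k\<in>I. \<bar>a k - \<beta> k\<bar>) * (\<kappa>\<kappa> n + Th3 n)) / n"
      using Ds.coef_bound(1)[OF ctx normal \<tau>K z1 e l] unfolding Ds.\<kappa>_def nT by (simp add: \<rho>\<rho>_def \<kappa>\<kappa>_def)
    also have "\<dots> \<le> Rmx * (\<rho>\<rho> n + DD n * (\<kappa>\<kappa> n + Th3 n)) / n"
      using Ds.nn Ds.\<kappa>0 n0 DDb Th_nonneg[OF n]
      by (intro divide_right_mono mult_left_mono add_left_mono mult_right_mono) (auto simp: Ds.\<kappa>_def \<kappa>\<kappa>_def)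
    finally show ?thesis .
  qed
  have hit: "\<exists>i<n. ?t i \<in> {real g / real (2 * r * (2 ^ J n * 1)) ..< (real g + 1) / real (2 * r * (2 ^ J n * 1))}" if "g < 2 * r * (2 ^ J n * 1)" for g
    using g that by (simp add: good_def mult.assoc)
  \<comment> \<open>If a fit vanishes on the sample, its coefficients vanish by
    \<open>coef_unique\<close>; what remains is a function of t that is zero at the sample points of
    every part of every cell, hence zero.\<close>
  have uniq: "ls_unique b I n D K (sub_fun I a v)"
  proof (rule pls_fit_ls_unique[OF fit n0 K0 v[unfolded rb]])
    fix d w assume w: "w \<in> ppoly_space (r_of b) K" and 0: "\<And>i. i < n \<Longrightarrow> sub_fun I d w (fst (D i)) = 0"
    have wV: "w \<in> ?V" using w sub[OF \<kappa>(2)] by (auto simp: K rb)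
    have 00: "(\<Sum>k\<in>I. d k * ?x i k) + w (?t i) = 0" if "i < n" for i using 0[OF that] that by (simp add: Dy sf)
    have d0: "d l = 0" if "l \<in> I" for l by (rule Ds.coef_unique[OF wV 00 that])
    have "w (?t i) = 0" if "i < n" for i using 00[OF that] d0 by simp
    then have "\<bar>w t\<bar> \<le> real r * (2 * real r) ^ r * 0" for t
      by (intro ppoly_bound_of_points[OF r _ _ wV hit]) auto
    then show "(\<forall>l\<in>I. d l = 0) \<and> w = (\<lambda>_. 0)" using d0 by (auto simp: fun_eq_iff)
  qed
  have DD0: "DD n \<ge> 0" by (rule order.trans[OF sum_nonneg DDb]) simp
  \<comment> \<open>A single residual is at most its Euclidean norm over the sample. This crude
    bound grows with n, but interpolation carries it from the sample points to all t, and the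
    truncation threshold leaves ample room for it.\<close>
  have vb: "\<bar>v t\<bar> \<le> real r * (2 * real r) ^ r * (ee n + Th3 n + DD n * B0)" for t
  proof (rule ppoly_bound_of_points[OF r _ _ vV hit])
    have comp: "\<bar>u i\<bar> \<le> nm n u" if "i < n" for i u
    proof -
      have "(u i)\<^sup>2 \<le> (\<Sum>i<n. (u i)\<^sup>2)" using that by (intro member_le_sum[of i "{..<n}" "\<lambda>i. (u i)\<^sup>2"]) auto
      then show ?thesis unfolding nm_def by (simp add: real_le_rsqrt)
    qed
    show "\<bar>v (?t i)\<bar> \<le> ee n + Th3 n + DD n * B0" if i: "i < n" for i
    proof -
      have 1: "\<bar>(\<Sum>j\<in>I. (a j - \<beta> j) * ?x i j) + (v (?t i) - f (?t i))\<bar> \<le> ee n"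
        using comp[OF i, of "\<lambda>i. (\<Sum>j\<in>I. (a j - \<beta> j) * ?x i j) + (v (?t i) - f (?t i))"] Ds.risk[OF ctx] e by linarith
      have 2: "\<bar>f (?t i)\<bar> \<le> Th3 n" using comp[OF i, of "\<lambda>i. f (?t i)"] g by (auto simp: good_def intro: order.trans)
      have "\<bar>\<Sum>j\<in>I. (a j - \<beta> j) * ?x i j\<bar> \<le> (\<Sum>j\<in>I. \<bar>a j - \<beta> j\<bar> * B0)"
        using g i by (intro order.trans[OF sum_abs] sum_mono) (auto simp: abs_mult good_def intro!: mult_left_mono)
      also have "\<dots> \<le> DD n * B0" unfolding sum_distrib_right[symmetric] using DDb B0 by (intro mult_right_mono) auto
      finally show ?thesis using 1 2 by linarith
    qed
    show "ee n + Th3 n + DD n * B0 \<ge> 0"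
    proof -
      have "ee n \<ge> 0" using e pn0 Th_nonneg[OF n] real_sqrt_ge_zero[OF pn0] by linarith
      then show ?thesis using Th_nonneg[OF n] DD0 B0 by simp
    qed
  qed auto
  have "(\<Sum>j\<in>I. \<bar>a j\<bar>) \<le> (\<Sum>j\<in>I. \<bar>a j - \<beta> j\<bar> + \<bar>\<beta> j\<bar>)" by (intro sum_mono) linarith
  then have ab: "(\<Sum>j\<in>I. \<bar>a j\<bar>) \<le> DD n + (\<Sum>j\<in>I. \<bar>\<beta> j\<bar>)" using DDb by (simp add: sum.distrib)
  have "L2_norm_of (restrict_space lborel (\<K> \<times> {0..1})) (sub_fun I a v) \<le> ereal (2 * exp ((ln (real n))\<^sup>2))"
    by (rule order.trans[OF L2_norm_sub_fun_le[OF \<K> B1(1) v vb ab B1(2)]]) (use gam in simp_all)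
  with uniq have "bh l = a l" using l by (simp add: bh)
  define s where "s = sqrt n"
  have s: "s > 0" "real n = s * s" using n0 by (auto simp: s_def)
  have "\<bar>s * (bh l - \<beta> l) - (\<Sum>j\<in>I. R j l * ip n ?W (\<lambda>i. \<xi> j (\<omega> i))) / s\<bar> = s * \<bar>(a l - \<beta> l) - (\<Sum>j\<in>I. R j l * ip n ?W (\<lambda>i. \<xi> j (\<omega> i))) / n\<bar>"
  proof -
    have "s * (bh l - \<beta> l) - (\<Sum>j\<in>I. R j l * ip n ?W (\<lambda>i. \<xi> j (\<omega> i))) / s = s * ((a l - \<beta> l) - (\<Sum>j\<in>I. R j l * ip n ?W (\<lambda>i. \<xi> j (\<omega> i))) / n)"
      unfolding s(2) \<open>bh l = a l\<close> using s(1) by (simp add: field_simps)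
    then show ?thesis using s(1) by (simp add: abs_mult)
  qed
  also have "\<dots> \<le> s * (Rmx * (\<rho>\<rho> n + DD n * (\<kappa>\<kappa> n + Th3 n)) / n)" using s(1) by (intro mult_left_mono main) auto
  finally show ?thesis by (simp add: s_def eps_def ip_def)
qed

text \<open>Quantifying over all data sets and all values of the estimator inside the event keeps
  ties and the measurability of the selected grid out of the argument.\<close>

lemma whp_estimate_linear:
  fixes \<beta> :: "'q \<Rightarrow> real"
  assumes rb: "r = r_of b" and \<K>: "compact \<K>"
  shows "whp P (\<lambda>n \<omega>. \<forall>D bh. (\<forall>i<n. D i = (fst (\<omega> i), (\<Sum>j\<in>I. \<beta> j * xx (\<omega> i) j) + f (tt (\<omega> i)) + snd (\<omega> i))) \<longrightarrow>
     pls_estimate b \<K> I n D bh \<longrightarrow>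
     (\<forall>l\<in>I. \<bar>sqrt n * (bh l - \<beta> l) - (\<Sum>j\<in>I. R j l * (\<Sum>i<n. snd (\<omega> i) * \<xi> j (\<omega> i))) / sqrt n\<bar> \<le> eps n))"
proof -
  obtain B1 where B1: "\<forall>x\<in>\<K>. norm x \<le> B1" "B1 > 0" using compact_imp_bounded[OF \<K>] unfolding bounded_pos by blast
  have B1': "\<bar>x $ j\<bar> \<le> B1" if "x \<in> \<K>" for x j using B1(1) that component_le_norm_cart[of x j] by force
  have "(\<lambda>n. Rmx * card I * ((\<kappa>\<kappa> n + Th3 n) / n)) \<longlonglongrightarrow> Rmx * card I * 0" by (intro tendsto_intros lim_\<kappa>)
  then have "\<forall>\<^sub>F n in sequentially. Rmx * card I * ((\<kappa>\<kappa> n + Th3 n) / n) < 1 / 2" by (rule order_tendstoD) simp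
  then have "\<forall>\<^sub>F n in sequentially. \<forall>\<omega>\<in>space (P n). good n \<omega> \<longrightarrow> (\<forall>D bh. (\<forall>i<n. D i = (fst (\<omega> i), (\<Sum>j\<in>I. \<beta> j * xx (\<omega> i) j) + f (tt (\<omega> i)) + snd (\<omega> i))) \<longrightarrow>
     pls_estimate b \<K> I n D bh \<longrightarrow>
     (\<forall>l\<in>I. \<bar>sqrt n * (bh l - \<beta> l) - (\<Sum>j\<in>I. R j l * (\<Sum>i<n. snd (\<omega> i) * \<xi> j (\<omega> i))) / sqrt n\<bar> \<le> eps n))"
    using ev2 ev_ell bound_lim[of "sqrt (measure lborel (\<K> \<times> {0..1::real}))" "\<Sum>j\<in>I. \<bar>\<beta> j\<bar>" B1 "real r * (2 * real r) ^ r" B0]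
  proof eventually_elim
    case (elim n)
    show ?case
    proof (intro ballI impI allI)
      fix \<omega> D bh l
      assume g: "good n \<omega>" and D: "\<forall>i<n. D i = (fst (\<omega> i), (\<Sum>j\<in>I. \<beta> j * xx (\<omega> i) j) + f (tt (\<omega> i)) + snd (\<omega> i))"
        and e: "pls_estimate b \<K> I n D bh" and l: "l \<in> I"
      show "\<bar>sqrt n * (bh l - \<beta> l) - (\<Sum>j\<in>I. R j l * (\<Sum>i<n. snd (\<omega> i) * \<xi> j (\<omega> i))) / sqrt n\<bar> \<le> eps n"
        by (rule estimate_linear[OF g elim(2,3) less_imp_le[OF elim(1)] rb \<K> B1' less_imp_le[OF B1(2)] elim(4) _ e l]) (use D in auto)
    qed
  qed
  with whp_good show ?thesis by (rule whp_mono)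
qed

end

section \<open>Asymptotic normality\<close>

text \<open>The central limit theorem concerns one infinite sequence with positive variance: hence
  the passage to the infinite product and back by restriction, and the separate case of zero
  variance, in which the sums vanish almost surely.\<close>

lemma clt_cos:
  fixes \<psi> :: "'v \<Rightarrow> real"
  assumes \<nu>: "prob_space \<nu>" and \<psi>[measurable]: "\<psi> \<in> borel_measurable \<nu>" and int: "integrable \<nu> (\<lambda>v. (\<psi> v)\<^sup>2)"
    and mean: "(\<integral>v. \<psi> v \<partial>\<nu>) = 0"
  shows "(\<lambda>n. \<integral>\<omega>. cos ((\<Sum>i<n. \<psi> (\<omega> i)) / sqrt n + a) \<partial>PiM {..<n::nat} (\<lambda>_. \<nu>)) \<longlonglongrightarrow> cos a * exp (- (\<integral>v. (\<psi> v)\<^sup>2 \<partial>\<nu>) / 2)"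
proof -
  let ?s2 = "\<integral>v. (\<psi> v)\<^sup>2 \<partial>\<nu>"
  interpret V: prob_space \<nu> by fact
  interpret P: product_prob_space "\<lambda>_::nat. \<nu>" UNIV by standard
  let ?\<Omega> = "PiM UNIV (\<lambda>_::nat. \<nu>)"
  show ?thesis
  proof (cases "?s2 = 0")
    case True
    have "(\<integral>\<omega>. cos ((\<Sum>i<n. \<psi> (\<omega> i)) / sqrt n + a) \<partial>PiM {..<n} (\<lambda>_. \<nu>)) = cos a" for n :: nat
    proof -
      interpret Q: prob_space "PiM {..<n} (\<lambda>_. \<nu>)" by (rule prob_space_PiM) (rule \<nu>)
      note S = iid_sum_square[OF \<nu> \<psi> int mean, of n]
      have "(\<integral>\<omega>. (\<Sum>i<n. \<psi> (\<omega> i))\<^sup>2 \<partial>PiM {..<n} (\<lambda>_. \<nu>)) = 0"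
        using S(2) True by (simp add: antisym)
      then have "AE \<omega> in PiM {..<n} (\<lambda>_. \<nu>). (\<Sum>i<n. \<psi> (\<omega> i))\<^sup>2 = 0"
        by (subst (asm) integral_nonneg_eq_0_iff_AE) (use S in auto)
      then have "(\<integral>\<omega>. cos ((\<Sum>i<n. \<psi> (\<omega> i)) / sqrt n + a) \<partial>PiM {..<n} (\<lambda>_. \<nu>)) = (\<integral>\<omega>. cos a \<partial>PiM {..<n} (\<lambda>_. \<nu>))"
        by (intro integral_cong_AE) (auto elim!: eventually_mono)
      then show ?thesis by (simp add: Q.prob_space)
    qed
    then show ?thesis using True by simp
  next
    case False
    define s where "s = sqrt ?s2"
    have "?s2 \<ge> 0" by (intro Bochner_Integration.integral_nonneg) auto
    then have s: "s > 0" "s\<^sup>2 = ?s2" using False by (auto simp: s_def less_le)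
    have ind0: "P.P.indep_vars (\<lambda>_. \<nu>) (\<lambda>i \<omega>. \<omega> i) UNIV"
      by (subst P.P.indep_vars_iff_distr_eq_PiM) (auto simp: P.PiM_component restrict_UNIV distr_id)
    have ind: "P.P.indep_vars (\<lambda>_. borel) (\<lambda>i \<omega>. \<psi> (\<omega> i)) UNIV"
      by (rule P.P.indep_vars_compose2[OF ind0, of "\<lambda>_. \<psi>" "\<lambda>_. borel"]) simp
    have cd: "distr ?\<Omega> \<nu> (\<lambda>\<omega>. \<omega> i) = \<nu>" for i by (rule P.PiM_component) simp
    have tr: "(\<integral>\<omega>. g (\<omega> i) \<partial>?\<Omega>) = (\<integral>v. g v \<partial>\<nu>)" "integrable \<nu> g \<Longrightarrow> integrable ?\<Omega> (\<lambda>\<omega>. g (\<omega> i))"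
      if [measurable]: "g \<in> borel_measurable \<nu>" for g :: "'v \<Rightarrow> real" and i
      using integral_distr[of "\<lambda>\<omega>. \<omega> i" ?\<Omega> \<nu> g] integrable_distr_eq[of "\<lambda>\<omega>. \<omega> i" ?\<Omega> \<nu> g] by (simp_all add: cd)
    have dd: "distr ?\<Omega> borel (\<lambda>\<omega>. \<psi> (\<omega> i)) = distr \<nu> borel \<psi>" for i
      by (subst cd[of i, symmetric], subst distr_distr) (auto simp: comp_def)
    have "weak_conv_m (\<lambda>n. distr ?\<Omega> borel (\<lambda>x. (\<Sum>i<n. \<psi> (x i)) / sqrt (n * s\<^sup>2))) std_normal_distribution"
    proof (rule P.P.central_limit_theorem_zero_mean[OF ind _ s(1) _ _ dd])
      have sq: "(\<lambda>v. (\<psi> v)\<^sup>2) \<in> borel_measurable \<nu>" by measurable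
      show 0: "P.P.expectation (\<lambda>\<omega>. \<psi> (\<omega> n)) = 0" for n using tr(1)[OF \<psi>] mean by simp
      show "integrable ?\<Omega> (\<lambda>\<omega>. (\<psi> (\<omega> n))\<^sup>2)" for n by (rule tr(2)[OF sq int])
      show "P.P.variance (\<lambda>\<omega>. \<psi> (\<omega> n)) = s\<^sup>2" for n using tr(1)[OF sq, of n] by (simp only: 0 s(2) diff_zero)
    qed
    then have lim: "(\<lambda>n. \<integral>x. cos (s * x + a) \<partial>distr ?\<Omega> borel (\<lambda>x. (\<Sum>i<n. \<psi> (x i)) / sqrt (n * s\<^sup>2))) \<longlonglongrightarrow> (\<integral>x. cos (s * x + a) \<partial>std_normal_distribution)"
    proof (rule weak_conv_imp_integral_bdd_continuous_conv[rotated 2, where B = 1])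
      show "real_distribution (distr ?\<Omega> borel (\<lambda>x. (\<Sum>i<n. \<psi> (x i)) / sqrt (n * s\<^sup>2)))" for n :: nat
        by (rule P.P.real_distribution_distr) measurable
      show "real_distribution std_normal_distribution" by (rule real_dist_normal_dist)
      show "isCont (\<lambda>x. cos (s * x + a)) x" for x by (intro continuous_intros)
    qed simp
    have eq: "(\<integral>x. cos (s * x + a) \<partial>distr ?\<Omega> borel (\<lambda>x. (\<Sum>i<n. \<psi> (x i)) / sqrt (n * s\<^sup>2))) =
       (\<integral>\<omega>. cos ((\<Sum>i<n. \<psi> (\<omega> i)) / sqrt n + a) \<partial>PiM {..<n} (\<lambda>_. \<nu>))" for n :: nat
    proof -
      have "(\<integral>\<omega>. cos ((\<Sum>i<n. \<psi> (\<omega> i)) / sqrt n + a) \<partial>PiM {..<n} (\<lambda>_. \<nu>)) =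
        (\<integral>\<omega>. cos ((\<Sum>i<n. \<psi> (\<omega> i)) / sqrt n + a) \<partial>distr ?\<Omega> (PiM {..<n} (\<lambda>_. \<nu>)) (\<lambda>x. restrict x {..<n}))"
        by (subst P.distr_PiM_restrict_finite) auto
      also have "\<dots> = (\<integral>\<omega>. cos ((\<Sum>i<n. \<psi> (\<omega> i)) / sqrt n + a) \<partial>?\<Omega>)"
        by (subst integral_distr) auto
      finally show ?thesis using s(1) by (subst integral_distr) (auto simp: real_sqrt_mult)
    qed
    have "(\<integral>x. cos (s * x + a) \<partial>std_normal_distribution) = Re (iexp a * char std_normal_distribution s)"
    proof -
      interpret N: real_distribution std_normal_distribution by (rule real_dist_normal_dist)
      have i: "integrable std_normal_distribution (\<lambda>x. iexp (s * x))" by (intro N.integrable_const_bound[where B=1]) auto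
      have "iexp a * char std_normal_distribution s = (CLINT x|std_normal_distribution. iexp a * iexp (s * x))"
        unfolding char_def using i by simp
      then have "Re (iexp a * char std_normal_distribution s) = (\<integral>x. Re (iexp a * iexp (s * x)) \<partial>std_normal_distribution)"
        using i by (simp only: integral_Re integrable_mult_right)
      also have "\<dots> = (\<integral>x. cos (s * x + a) \<partial>std_normal_distribution)"
        by (intro Bochner_Integration.integral_cong refl) (simp add: cos_add Re_exp Im_exp)
      finally show ?thesis ..
    qed
    also have "\<dots> = cos a * exp (- ?s2 / 2)" using s(2) by (simp add: char_std_normal_distribution Re_exp)
    finally show ?thesis using lim unfolding eq by simp
  qed
qed

lemma abs_cos_diff_le: "\<bar>cos x - cos y\<bar> \<le> \<bar>x - y\<bar>" for x y :: real
proof -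
  have "\<bar>cos x - cos y\<bar> = 2 * (\<bar>sin ((x + y) / 2)\<bar> * \<bar>sin ((y - x) / 2)\<bar>)" by (simp add: cos_diff_cos abs_mult)
  also have "\<dots> \<le> 2 * (1 * \<bar>(y - x) / 2\<bar>)"
    by (intro mult_left_mono mult_mono abs_sin_le_one abs_sin_x_le_abs_x) auto
  finally show ?thesis by simp
qed

text \<open>Cosine is bounded and 1-Lipschitz, so \<open>Z\<close> may be replaced by
  \<open>T\<close> up to a multiple of \<open>eps n\<close> plus twice the probability of the bad
  set. Tightness of \<open>Z\<close> is inherited from the second moments of
  \<open>T\<close>.\<close>

lemma slutsky_normal:
  fixes P :: "nat \<Rightarrow> 'v measure" and Z T :: "nat \<Rightarrow> 'v \<Rightarrow> 'q::finite \<Rightarrow> real"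
  assumes prob: "\<And>n. prob_space (P n)" and Zm: "\<forall>\<^sub>F n in sequentially. Z n \<in> measurable (P n) (PiM I (\<lambda>_. borel))"
    and Tm: "\<And>n l. l \<in> I \<Longrightarrow> (\<lambda>\<omega>. T n \<omega> l) \<in> borel_measurable (P n)"
    and close: "whp P (\<lambda>n \<omega>. \<forall>l\<in>I. \<bar>Z n \<omega> l - T n \<omega> l\<bar> \<le> eps n)" and eps: "eps \<longlonglongrightarrow> 0"
    and Tint: "\<And>n l. l \<in> I \<Longrightarrow> integrable (P n) (\<lambda>\<omega>. (T n \<omega> l)\<^sup>2)" and TC: "\<And>n l. l \<in> I \<Longrightarrow> (\<integral>\<omega>. (T n \<omega> l)\<^sup>2 \<partial>P n) \<le> C"
    and cos: "\<And>u a. (\<lambda>n. \<integral>\<omega>. cos ((\<Sum>l\<in>I. u l * T n \<omega> l) + a) \<partial>P n) \<longlonglongrightarrow> cos a * exp (- (\<Sum>i\<in>I. \<Sum>j\<in>I. u i * S i j * u j) / 2)"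
    and N: "is_normal_law I (\<lambda>_. 0) S N"
  shows "weak_conv_on I (\<lambda>n. distr (P n) (PiM I (\<lambda>_. borel)) (Z n)) N"
  unfolding weak_conv_on_def
proof (intro allI impI)
  fix g :: "('q \<Rightarrow> real) \<Rightarrow> real"
  assume gc: "continuous_on (I \<rightarrow>\<^sub>E UNIV) g" and gb: "bounded (g ` (I \<rightarrow>\<^sub>E UNIV))"
  \<comment> \<open>Vectors indexed by \<open>I\<close> are padded with zeros, so that convergence
    can be studied in a Euclidean space; \<open>G\<close> is \<open>g\<close> transported
    there.\<close>
  define em :: "('q \<Rightarrow> real) \<Rightarrow> real^'q" where "em z = (\<chi> l. if l \<in> I then z l else 0)" for z
  define G where "G x = g (\<lambda>l\<in>I. x $ l)" for x
  have Gc: "continuous_on UNIV G" unfolding G_def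
  proof (rule continuous_on_compose2[OF gc])
    show "continuous_on UNIV (\<lambda>x::real^'q. \<lambda>l\<in>I. x $ l)"
    proof (rule continuous_on_coordinatewise_then_product)
      fix i show "continuous_on UNIV (\<lambda>x::real^'q. (\<lambda>l\<in>I. x $ l) i)"
        by (cases "i \<in> I") (auto intro!: continuous_intros)
    qed
  qed auto
  have Gm[measurable]: "G \<in> borel_measurable borel" using Gc by (rule borel_measurable_continuous_onI)
  obtain B where B: "\<And>x. \<bar>G x\<bar> \<le> B" using gb unfolding bounded_iff G_def by (force simp: PiE_iff extensional_def)
  have em_m[measurable]: "em \<in> borel_measurable (PiM I (\<lambda>_. borel))"
  proof (rule borel_measurable_euclidean_space[THEN iffD2], rule ballI)
    fix i :: "real^'q" assume "i \<in> Basis"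
    then obtain l where i: "i = axis l 1" by (auto simp: Basis_vec_def)
    show "(\<lambda>z. em z \<bullet> i) \<in> borel_measurable (PiM I (\<lambda>_. borel))"
      unfolding i inner_axis em_def by (cases "l \<in> I") auto
  qed
  have gG: "g z = G (em z)" if "z \<in> I \<rightarrow>\<^sub>E UNIV" for z
  proof -
    have "(\<lambda>l\<in>I. em z $ l) = z" using that by (auto simp: em_def fun_eq_iff PiE_iff extensional_def)
    then show ?thesis by (simp add: G_def)
  qed
  have gG': "(\<integral>z. g z \<partial>Q) = (\<integral>x. G x \<partial>distr Q borel em)" if "sets Q = sets (PiM I (\<lambda>_. borel :: real measure))" for Q
  proof -
    have [measurable_cong]: "sets Q = sets (PiM I (\<lambda>_. borel))" by fact
    have "space Q = I \<rightarrow>\<^sub>E UNIV" using sets_eq_imp_space_eq[OF that] by (simp add: space_PiM)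
    then have "(\<integral>z. g z \<partial>Q) = (\<integral>z. G (em z) \<partial>Q)" by (intro Bochner_Integration.integral_cong gG) auto
    also have "\<dots> = (\<integral>x. G x \<partial>distr Q borel em)" by (subst integral_distr) auto
    finally show ?thesis .
  qed
  have emu: "u \<bullet> em z = (\<Sum>l\<in>I. u $ l * z l)" for u :: "real^'q" and z
  proof -
    have "(\<Sum>l\<in>I. u $ l * z l) = (\<Sum>l\<in>UNIV. u $ l * em z $ l)" by (rule sum.mono_neutral_cong_left) (auto simp: em_def)
    then show ?thesis by (simp add: inner_vec_def)
  qed
  have Np: "prob_space N" and Ns[measurable_cong]: "sets N = sets (PiM I (\<lambda>_. borel))"
    and Nc: "\<And>u. (CLINT x|N. iexp (\<Sum>i\<in>I. u i * x i)) = of_real (exp (- (\<Sum>i\<in>I. \<Sum>j\<in>I. u i * S i j * u j) / 2))"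
    using N unfolding is_normal_law_def by auto
  interpret N: prob_space N by fact
  obtain Bd where Bd: "\<And>n. Bd n \<in> sets (P n)" "(\<lambda>n. measure (P n) (Bd n)) \<longlonglongrightarrow> 0"
    and good: "\<forall>\<^sub>F n in sequentially. \<forall>\<omega>\<in>space (P n) - Bd n. \<forall>l\<in>I. \<bar>Z n \<omega> l - T n \<omega> l\<bar> \<le> eps n"
    using close unfolding whp_def by blast
  define \<nu>s where "\<nu>s n = distr (P n) borel (\<lambda>\<omega>. em (Z n \<omega>))" for n
  have \<nu>s: "distr (distr (P n) (PiM I (\<lambda>_. borel)) (Z n)) borel em = \<nu>s n" if "Z n \<in> measurable (P n) (PiM I (\<lambda>_. borel))" for n
    unfolding \<nu>s_def using that by (subst distr_distr) (auto simp: comp_def)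
  have "(\<lambda>n. \<integral>x. G x \<partial>\<nu>s n) \<longlonglongrightarrow> (\<integral>x. G x \<partial>distr N borel em)"
  proof (rule integral_converges_of_trig[OF _ _ _ _ _ _ Gc B])
    show "\<forall>\<^sub>F n in sequentially. prob_space (\<nu>s n)" using Zm
    proof eventually_elim
      case (elim n)
      note [measurable] = elim
      show ?case unfolding \<nu>s_def by (rule prob_space.prob_space_distr[OF prob]) measurable
    qed
    show "prob_space (distr N borel em)" by (rule N.prob_space_distr) measurable
    show "\<forall>\<^sub>F n in sequentially. sets (\<nu>s n) = sets borel" by (simp add: \<nu>s_def)
    show "sets (distr N borel em) = sets borel" by simp
  next
    fix u :: "real^'q" and a :: real
    let ?L = "cos a * exp (- (\<Sum>i\<in>I. \<Sum>j\<in>I. u $ i * S i j * u $ j) / 2)"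
    have "(\<integral>x. cos (u \<bullet> x + a) \<partial>distr N borel em) = (\<integral>z. cos ((\<Sum>l\<in>I. u $ l * z l) + a) \<partial>N)"
      by (subst integral_distr) (auto simp: emu)
    also have "\<dots> = (\<integral>z. Re (iexp a * iexp (\<Sum>l\<in>I. u $ l * z l)) \<partial>N)"
      by (intro Bochner_Integration.integral_cong refl) (simp add: cos_add Re_exp Im_exp)
    also have "\<dots> = Re (iexp a * (CLINT x|N. iexp (\<Sum>i\<in>I. u $ i * x i)))"
    proof -
      have i: "integrable N (\<lambda>z. iexp (\<Sum>i\<in>I. u $ i * z i))" by (intro N.integrable_const_bound[where B=1]) auto
      then show ?thesis by (simp only: integral_Re integrable_mult_right integral_mult_right_zero)
    qed
    also have "\<dots> = ?L" unfolding Nc[of "\<lambda>i. u $ i"] by (simp add: Re_exp)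
    finally have NL: "(\<integral>x. cos (u \<bullet> x + a) \<partial>distr N borel em) = ?L" .
    let ?A = "\<lambda>n. \<integral>\<omega>. cos ((\<Sum>l\<in>I. u $ l * Z n \<omega> l) + a) \<partial>P n" and ?B = "\<lambda>n. \<integral>\<omega>. cos ((\<Sum>l\<in>I. u $ l * T n \<omega> l) + a) \<partial>P n"
    have "(\<lambda>n. ?A n - ?B n) \<longlonglongrightarrow> 0"
    proof (rule Lim_null_comparison)
      show "(\<lambda>n. (\<Sum>l\<in>I. \<bar>u $ l\<bar>) * \<bar>eps n\<bar> + 2 * measure (P n) (Bd n)) \<longlonglongrightarrow> 0"
        using tendsto_add[OF tendsto_mult_right[OF tendsto_rabs[OF eps], of "\<Sum>l\<in>I. \<bar>u $ l\<bar>"] tendsto_mult_right[OF Bd(2), of 2]] by (simp add: mult.commute)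
      show "\<forall>\<^sub>F n in sequentially. norm (?A n - ?B n) \<le> (\<Sum>l\<in>I. \<bar>u $ l\<bar>) * \<bar>eps n\<bar> + 2 * measure (P n) (Bd n)"
        using Zm good
      proof eventually_elim
        case (elim n)
        note [measurable] = elim(1) Bd(1)[of n]
        interpret Q: prob_space "P n" by (rule prob)
        have Zl[measurable]: "(\<lambda>\<omega>. Z n \<omega> l) \<in> borel_measurable (P n)" if "l \<in> I" for l using that by measurable
        have iA: "integrable (P n) (\<lambda>\<omega>. cos ((\<Sum>l\<in>I. u $ l * Z n \<omega> l) + a))" by (rule Q.integrable_const_bound[where B=1]) auto
        have iB: "integrable (P n) (\<lambda>\<omega>. cos ((\<Sum>l\<in>I. u $ l * T n \<omega> l) + a))" by (rule Q.integrable_const_bound[where B=1]) (use Tm in auto)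
        let ?h = "\<lambda>\<omega>. (\<Sum>l\<in>I. \<bar>u $ l\<bar>) * \<bar>eps n\<bar> + 2 * indicator (Bd n) \<omega>"
        have iI: "integrable (P n) (indicator (Bd n) :: _ \<Rightarrow> real)"
          using Bd(1)[of n] by (intro integrable_real_indicator) (simp_all add: less_top[symmetric])
        then have ih: "integrable (P n) ?h" by (intro Bochner_Integration.integrable_add integrable_mult_right) auto
        have pt: "\<bar>cos ((\<Sum>l\<in>I. u $ l * Z n \<omega> l) + a) - cos ((\<Sum>l\<in>I. u $ l * T n \<omega> l) + a)\<bar> \<le> ?h \<omega>" if w: "\<omega> \<in> space (P n)" for \<omega>
        proof (cases "\<omega> \<in> Bd n")
          case True
          have "\<bar>cos ((\<Sum>l\<in>I. u $ l * Z n \<omega> l) + a) - cos ((\<Sum>l\<in>I. u $ l * T n \<omega> l) + a)\<bar> \<le> 1 + 1"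
            by (intro order.trans[OF abs_triangle_ineq4] add_mono abs_cos_le_one)
          moreover have "(\<Sum>l\<in>I. \<bar>u $ l\<bar>) * \<bar>eps n\<bar> \<ge> 0" by (intro mult_nonneg_nonneg sum_nonneg) auto
          moreover have "?h \<omega> = (\<Sum>l\<in>I. \<bar>u $ l\<bar>) * \<bar>eps n\<bar> + 2" using True by simp
          ultimately show ?thesis by linarith
        next
          case False
          have "\<bar>cos ((\<Sum>l\<in>I. u $ l * Z n \<omega> l) + a) - cos ((\<Sum>l\<in>I. u $ l * T n \<omega> l) + a)\<bar> \<le> \<bar>(\<Sum>l\<in>I. u $ l * Z n \<omega> l) - (\<Sum>l\<in>I. u $ l * T n \<omega> l)\<bar>"
            using abs_cos_diff_le[of "(\<Sum>l\<in>I. u $ l * Z n \<omega> l) + a" "(\<Sum>l\<in>I. u $ l * T n \<omega> l) + a"] by simp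
          also have "\<dots> = \<bar>\<Sum>l\<in>I. u $ l * (Z n \<omega> l - T n \<omega> l)\<bar>" by (simp add: right_diff_distrib sum_subtractf)
          also have "\<dots> \<le> (\<Sum>l\<in>I. \<bar>u $ l\<bar> * \<bar>eps n\<bar>)"
            using elim(2) w False by (intro order.trans[OF sum_abs] sum_mono) (force simp: abs_mult intro!: mult_left_mono)
          finally show ?thesis using False by (simp add: sum_distrib_right)
        qed
        have "norm (?A n - ?B n) = \<bar>\<integral>\<omega>. cos ((\<Sum>l\<in>I. u $ l * Z n \<omega> l) + a) - cos ((\<Sum>l\<in>I. u $ l * T n \<omega> l) + a) \<partial>P n\<bar>"
          using iA iB by simp
        also have "\<dots> \<le> (\<integral>\<omega>. \<bar>cos ((\<Sum>l\<in>I. u $ l * Z n \<omega> l) + a) - cos ((\<Sum>l\<in>I. u $ l * T n \<omega> l) + a)\<bar> \<partial>P n)"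
          by (rule integral_abs_bound)
        also have "\<dots> \<le> (\<integral>\<omega>. ?h \<omega> \<partial>P n)" by (rule integral_mono[OF _ ih pt]) (use iA iB in auto)
        also have "\<dots> = (\<Sum>l\<in>I. \<bar>u $ l\<bar>) * \<bar>eps n\<bar> + 2 * measure (P n) (Bd n)" using Bd(1)[of n] iI by (subst Bochner_Integration.integral_add) (auto simp: Q.prob_space)
        finally show ?case .
      qed
    qed
    from tendsto_add[OF this cos[of "\<lambda>l. u $ l" a]] have "?A \<longlonglongrightarrow> ?L" by simp
    moreover have "\<forall>\<^sub>F n in sequentially. ?A n = (\<integral>x. cos (u \<bullet> x + a) \<partial>\<nu>s n)"
      using Zm by eventually_elim (subst \<nu>s_def, subst integral_distr, auto simp: emu)
    ultimately show "(\<lambda>n. \<integral>x. cos (u \<bullet> x + a) \<partial>\<nu>s n) \<longlonglongrightarrow> (\<integral>x. cos (u \<bullet> x + a) \<partial>distr N borel em)"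
      unfolding NL by (rule Lim_transform_eventually)
  next
    fix e :: real assume e: "e > 0"
    let ?f = "\<lambda>n \<omega>. \<Sum>l\<in>I. 2 + (T n \<omega> l)\<^sup>2"
    define m where "m = card I * (2 + C) + 1"
    \<comment> \<open>Chosen so that Markov's inequality leaves at most e / 2; the other half is for
      the bad set.\<close>
    define L where "L = 2 * \<bar>m\<bar> / e + 1"
    have L: "L > 0" using e by (simp add: L_def add_nonneg_pos)
    have "\<forall>\<^sub>F n in sequentially. eps n < 1" using eps by (rule order_tendstoD) simp
    moreover have "\<forall>\<^sub>F n in sequentially. measure (P n) (Bd n) < e / 2" using Bd(2) by (rule order_tendstoD) (use e in simp)
    ultimately have "\<forall>\<^sub>F n in sequentially. measure (\<nu>s n) {x. norm x > L} \<le> e"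
      using Zm good
    proof eventually_elim
      case (elim n)
      note [measurable] = elim(3) Bd(1)[of n]
      interpret Q: prob_space "P n" by (rule prob)
      have if': "integrable (P n) (?f n)" by (intro Bochner_Integration.integrable_sum Bochner_Integration.integrable_add Tint) auto
      have "(\<integral>\<omega>. ?f n \<omega> \<partial>P n) = (\<Sum>l\<in>I. 2 + (\<integral>\<omega>. (T n \<omega> l)\<^sup>2 \<partial>P n))"
        using Tint by (subst Bochner_Integration.integral_sum) (auto simp: Q.prob_space)
      also have "\<dots> \<le> (\<Sum>l\<in>I. 2 + C)" by (intro sum_mono add_left_mono TC)
      finally have fm: "(\<integral>\<omega>. ?f n \<omega> \<partial>P n) \<le> \<bar>m\<bar>" by (simp add: m_def)
      have fs: "{\<omega>\<in>space (P n). ?f n \<omega> \<ge> L} \<in> sets (P n)" using if' by measurable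
      have "measure (\<nu>s n) {x. norm x > L} = measure (P n) {\<omega>\<in>space (P n). norm (em (Z n \<omega>)) > L}"
        unfolding \<nu>s_def by (subst measure_distr) (auto intro!: arg_cong[where f = "measure (P n)"])
      also have "\<dots> \<le> measure (P n) (Bd n \<union> {\<omega>\<in>space (P n). ?f n \<omega> \<ge> L})"
      proof (rule Q.finite_measure_mono)
        show "{\<omega>\<in>space (P n). norm (em (Z n \<omega>)) > L} \<subseteq> Bd n \<union> {\<omega>\<in>space (P n). ?f n \<omega> \<ge> L}"
        proof
          fix \<omega> assume w: "\<omega> \<in> {\<omega>\<in>space (P n). norm (em (Z n \<omega>)) > L}"
          have "L \<le> ?f n \<omega>" if "\<omega> \<notin> Bd n"
          proof -
            have "L \<le> (\<Sum>l\<in>UNIV. \<bar>em (Z n \<omega>) $ l\<bar>)" using w norm_le_l1_cart[of "em (Z n \<omega>)"] by simp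
            also have "\<dots> = (\<Sum>l\<in>I. \<bar>Z n \<omega> l\<bar>)" by (rule sum.mono_neutral_cong_right) (auto simp: em_def)
            also have "\<dots> \<le> ?f n \<omega>"
            proof (rule sum_mono)
              fix l assume l: "l \<in> I"
              have "\<bar>Z n \<omega> l - T n \<omega> l\<bar> \<le> eps n" using elim(4) w that l by blast
              then have "\<bar>Z n \<omega> l\<bar> \<le> \<bar>T n \<omega> l\<bar> + 1" using elim(1) by linarith
              moreover have "\<bar>T n \<omega> l\<bar> \<le> 1 + (T n \<omega> l)\<^sup>2"
              proof -
                have "0 \<le> (\<bar>T n \<omega> l\<bar> - 1)\<^sup>2 + (T n \<omega> l)\<^sup>2 + 1" by (intro add_nonneg_nonneg) auto
                then show ?thesis by (simp add: power2_diff)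
              qed
              ultimately show "\<bar>Z n \<omega> l\<bar> \<le> 2 + (T n \<omega> l)\<^sup>2" by linarith
            qed
            finally show ?thesis .
          qed
          then show "\<omega> \<in> Bd n \<union> {\<omega>\<in>space (P n). ?f n \<omega> \<ge> L}" using w by blast
        qed
        show "Bd n \<union> {\<omega>\<in>space (P n). ?f n \<omega> \<ge> L} \<in> sets (P n)" using fs Bd(1)[of n] by blast
      qed
      also have "\<dots> \<le> measure (P n) (Bd n) + measure (P n) {\<omega>\<in>space (P n). ?f n \<omega> \<ge> L}"
        by (rule measure_Un_le) (use Bd(1) fs in auto)
      also have "measure (P n) {\<omega>\<in>space (P n). ?f n \<omega> \<ge> L} \<le> (\<integral>\<omega>. ?f n \<omega> \<partial>P n) / L"
        by (rule integral_Markov_inequality_measure[OF if', of "{}"]) (use L in \<open>auto intro!: sum_nonneg\<close>)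
      also have "\<dots> \<le> \<bar>m\<bar> / L" using fm L by (intro divide_right_mono) auto
      also have "\<dots> \<le> e / 2"
      proof -
        have "\<bar>m\<bar> * 2 \<le> e * L" using e by (simp add: L_def distrib_left)
        then show ?thesis using L by (simp add: field_simps)
      qed
      finally show ?case using elim(2) by linarith
    qed
    then show "\<exists>L. \<forall>\<^sub>F n in sequentially. measure (\<nu>s n) {x. norm x > L} \<le> e" by blast
  qed
  moreover have "\<forall>\<^sub>F n in sequentially. (\<integral>x. G x \<partial>\<nu>s n) = (\<integral>z. g z \<partial>distr (P n) (PiM I (\<lambda>_. borel)) (Z n))"
    using Zm by eventually_elim (simp add: gG' \<nu>s)
  ultimately show "(\<lambda>n. \<integral>z. g z \<partial>distr (P n) (PiM I (\<lambda>_. borel)) (Z n)) \<longlonglongrightarrow> (\<integral>z. g z \<partial>N)"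
    unfolding gG'[OF Ns] by (rule Lim_transform_eventually)
qed

section \<open>Covariance of the linear term and convergence on the product space\<close>

context pl_law
begin

lemma score_moments:
  fixes c :: "'q \<Rightarrow> real"
  shows "(\<lambda>v. snd v * (\<Sum>j\<in>I. c j * \<xi> j v)) \<in> borel_measurable \<nu>"
    and "integrable \<nu> (\<lambda>v. (snd v * (\<Sum>j\<in>I. c j * \<xi> j v))\<^sup>2)"
    and "(\<integral>v. snd v * (\<Sum>j\<in>I. c j * \<xi> j v) \<partial>\<nu>) = 0"
    and "(\<integral>v. (snd v * (\<Sum>j\<in>I. c j * \<xi> j v))\<^sup>2 \<partial>\<nu>) = s2 * (\<Sum>k\<in>I. \<Sum>j\<in>I. c k * \<Sigma> k j * c j)"
proof -
  let ?\<phi> = "\<lambda>z. \<Sum>j\<in>I. c j * (fst z $ j - \<theta> j (snd z))"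
  show "(\<lambda>v. snd v * (\<Sum>j\<in>I. c j * \<xi> j v)) \<in> borel_measurable \<nu>" by measurable
  have m: "?\<phi> \<in> borel_measurable borel"
    by (intro borel_measurable_sum borel_measurable_times borel_measurable_diff borel_measurable_const x1m measurable_compose[OF t1m \<theta>m])
  have e: "(?\<phi> (fst v))\<^sup>2 = (\<Sum>k\<in>I. \<Sum>j\<in>I. c k * (\<xi> k v * \<xi> j v) * c j)" for v
    by (simp add: power2_eq_square sum_product algebra_simps)
  have i: "integrable \<nu> (\<lambda>v. c k * (\<xi> k v * \<xi> j v) * c j)" for k j
    by (intro integrable_mult_left integrable_mult_right \<xi>_mult_int \<xi>_int)
  have I2: "integrable \<nu> (\<lambda>v. (?\<phi> (fst v))\<^sup>2)" unfolding e by (intro Bochner_Integration.integrable_sum i)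
  have E2: "(\<integral>v. (?\<phi> (fst v))\<^sup>2 \<partial>\<nu>) = (\<Sum>k\<in>I. \<Sum>j\<in>I. c k * \<Sigma> k j * c j)"
    unfolding e by (subst Bochner_Integration.integral_sum, intro Bochner_Integration.integrable_sum i)+
      (simp add: Bochner_Integration.integral_sum i \<Sigma>)
  show "integrable \<nu> (\<lambda>v. (snd v * (\<Sum>j\<in>I. c j * \<xi> j v))\<^sup>2)" by (rule W_L2(1)[OF m I2])
  show "(\<integral>v. snd v * (\<Sum>j\<in>I. c j * \<xi> j v) \<partial>\<nu>) = 0" by (rule W_L2(3)[OF m I2])
  show "(\<integral>v. (snd v * (\<Sum>j\<in>I. c j * \<xi> j v))\<^sup>2 \<partial>\<nu>) = s2 * (\<Sum>k\<in>I. \<Sum>j\<in>I. c k * \<Sigma> k j * c j)"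
    unfolding W_L2(2)[OF m I2] E2 ..
qed

text \<open>With c = R u, the form of \<Sigma> at c is the form of \<open>R\<close> at u, as
  \<Sigma> R is the identity on \<open>I\<close>. So the linear term has the variance of the claimed
  limit.\<close>

lemma quadratic_inverse:
  "(\<Sum>k\<in>I. \<Sum>j\<in>I. (\<Sum>l\<in>I. u l * R k l) * \<Sigma> k j * (\<Sum>l\<in>I. u l * R j l)) = (\<Sum>k\<in>I. \<Sum>l\<in>I. u k * R k l * u l)"
proof -
  have "(\<Sum>j\<in>I. \<Sigma> k j * (\<Sum>l\<in>I. u l * R j l)) = u k" if "k \<in> I" for k
  proof -
    have "(\<Sum>j\<in>I. \<Sigma> k j * (\<Sum>l\<in>I. u l * R j l)) = (\<Sum>l\<in>I. u l * (\<Sum>j\<in>I. \<Sigma> k j * R j l))"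
      unfolding sum_distrib_left by (subst sum.swap) (simp add: mult_ac)
    also have "\<dots> = (\<Sum>l\<in>I. if l = k then u l else 0)" using inv[OF that] by (intro sum.cong) auto
    finally show ?thesis using that by simp
  qed
  then have "(\<Sum>j\<in>I. (\<Sum>l\<in>I. u l * R k l) * \<Sigma> k j * (\<Sum>l\<in>I. u l * R j l)) = (\<Sum>l\<in>I. u k * R k l * u l)" if "k \<in> I" for k
    unfolding mult.assoc sum_distrib_left[of "\<Sum>l\<in>I. u l * R k l", symmetric] by (simp add: that sum_distrib_left mult_ac)
  then show ?thesis by simp
qed

text \<open>Formulated on the product space of observations, with the responses rebuilt by
  \<open>dat\<close> from regressors and errors; the original probability space enters only through
  the law of one observation.\<close>

theorem estimator_weak_conv:
  fixes \<beta> :: "'q \<Rightarrow> real"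
  assumes rb: "r = r_of b" and \<K>: "compact \<K>" and proc: "pls_procedure b \<K> I bhat"
    and N: "is_normal_law I (\<lambda>_. 0) (\<lambda>k j. s2 * R k j) N"
  defines "dat n \<omega> \<equiv> \<lambda>i\<in>{..<n}. (fst (\<omega> i), (\<Sum>j\<in>I. \<beta> j * xx (\<omega> i) j) + f (tt (\<omega> i)) + snd (\<omega> i))"
  shows "\<And>n. dat n \<in> measurable (P n) (PiM {..<n} (\<lambda>_. borel))"
    and "weak_conv_on I (\<lambda>n. distr (P n) (PiM I (\<lambda>_. borel)) (\<lambda>\<omega>. \<lambda>j\<in>I. sqrt n * (bhat n (dat n \<omega>) j - \<beta> j))) N"
proof -
  show dm: "dat n \<in> measurable (P n) (PiM {..<n} (\<lambda>_. borel))" for n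
    unfolding dat_def
  proof (rule measurable_restrict)
    fix i assume i: "i \<in> {..<n}"
    have g: "(\<lambda>v. (fst v, (\<Sum>j\<in>I. \<beta> j * xx v j) + f (tt v) + snd v)) \<in> measurable \<nu> borel"
      by (intro borel_measurable_Pair fstm) measurable
    show "(\<lambda>\<omega>. (fst (\<omega> i), (\<Sum>j\<in>I. \<beta> j * xx (\<omega> i) j) + f (tt (\<omega> i)) + snd (\<omega> i))) \<in> borel_measurable (P n)"
      by (rule measurable_compose[OF measurable_component_singleton[OF i] g])
  qed
  define T where "T n \<omega> l = (\<Sum>i<n. snd (\<omega> i) * (\<Sum>j\<in>I. R j l * \<xi> j (\<omega> i))) / sqrt n" for n :: nat and \<omega> and l
  let ?\<psi> = "\<lambda>c v. snd v * (\<Sum>j\<in>I. c j * \<xi> j v)"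
  note S = iid_sum_square[OF prob_space_axioms score_moments(1-3)]
  show "weak_conv_on I (\<lambda>n. distr (P n) (PiM I (\<lambda>_. borel)) (\<lambda>\<omega>. \<lambda>j\<in>I. sqrt n * (bhat n (dat n \<omega>) j - \<beta> j))) N"
  proof (rule slutsky_normal[OF P_prob _ _ _ eps_lim _ _ _ N, where T = T and C = "\<Sum>l\<in>I. \<integral>v. (?\<psi> (\<lambda>j. R j l) v)\<^sup>2 \<partial>\<nu>"])
    show "\<forall>\<^sub>F n in sequentially. (\<lambda>\<omega>. \<lambda>j\<in>I. sqrt n * (bhat n (dat n \<omega>) j - \<beta> j)) \<in> measurable (P n) (PiM I (\<lambda>_. borel))"
      using ev2
    proof eventually_elim
      case (elim n)
      have "bhat n \<in> measurable (PiM {..<n} (\<lambda>_. borel)) (PiM I (\<lambda>_. borel))" using proc elim unfolding pls_procedure_def by blast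
      from measurable_compose[OF dm this] have bm: "(\<lambda>\<omega>. bhat n (dat n \<omega>)) \<in> measurable (P n) (PiM I (\<lambda>_. borel))" .
      show ?case
      proof (rule measurable_restrict)
        fix j assume "j \<in> I"
        then have "(\<lambda>\<omega>. bhat n (dat n \<omega>) j) \<in> borel_measurable (P n)" by (rule measurable_compose[OF bm measurable_component_singleton])
        then show "(\<lambda>\<omega>. sqrt n * (bhat n (dat n \<omega>) j - \<beta> j)) \<in> borel_measurable (P n)" by measurable
      qed
    qed
    show Tm: "(\<lambda>\<omega>. T n \<omega> l) \<in> borel_measurable (P n)" for n l
    proof -
      have "(\<lambda>\<omega>. ?\<psi> (\<lambda>j. R j l) (\<omega> i)) \<in> borel_measurable (P n)" if "i \<in> {..<n}" for i
        by (rule measurable_compose[OF measurable_component_singleton[OF that] score_moments(1)])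
      then show ?thesis unfolding T_def by (intro borel_measurable_divide borel_measurable_sum) auto
    qed
    show Ti: "integrable (P n) (\<lambda>\<omega>. (T n \<omega> l)\<^sup>2)" for n l
      unfolding T_def power_divide by (intro Bochner_Integration.integrable_divide S(1))
    show "(\<integral>\<omega>. (T n \<omega> l)\<^sup>2 \<partial>P n) \<le> (\<Sum>l\<in>I. \<integral>v. (?\<psi> (\<lambda>j. R j l) v)\<^sup>2 \<partial>\<nu>)" if l: "l \<in> I" for n l
    proof -
      have p: "(\<integral>v. (?\<psi> c v)\<^sup>2 \<partial>\<nu>) \<ge> 0" for c by (intro Bochner_Integration.integral_nonneg) auto
      have "(\<integral>\<omega>. (T n \<omega> l)\<^sup>2 \<partial>P n) = (\<integral>\<omega>. (\<Sum>i<n. ?\<psi> (\<lambda>j. R j l) (\<omega> i))\<^sup>2 \<partial>P n) / n"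
        unfolding T_def power_divide by simp
      also have "\<dots> \<le> (n * (\<integral>v. (?\<psi> (\<lambda>j. R j l) v)\<^sup>2 \<partial>\<nu>)) / n" by (intro divide_right_mono S(2)) auto
      \<comment> \<open>For \<open>n = 0\<close> the quotient is 0 by convention.\<close>
      also have "\<dots> \<le> (\<integral>v. (?\<psi> (\<lambda>j. R j l) v)\<^sup>2 \<partial>\<nu>)" using p by (cases "n = 0") auto
      also have "\<dots> \<le> (\<Sum>l\<in>I. \<integral>v. (?\<psi> (\<lambda>j. R j l) v)\<^sup>2 \<partial>\<nu>)"
        by (rule member_le_sum[OF l]) (use p in auto)
      finally show ?thesis .
    qed
    show "(\<lambda>n. \<integral>\<omega>. cos ((\<Sum>l\<in>I. u l * T n \<omega> l) + a) \<partial>P n) \<longlonglongrightarrow> cos a * exp (- (\<Sum>i\<in>I. \<Sum>j\<in>I. u i * (s2 * R i j) * u j) / 2)" for u a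
    proof -
      have e: "(\<Sum>l\<in>I. u l * T n \<omega> l) = (\<Sum>i<n. ?\<psi> (\<lambda>j. \<Sum>l\<in>I. u l * R j l) (\<omega> i)) / sqrt n" for n \<omega>
      proof -
        have "(\<Sum>l\<in>I. u l * T n \<omega> l) = (\<Sum>l\<in>I. \<Sum>i<n. u l * (snd (\<omega> i) * (\<Sum>j\<in>I. R j l * \<xi> j (\<omega> i)))) / sqrt n"
          by (simp add: T_def sum_divide_distrib sum_distrib_left)
        also have "(\<Sum>l\<in>I. \<Sum>i<n. u l * (snd (\<omega> i) * (\<Sum>j\<in>I. R j l * \<xi> j (\<omega> i)))) = (\<Sum>i<n. \<Sum>l\<in>I. u l * (snd (\<omega> i) * (\<Sum>j\<in>I. R j l * \<xi> j (\<omega> i))))"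
          by (rule sum.swap)
        also have "\<dots> = (\<Sum>i<n. ?\<psi> (\<lambda>j. \<Sum>l\<in>I. u l * R j l) (\<omega> i))"
        proof (rule sum.cong[OF refl])
          fix i
          have "(\<Sum>j\<in>I. (\<Sum>l\<in>I. u l * R j l) * \<xi> j (\<omega> i)) = (\<Sum>l\<in>I. u l * (\<Sum>j\<in>I. R j l * \<xi> j (\<omega> i)))"
            unfolding sum_distrib_left sum_distrib_right by (subst sum.swap) (simp only: mult.assoc)
          then show "(\<Sum>l\<in>I. u l * (snd (\<omega> i) * (\<Sum>j\<in>I. R j l * \<xi> j (\<omega> i)))) = ?\<psi> (\<lambda>j. \<Sum>l\<in>I. u l * R j l) (\<omega> i)"
            by (simp only: sum_distrib_left mult.left_commute[of "u _"])
        qed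
        finally show ?thesis .
      qed
      have "s2 * (\<Sum>k\<in>I. \<Sum>j\<in>I. (\<Sum>l\<in>I. u l * R k l) * \<Sigma> k j * (\<Sum>l\<in>I. u l * R j l)) = (\<Sum>i\<in>I. \<Sum>j\<in>I. u i * (s2 * R i j) * u j)"
        unfolding quadratic_inverse by (simp only: sum_distrib_left mult_ac)
      then show ?thesis
        using clt_cos[OF prob_space_axioms score_moments(1-3), of "\<lambda>j. \<Sum>l\<in>I. u l * R j l" a] unfolding e score_moments(4) by simp
    qed
    have q: "T n \<omega> l = (\<Sum>j\<in>I. R j l * (\<Sum>i<n. snd (\<omega> i) * \<xi> j (\<omega> i))) / sqrt n" for n \<omega> l
    proof -
      have "(\<Sum>i<n. snd (\<omega> i) * (\<Sum>j\<in>I. R j l * \<xi> j (\<omega> i))) = (\<Sum>j\<in>I. R j l * (\<Sum>i<n. snd (\<omega> i) * \<xi> j (\<omega> i)))"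
        unfolding sum_distrib_left by (subst sum.swap) (simp only: mult.left_commute)
      then show ?thesis by (simp only: T_def)
    qed
    have "\<forall>\<^sub>F n in sequentially. \<forall>\<omega>\<in>space (P n).
        (\<forall>D bh. (\<forall>i<n. D i = (fst (\<omega> i), (\<Sum>j\<in>I. \<beta> j * xx (\<omega> i) j) + f (tt (\<omega> i)) + snd (\<omega> i))) \<longrightarrow> pls_estimate b \<K> I n D bh \<longrightarrow>
          (\<forall>l\<in>I. \<bar>sqrt n * (bh l - \<beta> l) - (\<Sum>j\<in>I. R j l * (\<Sum>i<n. snd (\<omega> i) * \<xi> j (\<omega> i))) / sqrt n\<bar> \<le> eps n)) \<longrightarrow>
        (\<forall>l\<in>I. \<bar>(\<lambda>j\<in>I. sqrt n * (bhat n (dat n \<omega>) j - \<beta> j)) l - T n \<omega> l\<bar> \<le> eps n)"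
      using ev2
    proof eventually_elim
      case (elim n)
      have "pls_estimate b \<K> I n (dat n \<omega>) (bhat n (dat n \<omega>))" for \<omega>
        using proc elim unfolding pls_procedure_def dat_def by (metis (no_types, lifting) PiE_UNIV_domain UNIV_I restrict_PiE_iff)
      moreover have "\<forall>i<n. dat n \<omega> i = (fst (\<omega> i), (\<Sum>j\<in>I. \<beta> j * xx (\<omega> i) j) + f (tt (\<omega> i)) + snd (\<omega> i))" for \<omega> by (simp add: dat_def)
      ultimately have "\<forall>l\<in>I. \<bar>sqrt n * (bhat n (dat n \<omega>) l - \<beta> l) - (\<Sum>j\<in>I. R j l * (\<Sum>i<n. snd (\<omega> i) * \<xi> j (\<omega> i))) / sqrt n\<bar> \<le> eps n"
        if "\<forall>D bh. (\<forall>i<n. D i = (fst (\<omega> i), (\<Sum>j\<in>I. \<beta> j * xx (\<omega> i) j) + f (tt (\<omega> i)) + snd (\<omega> i))) \<longrightarrow> pls_estimate b \<K> I n D bh \<longrightarrow>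
          (\<forall>l\<in>I. \<bar>sqrt n * (bh l - \<beta> l) - (\<Sum>j\<in>I. R j l * (\<Sum>i<n. snd (\<omega> i) * \<xi> j (\<omega> i))) / sqrt n\<bar> \<le> eps n)" for \<omega>
        using that by blast
      then show ?case unfolding q by (intro ballI impI) simp
    qed
    with whp_estimate_linear[OF rb \<K>, of \<beta>]
    show "whp P (\<lambda>n \<omega>. \<forall>l\<in>I. \<bar>(\<lambda>j\<in>I. sqrt n * (bhat n (dat n \<omega>) j - \<beta> j)) l - T n \<omega> l\<bar> \<le> eps n)"
      by (rule whp_mono)
  qed
qed

end

section \<open>The partially linear model\<close>

lemma nn_integral_Times_strip:
  fixes \<K> :: "'a::euclidean_space set" and \<phi> :: "real \<Rightarrow> ennreal"
  assumes \<K>[measurable]: "\<K> \<in> sets borel" and \<phi>[measurable]: "\<phi> \<in> borel_measurable borel"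
  shows "(\<integral>\<^sup>+z. \<phi> (snd z) * indicator (\<K> \<times> {0..1}) z \<partial>lborel) = emeasure lborel \<K> * (\<integral>\<^sup>+t\<in>{0..1}. \<phi> t \<partial>lborel)"
proof -
  have "(\<integral>\<^sup>+z. \<phi> (snd z) * indicator (\<K> \<times> {0..1}) z \<partial>lborel) = (\<integral>\<^sup>+z. \<phi> (snd z) * indicator (\<K> \<times> {0..1}) z \<partial>(lborel \<Otimes>\<^sub>M lborel))"
    by (simp add: lborel_prod)
  also have "\<dots> = (\<integral>\<^sup>+x. \<integral>\<^sup>+t. \<phi> (snd (x, t)) * indicator (\<K> \<times> {0..1}) (x, t) \<partial>lborel \<partial>lborel)"
    by (rule lborel.nn_integral_fst[symmetric]) measurable
  also have "\<dots> = (\<integral>\<^sup>+x. indicator \<K> x * (\<integral>\<^sup>+t\<in>{0..1}. \<phi> t \<partial>lborel) \<partial>lborel)"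
  proof (rule nn_integral_cong)
    fix x
    have "(\<integral>\<^sup>+t. \<phi> (snd (x, t)) * indicator (\<K> \<times> {0..1}) (x, t) \<partial>lborel) = (\<integral>\<^sup>+t. indicator \<K> x * (\<phi> t * indicator {0..1} t) \<partial>lborel)"
      by (intro nn_integral_cong) (auto simp: indicator_def)
    also have "\<dots> = indicator \<K> x * (\<integral>\<^sup>+t\<in>{0..1}. \<phi> t \<partial>lborel)" by (rule nn_integral_cmult) measurable
    finally show "(\<integral>\<^sup>+t. \<phi> (snd (x, t)) * indicator (\<K> \<times> {0..1}) (x, t) \<partial>lborel) = indicator \<K> x * (\<integral>\<^sup>+t\<in>{0..1}. \<phi> t \<partial>lborel)" .
  qed
  also have "\<dots> = emeasure lborel \<K> * (\<integral>\<^sup>+t\<in>{0..1}. \<phi> t \<partial>lborel)" by (subst nn_integral_multc) auto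
  finally show ?thesis .
qed

text \<open>The part of the model that mentions neither f nor the responses, so that the law of one
  observation can be studied before the smoothness indices are fixed.\<close>

locale pl_model = prob_space M for M :: "'a measure" +
  fixes b h0 h1 \<sigma> :: real and \<K> :: "(real ^ 'q::finite) set"
    and X :: "nat \<Rightarrow> 'a \<Rightarrow> real ^ 'q" and T W :: "nat \<Rightarrow> 'a \<Rightarrow> real"
    and h :: "(real ^ 'q) \<times> real \<Rightarrow> real" and \<theta> :: "'q \<Rightarrow> real \<Rightarrow> real"
    and \<mu> :: "((real ^ 'q) \<times> real) measure" and \<mu>T :: "real measure"
  assumes b: "b \<ge> 3"
    and XT_indep: "indep_vars (\<lambda>_. borel) (\<lambda>i \<omega>. (X i \<omega>, T i \<omega>)) UNIV"
    and XT_distr: "\<And>i. distr M borel (\<lambda>\<omega>. (X i \<omega>, T i \<omega>)) = \<mu>"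
    and T_distr: "\<mu>T = distr M borel (T 0)"
    and W_indep: "indep_vars (\<lambda>_. borel) W UNIV"
    and W_distr: "\<And>i. distr M borel (W i) = distr M borel (W 0)"
    and XT_W_indep: "indep_set
          (sets (vimage_algebra (space M) (\<lambda>\<omega> i. (X i \<omega>, T i \<omega>)) (PiM UNIV (\<lambda>_. borel))))
          (sets (vimage_algebra (space M) (\<lambda>\<omega> i. W i \<omega>) (PiM UNIV (\<lambda>_. borel))))"
    and W_mean: "integrable M (W 0)" "integral\<^sup>L M (W 0) = 0"
    and W_var: "integrable M (\<lambda>\<omega>. (W 0 \<omega>)\<^sup>2)" "(\<integral>\<omega>. (W 0 \<omega>)\<^sup>2 \<partial>M) = \<sigma>\<^sup>2"
    and K_compact: "compact \<K>"
    and h_meas[measurable]: "h \<in> borel_measurable borel"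
    and density: "\<mu> = density lborel (\<lambda>z. ennreal (h z * indicator (\<K> \<times> {0..1}) z))"
    and h0: "h0 > 0"
    and h_bounds: "\<And>z. z \<in> \<K> \<times> {0..1} \<Longrightarrow> h0 \<le> h z \<and> h z \<le> h1"
    and cond_var: "\<And>l. l \<noteq> 0 \<Longrightarrow>
          \<exists>V. is_cond_var M (T 0) (\<lambda>\<omega>. l \<bullet> X 0 \<omega>) V \<and> (\<forall>t\<in>{0..1}. V t > 0)"
    and theta: "\<And>j. is_cond_exp M (T 0) (\<lambda>\<omega>. X 0 \<omega> $ j) (\<theta> j)"
begin

lemma U_meas[measurable]: "(\<lambda>\<omega>. (X i \<omega>, T i \<omega>)) \<in> borel_measurable M"
  and W_meas[measurable]: "W i \<in> borel_measurable M"
  using XT_indep W_indep by (auto simp: indep_vars_def2)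

lemma X_meas[measurable]: "X i \<in> borel_measurable M" and T_meas[measurable]: "T i \<in> borel_measurable M"
proof -
  have "(fst :: (real^'q) \<times> real \<Rightarrow> _) \<in> borel_measurable borel" "(snd :: (real^'q) \<times> real \<Rightarrow> _) \<in> borel_measurable borel"
    by (intro borel_measurable_continuous_onI continuous_intros)+
  from measurable_compose[OF U_meas this(1)] measurable_compose[OF U_meas this(2)]
  show "X i \<in> borel_measurable M" "T i \<in> borel_measurable M" by simp_all
qed

lemma Xj_meas[measurable]: "(\<lambda>\<omega>. X i \<omega> $ j) \<in> borel_measurable M"
  by (rule measurable_compose[OF X_meas]) (intro borel_measurable_continuous_onI continuous_intros)

lemma \<theta>_meas[measurable]: "\<theta> j \<in> borel_measurable borel" and \<theta>_AE: "AE \<omega> in M. \<theta> j (T 0 \<omega>) = cond_exp_on M (T 0) (\<lambda>\<omega>. X 0 \<omega> $ j) \<omega>"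
  using theta[of j] by (auto simp: is_cond_exp_def)

lemma K_meas[measurable]: "\<K> \<in> sets borel" using K_compact by (rule borel_compact)

lemma S_meas[measurable]: "\<K> \<times> {0..1::real} \<in> sets borel"
  using K_compact by (intro borel_compact compact_Times) auto

lemma U_AE: "AE \<omega> in M. X i \<omega> \<in> \<K> \<and> T i \<omega> \<in> {0..1}"
proof -
  have "AE z in \<mu>. z \<in> \<K> \<times> {0..1}"
    unfolding density by (subst AE_density) (auto simp: indicator_def)
  then have "AE \<omega> in M. (X i \<omega>, T i \<omega>) \<in> \<K> \<times> {0..1}"
    unfolding XT_distr[of i, symmetric] by (rule AE_distrD[OF U_meas])
  then show ?thesis by simp
qed

definition "k\<K> = measure lborel \<K>"

lemma k\<K>: "emeasure lborel \<K> = ennreal k\<K>"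
  unfolding k\<K>_def using emeasure_compact_finite[OF K_compact] by (intro emeasure_eq_ennreal_measure) auto

lemma nn_integral_\<mu>T:
  assumes [measurable]: "\<phi> \<in> borel_measurable borel"
  shows "(\<integral>\<^sup>+t. \<phi> t \<partial>\<mu>T) = (\<integral>\<^sup>+z. ennreal (h z * indicator (\<K> \<times> {0..1}) z) * \<phi> (snd z) \<partial>lborel)"
proof -
  have [measurable]: "(snd :: (real^'q) \<times> real \<Rightarrow> _) \<in> borel_measurable borel"
    by (intro borel_measurable_continuous_onI continuous_intros)
  have "(\<integral>\<^sup>+t. \<phi> t \<partial>\<mu>T) = (\<integral>\<^sup>+\<omega>. \<phi> (snd (X 0 \<omega>, T 0 \<omega>)) \<partial>M)" unfolding T_distr by (subst nn_integral_distr) auto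
  also have "\<dots> = (\<integral>\<^sup>+z. \<phi> (snd z) \<partial>distr M borel (\<lambda>\<omega>. (X 0 \<omega>, T 0 \<omega>)))" by (subst nn_integral_distr) auto
  also have "\<dots> = (\<integral>\<^sup>+z. ennreal (h z * indicator (\<K> \<times> {0..1}) z) * \<phi> (snd z) \<partial>lborel)"
    unfolding XT_distr density by (rule nn_integral_density) measurable
  finally show ?thesis .
qed

text \<open>Integrating the joint density over the fibre \<K> places the density of T between h0 and
  h1 times the volume of \<K>. The absolute value keeps the upper constant nonnegative without
  further information on \<K>.\<close>

lemma \<mu>T_bounds:
  assumes \<phi>[measurable]: "\<phi> \<in> borel_measurable borel"
  shows "ennreal (h0 * k\<K>) * (\<integral>\<^sup>+t\<in>{0..1}. \<phi> t \<partial>lborel) \<le> (\<integral>\<^sup>+t. \<phi> t \<partial>\<mu>T)"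
    and "(\<integral>\<^sup>+t. \<phi> t \<partial>\<mu>T) \<le> ennreal (\<bar>h1\<bar> * k\<K>) * (\<integral>\<^sup>+t\<in>{0..1}. \<phi> t \<partial>lborel)"
proof -
  have [measurable]: "(snd :: (real^'q) \<times> real \<Rightarrow> _) \<in> borel_measurable borel"
    by (intro borel_measurable_continuous_onI continuous_intros)
  have e: "ennreal (c * k\<K>) * (\<integral>\<^sup>+t\<in>{0..1}. \<phi> t \<partial>lborel) = (\<integral>\<^sup>+z. ennreal c * (\<phi> (snd z) * indicator (\<K> \<times> {0..1}) z) \<partial>lborel)" if "c \<ge> 0" for c
    using that by (subst nn_integral_cmult) (auto simp: nn_integral_Times_strip k\<K> ennreal_mult' mult.assoc)
  show "ennreal (h0 * k\<K>) * (\<integral>\<^sup>+t\<in>{0..1}. \<phi> t \<partial>lborel) \<le> (\<integral>\<^sup>+t. \<phi> t \<partial>\<mu>T)"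
    unfolding nn_integral_\<mu>T[OF \<phi>] e[OF less_imp_le[OF h0]]
    using h_bounds by (intro nn_integral_mono) (auto simp: indicator_def intro!: mult_right_mono ennreal_leI)
  have "\<And>z. z \<in> \<K> \<times> {0..1} \<Longrightarrow> h z \<le> \<bar>h1\<bar>" using h_bounds abs_ge_self[of h1] by (meson order.trans)
  then show "(\<integral>\<^sup>+t. \<phi> t \<partial>\<mu>T) \<le> ennreal (\<bar>h1\<bar> * k\<K>) * (\<integral>\<^sup>+t\<in>{0..1}. \<phi> t \<partial>lborel)"
    unfolding nn_integral_\<mu>T[OF \<phi>] e[OF abs_ge_zero]
    by (intro nn_integral_mono) (auto simp: indicator_def intro!: mult_right_mono ennreal_leI)
qed

lemma \<mu>T_prob: "prob_space \<mu>T" unfolding T_distr by (rule prob_space_distr) simp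

lemma sets_\<mu>T[measurable_cong]: "sets \<mu>T = sets borel" by (simp add: T_distr)

text \<open>Volume zero would leave T with total mass zero, by the upper bound.\<close>

lemma k\<K>_pos: "k\<K> > 0"
proof (rule ccontr)
  assume "\<not> k\<K> > 0"
  then have "k\<K> = 0" using measure_nonneg[of lborel \<K>] by (simp add: k\<K>_def)
  then have "(\<integral>\<^sup>+t. 1 \<partial>\<mu>T) \<le> 0" using \<mu>T_bounds(2)[of "\<lambda>_. 1"] by simp
  then show False using prob_space.emeasure_space_1[OF \<mu>T_prob] by simp
qed

definition "B1 = (SOME B. 0 < B \<and> (\<forall>x\<in>\<K>. norm x \<le> B))"

lemma B1: "B1 > 0" "x \<in> \<K> \<Longrightarrow> \<bar>x $ j\<bar> \<le> B1"
proof -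
  have "\<exists>B. 0 < B \<and> (\<forall>x\<in>\<K>. norm x \<le> B)" using compact_imp_bounded[OF K_compact] unfolding bounded_pos by blast
  from someI_ex[OF this] show "B1 > 0" "x \<in> \<K> \<Longrightarrow> \<bar>x $ j\<bar> \<le> B1"
    using component_le_norm_cart[of x j] unfolding B1_def by (auto intro: order.trans)
qed

definition "F = vimage_algebra (space M) (T 0) borel"

lemma F_sub: "finite_measure_subalgebra M F"
proof (unfold_locales)
  show "subalgebra M F" unfolding subalgebra_def F_def
  proof safe
    fix A assume "A \<in> sets (vimage_algebra (space M) (T 0) borel)"
    then show "A \<in> sets M" by (subst (asm) sets_vimage_algebra2) (auto intro: measurable_sets[OF T_meas])
  qed simp_all
qed

sublocale CE: finite_measure_subalgebra M F by (rule F_sub)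

lemma T_F: "T 0 \<in> borel_measurable F" unfolding F_def by (rule measurable_vimage_algebra1) simp

lemma X_AE: "AE \<omega> in M. \<forall>j. \<bar>X 0 \<omega> $ j\<bar> \<le> B1" using U_AE[of 0] by eventually_elim (use B1 in auto)

lemma X_int: "integrable M (\<lambda>\<omega>. X 0 \<omega> $ j)"
  by (rule integrable_const_bound[of _ B1]) (use X_AE in auto)

lemma \<theta>F_AE: "AE \<omega> in M. \<theta> j (T 0 \<omega>) = real_cond_exp M F (\<lambda>\<omega>. X 0 \<omega> $ j) \<omega>"
  using \<theta>_AE unfolding F_def .

lemma \<theta>_bound: "AE \<omega> in M. \<bar>\<theta> j (T 0 \<omega>)\<bar> \<le> B1"
proof -
  have "AE \<omega> in M. X 0 \<omega> $ j \<le> B1" "AE \<omega> in M. X 0 \<omega> $ j \<ge> - B1"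
    using X_AE by (eventually_elim, metis abs_le_iff minus_le_iff)+
  from CE.real_cond_exp_le_c[OF X_int this(1)] CE.real_cond_exp_ge_c[OF X_int this(2)]
  show ?thesis using \<theta>F_AE[of j] by eventually_elim auto
qed

lemma \<theta>_int: "integrable M (\<lambda>\<omega>. \<theta> j (T 0 \<omega>))"
  by (rule integrable_const_bound[of _ B1]) (use \<theta>_bound in auto)

text \<open>Taking out what is known. \<phi> may be unbounded, because the coordinates of X are
  bounded on the compact set \<K>.\<close>

lemma cond_mean:
  assumes [measurable]: "\<phi> \<in> borel_measurable borel" and i: "integrable M (\<lambda>\<omega>. \<phi> (T 0 \<omega>))"
  shows "integrable M (\<lambda>\<omega>. X 0 \<omega> $ j * \<phi> (T 0 \<omega>))" "integrable M (\<lambda>\<omega>. \<theta> j (T 0 \<omega>) * \<phi> (T 0 \<omega>))"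
    "(\<integral>\<omega>. X 0 \<omega> $ j * \<phi> (T 0 \<omega>) \<partial>M) = (\<integral>\<omega>. \<theta> j (T 0 \<omega>) * \<phi> (T 0 \<omega>) \<partial>M)"
proof -
  show i1: "integrable M (\<lambda>\<omega>. X 0 \<omega> $ j * \<phi> (T 0 \<omega>))"
  proof (rule Bochner_Integration.integrable_bound[of _ "\<lambda>\<omega>. B1 * \<phi> (T 0 \<omega>)"])
    show "AE \<omega> in M. norm (X 0 \<omega> $ j * \<phi> (T 0 \<omega>)) \<le> norm (B1 * \<phi> (T 0 \<omega>))"
      using X_AE by eventually_elim (use B1(1) in \<open>auto simp: abs_mult intro!: mult_right_mono\<close>)
  qed (use i in auto)
  have m: "(\<lambda>\<omega>. \<phi> (T 0 \<omega>)) \<in> borel_measurable F" by (rule measurable_compose[OF T_F]) simp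
  have i2: "integrable M (\<lambda>\<omega>. \<phi> (T 0 \<omega>) * X 0 \<omega> $ j)" using i1 by (simp add: mult.commute)
  note C = CE.real_cond_exp_intg[OF i2 m Xj_meas]
  have ae: "AE \<omega> in M. \<phi> (T 0 \<omega>) * real_cond_exp M F (\<lambda>\<omega>. X 0 \<omega> $ j) \<omega> = \<theta> j (T 0 \<omega>) * \<phi> (T 0 \<omega>)"
    using \<theta>F_AE[of j] by eventually_elim simp
  show "integrable M (\<lambda>\<omega>. \<theta> j (T 0 \<omega>) * \<phi> (T 0 \<omega>))"
    by (rule integrable_cong_AE_imp[OF C(1) _ ae]) measurable
  have "(\<integral>\<omega>. \<theta> j (T 0 \<omega>) * \<phi> (T 0 \<omega>) \<partial>M) = (\<integral>\<omega>. \<phi> (T 0 \<omega>) * real_cond_exp M F (\<lambda>\<omega>. X 0 \<omega> $ j) \<omega> \<partial>M)"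
    by (rule integral_cong_AE[OF _ _ ae[THEN AE_symmetric]]) measurable
  then show "(\<integral>\<omega>. X 0 \<omega> $ j * \<phi> (T 0 \<omega>) \<partial>M) = (\<integral>\<omega>. \<theta> j (T 0 \<omega>) * \<phi> (T 0 \<omega>) \<partial>M)"
    unfolding C(2) by (simp add: mult.commute)
qed

abbreviation "\<zeta> j \<omega> \<equiv> X 0 \<omega> $ j - \<theta> j (T 0 \<omega>)"

lemma \<zeta>_bound: "AE \<omega> in M. \<bar>\<zeta> j \<omega>\<bar> \<le> 2 * B1"
  using X_AE \<theta>_bound[of j] by eventually_elim (smt (verit))

text \<open>Both cross terms E(X k \<theta> j) equal E(\<theta> k \<theta> j), and X and \<theta>(T)
  have the same means. So the difference of covariances is the second moment matrix of X -
  \<theta>(T), which is the form in which the normal equations produce it.\<close>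

lemma Sigma_mat_eq: "Sigma_mat M (X 0) (T 0) \<theta> k j = (\<integral>\<omega>. \<zeta> k \<omega> * \<zeta> j \<omega> \<partial>M)"
proof -
  note ck = cond_mean[OF \<theta>_meas \<theta>_int]
  have m: "(\<integral>\<omega>. X 0 \<omega> $ j \<partial>M) = (\<integral>\<omega>. \<theta> j (T 0 \<omega>) \<partial>M)" for j
    using CE.real_cond_exp_int(2)[OF X_int[of j]] integral_cong_AE[OF _ _ \<theta>F_AE[of j]] by simp
  have XX: "integrable M (\<lambda>\<omega>. X 0 \<omega> $ k * X 0 \<omega> $ j)"
  proof (rule Bochner_Integration.integrable_bound[of _ "\<lambda>\<omega>. B1 * X 0 \<omega> $ j"])
    show "AE \<omega> in M. norm (X 0 \<omega> $ k * X 0 \<omega> $ j) \<le> norm (B1 * X 0 \<omega> $ j)"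
      using X_AE by eventually_elim (use B1(1) in \<open>auto simp: abs_mult intro!: mult_right_mono\<close>)
  qed (use X_int in auto)
  have cov: "covariance M U V = (\<integral>\<omega>. U \<omega> * V \<omega> \<partial>M) - (\<integral>\<omega>. U \<omega> \<partial>M) * (\<integral>\<omega>. V \<omega> \<partial>M)"
    if i: "integrable M U" "integrable M V" "integrable M (\<lambda>\<omega>. U \<omega> * V \<omega>)" for U V
  proof -
    define u v where "u = integral\<^sup>L M U" and "v = integral\<^sup>L M V"
    have "covariance M U V = (\<integral>\<omega>. U \<omega> * V \<omega> - v * U \<omega> - u * V \<omega> + u * v \<partial>M)"
      unfolding covariance_def u_def[symmetric] v_def[symmetric] by (intro Bochner_Integration.integral_cong refl) (simp add: algebra_simps)
    also have "\<dots> = (\<integral>\<omega>. U \<omega> * V \<omega> \<partial>M) - v * u - u * v + u * v"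
      using i by (simp add: prob_space u_def v_def)
    finally show ?thesis by (simp add: u_def v_def)
  qed
  have "(\<integral>\<omega>. \<zeta> k \<omega> * \<zeta> j \<omega> \<partial>M) = (\<integral>\<omega>. X 0 \<omega> $ k * X 0 \<omega> $ j - X 0 \<omega> $ k * \<theta> j (T 0 \<omega>) - X 0 \<omega> $ j * \<theta> k (T 0 \<omega>) + \<theta> k (T 0 \<omega>) * \<theta> j (T 0 \<omega>) \<partial>M)"
    by (intro Bochner_Integration.integral_cong refl) (simp add: algebra_simps)
  also have "\<dots> = (\<integral>\<omega>. X 0 \<omega> $ k * X 0 \<omega> $ j \<partial>M) - (\<integral>\<omega>. X 0 \<omega> $ k * \<theta> j (T 0 \<omega>) \<partial>M) - (\<integral>\<omega>. X 0 \<omega> $ j * \<theta> k (T 0 \<omega>) \<partial>M) + (\<integral>\<omega>. \<theta> k (T 0 \<omega>) * \<theta> j (T 0 \<omega>) \<partial>M)"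
    using XX ck by simp
  also have "\<dots> = (\<integral>\<omega>. X 0 \<omega> $ k * X 0 \<omega> $ j \<partial>M) - (\<integral>\<omega>. \<theta> k (T 0 \<omega>) * \<theta> j (T 0 \<omega>) \<partial>M)"
    unfolding ck(3) by (simp add: mult.commute)
  finally show ?thesis
    unfolding Sigma_mat_def using cov[OF X_int X_int XX] cov[OF \<theta>_int \<theta>_int ck(2)] by (simp add: m)
qed

lemma \<zeta>\<zeta>_int: "integrable M (\<lambda>\<omega>. \<zeta> k \<omega> * \<zeta> j \<omega>)"
proof (rule Bochner_Integration.integrable_bound[of _ "\<lambda>\<omega>. 2 * B1 * \<zeta> j \<omega>"])
  show "AE \<omega> in M. norm (\<zeta> k \<omega> * \<zeta> j \<omega>) \<le> norm (2 * B1 * \<zeta> j \<omega>)"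
    using \<zeta>_bound[of k] by eventually_elim (use B1(1) in \<open>auto simp: abs_mult intro!: mult_right_mono\<close>)
qed (use X_int \<theta>_int in auto)

text \<open>The form at u is the mean of the conditional variance of l'X given T, where l is u
  padded with zeros. A function that is positive at almost every value of T has a positive
  mean.\<close>

lemma Sigma_pos:
  assumes u: "\<exists>i\<in>I. u i \<noteq> 0"
  shows "(\<Sum>i\<in>I. \<Sum>j\<in>I. u i * Sigma_mat M (X 0) (T 0) \<theta> i j * u j) > 0"
proof -
  define l :: "real^'q" where "l = (\<chi> j. if j \<in> I then u j else 0)"
  have "l \<noteq> 0" using u by (auto simp: l_def vec_eq_iff)
  from cond_var[OF this] obtain V where V: "is_cond_var M (T 0) (\<lambda>\<omega>. l \<bullet> X 0 \<omega>) V" and V0: "\<forall>t\<in>{0..1}. V t > 0" by blast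
  let ?Z = "\<lambda>\<omega>. l \<bullet> X 0 \<omega>" and ?D = "\<lambda>\<omega>. \<Sum>j\<in>I. u j * \<zeta> j \<omega>"
  have [measurable]: "V \<in> borel_measurable borel" and Vae: "AE \<omega> in M. V (T 0 \<omega>) = real_cond_exp M F (\<lambda>\<omega>. (?Z \<omega> - real_cond_exp M F ?Z \<omega>)\<^sup>2) \<omega>"
    using V unfolding is_cond_var_def is_cond_exp_def F_def by auto
  have Z: "?Z \<omega> = (\<Sum>j\<in>I. u j * X 0 \<omega> $ j)" for \<omega>
  proof -
    have "(\<Sum>j\<in>I. u j * X 0 \<omega> $ j) = (\<Sum>j\<in>UNIV. l $ j * X 0 \<omega> $ j)" by (rule sum.mono_neutral_cong_left) (auto simp: l_def)
    then show ?thesis by (simp add: inner_vec_def)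
  qed
  have "AE \<omega> in M. real_cond_exp M F (\<lambda>\<omega>. \<Sum>j\<in>I. u j * X 0 \<omega> $ j) \<omega> = (\<Sum>j\<in>I. real_cond_exp M F (\<lambda>\<omega>. u j * X 0 \<omega> $ j) \<omega>)"
    by (rule CE.real_cond_exp_sum) (use X_int in auto)
  moreover have "AE \<omega> in M. \<forall>j\<in>I. real_cond_exp M F (\<lambda>\<omega>. u j * X 0 \<omega> $ j) \<omega> = u j * \<theta> j (T 0 \<omega>)"
  proof (rule AE_finite_allI)
    fix j
    show "AE \<omega> in M. real_cond_exp M F (\<lambda>\<omega>. u j * X 0 \<omega> $ j) \<omega> = u j * \<theta> j (T 0 \<omega>)"
      using CE.real_cond_exp_cmult[OF X_int, of "u j" j] \<theta>F_AE[of j] by eventually_elim simp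
  qed simp
  ultimately have DZ: "AE \<omega> in M. ?Z \<omega> - real_cond_exp M F ?Z \<omega> = ?D \<omega>"
    unfolding Z by eventually_elim (simp add: right_diff_distrib sum_subtractf)
  have D2: "(?D \<omega>)\<^sup>2 = (\<Sum>i\<in>I. \<Sum>j\<in>I. u i * (\<zeta> i \<omega> * \<zeta> j \<omega>) * u j)" for \<omega>
    by (simp add: power2_eq_square sum_product algebra_simps)
  have Di: "integrable M (\<lambda>\<omega>. (?D \<omega>)\<^sup>2)"
    unfolding D2 by (intro Bochner_Integration.integrable_sum integrable_mult_left integrable_mult_right \<zeta>\<zeta>_int)
  have DE: "(\<integral>\<omega>. (?D \<omega>)\<^sup>2 \<partial>M) = (\<Sum>i\<in>I. \<Sum>j\<in>I. u i * Sigma_mat M (X 0) (T 0) \<theta> i j * u j)"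
    unfolding D2 Sigma_mat_eq using \<zeta>\<zeta>_int by (simp add: Bochner_Integration.integral_sum)
  have ZD: "AE \<omega> in M. (?Z \<omega> - real_cond_exp M F ?Z \<omega>)\<^sup>2 = (?D \<omega>)\<^sup>2" using DZ by eventually_elim simp
  have mZ: "?Z \<in> borel_measurable M" unfolding Z by measurable
  have mC: "real_cond_exp M F ?Z \<in> borel_measurable M" by simp
  have mZC: "(\<lambda>\<omega>. (?Z \<omega> - real_cond_exp M F ?Z \<omega>)\<^sup>2) \<in> borel_measurable M" by (intro borel_measurable_power borel_measurable_diff mZ mC)
  have Zi: "integrable M (\<lambda>\<omega>. (?Z \<omega> - real_cond_exp M F ?Z \<omega>)\<^sup>2)"
    by (rule integrable_cong_AE_imp[OF Di mZC ZD[THEN AE_symmetric]])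
  have ZE: "(\<integral>\<omega>. (?Z \<omega> - real_cond_exp M F ?Z \<omega>)\<^sup>2 \<partial>M) = (\<integral>\<omega>. (?D \<omega>)\<^sup>2 \<partial>M)"
    by (rule integral_cong_AE[OF mZC _ ZD]) (use Di in auto)
  note CI = CE.real_cond_exp_int[OF Zi]
  have Vi: "integrable M (\<lambda>\<omega>. V (T 0 \<omega>))" by (rule integrable_cong_AE_imp[OF CI(1) _ Vae[THEN AE_symmetric]]) measurable
  have VE: "(\<integral>\<omega>. V (T 0 \<omega>) \<partial>M) = (\<integral>\<omega>. (?D \<omega>)\<^sup>2 \<partial>M)"
    unfolding ZE[symmetric] CI(2)[symmetric] by (rule integral_cong_AE[OF _ _ Vae]) measurable
  have Vp: "AE \<omega> in M. V (T 0 \<omega>) > 0" using U_AE[of 0] by eventually_elim (use V0 in auto)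
  then have Vn: "AE \<omega> in M. V (T 0 \<omega>) \<ge> 0" by eventually_elim simp
  have "(\<integral>\<omega>. V (T 0 \<omega>) \<partial>M) \<noteq> 0"
  proof
    assume "(\<integral>\<omega>. V (T 0 \<omega>) \<partial>M) = 0"
    then have "AE \<omega> in M. V (T 0 \<omega>) = 0" using integral_nonneg_eq_0_iff_AE[OF Vi Vn] by simp
    with Vp have "AE \<omega> in M. False" by eventually_elim simp
    then show False by simp
  qed
  moreover have "(\<integral>\<omega>. V (T 0 \<omega>) \<partial>M) \<ge> 0" by (rule integral_nonneg_AE[OF Vn])
  ultimately show ?thesis using DE VE by linarith
qed

end

section \<open>From the model to i.i.d. observations\<close>

context pl_model
begin

definition "V i \<omega> = ((X i \<omega>, T i \<omega>), W i \<omega>)"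
definition "\<nu> = distr M borel (V 0)"

lemma V_meas[measurable]: "V i \<in> borel_measurable M"
  unfolding V_def by measurable

lemma coord_meas[measurable]:
  "(\<lambda>v::((real^'q) \<times> real) \<times> real. xx v j) \<in> borel_measurable borel" "(\<lambda>v::((real^'q) \<times> real) \<times> real. tt v) \<in> borel_measurable borel"
  "(fst :: ((real^'q) \<times> real) \<times> real \<Rightarrow> _) \<in> borel_measurable borel" "(snd :: ((real^'q) \<times> real) \<times> real \<Rightarrow> _) \<in> borel_measurable borel"
  by (intro borel_measurable_continuous_onI continuous_intros)+

lemma \<nu>_integral:
  assumes [measurable]: "g \<in> borel_measurable borel"
  shows "(\<integral>v. g v \<partial>\<nu>) = (\<integral>\<omega>. g (V 0 \<omega>) \<partial>M)" "integrable \<nu> g \<longleftrightarrow> integrable M (\<lambda>\<omega>. g (V 0 \<omega>) :: real)"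
  unfolding \<nu>_def by (simp_all add: integral_distr integrable_distr_eq)

lemma \<nu>_prob: "prob_space \<nu>" unfolding \<nu>_def by (rule prob_space_distr) simp

lemma V_distr: "distr M borel (V i) = \<nu>"
proof -
  have "distr M borel (V i) = distr M borel (\<lambda>\<omega>. (X i \<omega>, T i \<omega>)) \<Otimes>\<^sub>M distr M borel (W i)" for i
    unfolding pair_indep_vars(2)[OF XT_indep W_indep XT_W_indep] borel_prod V_def[abs_def] ..
  then show ?thesis unfolding \<nu>_def by (simp add: XT_distr W_distr[of i])
qed

lemma V_sample:
  assumes n: "n > 0"
  shows "distr M (PiM {..<n} (\<lambda>_. borel)) (\<lambda>\<omega>. \<lambda>i\<in>{..<n}. V i \<omega>) = PiM {..<n} (\<lambda>_. \<nu>)"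
proof -
  have "indep_vars (\<lambda>_. borel) V {..<n}"
    by (rule indep_vars_subset[of _ _ UNIV]) (use pair_indep_vars(1)[OF XT_indep W_indep XT_W_indep] in \<open>simp_all add: V_def[abs_def]\<close>)
  then show ?thesis using n by (subst (asm) indep_vars_iff_distr_eq_PiM') (auto simp: V_distr)
qed

lemma UW_indep:
  assumes [measurable]: "\<phi> \<in> borel_measurable borel" "g \<in> borel_measurable borel"
  shows "indep_var borel (\<lambda>\<omega>. \<phi> (X 0 \<omega>, T 0 \<omega>) :: real) borel (\<lambda>\<omega>. g (W 0 \<omega>))"
  unfolding indep_var_distribution_eq
proof (intro conjI)
  let ?U = "\<lambda>\<omega>. (X 0 \<omega>, T 0 \<omega>)"
  interpret dW: prob_space "distr M borel (W 0)" by (rule prob_space_distr) simp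
  interpret dg: prob_space "distr (distr M borel (W 0)) borel g" by (rule dW.prob_space_distr) simp
  have "distr M borel (\<lambda>\<omega>. \<phi> (?U \<omega>)) \<Otimes>\<^sub>M distr M borel (\<lambda>\<omega>. g (W 0 \<omega>)) =
      distr (distr M borel ?U) borel \<phi> \<Otimes>\<^sub>M distr (distr M borel (W 0)) borel g"
    by (simp add: distr_distr comp_def)
  also have "\<dots> = distr (distr M borel ?U \<Otimes>\<^sub>M distr M borel (W 0)) (borel \<Otimes>\<^sub>M borel) (\<lambda>(x, y). (\<phi> x, g y))"
    by (rule pair_measure_distr) (auto intro: dg.sigma_finite_measure)
  also have "\<dots> = distr M (borel \<Otimes>\<^sub>M borel) (\<lambda>\<omega>. (\<phi> (?U \<omega>), g (W 0 \<omega>)))"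
    unfolding pair_indep_vars(2)[OF XT_indep W_indep XT_W_indep] by (subst distr_distr) (auto simp: comp_def)
  finally show "distr M borel (\<lambda>\<omega>. \<phi> (?U \<omega>)) \<Otimes>\<^sub>M distr M borel (\<lambda>\<omega>. g (W 0 \<omega>)) = distr M (borel \<Otimes>\<^sub>M borel) (\<lambda>\<omega>. (\<phi> (?U \<omega>), g (W 0 \<omega>)))" .
qed measurable

lemma W_orthogonal:
  assumes [measurable]: "\<phi> \<in> borel_measurable borel" and i: "integrable M (\<lambda>\<omega>. \<phi> (X 0 \<omega>, T 0 \<omega>) :: real)"
  shows "(\<integral>\<omega>. W 0 \<omega> * \<phi> (X 0 \<omega>, T 0 \<omega>) \<partial>M) = 0"
    and "integrable M (\<lambda>\<omega>. (W 0 \<omega>)\<^sup>2 * \<phi> (X 0 \<omega>, T 0 \<omega>))"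
    and "(\<integral>\<omega>. (W 0 \<omega>)\<^sup>2 * \<phi> (X 0 \<omega>, T 0 \<omega>) \<partial>M) = \<sigma>\<^sup>2 * (\<integral>\<omega>. \<phi> (X 0 \<omega>, T 0 \<omega>) \<partial>M)"
proof -
  have 1: "indep_var borel (\<lambda>\<omega>. \<phi> (X 0 \<omega>, T 0 \<omega>)) borel (\<lambda>\<omega>. W 0 \<omega>)"
    by (rule UW_indep) auto
  have 2: "indep_var borel (\<lambda>\<omega>. \<phi> (X 0 \<omega>, T 0 \<omega>)) borel (\<lambda>\<omega>. (W 0 \<omega>)\<^sup>2)"
    by (rule UW_indep) auto
  show "(\<integral>\<omega>. W 0 \<omega> * \<phi> (X 0 \<omega>, T 0 \<omega>) \<partial>M) = 0"
    using indep_var_lebesgue_integral[OF 1 i W_mean(1)] W_mean(2) by (simp add: mult.commute)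
  show "integrable M (\<lambda>\<omega>. (W 0 \<omega>)\<^sup>2 * \<phi> (X 0 \<omega>, T 0 \<omega>))"
    using indep_var_integrable[OF 2 i W_var(1)] by (simp add: mult.commute)
  show "(\<integral>\<omega>. (W 0 \<omega>)\<^sup>2 * \<phi> (X 0 \<omega>, T 0 \<omega>) \<partial>M) = \<sigma>\<^sup>2 * (\<integral>\<omega>. \<phi> (X 0 \<omega>, T 0 \<omega>) \<partial>M)"
    using indep_var_lebesgue_integral[OF 2 i W_var(1)] W_var(2) by (simp add: mult.commute)
qed

lemma r_ge_1: "r_of b \<ge> 1"
proof -
  have "(b - 1) / 2 \<ge> 1" using b by simp
  then have "\<lfloor>(b - 1) / 2\<rfloor> \<ge> 1" by simp
  then have "nat 1 \<le> nat \<lfloor>(b - 1) / 2\<rfloor>" by (rule nat_mono)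
  then show ?thesis by (simp only: r_of_def nat_one_as_int[symmetric] of_nat_1)
qed

lemma \<mu>T_AE: "AE t in \<mu>T. t \<in> {0..1}"
  unfolding T_distr by (subst AE_distr_iff) (use U_AE[of 0] in auto)

text \<open>\<open>g1\<close> is a Borel version of \<open>g\<close> on the whole line. T lies in
  [0,1] almost surely, so errors under the law of an observation are those under \<mu>T on
  [0,1].\<close>

lemma approximants:
  assumes g: "g \<in> Lip_ball \<mu>T \<alpha> L" and \<alpha>: "0 < \<alpha>" "\<alpha> < real r" and L: "L > 0"
    and g1[measurable]: "g1 \<in> borel_measurable borel" and eq: "\<And>t. t \<in> {0..1} \<Longrightarrow> g1 t = g t"
  shows "\<exists>C\<ge>0. \<exists>va. \<forall>\<kappa>. va \<kappa> \<in> ppoly_space r (2 ^ \<kappa>) \<and> integrable \<nu> (\<lambda>v. (g1 (tt v) - va \<kappa> (tt v))\<^sup>2) \<and>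
    (\<integral>v. (g1 (tt v) - va \<kappa> (tt v))\<^sup>2 \<partial>\<nu>) \<le> C * (2 ^ \<kappa>) powr (- (2 * \<alpha>))"
proof -
  have c: "h0 * k\<K> > 0" "\<bar>h1\<bar> * k\<K> \<ge> 0" using h0 k\<K>_pos by auto
  obtain C where C: "C \<ge> 0" "\<And>\<kappa>. \<exists>v\<in>ppoly_space r (2 ^ \<kappa>). (\<integral>\<^sup>+t\<in>{0..1}. ennreal ((g t - v t)\<^sup>2) \<partial>\<mu>T) \<le> ennreal (C * (2 ^ \<kappa>) powr (- 2 * \<alpha>))"
    using jackson_Lip_ball[OF sets_\<mu>T c(1) \<mu>T_bounds(1) c(2) \<mu>T_bounds(2) g \<alpha> L] by blast
  have "\<exists>v. v \<in> ppoly_space r (2 ^ \<kappa>) \<and> (\<integral>\<^sup>+t\<in>{0..1}. ennreal ((g t - v t)\<^sup>2) \<partial>\<mu>T) \<le> ennreal (C * (2 ^ \<kappa>) powr (- 2 * \<alpha>))" for \<kappa>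
    using C(2)[of \<kappa>] by blast
  then obtain va where va: "\<And>\<kappa>. va \<kappa> \<in> ppoly_space r (2 ^ \<kappa>)"
    "\<And>\<kappa>. (\<integral>\<^sup>+t\<in>{0..1}. ennreal ((g t - va \<kappa> t)\<^sup>2) \<partial>\<mu>T) \<le> ennreal (C * (2 ^ \<kappa>) powr (- 2 * \<alpha>))" by metis
  have "integrable \<nu> (\<lambda>v. (g1 (tt v) - va \<kappa> (tt v))\<^sup>2) \<and> (\<integral>v. (g1 (tt v) - va \<kappa> (tt v))\<^sup>2 \<partial>\<nu>) \<le> C * (2 ^ \<kappa>) powr (- (2 * \<alpha>))" for \<kappa>
  proof -
    have [measurable]: "va \<kappa> \<in> borel_measurable borel" using ppoly_measurable[OF va(1)] .
    have "(\<integral>\<^sup>+\<omega>. ennreal ((g1 (T 0 \<omega>) - va \<kappa> (T 0 \<omega>))\<^sup>2) \<partial>M) = (\<integral>\<^sup>+t. ennreal ((g1 t - va \<kappa> t)\<^sup>2) \<partial>\<mu>T)"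
      unfolding T_distr by (subst nn_integral_distr) auto
    also have "\<dots> = (\<integral>\<^sup>+t\<in>{0..1}. ennreal ((g t - va \<kappa> t)\<^sup>2) \<partial>\<mu>T)"
    proof (rule nn_integral_cong_AE)
      show "AE t in \<mu>T. ennreal ((g1 t - va \<kappa> t)\<^sup>2) = ennreal ((g t - va \<kappa> t)\<^sup>2) * indicator {0..1} t"
        using \<mu>T_AE by eventually_elim (simp add: eq)
    qed
    finally have le: "(\<integral>\<^sup>+\<omega>. ennreal ((g1 (T 0 \<omega>) - va \<kappa> (T 0 \<omega>))\<^sup>2) \<partial>M) \<le> ennreal (C * (2 ^ \<kappa>) powr (- 2 * \<alpha>))" using va(2)[of \<kappa>] by simp
    have i: "integrable M (\<lambda>\<omega>. (g1 (T 0 \<omega>) - va \<kappa> (T 0 \<omega>))\<^sup>2)"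
      using le by (intro integrableI_bounded) (auto simp: order.strict_trans1)
    then have "ennreal (\<integral>\<omega>. (g1 (T 0 \<omega>) - va \<kappa> (T 0 \<omega>))\<^sup>2 \<partial>M) \<le> ennreal (C * (2 ^ \<kappa>) powr (- 2 * \<alpha>))"
      using le by (subst nn_integral_eq_integral[symmetric]) auto
    then have "(\<integral>\<omega>. (g1 (T 0 \<omega>) - va \<kappa> (T 0 \<omega>))\<^sup>2 \<partial>M) \<le> C * (2 ^ \<kappa>) powr (- (2 * \<alpha>))"
      using C(1) by (subst (asm) ennreal_le_iff) auto
    moreover have m: "(\<lambda>v::((real^'q) \<times> real) \<times> real. (g1 (tt v) - va \<kappa> (tt v))\<^sup>2) \<in> borel_measurable borel"
      by (intro borel_measurable_power borel_measurable_diff measurable_compose[OF coord_meas(2)]) auto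
    ultimately show ?thesis using i unfolding \<nu>_integral[OF m] by (simp add: V_def)
  qed
  then show ?thesis using C(1) va(1) by blast
qed

text \<open>Conditional means of coordinates bounded by \<open>B1\<close> are bounded by
  \<open>B1\<close>, which explains the constant \<open>2 * B1\<close> for X - \<theta>(T);
  \<open>h0 * k\<K>\<close> is the lower bound for the density of T.\<close>

lemma pl_law_observation:
  assumes f: "f \<in> Lip_ball \<mu>T \<alpha> L" and \<alpha>: "1/2 < \<alpha>" "\<alpha> < real (r_of b)" and L: "L > 0"
    and th: "\<And>j. \<theta> j \<in> Lip_ball \<mu>T \<gamma> A" and \<gamma>: "b/4 < \<gamma>" "\<gamma> < real (r_of b)" and A: "A > 0"
    and R: "is_inverse_on I (Sigma_mat M (X 0) (T 0) \<theta>) R"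
  shows "\<exists>Cf C\<theta> fa ph. pl_law \<nu> I \<theta> (\<lambda>t. indicator {0..1} t * f t) b (2 * B1) (h0 * k\<K>) (\<sigma>\<^sup>2) \<alpha> \<gamma> Cf C\<theta> fa ph (Sigma_mat M (X 0) (T 0) \<theta>) R (r_of b)"
proof -
  \<comment> \<open>Nothing is known of \<open>f\<close> outside [0,1], so it is replaced by 0
    there; T stays in [0,1] almost surely.\<close>
  define f1 where "f1 t = indicator {0..1} t * f t" for t
  have fL: "f \<in> borel_measurable (restrict_space \<mu>T {0..1})" "integrable (restrict_space \<mu>T {0..1}) (\<lambda>x. (f x)\<^sup>2)"
    using f by (auto simp: Lip_ball_def Lip_star_def in_L2_def)
  have f1m[measurable]: "f1 \<in> borel_measurable borel"
  proof -
    have "(\<lambda>t. indicator {0..1} t *\<^sub>R f t) \<in> borel_measurable \<mu>T" by (subst borel_measurable_restrict_space_iff[symmetric]) (use fL in \<open>auto simp: sets_\<mu>T\<close>)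
    then show ?thesis unfolding f1_def[abs_def] by (simp cong: measurable_cong_sets add: sets_\<mu>T)
  qed
  have f1i: "integrable M (\<lambda>\<omega>. (f1 (T 0 \<omega>))\<^sup>2)"
  proof -
    have "integrable \<mu>T (\<lambda>t. indicator {0..1} t *\<^sub>R (f t)\<^sup>2)" by (subst integrable_restrict_space[symmetric]) (use fL in \<open>auto simp: sets_\<mu>T\<close>)
    also have "(\<lambda>t. indicator {0..1} t *\<^sub>R (f t)\<^sup>2) = (\<lambda>t. (f1 t)\<^sup>2)" by (auto simp: f1_def fun_eq_iff indicator_def)
    finally show ?thesis unfolding T_distr by (subst (asm) integrable_distr_eq) auto
  qed
  have \<alpha>0: "0 < \<alpha>" using \<alpha> by simp
  have \<gamma>0: "0 < \<gamma>" using \<gamma> b by simp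
  obtain Cf va where Cf: "Cf \<ge> 0" and va: "\<And>\<kappa>. va \<kappa> \<in> ppoly_space (r_of b) (2 ^ \<kappa>) \<and> integrable \<nu> (\<lambda>v. (f1 (tt v) - va \<kappa> (tt v))\<^sup>2) \<and>
    (\<integral>v. (f1 (tt v) - va \<kappa> (tt v))\<^sup>2 \<partial>\<nu>) \<le> Cf * (2 ^ \<kappa>) powr (- (2 * \<alpha>))"
    using approximants[OF f \<alpha>0 \<alpha>(2) L f1m] by (auto simp: f1_def)
  have "\<exists>C ph. C \<ge> 0 \<and> (\<forall>\<kappa>. ph \<kappa> \<in> ppoly_space (r_of b) (2 ^ \<kappa>) \<and> integrable \<nu> (\<lambda>v. (\<theta> j (tt v) - ph \<kappa> (tt v))\<^sup>2) \<and>
    (\<integral>v. (\<theta> j (tt v) - ph \<kappa> (tt v))\<^sup>2 \<partial>\<nu>) \<le> C * (2 ^ \<kappa>) powr (- (2 * \<gamma>)))" for j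
    using approximants[OF th \<gamma>0 \<gamma>(2) A \<theta>_meas refl] by blast
  then have "\<forall>j. \<exists>C ph. C \<ge> 0 \<and> (\<forall>\<kappa>. ph \<kappa> \<in> ppoly_space (r_of b) (2 ^ \<kappa>) \<and> integrable \<nu> (\<lambda>v. (\<theta> j (tt v) - ph \<kappa> (tt v))\<^sup>2) \<and>
    (\<integral>v. (\<theta> j (tt v) - ph \<kappa> (tt v))\<^sup>2 \<partial>\<nu>) \<le> C * (2 ^ \<kappa>) powr (- (2 * \<gamma>)))" by blast
  from choice[OF this] obtain C where "\<forall>j. \<exists>ph. C j \<ge> 0 \<and> (\<forall>\<kappa>. ph \<kappa> \<in> ppoly_space (r_of b) (2 ^ \<kappa>) \<and> integrable \<nu> (\<lambda>v. (\<theta> j (tt v) - ph \<kappa> (tt v))\<^sup>2) \<and>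
    (\<integral>v. (\<theta> j (tt v) - ph \<kappa> (tt v))\<^sup>2 \<partial>\<nu>) \<le> C j * (2 ^ \<kappa>) powr (- (2 * \<gamma>)))" ..
  from choice[OF this] obtain ph where P: "\<forall>j. C j \<ge> 0 \<and> (\<forall>\<kappa>. ph j \<kappa> \<in> ppoly_space (r_of b) (2 ^ \<kappa>) \<and> integrable \<nu> (\<lambda>v. (\<theta> j (tt v) - ph j \<kappa> (tt v))\<^sup>2) \<and>
    (\<integral>v. (\<theta> j (tt v) - ph j \<kappa> (tt v))\<^sup>2 \<partial>\<nu>) \<le> C j * (2 ^ \<kappa>) powr (- (2 * \<gamma>)))" ..
  have C: "C j \<ge> 0" and ph: "ph j \<kappa> \<in> ppoly_space (r_of b) (2 ^ \<kappa>) \<and> integrable \<nu> (\<lambda>v. (\<theta> j (tt v) - ph j \<kappa> (tt v))\<^sup>2) \<and>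
    (\<integral>v. (\<theta> j (tt v) - ph j \<kappa> (tt v))\<^sup>2 \<partial>\<nu>) \<le> C j * (2 ^ \<kappa>) powr (- (2 * \<gamma>))" for j \<kappa> using P by blast+
  \<comment> \<open>The sum serves as one constant for all coordinates.\<close>
  have Cs: "C j \<le> (\<Sum>j\<in>UNIV. C j)" for j by (rule member_le_sum) (use C in auto)
  have "pl_law \<nu> I \<theta> f1 b (2 * B1) (h0 * k\<K>) (\<sigma>\<^sup>2) \<alpha> \<gamma> Cf (\<Sum>j\<in>UNIV. C j) va ph (Sigma_mat M (X 0) (T 0) \<theta>) R (r_of b)"
  proof (intro pl_law.intro \<nu>_prob pl_law_axioms.intro)
    show "sets \<nu> = sets borel" by (simp add: \<nu>_def)
    show "AE v in \<nu>. \<forall>j. \<bar>xx v j\<bar> \<le> 2 * B1 \<and> \<bar>xx v j - \<theta> j (tt v)\<bar> \<le> 2 * B1"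
    proof -
      have "AE \<omega> in M. \<forall>j\<in>UNIV. \<bar>\<zeta> j \<omega>\<bar> \<le> 2 * B1" by (rule AE_finite_allI) (use \<zeta>_bound in auto)
      then have "AE \<omega> in M. \<forall>j. \<bar>xx (V 0 \<omega>) j\<bar> \<le> 2 * B1 \<and> \<bar>xx (V 0 \<omega>) j - \<theta> j (tt (V 0 \<omega>))\<bar> \<le> 2 * B1"
        using X_AE
      proof eventually_elim
        case (elim \<omega>)
        have "\<bar>X 0 \<omega> $ j\<bar> \<le> 2 * B1" for j using elim(2)[rule_format, of j] B1(1) by linarith
        then show ?case using elim(1) by (simp add: V_def)
      qed
      then show ?thesis unfolding \<nu>_def by (subst AE_distr_iff) measurable
    qed
    show "h0 * k\<K> * (d - c) \<le> Sigma_Algebra.measure \<nu> {v\<in>space \<nu>. tt v \<in> {c..<d}}" if "0 \<le> c" "c \<le> d" "d \<le> 1" for c d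
    proof -
      interpret mT: prob_space \<mu>T by (rule \<mu>T_prob)
      have "Sigma_Algebra.measure \<nu> {v\<in>space \<nu>. tt v \<in> {c..<d}} = measure M {\<omega>\<in>space M. T 0 \<omega> \<in> {c..<d}}"
        unfolding \<nu>_def by (subst measure_distr) (auto simp: V_def intro!: arg_cong[where f = "measure M"])
      also have "\<dots> = measure \<mu>T {c..<d}"
        unfolding T_distr by (subst measure_distr) (auto intro!: arg_cong[where f = "measure M"])
      finally have m: "Sigma_Algebra.measure \<nu> {v\<in>space \<nu>. tt v \<in> {c..<d}} = measure \<mu>T {c..<d}" .
      have "(\<integral>\<^sup>+t\<in>{0..1}. indicator {c..<d} t \<partial>lborel) = (\<integral>\<^sup>+t. indicator {c..<d} t \<partial>lborel)"
        using that by (intro nn_integral_cong) (auto simp: indicator_def)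
      also have "\<dots> = ennreal (d - c)" using that by simp
      finally have "ennreal (h0 * k\<K> * (d - c)) \<le> (\<integral>\<^sup>+t. indicator {c..<d} t \<partial>\<mu>T)"
        using \<mu>T_bounds(1)[of "indicator {c..<d}"] h0 k\<K>_pos that by (simp add: ennreal_mult'')
      also have "\<dots> = ennreal (measure \<mu>T {c..<d})" by (simp add: mT.emeasure_eq_measure)
      finally show ?thesis unfolding m by (subst (asm) ennreal_le_iff) auto
    qed
    show "(\<integral>v. (xx v j - \<theta> j (tt v)) * \<phi> (tt v) \<partial>\<nu>) = 0" if \<phi>[measurable]: "\<phi> \<in> borel_measurable borel" and i: "integrable \<nu> (\<lambda>v. \<phi> (tt v))" for j \<phi>
    proof -
      have m: "(\<lambda>v::((real^'q) \<times> real) \<times> real. \<phi> (tt v)) \<in> borel_measurable borel" "(\<lambda>v::((real^'q) \<times> real) \<times> real. (xx v j - \<theta> j (tt v)) * \<phi> (tt v)) \<in> borel_measurable borel" by measurable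
      have "integrable M (\<lambda>\<omega>. \<phi> (T 0 \<omega>))" using i unfolding \<nu>_integral(2)[OF m(1)] by (simp add: V_def)
      from cond_mean[OF \<phi> this, of j] show ?thesis unfolding \<nu>_integral(1)[OF m(2)] by (simp add: V_def left_diff_distrib)
    qed
    show "(\<integral>v. snd v * \<phi> (fst v) \<partial>\<nu>) = 0" if \<phi>[measurable]: "\<phi> \<in> borel_measurable borel" and i: "integrable \<nu> (\<lambda>v. \<phi> (fst v))" for \<phi>
    proof -
      have m: "(\<lambda>v::((real^'q) \<times> real) \<times> real. \<phi> (fst v)) \<in> borel_measurable borel" "(\<lambda>v::((real^'q) \<times> real) \<times> real. snd v * \<phi> (fst v)) \<in> borel_measurable borel" by measurable
      have "integrable M (\<lambda>\<omega>. \<phi> (X 0 \<omega>, T 0 \<omega>))" using i unfolding \<nu>_integral(2)[OF m(1)] by (simp add: V_def)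
      from W_orthogonal(1)[OF \<phi> this] show ?thesis unfolding \<nu>_integral(1)[OF m(2)] by (simp add: V_def)
    qed
    show "integrable \<nu> (\<lambda>v. (snd v)\<^sup>2 * \<phi> (fst v)) \<and> (\<integral>v. (snd v)\<^sup>2 * \<phi> (fst v) \<partial>\<nu>) = \<sigma>\<^sup>2 * (\<integral>v. \<phi> (fst v) \<partial>\<nu>)"
      if \<phi>[measurable]: "\<phi> \<in> borel_measurable borel" and i: "integrable \<nu> (\<lambda>v. \<phi> (fst v))" for \<phi>
    proof -
      have m: "(\<lambda>v::((real^'q) \<times> real) \<times> real. \<phi> (fst v)) \<in> borel_measurable borel" "(\<lambda>v::((real^'q) \<times> real) \<times> real. (snd v)\<^sup>2 * \<phi> (fst v)) \<in> borel_measurable borel" by measurable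
      have "integrable M (\<lambda>\<omega>. \<phi> (X 0 \<omega>, T 0 \<omega>))" using i unfolding \<nu>_integral(2)[OF m(1)] by (simp add: V_def)
      from W_orthogonal(2,3)[OF \<phi> this] show ?thesis unfolding \<nu>_integral(1)[OF m(1)] \<nu>_integral[OF m(2)] by (simp add: V_def)
    qed
    show "integrable \<nu> (\<lambda>v. (f1 (tt v))\<^sup>2)"
    proof -
      have m: "(\<lambda>v::((real^'q) \<times> real) \<times> real. (f1 (tt v))\<^sup>2) \<in> borel_measurable borel" by measurable
      show ?thesis using f1i unfolding \<nu>_integral(2)[OF m] by (simp add: V_def)
    qed
    show "Sigma_mat M (X 0) (T 0) \<theta> k j = (\<integral>v. (xx v k - \<theta> k (tt v)) * (xx v j - \<theta> j (tt v)) \<partial>\<nu>)" for k j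
    proof -
      have m: "(\<lambda>v::((real^'q) \<times> real) \<times> real. (xx v k - \<theta> k (tt v)) * (xx v j - \<theta> j (tt v))) \<in> borel_measurable borel" by measurable
      show ?thesis unfolding Sigma_mat_eq \<nu>_integral(1)[OF m] by (simp add: V_def)
    qed
    show "(\<Sum>j\<in>I. Sigma_mat M (X 0) (T 0) \<theta> k j * R j l) = (if k = l then 1 else 0)" if "k \<in> I" "l \<in> I" for k l
      using R that unfolding is_inverse_on_def by blast
    show "(\<integral>v. (\<theta> j (tt v) - ph j \<kappa> (tt v))\<^sup>2 \<partial>\<nu>) \<le> (\<Sum>j\<in>UNIV. C j) * (2 ^ \<kappa>) powr (- (2 * \<gamma>))" for j \<kappa>
      using ph by (rule order.trans[OF conjunct2[OF conjunct2]]) (intro mult_right_mono Cs, simp)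
  qed (use \<alpha> \<gamma> b r_ge_1 B1 h0 k\<K>_pos Cf C va ph in \<open>auto simp: power2_commute intro!: sum_nonneg\<close>)
  then show ?thesis unfolding f1_def[abs_def] by blast
qed

end

lemma weak_conv_on_eventually_cong:
  assumes "weak_conv_on I A N" "\<forall>\<^sub>F n in sequentially. A n = B n"
  shows "weak_conv_on I B N"
  unfolding weak_conv_on_def
proof (intro allI impI)
  fix g :: "('a \<Rightarrow> real) \<Rightarrow> real"
  assume "continuous_on (I \<rightarrow>\<^sub>E UNIV) g" "bounded (g ` (I \<rightarrow>\<^sub>E UNIV))"
  then have "(\<lambda>n. \<integral>x. g x \<partial>A n) \<longlonglongrightarrow> (\<integral>x. g x \<partial>N)" using assms(1) unfolding weak_conv_on_def by blast
  moreover have "\<forall>\<^sub>F n in sequentially. (\<integral>x. g x \<partial>A n) = (\<integral>x. g x \<partial>B n)" using assms(2) by eventually_elim simp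
  ultimately show "(\<lambda>n. \<integral>x. g x \<partial>B n) \<longlonglongrightarrow> (\<integral>x. g x \<partial>N)" by (rule Lim_transform_eventually)
qed

theorem theorem4p1:
  fixes b h0 h1 d p \<sigma> :: real
    and \<K> :: "(real ^ 'q) set" and I0 :: "'q::finite set"
    and bhat :: "nat \<Rightarrow> (nat \<Rightarrow> ((real ^ 'q) \<times> real) \<times> real) \<Rightarrow> 'q \<Rightarrow> real"
    and M :: "'a measure"
    and X :: "nat \<Rightarrow> 'a \<Rightarrow> real ^ 'q" and T Y W :: "nat \<Rightarrow> 'a \<Rightarrow> real"
    and \<beta> :: "real ^ 'q" and f :: "real \<Rightarrow> real"
    and h :: "(real ^ 'q) \<times> real \<Rightarrow> real" and \<theta> :: "'q \<Rightarrow> real \<Rightarrow> real"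
    and \<mu> :: "((real ^ 'q) \<times> real) measure" and \<mu>T :: "real measure"
  assumes b: "b \<ge> 3"
    \<comment> \<open>the estimator, depending only on the data, \<open>b\<close>, \<open>\<K>\<close> and the known index set\<close>
    and procedure: "pls_procedure b \<K> I0 bhat"
    and I0: "I0 = {j. \<beta> $ j \<noteq> 0}"
    \<comment> \<open>the model\<close>
    and M: "prob_space M"
    and Y_rv: "\<And>i. Y i \<in> borel_measurable M"
    and Y_eq: "\<And>i \<omega>. \<omega> \<in> space M \<Longrightarrow> Y i \<omega> = pl_fun \<beta> f (X i \<omega>, T i \<omega>) + W i \<omega>"
    and XT_indep: "prob_space.indep_vars M (\<lambda>_. borel) (\<lambda>i \<omega>. (X i \<omega>, T i \<omega>)) UNIV"
    and XT_distr: "\<And>i. distr M borel (\<lambda>\<omega>. (X i \<omega>, T i \<omega>)) = \<mu>"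
    and T_distr: "\<mu>T = distr M borel (T 0)"
    and W_indep: "prob_space.indep_vars M (\<lambda>_. borel) W UNIV"
    and W_distr: "\<And>i. distr M borel (W i) = distr M borel (W 0)"
    and XT_W_indep: "prob_space.indep_set M
          (sets (vimage_algebra (space M) (\<lambda>\<omega> i. (X i \<omega>, T i \<omega>)) (PiM UNIV (\<lambda>_. borel))))
          (sets (vimage_algebra (space M) (\<lambda>\<omega> i. W i \<omega>) (PiM UNIV (\<lambda>_. borel))))"
    and W_mean: "integrable M (W 0)" "integral\<^sup>L M (W 0) = 0"
    and W_var: "integrable M (\<lambda>\<omega>. (W 0 \<omega>)\<^sup>2)" "(\<integral>\<omega>. (W 0 \<omega>)\<^sup>2 \<partial>M) = \<sigma>\<^sup>2"
    \<comment> \<open>(A1)\<close>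
    and K_compact: "compact \<K>"
    and supp: "measure_support \<mu> = \<K> \<times> {0..1}"
    and h_meas: "h \<in> borel_measurable borel"
    and density: "\<mu> = density lborel (\<lambda>z. ennreal (h z * indicator (\<K> \<times> {0..1}) z))"
    and h0: "h0 > 0"
    and h_bounds: "\<And>z. z \<in> \<K> \<times> {0..1} \<Longrightarrow> h0 \<le> h z \<and> h z \<le> h1"
    \<comment> \<open>(A2)\<close>
    and d: "d > 0" and p: "p > 4 + d"
    and W_moment: "integrable M (\<lambda>\<omega>. \<bar>W 0 \<omega>\<bar> powr p)"
    \<comment> \<open>(A3)\<close>
    and cond_var: "\<And>l. l \<noteq> 0 \<Longrightarrow>
          \<exists>V. is_cond_var M (T 0) (\<lambda>\<omega>. l \<bullet> X 0 \<omega>) V \<and> (\<forall>t\<in>{0..1}. V t > 0)"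
    \<comment> \<open>(A4)\<close>
    and s_L2: "in_L2 (restrict_space lborel (\<K> \<times> {0..1})) (pl_fun \<beta> f)"
    \<comment> \<open>the functions of (A5)\<close>
    and theta: "\<And>j. is_cond_exp M (T 0) (\<lambda>\<omega>. X 0 \<omega> $ j) (\<theta> j)"
  shows "\<forall>\<alpha>\<in>{1/2<..<real (r_of b)}. \<forall>\<gamma>\<in>{b/4<..<real (r_of b)}. \<forall>L>0. \<forall>A>0.
           f \<in> Lip_ball \<mu>T \<alpha> L \<longrightarrow> (\<forall>j. \<theta> j \<in> Lip_ball \<mu>T \<gamma> A) \<longrightarrow>
           (\<exists>R N. is_inverse_on I0 (Sigma_mat M (X 0) (T 0) \<theta>) R \<and>
                  is_normal_law I0 (\<lambda>_. 0) (\<lambda>k j. \<sigma>\<^sup>2 * R k j) N \<and>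
                  weak_conv_on I0
                    (\<lambda>n. distr M (PiM I0 (\<lambda>_. borel))
                      (\<lambda>\<omega>. \<lambda>j\<in>I0. sqrt (real n) *
                         (bhat n (\<lambda>i\<in>{..<n}. ((X i \<omega>, T i \<omega>), Y i \<omega>)) j - \<beta> $ j)))
                    N)"
proof (intro ballI allI impI)
  fix \<alpha> \<gamma> L A :: real
  assume \<alpha>: "\<alpha> \<in> {1/2<..<real (r_of b)}" and \<gamma>: "\<gamma> \<in> {b/4<..<real (r_of b)}" and L: "L > 0" and A: "A > 0"
    and f: "f \<in> Lip_ball \<mu>T \<alpha> L" and th: "\<forall>j. \<theta> j \<in> Lip_ball \<mu>T \<gamma> A"
  interpret pl_model M b h0 h1 \<sigma> \<K> X T W h \<theta> \<mu> \<mu>T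
    by (intro pl_model.intro pl_model_axioms.intro M b XT_indep XT_distr T_distr W_indep W_distr XT_W_indep W_mean W_var K_compact
        h_meas density h0 h_bounds cond_var theta)
  let ?S = "Sigma_mat M (X 0) (T 0) \<theta>"
  have "\<exists>R. is_inverse_on I0 ?S R \<and> (\<forall>i\<in>I0. \<forall>j\<in>I0. R i j = R j i) \<and> (\<forall>u. (\<Sum>i\<in>I0. \<Sum>j\<in>I0. u i * R i j * u j) \<ge> 0)"
  proof (rule pd_inverse)
    show "?S i j = ?S j i" for i j by (simp add: Sigma_mat_eq mult.commute)
    show "(\<Sum>i\<in>I0. \<Sum>j\<in>I0. u i * ?S i j * u j) > 0" if "\<exists>i\<in>I0. u i \<noteq> 0" for u by (rule Sigma_pos[OF that])
  qed
  then obtain R where R: "is_inverse_on I0 ?S R" "\<And>i j. i \<in> I0 \<Longrightarrow> j \<in> I0 \<Longrightarrow> R i j = R j i"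
    "\<And>u. (\<Sum>i\<in>I0. \<Sum>j\<in>I0. u i * R i j * u j) \<ge> 0" by blast
  \<comment> \<open>Semidefiniteness is all that can be asked for, since \<sigma> may be 0; the
    limit is then a point mass at the origin.\<close>
  have "\<exists>N. is_normal_law I0 (\<lambda>_. 0) (\<lambda>k j. \<sigma>\<^sup>2 * R k j) N"
  proof (rule ex_normal_law)
    fix u :: "'q \<Rightarrow> real"
    have "(\<Sum>i\<in>I0. \<Sum>j\<in>I0. u i * (\<sigma>\<^sup>2 * R i j) * u j) = \<sigma>\<^sup>2 * (\<Sum>i\<in>I0. \<Sum>j\<in>I0. u i * R i j * u j)"
      by (simp only: sum_distrib_left mult_ac)
    then show "(\<Sum>i\<in>I0. \<Sum>j\<in>I0. u i * (\<sigma>\<^sup>2 * R i j) * u j) \<ge> 0" using R(3) by simp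
  qed (use R(2) in auto)
  then obtain N where N: "is_normal_law I0 (\<lambda>_. 0) (\<lambda>k j. \<sigma>\<^sup>2 * R k j) N" by blast
  define f1 where "f1 t = indicator {0..1} t * f t" for t
  have \<alpha>': "1/2 < \<alpha>" "\<alpha> < real (r_of b)" and \<gamma>': "b/4 < \<gamma>" "\<gamma> < real (r_of b)" using \<alpha> \<gamma> by auto
  obtain Cf C\<theta> fa ph where "pl_law \<nu> I0 \<theta> f1 b (2 * B1) (h0 * k\<K>) (\<sigma>\<^sup>2) \<alpha> \<gamma> Cf C\<theta> fa ph ?S R (r_of b)"
    using pl_law_observation[OF f \<alpha>' L th[rule_format] \<gamma>' A R(1)] unfolding f1_def[abs_def] by blast
  note E = pl_law.estimator_weak_conv[OF this refl K_compact procedure N, of "\<lambda>j. \<beta> $ j"]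
  define dat where "dat n \<omega> = (\<lambda>i\<in>{..<n}. (fst (\<omega> i), (\<Sum>j\<in>I0. \<beta> $ j * xx (\<omega> i) j) + f1 (tt (\<omega> i)) + snd (\<omega> i)))"
    for n :: nat and \<omega> :: "nat \<Rightarrow> ((real^'q) \<times> real) \<times> real"
  note E = E[folded dat_def]
  let ?Q = "PiM I0 (\<lambda>_. borel :: real measure)"
  let ?F = "\<lambda>n D. \<lambda>j\<in>I0. sqrt (real n) * (bhat n D j - \<beta> $ j)"
  let ?obs = "\<lambda>n \<omega>. \<lambda>i\<in>{..<n::nat}. ((X i \<omega>, T i \<omega>), Y i \<omega>)"
  \<comment> \<open>The estimate is a function of the data, so its law under \<open>M\<close> is
    that of the same function of an i.i.d. sample from \<open>\<nu>\<close>. The procedure is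
    specified for n \<ge> 2, hence the restriction to large n.\<close>
  have "\<forall>\<^sub>F n in sequentially. distr (PiM {..<n} (\<lambda>_. \<nu>)) ?Q (\<lambda>\<omega>. ?F n (dat n \<omega>)) = distr M ?Q (\<lambda>\<omega>. ?F n (?obs n \<omega>))"
    using eventually_ge_at_top[of 2]
  proof eventually_elim
    case (elim n)
    have bm: "bhat n \<in> measurable (PiM {..<n} (\<lambda>_. borel)) ?Q" using procedure elim unfolding pls_procedure_def by blast
    have Fm: "?F n \<in> measurable (PiM {..<n} (\<lambda>_. borel)) ?Q"
    proof (rule measurable_restrict)
      fix j assume "j \<in> I0"
      then have "(\<lambda>D. bhat n D j) \<in> borel_measurable (PiM {..<n} (\<lambda>_. borel))" by (rule measurable_compose[OF bm measurable_component_singleton])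
      then show "(\<lambda>D. sqrt (real n) * (bhat n D j - \<beta> $ j)) \<in> borel_measurable (PiM {..<n} (\<lambda>_. borel))" by measurable
    qed
    have Vm: "(\<lambda>\<omega>. \<lambda>i\<in>{..<n}. V i \<omega>) \<in> measurable M (PiM {..<n} (\<lambda>_. borel))" by (rule measurable_restrict) simp
    have om: "?obs n \<in> measurable M (PiM {..<n} (\<lambda>_. borel))"
      by (rule measurable_restrict) (intro borel_measurable_Pair U_meas Y_rv)
    have dm: "dat n \<in> measurable (PiM {..<n} (\<lambda>_. borel)) (PiM {..<n} (\<lambda>_. borel))"
      using E(1)[of n] by (simp add: \<nu>_def cong: measurable_cong_sets sets_PiM_cong)
    have "distr (PiM {..<n} (\<lambda>_. \<nu>)) ?Q (\<lambda>\<omega>. ?F n (dat n \<omega>)) = distr M ?Q (\<lambda>\<omega>. ?F n (dat n (\<lambda>i\<in>{..<n}. V i \<omega>)))"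
      using elim by (subst V_sample[symmetric], simp, subst distr_distr[OF measurable_compose[OF dm Fm] Vm]) (simp add: comp_def)
    also have "\<dots> = distr M ?Q (\<lambda>\<omega>. ?F n (?obs n \<omega>))"
    \<comment> \<open>The two data sets agree only almost surely: \<open>f1\<close> and
      \<open>f\<close> may differ where T leaves [0,1].\<close>
    proof (rule distr_cong_AE[OF refl refl])
      have "AE \<omega> in M. \<forall>i\<in>{..<n}. T i \<omega> \<in> {0..1}"
        by (rule AE_finite_allI) (use U_AE in \<open>auto elim!: eventually_mono\<close>)
      then show "AE \<omega> in M. ?F n (dat n (\<lambda>i\<in>{..<n}. V i \<omega>)) = ?F n (?obs n \<omega>)"
        using AE_space
      proof eventually_elim
        case (elim \<omega>)
        have "dat n (\<lambda>i\<in>{..<n}. V i \<omega>) = ?obs n \<omega>"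
          unfolding dat_def
        proof (rule restrict_ext)
          fix i assume i: "i \<in> {..<n}"
          \<comment> \<open>Coefficients outside \<open>I0\<close> vanish by the definition of
            \<open>I0\<close>, so the reduced model is the true one.\<close>
          have "(\<Sum>j\<in>I0. \<beta> $ j * X i \<omega> $ j) = (\<Sum>j\<in>UNIV. \<beta> $ j * X i \<omega> $ j)"
            by (rule sum.mono_neutral_left) (auto simp: I0)
          then have "\<beta> \<bullet> X i \<omega> = (\<Sum>j\<in>I0. \<beta> $ j * X i \<omega> $ j)" by (simp add: inner_vec_def)
          moreover have "f1 (T i \<omega>) = f (T i \<omega>)" using elim(1) i by (auto simp: f1_def)
          ultimately show "(fst ((\<lambda>i\<in>{..<n}. V i \<omega>) i), (\<Sum>j\<in>I0. \<beta> $ j * xx ((\<lambda>i\<in>{..<n}. V i \<omega>) i) j) + f1 (tt ((\<lambda>i\<in>{..<n}. V i \<omega>) i)) + snd ((\<lambda>i\<in>{..<n}. V i \<omega>) i))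
              = ((X i \<omega>, T i \<omega>), Y i \<omega>)"
            using i Y_eq[OF elim(2), of i] by (simp add: V_def pl_fun_def)
        qed
        then show ?case by simp
      qed
      show "(\<lambda>\<omega>. ?F n (dat n (\<lambda>i\<in>{..<n}. V i \<omega>))) \<in> measurable M ?Q"
        by (rule measurable_compose[OF Vm measurable_compose[OF dm Fm]])
      show "(\<lambda>\<omega>. ?F n (?obs n \<omega>)) \<in> measurable M ?Q" by (rule measurable_compose[OF om Fm])
    qed
    finally show ?case .
  qed
  with E(2) have "weak_conv_on I0 (\<lambda>n. distr M ?Q (\<lambda>\<omega>. ?F n (?obs n \<omega>))) N" by (rule weak_conv_on_eventually_cong)
  with R(1) N show "\<exists>R N. is_inverse_on I0 ?S R \<and> is_normal_law I0 (\<lambda>_. 0) (\<lambda>k j. \<sigma>\<^sup>2 * R k j) N \<and>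
      weak_conv_on I0 (\<lambda>n. distr M ?Q (\<lambda>\<omega>. ?F n (?obs n \<omega>))) N" by blast
qed

end
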